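(* Let $X$ be a spectrally positive Lévy process with non-monotone paths and finite mean $\mu=\mathbb{E}[X_1]$, let $q>0$ and $\beta>0$, and let $(c_1^*,c_2^* )$ with $0\le c_1^*<c_2^*<\infty$ be a pair such that $G(c_1^*,c_2^* )=0$ and either ($c_1^*>0$ and $H(c_1^*,c_2^* )=0$) or ($c_1^*=0$ and $H(0,c_2^* )\ge 0$). Then for every $x\ge0$, $$v_{c_1^*,c_2^*}(x)=-R^{(q)}(c_2^*-x)+\gamma(c_1^*,c_2^* )\,Z^{(q)}(c_2^*-x).$$
   Context: Process. $X=\{X_t;t\ge0\}$ is a spectrally positive Lévy process; $\mathbb{P}_x$ is the law under which $X_0=x$, $\mathbb{P}=\mathbb{P}_0$. Its Laplace exponent is $\psi(s)=\log\mathbb{E}[e^{-sX_1}]=cs+\frac12\sigma^2s^2+\int_{(0,\infty)}(e^{-sz}-1+sz1_{\{0<z<1\}})\nu(dz)$, where $\nu$ is a Lévy measure on $(0,\infty)$ with $\int(1\wedge z^2)\nu(dz)<\infty$. The case where $X$ has monotone paths a.s. is excluded. $\mu:=\mathbb{E}[X_1]=-\psi'(0+)$ is assumed finite. Fix $q>0$ (discount rate) and $\beta>0$ (fixed transaction cost). $(c_1,c_2)$-policy. For $0\le c_1<c_2$, the $(c_1,c_2)$-policy is the dividend process $L=L^{c_1,c_2}$ (pure jump, nondecreasing, right-continuous, adapted, $L_{0-}=0$) that brings the controlled surplus $U=X-L$ (with $U_{0-}=x$) down to $c_1$ whenever it reaches or exceeds $c_2$, with no other payments. With ruin time $\sigma_{c_1,c_2}=\inf\{t>0:U_t<0\}$,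 $v_{c_1,c_2}(x)=\mathbb{E}_x\big[\int_0^{\sigma_{c_1,c_2}}e^{-qt}d\big(L_t-\sum_{0\le s\le t}\beta1_{\{\Delta L_s>0\}}\big)\big]$, $x\ge0$ (a payment at time $0$ is included), and $\bar v_{c_1,c_2}:=v_{c_1,c_2}(c_1)$. Scale functions. $\Phi(q)=\sup\{\lambda\ge0:\psi(\lambda)=q\}$. $W^{(q)}:\mathbb{R}\to[0,\infty)$ is zero on $(-\infty,0)$, continuous and strictly increasing on $[0,\infty)$, with $\int_0^\infty e^{-sx}W^{(q)}(x)dx=1/(\psi(s)-q)$ for $s>\Phi(q)$. $\overline W^{(q)}(x)=\int_0^xW^{(q)}(y)dy$, $Z^{(q)}(x)=1+q\overline W^{(q)}(x)$, $\overline Z^{(q)}(x)=\int_0^xZ^{(q)}(z)dz$, $R^{(q)}(x)=\overline Z^{(q)}(x)-\mu/q$, for all $x\in\mathbb{R}$ (so $Z^{(q)}(x)=1$ and $\overline Z^{(q)}(x)=x$ for $x\le0$). Auxiliary functions, for $0\le c_1<c_2$: $\gamma(c_1,c_2)=\bar v_{c_1,c_2}+c_2-c_1-\beta-\mu/q$; $G(c_1,c_2)=\gamma(c_1,c_2)Z^{(q)}(c_2)-R^{(q)}(c_2)$; $H(c_1,c_2)=q[\gamma(c_1,c_2)W^{(q)}(c_2-c_1)-\overline W^{(q)}(c_2-c_1)]$. *)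

theory Defs
  imports "HOL-Probability.Probability"
begin

section \<open>Spectrally positive Levy processes\<close>

definition cadlag :: "(real \<Rightarrow> real) \<Rightarrow> bool" where
  "cadlag f \<longleftrightarrow> (\<forall>t\<ge>0. continuous (at_right t) f) \<and> (\<forall>t>0. \<exists>l. (f \<longlongrightarrow> l) (at_left t))"

definition jump :: "(real \<Rightarrow> real) \<Rightarrow> real \<Rightarrow> real" where
  "jump f t = f t - Lim (at_left t) f"

text \<open>Only the values of \<open>X t\<close> for \<open>t \<ge> 0\<close> are relevant. The measure of the locale is the law
  \<open>P = P_0\<close>; under \<open>P_x\<close> the process is \<open>x + X\<close>.\<close>

locale levy_process = prob_space M for M :: "'a measure" +
  fixes X :: "real \<Rightarrow> 'a \<Rightarrow> real"
  assumes X_measurable: "0 \<le> t \<Longrightarrow> X t \<in> borel_measurable M"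
    and X_start: "AE \<omega> in M. X 0 \<omega> = 0"
    and X_cadlag: "AE \<omega> in M. cadlag (\<lambda>t. X t \<omega>)"
    and X_indep_increments: "0 \<le> r 0 \<Longrightarrow> mono r \<Longrightarrow>
      indep_vars (\<lambda>_. borel) (\<lambda>i \<omega>. X (r (Suc i)) \<omega> - X (r i) \<omega>) {..<n::nat}"
    and X_stationary_increments: "0 \<le> s \<Longrightarrow> s \<le> u \<Longrightarrow>
      distr M borel (\<lambda>\<omega>. X u \<omega> - X s \<omega>) = distr M borel (X (u - s))"

definition levy_khintchine_exponent :: "real \<Rightarrow> real \<Rightarrow> real measure \<Rightarrow> real \<Rightarrow> real" where
  "levy_khintchine_exponent c \<sigma> \<nu> s =
     c * s + 1 / 2 * \<sigma>\<^sup>2 * s\<^sup>2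
       + (\<integral>z. (exp (- s * z) - 1 + s * z * indicator {0<..<1} z) \<partial>\<nu>)"

definition laplace_exponent :: "'a measure \<Rightarrow> (real \<Rightarrow> 'a \<Rightarrow> real) \<Rightarrow> real \<Rightarrow> real" where
  "laplace_exponent M X s = ln (\<integral>\<omega>. exp (- s * X 1 \<omega>) \<partial>M)"

text \<open>The integrability of \<open>exp (- s * X 1)\<close> has to be recorded explicitly, since the Bochner
  integral of a non-integrable function is 0. The Levy measure lives on the whole real line but
  does not charge the non-positive half-line.\<close>

locale spectrally_positive_levy = levy_process M X
  for M :: "'a measure" and X :: "real \<Rightarrow> 'a \<Rightarrow> real" +
  fixes c \<sigma> :: real and \<nu> :: "real measure"
  assumes no_negative_jumps: "AE \<omega> in M. \<forall>t>0. 0 \<le> jump (\<lambda>t. X t \<omega>) t"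
    and not_monotone:
      "\<not> (AE \<omega> in M. mono_on {0..} (\<lambda>t. X t \<omega>) \<or> antimono_on {0..} (\<lambda>t. X t \<omega>))"
    and levy_measure_sets: "sets \<nu> = sets borel"
    and levy_measure_positive: "emeasure \<nu> {..0} = 0"
    and levy_measure_integrable: "integrable \<nu> (\<lambda>z. min 1 (z\<^sup>2))"
    and laplace_integrable: "0 \<le> s \<Longrightarrow> integrable M (\<lambda>\<omega>. exp (- s * X 1 \<omega>))"
    and laplace_exponent_eq: "0 \<le> s \<Longrightarrow> laplace_exponent M X s = levy_khintchine_exponent c \<sigma> \<nu> s"

definition levy_mean :: "'a measure \<Rightarrow> (real \<Rightarrow> 'a \<Rightarrow> real) \<Rightarrow> real" where
  "levy_mean M X = (\<integral>\<omega>. X 1 \<omega> \<partial>M)"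


section \<open>The value of a \<open>(c1, c2)\<close>-policy\<close>

text \<open>The definitions are pathwise, for a path \<open>f\<close> of the uncontrolled surplus (\<open>f t = x + X t \<omega>\<close>).
  Payment times are extended reals, infinite if no further payment is made. Before payment \<open>0\<close> the
  controlled surplus is \<open>f\<close>; after payment \<open>n\<close>, which is made at time \<open>T\<close>, and until the next one,
  it is \<open>c1 + (f t - f T)\<close>.\<close>

primrec payment_time :: "real \<Rightarrow> real \<Rightarrow> (real \<Rightarrow> real) \<Rightarrow> nat \<Rightarrow> ereal" where
  "payment_time c1 c2 f 0 = Inf (ereal ` {t. 0 \<le> t \<and> c2 \<le> f t})"
| "payment_time c1 c2 f (Suc n) =
     Inf (ereal ` {t. payment_time c1 c2 f n < ereal t \<and>
                      c2 \<le> c1 + (f t - f (real_of_ereal (payment_time c1 c2 f n)))})"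

primrec payment :: "real \<Rightarrow> real \<Rightarrow> (real \<Rightarrow> real) \<Rightarrow> nat \<Rightarrow> real" where
  "payment c1 c2 f 0 = f (real_of_ereal (payment_time c1 c2 f 0)) - c1"
| "payment c1 c2 f (Suc n) =
     (c1 + (f (real_of_ereal (payment_time c1 c2 f (Suc n)))
             - f (real_of_ereal (payment_time c1 c2 f n)))) - c1"

text \<open>For a cadlag path and \<open>c1 < c2\<close> only finitely many payments are made up to time \<open>t\<close>. The
  dividend process and the cost process vanish on the negative half-line, so that \<open>L_{0-} = 0\<close> and
  a payment at time 0 is a jump of both.\<close>

definition dividends :: "real \<Rightarrow> real \<Rightarrow> (real \<Rightarrow> real) \<Rightarrow> real \<Rightarrow> real" where
  "dividends c1 c2 f t = (\<Sum>n | payment_time c1 c2 f n \<le> ereal t. payment c1 c2 f n)"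

definition transaction_costs :: "real \<Rightarrow> (real \<Rightarrow> real) \<Rightarrow> real \<Rightarrow> real" where
  "transaction_costs \<beta> L t = (\<Sum>s | 0 \<le> s \<and> s \<le> t \<and> 0 < jump L s. \<beta>)"

definition ruin_time :: "real \<Rightarrow> real \<Rightarrow> (real \<Rightarrow> real) \<Rightarrow> ereal" where
  "ruin_time c1 c2 f = Inf (ereal ` {t. 0 < t \<and> f t - dividends c1 c2 f t < 0})"

text \<open>The Stieltjes integral against \<open>L - costs\<close> over the closed interval from 0 to the ruin time.
  The integrator is a difference of nondecreasing right-continuous functions, and
  \<^const>\<open>interval_measure\<close> is the Stieltjes measure of such a function. The right end point matters:
  for \<open>c1 = 0\<close> a payment is immediately followed by ruin.\<close>

definition net_dividends :: "real \<Rightarrow> real \<Rightarrow> real \<Rightarrow> real \<Rightarrow> (real \<Rightarrow> real) \<Rightarrow> real" where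
  "net_dividends q \<beta> c1 c2 f =
     (let L = dividends c1 c2 f; I = {t. 0 \<le> t \<and> ereal t \<le> ruin_time c1 c2 f} in
        set_lebesgue_integral (interval_measure L) I (\<lambda>t. exp (- q * t))
      - set_lebesgue_integral (interval_measure (transaction_costs \<beta> L)) I (\<lambda>t. exp (- q * t)))"

text \<open>The paths are regular only almost surely, so the integrand may fail to be measurable on a null
  set; hence the completion, which does not change the integral of a measurable function.\<close>

definition policy_value ::
  "'a measure \<Rightarrow> (real \<Rightarrow> 'a \<Rightarrow> real) \<Rightarrow> real \<Rightarrow> real \<Rightarrow> real \<Rightarrow> real \<Rightarrow> real \<Rightarrow> real" where
  "policy_value M X q \<beta> c1 c2 x =
     (\<integral>\<omega>. net_dividends q \<beta> c1 c2 (\<lambda>t. x + X t \<omega>) \<partial>completion M)"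


section \<open>Scale functions\<close>

definition right_inverse :: "(real \<Rightarrow> real) \<Rightarrow> real \<Rightarrow> real" where
  "right_inverse \<psi> q = Sup {l. 0 \<le> l \<and> \<psi> l = q}"

definition is_scale_function :: "(real \<Rightarrow> real) \<Rightarrow> real \<Rightarrow> (real \<Rightarrow> real) \<Rightarrow> bool" where
  "is_scale_function \<psi> q W \<longleftrightarrow>
     (\<forall>x. 0 \<le> W x) \<and> (\<forall>x<0. W x = 0) \<and> continuous_on {0..} W \<and> strict_mono_on {0..} W \<and>
     (\<forall>s > right_inverse \<psi> q.
        has_bochner_integral lborel (\<lambda>x. indicator {0..} x * (exp (- s * x) * W x))
          (1 / (\<psi> s - q)))"

definition W_bar :: "(real \<Rightarrow> real) \<Rightarrow> real \<Rightarrow> real" where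
  "W_bar W x = (LBINT y=0..x. W y)"

definition Z_fun :: "real \<Rightarrow> (real \<Rightarrow> real) \<Rightarrow> real \<Rightarrow> real" where
  "Z_fun q W x = 1 + q * W_bar W x"

definition Z_bar :: "real \<Rightarrow> (real \<Rightarrow> real) \<Rightarrow> real \<Rightarrow> real" where
  "Z_bar q W x = (LBINT z=0..x. Z_fun q W z)"

definition R_fun :: "real \<Rightarrow> real \<Rightarrow> (real \<Rightarrow> real) \<Rightarrow> real \<Rightarrow> real" where
  "R_fun \<mu> q W x = Z_bar q W x - \<mu> / q"


section \<open>The auxiliary functions\<close>

definition gamma_fun ::
  "'a measure \<Rightarrow> (real \<Rightarrow> 'a \<Rightarrow> real) \<Rightarrow> real \<Rightarrow> real \<Rightarrow> real \<Rightarrow> real \<Rightarrow> real" where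
  "gamma_fun M X q \<beta> c1 c2 =
     policy_value M X q \<beta> c1 c2 c1 + c2 - c1 - \<beta> - levy_mean M X / q"

definition G_fun ::
  "'a measure \<Rightarrow> (real \<Rightarrow> 'a \<Rightarrow> real) \<Rightarrow> (real \<Rightarrow> real) \<Rightarrow> real \<Rightarrow> real \<Rightarrow> real \<Rightarrow> real \<Rightarrow> real" where
  "G_fun M X W q \<beta> c1 c2 =
     gamma_fun M X q \<beta> c1 c2 * Z_fun q W c2 - R_fun (levy_mean M X) q W c2"

definition H_fun ::
  "'a measure \<Rightarrow> (real \<Rightarrow> 'a \<Rightarrow> real) \<Rightarrow> (real \<Rightarrow> real) \<Rightarrow> real \<Rightarrow> real \<Rightarrow> real \<Rightarrow> real \<Rightarrow> real" where
  "H_fun M X W q \<beta> c1 c2 =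
     q * (gamma_fun M X q \<beta> c1 c2 * W (c2 - c1) - W_bar W (c2 - c1))"

end

(* Put h(y) = gamma Z(y) - R(y). The Laplace transform of W shows that
   exp(-q t) E h(y - X_t) = h(y) - q int_0^t exp(-q r) E k(y - X_r) dr with k(y) = gamma - y for y < 0
   and k(y) = 0 for y >= 0. Hence exp(-q t) h(c2 - x - X_t) is a martingale until the surplus reaches
   c2 or is ruined. G = 0 says h(c2) = 0, so ruin contributes nothing to the stopped expectation, and
   for y <= 0 the value h(y) is linear and equals the net amount paid at a surplus c2 - y plus the
   value of restarting at c1. There are no negative jumps, so ruin happens continuously and h(c2) is
   the exact boundary value. Summing over the payments gives v(x) = h(c2 - x) + A (h(c2 - c1) - v(c1))
   with some A >= 0; at x = c1 this forces h(c2 - c1) = v(c1), so the correction vanishes for every x. *)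

theory Submission
  imports Defs "HOL-Complex_Analysis.Complex_Analysis"
begin

section \<open>Payment times along a path\<close>

text \<open>\<open>W\<close> need not be differentiable, so no generator is applied to h. Only
  integrals of \<open>W\<close> enter h, and on the Laplace transform in the starting point the
  semigroup acts as multiplication by exp(t psi(s)); this is why the martingale identity can be read
  off from the transform. Since \<open>X\<close> also moves down, y runs over the whole line and
  uniqueness of two-sided transforms is needed.

  The raw natural filtration is another obstacle: of the exit time only the events {exit < u} are
  known at time u. Random times are therefore rounded up to strictly later dyadic times. In optional
  stopping the resulting error lives in one cell and vanishes by domination over bounded time
  intervals, for which Ottaviani's inequality supplies the integrable bound.

  Payments after the first are reached by a change of measure: the weight exp(-q T) on the event of
  a payment, normalised, makes the restarted process one with the same increment laws. The sum A
  converges because each climb from c1 to c2 costs a discount factor of mean at most some constant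
  below 1.\<close>

definition good_path :: "(real \<Rightarrow> real) \<Rightarrow> bool" where
  "good_path f \<longleftrightarrow> (\<forall>t\<ge>0. continuous (at_right t) f) \<and> (\<forall>t>0. \<exists>l\<le>f t. (f \<longlongrightarrow> l) (at_left t))"

text \<open>\<open>good_path\<close> keeps an explicit left limit l with l \<le> f t, because
  \<open>jump\<close> is defined through \<open>Lim\<close> and says nothing until the limit is
  known to exist. Right continuity together with l \<le> f t is upper semicontinuity, the form in
  which the sign of the jumps is used later.\<close>

lemma good_path_if_cadlag:
  assumes "cadlag f" "\<forall>t>0. 0 \<le> jump f t"
  shows "good_path f"
proof -
  have "\<exists>l\<le>f t. (f \<longlongrightarrow> l) (at_left t)" if "t > 0" for t
  proof -
    have "\<exists>l. (f \<longlongrightarrow> l) (at_left t)"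
      using assms(1) that unfolding cadlag_def by simp
    then obtain l where l: "(f \<longlongrightarrow> l) (at_left t)" ..
    have "Lim (at_left t) f = l"
      by (rule tendsto_Lim[OF _ l]) simp
    moreover have "0 \<le> jump f t" using assms(2) that by blast
    ultimately show ?thesis
      using l unfolding jump_def by (intro exI[of _ l]) simp
  qed
  then show ?thesis
    using assms(1) unfolding cadlag_def good_path_def by simp
qed

lemma good_path_right: "good_path f \<Longrightarrow> 0 \<le> t \<Longrightarrow> (f \<longlongrightarrow> f t) (at_right t)"
  unfolding good_path_def continuous_within by simp

lemma good_path_left: "good_path f \<Longrightarrow> 0 < t \<Longrightarrow> \<exists>l\<le>f t. (f \<longlongrightarrow> l) (at_left t)"
  unfolding good_path_def by simp

lemma filterlim_add_at_right: "filterlim (\<lambda>t. s + t) (at_right (s + t)) (at_right (t::real))"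
proof -
  have "((\<lambda>t. s + t) \<longlongrightarrow> s + t) (at_right t)" by (intro tendsto_intros)
  moreover have "eventually (\<lambda>x. s + x \<in> {s + t<..} \<and> s + x \<noteq> s + t) (at_right t)"
    unfolding eventually_at_filter by simp
  ultimately show ?thesis unfolding filterlim_at by (rule conjI[rotated])
qed

lemma filterlim_add_at_left: "filterlim (\<lambda>t. s + t) (at_left (s + t)) (at_left (t::real))"
proof -
  have "((\<lambda>t. s + t) \<longlongrightarrow> s + t) (at_left t)" by (intro tendsto_intros)
  moreover have "eventually (\<lambda>x. s + x \<in> {..<s + t} \<and> s + x \<noteq> s + t) (at_left t)"
    unfolding eventually_at_filter by simp
  ultimately show ?thesis unfolding filterlim_at by (rule conjI[rotated])
qed

text \<open>The constants cover both uses: a translated starting point, and a path restarted at time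
  s from a new level.\<close>

lemma good_path_shift:
  assumes "good_path f" "0 \<le> s"
  shows "good_path (\<lambda>t. a + (f (s + t) - b))"
  unfolding good_path_def continuous_within Ball_def
proof (intro conjI allI impI)
  fix t :: real assume t: "0 \<le> t"
  have "((\<lambda>t. f (s + t)) \<longlongrightarrow> f (s + t)) (at_right t)"
    using good_path_right[OF assms(1), of "s + t"] t assms(2)
    by (intro filterlim_compose[OF _ filterlim_add_at_right]) auto
  then show "((\<lambda>t. a + (f (s + t) - b)) \<longlongrightarrow> a + (f (s + t) - b)) (at_right t)"
    by (intro tendsto_intros)
next
  fix t :: real assume t: "0 < t"
  obtain l where l: "l \<le> f (s + t)" "(f \<longlongrightarrow> l) (at_left (s + t))"
    using good_path_left[OF assms(1), of "s + t"] t assms(2) by auto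
  have "((\<lambda>t. f (s + t)) \<longlongrightarrow> l) (at_left t)"
    by (intro filterlim_compose[OF l(2) filterlim_add_at_left])
  then have "((\<lambda>t. a + (f (s + t) - b)) \<longlongrightarrow> a + (l - b)) (at_left t)"
    by (intro tendsto_intros)
  then show "\<exists>l\<le>a + (f (s + t) - b). ((\<lambda>t. a + (f (s + t) - b)) \<longlongrightarrow> l) (at_left t)"
    using l(1) by (intro exI[of _ "a + (l - b)"]) auto
qed

section \<open>Hitting times of a level\<close>

definition hits :: "real \<Rightarrow> (real \<Rightarrow> real) \<Rightarrow> bool" where
  "hits a f \<longleftrightarrow> (\<exists>t\<ge>0. a \<le> f t)"

text \<open>The default 0 for a path that never reaches the level keeps the time real and
  nonnegative; whether there is a genuine hit is recorded separately by \<open>hits\<close>.\<close>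

definition hit_time :: "real \<Rightarrow> (real \<Rightarrow> real) \<Rightarrow> real" where
  "hit_time a f = (if hits a f then Inf {t. 0 \<le> t \<and> a \<le> f t} else 0)"

lemma hit_time_nonneg: "0 \<le> hit_time a f"
  unfolding hit_time_def hits_def by (auto intro!: cInf_greatest)

lemma hit_time_le: "0 \<le> t \<Longrightarrow> a \<le> f t \<Longrightarrow> hit_time a f \<le> t"
  unfolding hit_time_def hits_def by (auto intro!: cInf_lower bdd_belowI[of _ 0])

lemma before_hit_time: "0 \<le> t \<Longrightarrow> t < hit_time a f \<Longrightarrow> f t < a"
  using hit_time_le[of t a f] by force

text \<open>The infimum is attained by right continuity: a value below the level at the hitting time
  would persist on an interval to its right, and there is no hit before, so the infimum would be
  larger.\<close>

lemma at_hit_time: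
  assumes "good_path f" "hits a f"
  shows "a \<le> f (hit_time a f)"
proof (rule ccontr)
  let ?S = "{t. 0 \<le> t \<and> a \<le> f t}" let ?t = "hit_time a f"
  assume "\<not> a \<le> f ?t"
  then have *: "f ?t < a" by simp
  have "eventually (\<lambda>t. f t < a) (at_right ?t)"
    using good_path_right[OF assms(1) hit_time_nonneg] * by (rule order_tendstoD)
  then obtain b where b: "b > ?t" "\<And>t. ?t < t \<Longrightarrow> t < b \<Longrightarrow> f t < a"
    unfolding eventually_at_right_field by auto
  have "b \<le> Inf ?S"
  proof (rule cInf_greatest)
    show "?S \<noteq> {}" using assms(2) unfolding hits_def by auto
    fix t assume "t \<in> ?S"
    then show "b \<le> t"
      using b(2)[of t] * before_hit_time[of t a f] not_less[of ?t t] by (cases "t = ?t") auto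
  qed
  then show False
    using b(1) assms(2) by (simp add: hit_time_def)
qed

lemma Inf_ereal_shift: "Inf (ereal ` ((+) a ` S)) = ereal a + Inf (ereal ` S)"
proof (rule antisym)
  have "Inf (ereal ` ((+) a ` S)) - ereal a \<le> Inf (ereal ` S)"
  proof (rule Inf_greatest)
    fix x assume "x \<in> ereal ` S"
    then obtain s where s: "x = ereal s" "s \<in> S" by auto
    have "Inf (ereal ` ((+) a ` S)) \<le> ereal (a + s)"
      using s(2) by (intro Inf_lower) auto
    then show "Inf (ereal ` ((+) a ` S)) - ereal a \<le> x"
      unfolding s(1) by (cases "Inf (ereal ` ((+) a ` S))") auto
  qed
  then show "Inf (ereal ` ((+) a ` S)) \<le> ereal a + Inf (ereal ` S)"
    by (cases "Inf (ereal ` ((+) a ` S))"; cases "Inf (ereal ` S)") auto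
  show "ereal a + Inf (ereal ` S) \<le> Inf (ereal ` ((+) a ` S))"
  proof (rule Inf_greatest)
    fix x assume "x \<in> ereal ` ((+) a ` S)"
    then obtain s where s: "x = ereal (a + s)" "s \<in> S" by auto
    have "Inf (ereal ` S) \<le> ereal s"
      using s(2) by (intro Inf_lower) auto
    then show "ereal a + Inf (ereal ` S) \<le> x"
      unfolding s(1) by (cases "Inf (ereal ` S)") auto
  qed
qed

lemma payment_time_0_hits:
  assumes "good_path f" "hits c2 f"
  shows "payment_time c1 c2 f 0 = ereal (hit_time c2 f)"
  unfolding payment_time.simps
  by (rule antisym; (rule Inf_lower | rule Inf_greatest))
     (use at_hit_time[OF assms] hit_time_nonneg[of c2 f] hit_time_le[of _ c2 f] in auto)

lemma payment_time_nonneg: "0 \<le> payment_time c1 c2 f n"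
proof (induction n)
  case 0 show ?case by (auto intro!: Inf_greatest)
next
  case (Suc n)
  have "0 \<le> ereal t" if "payment_time c1 c2 f n < ereal t" for t
    using Suc less_imp_le[OF that] by (rule order_trans)
  then show ?case unfolding payment_time.simps(2) by (intro Inf_greatest) blast
qed

lemma payment_time_not_hits: "\<not> hits c2 f \<Longrightarrow> payment_time c1 c2 f n = \<infinity>"
proof (induction n)
  case 0
  then have "{t. 0 \<le> t \<and> c2 \<le> f t} = {}" unfolding hits_def by auto
  then show ?case unfolding payment_time.simps by (simp only: image_empty Inf_empty top_ereal_def)
next
  case (Suc n)
  then have "payment_time c1 c2 f n = \<infinity>" by simp
  then show ?case by (simp add: top_ereal_def)
qed

section \<open>The path restarted after its first payment\<close>

definition restart :: "real \<Rightarrow> real \<Rightarrow> (real \<Rightarrow> real) \<Rightarrow> real \<Rightarrow> real" where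
  "restart c1 c2 f = (\<lambda>t. c1 + (f (hit_time c2 f + t) - f (hit_time c2 f)))"

lemma good_path_restart: "good_path f \<Longrightarrow> good_path (restart c1 c2 f)"
  unfolding restart_def by (rule good_path_shift) (auto simp: hit_time_nonneg)

lemma restart_0 [simp]: "restart c1 c2 f 0 = c1"
  by (simp add: restart_def)

text \<open>Payments depend on the path only through its increments after the previous payment. So
  the payments of the restarted path are those of f with index and clock moved by one payment; all
  later inductions on the number of payments rest on this shift.\<close>

lemma payment_time_Suc_eq:
  assumes f: "good_path f" "hits c2 f" and "c1 < c2"
  shows "payment_time c1 c2 f (Suc n) = ereal (hit_time c2 f) + payment_time c1 c2 (restart c1 c2 f) n"
proof (induction n)
  let ?T = "hit_time c2 f" and ?g = "restart c1 c2 f"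
  case 0
  have "{t. ?T < t \<and> c2 \<le> c1 + (f t - f ?T)} = (+) ?T ` {t. 0 \<le> t \<and> c2 \<le> ?g t}" (is "?A = (+) ?T ` ?B")
  proof (intro set_eqI iffI)
    fix t assume "t \<in> ?A"
    then show "t \<in> (+) ?T ` ?B"
      by (intro image_eqI[of _ _ "t - ?T"]) (auto simp: restart_def)
  next
    fix t assume "t \<in> (+) ?T ` ?B"
    then obtain s where s: "t = ?T + s" "0 \<le> s" "c2 \<le> ?g s" by auto
    \<comment> \<open>The original path asks for a time strictly after the payment, the restarted
      path allows time 0. The two agree since the restarted path begins at c1 < c2.\<close>
    then have "s \<noteq> 0" using \<open>c1 < c2\<close> by (auto intro!: notI)
    then show "t \<in> ?A" using s by (auto simp: restart_def)
  qed
  then show ?case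
    unfolding payment_time.simps(2) payment_time_0_hits[OF f]
    by (simp add: Inf_ereal_shift)
next
  let ?T = "hit_time c2 f" and ?g = "restart c1 c2 f"
  case (Suc n)
  let ?t = "payment_time c1 c2 ?g n"
  show ?case
  proof (cases "?t")
    case (real r)
    have "{t. ereal (?T + r) < ereal t \<and> c2 \<le> c1 + (f t - f (?T + r))}
        = (+) ?T ` {t. ?t < ereal t \<and> c2 \<le> c1 + (?g t - ?g r)}" (is "?A = (+) ?T ` ?B")
    proof (intro set_eqI iffI)
      fix t assume "t \<in> ?A"
      then show "t \<in> (+) ?T ` ?B"
        unfolding real by (intro image_eqI[of _ _ "t - ?T"]) (auto simp: restart_def)
    next
      fix t assume "t \<in> (+) ?T ` ?B"
      then show "t \<in> ?A" unfolding real by (auto simp: restart_def)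
    qed
    then show ?thesis
      unfolding payment_time.simps(2)[of _ _ _ "Suc n"] Suc
      unfolding payment_time.simps(2)[of _ _ ?g n]
      by (simp add: real Inf_ereal_shift del: payment_time.simps)
  next
    case PInf
    show ?thesis
      unfolding payment_time.simps(2)[of _ _ _ "Suc n"] Suc
      unfolding payment_time.simps(2)[of _ _ ?g n]
      by (simp add: PInf top_ereal_def del: payment_time.simps)
  next
    case MInf
    then show ?thesis using payment_time_nonneg[of c1 c2 ?g n] by simp
  qed
qed

declare payment_time.simps [simp del]

text \<open>Finiteness matters because \<open>payment\<close> evaluates the path at
  \<open>real_of_ereal\<close> of the payment time, whose value at infinity is a mere default and is
  not moved by the shift.\<close>

lemma payment_Suc_eq:
  assumes f: "good_path f" "hits c2 f" and "c1 < c2"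
    and fin: "payment_time c1 c2 (restart c1 c2 f) n < \<infinity>"
  shows "payment c1 c2 f (Suc n) = payment c1 c2 (restart c1 c2 f) n"
proof (cases n)
  let ?T = "hit_time c2 f" and ?g = "restart c1 c2 f"
  case 0
  obtain r where r: "payment_time c1 c2 ?g 0 = ereal r"
    using fin payment_time_nonneg[of c1 c2 ?g 0] unfolding 0
    by (cases "payment_time c1 c2 ?g 0") auto
  show ?thesis
    unfolding 0 payment.simps payment_time_Suc_eq[OF f \<open>c1 < c2\<close>] r payment_time_0_hits[OF f]
    by (simp add: restart_def)
next
  let ?T = "hit_time c2 f" and ?g = "restart c1 c2 f"
  case (Suc m)
  have "payment_time c1 c2 ?g m \<noteq> \<infinity>"
    using fin unfolding Suc payment_time.simps(2) by (auto simp: top_ereal_def)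
  then obtain s where s: "payment_time c1 c2 ?g m = ereal s"
    using payment_time_nonneg[of c1 c2 ?g m] by (cases "payment_time c1 c2 ?g m") auto
  obtain r where r: "payment_time c1 c2 ?g (Suc m) = ereal r"
    using fin payment_time_nonneg[of c1 c2 ?g "Suc m"] unfolding Suc
    by (cases "payment_time c1 c2 ?g (Suc m)") auto
  show ?thesis
    unfolding Suc payment.simps payment_time_Suc_eq[OF f \<open>c1 < c2\<close>] r s
    by (simp add: restart_def)
qed

lemma hit_time_pos:
  assumes "good_path f" "hits a f" "f 0 < a"
  shows "0 < hit_time a f"
  using at_hit_time[OF assms(1,2)] hit_time_nonneg[of a f] assms(3)
  by (cases "hit_time a f = 0") auto

lemma payment_time_pos:
  assumes "good_path f" "f 0 < c2" "c1 < c2"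
  shows "0 < payment_time c1 c2 f n"
proof (cases "hits c2 f")
  case True
  have *: "0 < hit_time c2 f" using hit_time_pos assms(1,2) True by blast
  show ?thesis
  proof (cases n)
    case 0
    then show ?thesis using * payment_time_0_hits[OF assms(1) True] by simp
  next
    case (Suc m)
    have "0 \<le> payment_time c1 c2 (restart c1 c2 f) m" by (rule payment_time_nonneg)
    then show ?thesis
      unfolding Suc payment_time_Suc_eq[OF assms(1) True assms(3)] using *
      by (cases "payment_time c1 c2 (restart c1 c2 f) m") auto
  qed
qed (simp add: payment_time_not_hits)

section \<open>Spacing and local finiteness of the payments\<close>

lemma payment_time_step:
  assumes "good_path f" "c1 < c2" "payment_time c1 c2 f n = ereal s" "payment_time c1 c2 f (Suc n) = ereal s'"
  shows "0 \<le> s" "s < s'" "f s + (c2 - c1) \<le> f s'"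
proof -
  have "hits c2 f" using assms(3) payment_time_not_hits[of c2 f c1 n] by auto
  have "0 \<le> s \<and> s < s' \<and> f s + (c2 - c1) \<le> f s'"
    using assms \<open>hits c2 f\<close>
  proof (induction n arbitrary: f s s')
    case 0
    let ?g = "restart c1 c2 f"
    have T: "hit_time c2 f = s" using 0(3) payment_time_0_hits[OF 0(1,5), of c1] by simp
    have g: "good_path ?g" using 0 good_path_restart by blast
    have *: "ereal s' = ereal s + payment_time c1 c2 ?g 0"
      using 0(4) payment_time_Suc_eq[OF 0(1,5,2), of 0] T by (simp del: payment_time.simps)
    have h: "hits c2 ?g"
    proof (rule ccontr)
      assume "\<not> hits c2 ?g"
      then show False using payment_time_not_hits[of c2 ?g c1 0] * by simp
    qed
    have "s' = s + hit_time c2 ?g" using * payment_time_0_hits[OF g h] by simp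
    moreover have "0 < hit_time c2 ?g" by (rule hit_time_pos[OF g h]) (use 0 in auto)
    moreover have "c2 \<le> ?g (hit_time c2 ?g)" by (rule at_hit_time[OF g h])
    ultimately show ?case using T hit_time_nonneg[of c2 f] by (auto simp: restart_def)
  next
    case (Suc n)
    let ?g = "restart c1 c2 f"
    let ?T = "hit_time c2 f"
    have g: "good_path ?g" using Suc good_path_restart by blast
    have *: "ereal s' = ereal ?T + payment_time c1 c2 ?g (Suc n)" "ereal s = ereal ?T + payment_time c1 c2 ?g n"
      using Suc.prems(3,4) payment_time_Suc_eq[OF Suc.prems(1,5,2)] by simp_all
    obtain r' where r': "payment_time c1 c2 ?g (Suc n) = ereal r'"
      using *(1) by (cases "payment_time c1 c2 ?g (Suc n)") auto
    obtain r where "payment_time c1 c2 ?g n = ereal r"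
      using *(2) by (cases "payment_time c1 c2 ?g n") auto
    note r = r' this
    then have h: "hits c2 ?g" using payment_time_not_hits[of c2 ?g c1 n] by auto
    have "0 \<le> r \<and> r < r' \<and> ?g r + (c2 - c1) \<le> ?g r'"
      using Suc.IH[OF g \<open>c1 < c2\<close> r(2,1) h] .
    then show ?case using * r hit_time_nonneg[of c2 f] by (auto simp: restart_def)
  qed
  then show "0 \<le> s" "s < s'" "f s + (c2 - c1) \<le> f s'" by auto
qed

lemma payment_time_less_Suc: "payment_time c1 c2 f n \<le> payment_time c1 c2 f (Suc n)"
  unfolding payment_time.simps(2) by (rule Inf_greatest) (auto simp: less_imp_le)

text \<open>Infinitely many payments up to t would accumulate from the left at some L > 0. The path
  has a left limit at L, so its values at consecutive payment times become close, although each
  exceeds the previous one by at least c2 - c1.\<close>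

lemma finite_payment_times:
  assumes f: "good_path f" "c1 < c2"
  shows "finite {n. payment_time c1 c2 f n \<le> ereal t}"
proof (rule ccontr)

  assume inf: "infinite {n. payment_time c1 c2 f n \<le> ereal t}"
  have mono: "mono (payment_time c1 c2 f)"
    by (rule incseq_SucI) (rule payment_time_less_Suc)
  have le: "payment_time c1 c2 f n \<le> ereal t" for n
  proof -
    obtain m where "m \<ge> n" "payment_time c1 c2 f m \<le> ereal t"
      using inf unfolding infinite_nat_iff_unbounded_le by auto
    then show ?thesis using monoD[OF mono] order_trans by blast
  qed
  define s where "s n = real_of_ereal (payment_time c1 c2 f n)" for n
  have s: "payment_time c1 c2 f n = ereal (s n)" for n
    using le[of n] payment_time_nonneg[of c1 c2 f n] unfolding s_def
    by (cases "payment_time c1 c2 f n") auto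
  note st = payment_time_step[OF f s s]
  have "incseq s" using st(2) by (intro incseq_SucI less_imp_le)
  moreover have "s n \<le> t" for n using le[of n] s by simp
  ultimately obtain L where L: "s \<longlonglongrightarrow> L" "\<And>n. s n \<le> L"
    using incseq_convergent by metis
  have lt: "s n < L" for n using st(2)[of n] L(2)[of "Suc n"] by linarith
  have "0 < L" using st(1)[of 0] lt[of 0] by linarith
  then obtain l where l: "(f \<longlongrightarrow> l) (at_left L)" using good_path_left f by blast
  have "filterlim s (at_left L) sequentially"
    unfolding filterlim_at using L lt by (auto intro!: always_eventually simp: less_imp_neq)
  then have 1: "(\<lambda>n. f (s n)) \<longlonglongrightarrow> l" by (rule filterlim_compose[OF l])
  have 2: "(\<lambda>n. f (s (Suc n)) - f (s n)) \<longlonglongrightarrow> l - l"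
    by (intro tendsto_diff 1 LIMSEQ_Suc[OF 1])
  have "c2 - c1 \<le> l - l"
    by (rule LIMSEQ_le_const[OF 2]) (use st(3) in \<open>auto simp: algebra_simps\<close>)
  then show False using f by simp
qed

lemma dividends_hits:
  assumes f: "good_path f" "c1 < c2" "hits c2 f"
  shows "dividends c1 c2 f t = (if t < hit_time c2 f then 0 else
    f (hit_time c2 f) - c1 + dividends c1 c2 (restart c1 c2 f) (t - hit_time c2 f))"
proof -
  let ?T = "hit_time c2 f" and ?g = "restart c1 c2 f"
  have Suc_le: "payment_time c1 c2 f (Suc n) \<le> ereal t \<longleftrightarrow> payment_time c1 c2 ?g n \<le> ereal (t - ?T)" for n
    unfolding payment_time_Suc_eq[OF f(1,3,2)]
    by (cases "payment_time c1 c2 ?g n") auto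
  have zero_le: "payment_time c1 c2 f 0 \<le> ereal t \<longleftrightarrow> ?T \<le> t"
    using payment_time_0_hits[OF f(1,3)] by simp
  have neg: "\<not> payment_time c1 c2 ?g n \<le> ereal u" if "u < 0" for n u
    using payment_time_nonneg[of c1 c2 ?g n] that
    by (cases "payment_time c1 c2 ?g n") auto
  have set_eq: "{n. payment_time c1 c2 f n \<le> ereal t} =
      (if t < ?T then {} else insert 0 (Suc ` {n. payment_time c1 c2 ?g n \<le> ereal (t - ?T)}))" (is "?A = ?B")
  proof (rule set_eqI)
    fix n show "n \<in> ?A \<longleftrightarrow> n \<in> ?B"
      by (cases n) (use Suc_le zero_le neg in \<open>auto simp: payment_time.simps\<close>)
  qed
  show ?thesis
  proof (cases "t < ?T")
    case True
    then show ?thesis unfolding dividends_def set_eq by simp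
  next
    case False
    have "(\<Sum>n\<in>Suc ` {n. payment_time c1 c2 ?g n \<le> ereal (t - ?T)}. payment c1 c2 f n)
       = (\<Sum>n | payment_time c1 c2 ?g n \<le> ereal (t - ?T). payment c1 c2 ?g n)"
      by (subst sum.reindex) (auto intro!: sum.cong payment_Suc_eq[OF f(1,3,2)] simp del: payment.simps)
    moreover have "finite (Suc ` {n. payment_time c1 c2 ?g n \<le> ereal (t - ?T)})"
      by (intro finite_imageI finite_payment_times good_path_restart f)
    ultimately show ?thesis
      using False unfolding dividends_def set_eq
      by (simp add: payment_time_0_hits[OF f(1,3)])
  qed
qed

section \<open>Payments made no later than ruin\<close>

lemma le_ruin_time_iff:
  "T \<le> ruin_time c1 c2 f \<longleftrightarrow> (\<forall>t>0. ereal t < T \<longrightarrow> 0 \<le> f t - dividends c1 c2 f t)"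
  unfolding ruin_time_def le_Inf_iff by (auto simp: not_less[symmetric])

text \<open>The first payment is made and is not preceded by ruin.\<close>

definition first_paid :: "real \<Rightarrow> (real \<Rightarrow> real) \<Rightarrow> bool" where
  "first_paid c2 f \<longleftrightarrow> hits c2 f \<and> (\<forall>t. 0 < t \<and> t < hit_time c2 f \<longrightarrow> 0 \<le> f t)"

text \<open>The recursion runs through the restarted path, the form in which the strong Markov
  property evaluates expectations; \<open>paid_iff\<close> and \<open>paid_eq\<close> tie it to the
  payment times of the policy.\<close>

primrec paid :: "real \<Rightarrow> real \<Rightarrow> nat \<Rightarrow> (real \<Rightarrow> real) \<Rightarrow> bool" where
  "paid c1 c2 0 = first_paid c2"
| "paid c1 c2 (Suc n) = (\<lambda>f. first_paid c2 f \<and> paid c1 c2 n (restart c1 c2 f))"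

primrec paid_time :: "real \<Rightarrow> real \<Rightarrow> nat \<Rightarrow> (real \<Rightarrow> real) \<Rightarrow> real" where
  "paid_time c1 c2 0 = hit_time c2"
| "paid_time c1 c2 (Suc n) = (\<lambda>f. hit_time c2 f + paid_time c1 c2 n (restart c1 c2 f))"

primrec paid_amount :: "real \<Rightarrow> real \<Rightarrow> nat \<Rightarrow> (real \<Rightarrow> real) \<Rightarrow> real" where
  "paid_amount c1 c2 0 = (\<lambda>f. f (hit_time c2 f) - c1)"
| "paid_amount c1 c2 (Suc n) = (\<lambda>f. paid_amount c1 c2 n (restart c1 c2 f))"

text \<open>After the first payment the controlled surplus of f is that of the restarted path. Hence
  ruin before payment n + 1 means ruin before the first payment, or ruin of the restarted path
  before its payment n. Ruin is tested strictly before the payment time, so a payment at the ruin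
  time itself counts, in accordance with the closed interval in
  \<open>net_dividends\<close>.\<close>

lemma paid_iff:
  assumes "good_path f" "0 \<le> c1" "c1 < c2"
  shows "paid c1 c2 n f \<longleftrightarrow> payment_time c1 c2 f n < \<infinity> \<and> payment_time c1 c2 f n \<le> ruin_time c1 c2 f"
  using assms(1)
proof (induction n arbitrary: f)
  case 0
  show ?case
  proof (cases "hits c2 f")
    case True
    then show ?thesis
      using payment_time_0_hits[OF 0(1) True] dividends_hits[OF 0 assms(3) True]
      by (auto simp: le_ruin_time_iff first_paid_def)
  qed (simp add: first_paid_def payment_time_not_hits)
next
  case (Suc n)
  let ?T = "hit_time c2 f" and ?g = "restart c1 c2 f"
  show ?case
  proof (cases "hits c2 f")
    case True
    have g: "good_path ?g" using Suc.prems good_path_restart by blast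
    note dv = dividends_hits[OF Suc.prems assms(3) True]
    note sucT = payment_time_Suc_eq[OF Suc.prems True assms(3)]
    \<comment> \<open>The restarted path is below c2 at time 0, so no further payment coincides with
      the one just made.\<close>
    have "\<not> payment_time c1 c2 ?g n \<le> ereal 0" for n
      using payment_time_pos[OF g _ assms(3), of n] assms(3) by (simp add: not_le zero_ereal_def)
    then have dv0: "dividends c1 c2 ?g 0 = 0"
      unfolding dividends_def by simp
    have fin: "payment_time c1 c2 f (Suc n) < \<infinity> \<longleftrightarrow> payment_time c1 c2 ?g n < \<infinity>"
      unfolding sucT by (cases "payment_time c1 c2 ?g n") auto
    have "payment_time c1 c2 f (Suc n) \<le> ruin_time c1 c2 f \<longleftrightarrow>
        (\<forall>t. 0 < t \<and> t < ?T \<longrightarrow> 0 \<le> f t) \<and> payment_time c1 c2 ?g n \<le> ruin_time c1 c2 ?g"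
      (is "?L \<longleftrightarrow> ?R1 \<and> ?R2")
    proof
      assume L: ?L
      then have *: "0 \<le> f t - dividends c1 c2 f t" if "0 < t" "ereal t < ereal ?T + payment_time c1 c2 ?g n" for t
        using that unfolding le_ruin_time_iff sucT by blast
      have ?R1
      proof (intro allI impI)
        fix t assume t: "0 < t \<and> t < ?T"
        then have "ereal t < ereal ?T + payment_time c1 c2 ?g n"
          using payment_time_nonneg[of c1 c2 ?g n] by (cases "payment_time c1 c2 ?g n") auto
        then show "0 \<le> f t" using *[of t] t dv[of t] by simp
      qed
      moreover have ?R2
        unfolding le_ruin_time_iff
      proof (intro allI impI)
        fix t assume t: "0 < t" "ereal t < payment_time c1 c2 ?g n"
        then have "ereal (?T + t) < ereal ?T + payment_time c1 c2 ?g n"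
          by (cases "payment_time c1 c2 ?g n") auto
        then show "0 \<le> ?g t - dividends c1 c2 ?g t"
          using *[of "?T + t"] dv[of "?T + t"] t hit_time_nonneg[of c2 f] by (auto simp: restart_def)
      qed
      ultimately show "?R1 \<and> ?R2" by blast
    next
      assume R: "?R1 \<and> ?R2"
      show ?L
        unfolding le_ruin_time_iff sucT
      proof (intro allI impI)
        fix t assume t: "0 < t" "ereal t < ereal ?T + payment_time c1 c2 ?g n"
        consider "t < ?T" | "t = ?T" | "?T < t" by linarith
        then show "0 \<le> f t - dividends c1 c2 f t"
        proof cases
          case 1 then show ?thesis using R t dv[of t] by simp
        next
          \<comment> \<open>At the payment time itself the surplus is c1, which is
            nonnegative.\<close>
          case 2 then show ?thesis using dv[of t] dv0 assms(2) by simp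
        next
          case 3
          have "ereal (t - ?T) < payment_time c1 c2 ?g n"
            using t by (cases "payment_time c1 c2 ?g n") auto
          then have "0 \<le> ?g (t - ?T) - dividends c1 c2 ?g (t - ?T)"
            using R 3 unfolding le_ruin_time_iff by simp
          then show ?thesis using dv[of t] 3 by (auto simp: restart_def)
        qed
      qed
    qed
    then show ?thesis
      unfolding fin using Suc.IH[OF g] True by (auto simp: first_paid_def)
  qed (simp add: first_paid_def payment_time_not_hits)
qed

lemma paid_eq:
  assumes "good_path f" "0 \<le> c1" "c1 < c2" "paid c1 c2 n f"
  shows "payment_time c1 c2 f n = ereal (paid_time c1 c2 n f)"
    and "payment c1 c2 f n = paid_amount c1 c2 n f"
    and "c2 - c1 \<le> paid_amount c1 c2 n f"
    and "0 \<le> paid_time c1 c2 n f"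
proof -
  have "payment_time c1 c2 f n = ereal (paid_time c1 c2 n f) \<and> payment c1 c2 f n = paid_amount c1 c2 n f
      \<and> c2 - c1 \<le> paid_amount c1 c2 n f"
    using assms(1,4)
  proof (induction n arbitrary: f)
    case 0
    then have "hits c2 f" by (simp add: first_paid_def)
    then show ?case using 0 payment_time_0_hits[of f c2] at_hit_time[of f c2] by simp
  next
    case (Suc n)
    let ?g = "restart c1 c2 f"
    have g: "good_path ?g" using Suc.prems good_path_restart by blast
    have h: "hits c2 f" and p: "paid c1 c2 n ?g" using Suc.prems by (auto simp: first_paid_def)
    show ?case
      using Suc.IH[OF g p] payment_time_Suc_eq[OF Suc.prems(1) h assms(3), of n]
        payment_Suc_eq[OF Suc.prems(1) h assms(3), of n]
      by (simp del: payment.simps)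
  qed
  then show "payment_time c1 c2 f n = ereal (paid_time c1 c2 n f)"
    and "payment c1 c2 f n = paid_amount c1 c2 n f"
    and "c2 - c1 \<le> paid_amount c1 c2 n f"
    by auto
  then show "0 \<le> paid_time c1 c2 n f"
    using payment_time_nonneg[of c1 c2 f n] by simp
qed

section \<open>Net dividends as a series\<close>

text \<open>Both measures give a half-open interval {a<..b} the mass L b - L a, and such intervals
  generate the Borel sets. Finiteness of the jump times up to each t supplies the right continuity
  that a Stieltjes measure needs.\<close>

lemma interval_measure_step:
  fixes \<tau> p :: "nat \<Rightarrow> real"
  assumes fin: "\<And>t. finite {n\<in>J. \<tau> n \<le> t}" and p: "\<And>n. n \<in> J \<Longrightarrow> 0 \<le> p n"
    and L: "\<And>t. L t = (\<Sum>n | n \<in> J \<and> \<tau> n \<le> t. p n)"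
  shows "interval_measure L = distr (density (count_space J) (\<lambda>n. ennreal (p n))) borel \<tau>"
proof -
  have mono: "L x \<le> L y" if "x \<le> y" for x y
    unfolding L using that fin[of y] by (intro sum_mono2) (auto intro: p)
  have right: "continuous (at_right a) L" for a
  proof -
    let ?S = "\<tau> ` {n\<in>J. \<tau> n \<le> a + 1 \<and> a < \<tau> n}"
    have finS: "finite ?S"
      by (intro finite_imageI finite_subset[OF _ fin[of "a+1"]]) auto
    \<comment> \<open>Only finitely many jump times lie in (a, a + 1], so L is constant from a until
      the first of them.\<close>
    obtain b where b: "a < b" "b \<le> a + 1" "\<And>x. x \<in> ?S \<Longrightarrow> b \<le> x"
    proof (cases "?S = {}")
      case True then show ?thesis using that[of "a+1"] by auto
    next
      case False
      show ?thesis
      proof (rule that[of "Min ?S"])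
        have "Min ?S \<in> ?S" by (rule Min_in[OF finS False])
        then show "a < Min ?S" "Min ?S \<le> a + 1" by auto
      qed (use finS in auto)
    qed
    have eqL: "L x = L a" if x: "a < x" "x < b" for x
    proof -
      have "\<tau> n \<le> a" if "n \<in> J" "\<tau> n \<le> x" for n
      proof (rule ccontr)
        assume "\<not> \<tau> n \<le> a"
        then have "\<tau> n \<in> ?S" using that x b(2) by auto
        then show False using b(3)[of "\<tau> n"] that x by simp
      qed
      then have "{n. n \<in> J \<and> \<tau> n \<le> x} = {n. n \<in> J \<and> \<tau> n \<le> a}"
        using x by (intro Collect_cong) (auto intro: order_trans)
      then show ?thesis unfolding L by simp
    qed
    have "eventually (\<lambda>x. L x = L a) (at_right a)"
      unfolding eventually_at_right_field by (intro exI[of _ b] conjI b(1) allI impI eqL)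
    then show ?thesis unfolding continuous_within by (rule tendsto_eventually)
  qed
  let ?N = "distr (density (count_space J) (\<lambda>n. ennreal (p n))) borel \<tau>"
  have N: "emeasure ?N {a<..b} = ennreal (L b - L a)" if "a \<le> b" for a b
  proof -
    let ?A = "{n. n \<in> J \<and> a < \<tau> n \<and> \<tau> n \<le> b}"
    have finA: "finite ?A" by (rule finite_subset[OF _ fin[of b]]) auto
    have "emeasure ?N {a<..b} = emeasure (density (count_space J) (\<lambda>n. ennreal (p n))) ?A"
      by (subst emeasure_distr) (auto intro!: arg_cong[where f="emeasure _"])
    also have "\<dots> = (\<integral>\<^sup>+n. ennreal (p n) * indicator ?A n \<partial>count_space J)"
      by (subst emeasure_density) auto
    also have "\<dots> = (\<Sum>n\<in>?A. ennreal (p n) * indicator ?A n)"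
      by (rule nn_integral_count_space'[OF finA]) auto
    also have "\<dots> = (\<Sum>n\<in>?A. ennreal (p n))" by (intro sum.cong) auto
    also have "\<dots> = ennreal (\<Sum>n\<in>?A. p n)" by (intro sum_ennreal) (auto intro: p)
    also have "(\<Sum>n\<in>?A. p n) = L b - L a"
    proof -
      have "{n. n \<in> J \<and> \<tau> n \<le> b} = {n. n \<in> J \<and> \<tau> n \<le> a} \<union> ?A" using that by auto
      then have "L b = L a + sum p ?A"
        unfolding L using finA fin[of a] by (subst sum.union_disjoint[symmetric]) auto
      then show ?thesis by simp
    qed
    finally show ?thesis .
  qed
  let ?E = "(\<lambda>(a, b). {a<..b}) ` {(a, b::real). a \<le> b}"
  show ?thesis
  proof (rule measure_eqI_generator_eq[where E = ?E and \<Omega> = UNIV and A = "\<lambda>i::nat. {- real i<..real i}"])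
    show "Int_stable ?E"
    proof (rule Int_stableI)
      fix x y assume "x \<in> ?E" "y \<in> ?E"
      then obtain a b a' b' where *: "x = {a<..b}" "y = {a'<..b'}" "a \<le> b" "a' \<le> b'" by auto
      \<comment> \<open>The outer \<open>max\<close> in ?b turns a disjoint pair into a degenerate
        interval, which is empty as well.\<close>
      let ?a = "max a a'" let ?b = "max ?a (min b b')"
      have "x \<inter> y = {?a<..?b}" unfolding * by auto
      then show "x \<inter> y \<in> ?E" by (auto intro!: image_eqI[of _ _ "(?a, ?b)"])
    qed
    show "?E \<subseteq> Pow UNIV" by simp
    show "emeasure (interval_measure L) X = emeasure ?N X" if "X \<in> ?E" for X
    proof -
      obtain a b where X: "X = {a<..b}" "a \<le> b" using \<open>X \<in> ?E\<close> by auto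
      show ?thesis unfolding X(1) N[OF X(2)]
        by (rule emeasure_interval_measure_Ioc[OF X(2) mono right])
    qed
    have gen: "sets (borel::real measure) = sigma_sets UNIV ?E"
    proof -
      have "sets (borel::real measure) = sigma_sets UNIV (range (\<lambda>(a, b). {a<..b}))"
        by (subst borel_sigma_sets_Ioc) (simp add: sets_measure_of)
      also have "range (\<lambda>(a, b). {a<..b::real}) = ?E"
      proof (intro set_eqI iffI)
        fix X assume "X \<in> range (\<lambda>(a, b). {a<..b::real})"
        then obtain a b :: real where "X = {a<..b}" by auto
        then have "X = {a<..max a b}" by auto
        then show "X \<in> ?E" by (auto intro!: image_eqI[of _ _ "(a, max a b)"])
      qed auto
      finally show ?thesis .
    qed
    show "sets (interval_measure L) = sigma_sets UNIV ?E" "sets ?N = sigma_sets UNIV ?E"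
      using gen by simp_all
    show "range (\<lambda>i::nat. {- real i<..real i}) \<subseteq> ?E" by auto
    show "(\<Union>i::nat. {- real i<..real i}) = UNIV"
    proof (intro set_eqI iffI UNIV_I)
      fix x :: real
      obtain n where "\<bar>x\<bar> < real n" using reals_Archimedean2 by blast
      then show "x \<in> (\<Union>i::nat. {- real i<..real i})" by (auto intro!: exI[of _ n])
    qed
    show "emeasure (interval_measure L) {- real i<..real i} \<noteq> \<infinity>" for i
      by (subst emeasure_interval_measure_Ioc[OF _ mono right]) auto
  qed
qed

text \<open>Absolute summability is demanded because only then does the Bochner integral over a
  counting measure equal the sum of the series.\<close>

lemma integral_step_measure:
  fixes \<tau> p :: "nat \<Rightarrow> real" and g :: "real \<Rightarrow> real"
  assumes "\<And>n. n \<in> J \<Longrightarrow> 0 \<le> p n" and [measurable]: "g \<in> borel_measurable borel" "I \<in> sets borel"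
    and summable: "summable (\<lambda>n. \<bar>if n \<in> J \<and> \<tau> n \<in> I then g (\<tau> n) * p n else 0\<bar>)"
  shows "set_lebesgue_integral (distr (density (count_space J) (\<lambda>n. ennreal (p n))) borel \<tau>) I g
     = (\<Sum>n. if n \<in> J \<and> \<tau> n \<in> I then g (\<tau> n) * p n else 0)"
proof -
  let ?f = "\<lambda>n. if n \<in> J \<and> \<tau> n \<in> I then g (\<tau> n) * p n else 0"
  have "set_lebesgue_integral (distr (density (count_space J) (\<lambda>n. ennreal (p n))) borel \<tau>) I g
     = (\<integral>n. indicator I (\<tau> n) *\<^sub>R g (\<tau> n) \<partial>density (count_space J) (\<lambda>n. ennreal (p n)))"
    unfolding set_lebesgue_integral_def by (subst integral_distr) auto
  also have "\<dots> = (\<integral>n. p n *\<^sub>R (indicator I (\<tau> n) *\<^sub>R g (\<tau> n)) \<partial>count_space J)"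
    by (subst integral_density) (auto simp: assms(1) intro!: AE_I2)
  also have "\<dots> = (\<integral>n. indicator J n *\<^sub>R (p n *\<^sub>R (indicator I (\<tau> n) *\<^sub>R g (\<tau> n))) \<partial>count_space UNIV)"
    using integral_restrict_space[of J "count_space UNIV" "\<lambda>n. p n *\<^sub>R (indicator I (\<tau> n) *\<^sub>R g (\<tau> n))"]
    by (simp add: restrict_count_space)
  also have "\<dots> = (\<integral>n. ?f n \<partial>count_space UNIV)"
    by (intro Bochner_Integration.integral_cong refl) (auto simp: indicator_def)
  also have "\<dots> = (\<Sum>n. ?f n)"
    using summable by (intro sums_unique sums_integral_count_space_nat) (simp add: integrable_count_space_nat_iff)
  finally show ?thesis .
qed

text \<open>\<open>transaction_costs\<close> counts jump times of L. Payments are positive and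
  happen at distinct times, so the jump times are the payment times and each is counted
  once.\<close>

lemma transaction_costs_step:
  fixes \<tau> p :: "nat \<Rightarrow> real"
  assumes fin: "\<And>t. finite {n\<in>J. \<tau> n \<le> t}" and p: "\<And>n. n \<in> J \<Longrightarrow> 0 < p n"
    and L: "\<And>t. L t = (\<Sum>n | n \<in> J \<and> \<tau> n \<le> t. p n)"
    and inj: "inj_on \<tau> J" and nonneg: "\<And>n. n \<in> J \<Longrightarrow> 0 \<le> \<tau> n"
  shows "transaction_costs \<beta> L t = (\<Sum>n | n \<in> J \<and> \<tau> n \<le> t. \<beta>)"
proof -
  have jump: "jump L s = (\<Sum>n | n \<in> J \<and> \<tau> n = s. p n)" for s
  proof -
    let ?S = "\<tau> ` {n\<in>J. \<tau> n \<le> s \<and> \<tau> n < s}"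
    \<comment> \<open>The point s - 1 keeps the set nonempty, so that \<open>Max\<close> makes sense
      even without a jump before s.\<close>
    have finS: "finite (insert (s - 1) ?S)"
      by (intro finite.insertI finite_imageI finite_subset[OF _ fin[of s]]) auto
    define b where "b = Max (insert (s - 1) ?S)"
    have "b \<in> insert (s - 1) ?S" unfolding b_def by (rule Max_in[OF finS]) auto
    then have b: "b < s" by auto
    have b2: "x \<le> b" if "x \<in> ?S" for x unfolding b_def using finS that by (intro Max_ge) auto
    have eqL: "L x = (\<Sum>n | n \<in> J \<and> \<tau> n < s. p n)" if x: "b < x" "x < s" for x
    proof -
      have "\<tau> n \<le> x" if "n \<in> J" "\<tau> n < s" for n
        using b2[of "\<tau> n"] that x by auto
      then have "{n. n \<in> J \<and> \<tau> n \<le> x} = {n. n \<in> J \<and> \<tau> n < s}"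
        using x by (intro Collect_cong) (auto intro: le_less_trans)
      then show ?thesis unfolding L by simp
    qed
    have ev: "eventually (\<lambda>x. L x = (\<Sum>n | n \<in> J \<and> \<tau> n < s. p n)) (at_left s)"
      unfolding eventually_at_left_field by (intro exI[of _ b] conjI b allI impI eqL)
    have "Lim (at_left s) L = (\<Sum>n | n \<in> J \<and> \<tau> n < s. p n)"
      by (rule tendsto_Lim[OF _ tendsto_eventually[OF ev]]) simp
    moreover have "L s = (\<Sum>n | n \<in> J \<and> \<tau> n < s. p n) + (\<Sum>n | n \<in> J \<and> \<tau> n = s. p n)"
    proof -
      have "{n. n \<in> J \<and> \<tau> n \<le> s} = {n. n \<in> J \<and> \<tau> n < s} \<union> {n. n \<in> J \<and> \<tau> n = s}" by auto
      moreover have "finite {n. n \<in> J \<and> \<tau> n < s}" "finite {n. n \<in> J \<and> \<tau> n = s}"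
        by (rule finite_subset[OF _ fin[of s]], force)+
      ultimately show ?thesis unfolding L by (simp add: sum.union_disjoint disjoint_iff)
    qed
    ultimately show ?thesis unfolding jump_def by simp
  qed
  have fin': "finite {n. n \<in> J \<and> \<tau> n = s}" for s by (rule finite_subset[OF _ fin[of s]]) auto
  have pos: "0 < jump L s \<longleftrightarrow> (\<exists>n\<in>J. \<tau> n = s)" for s
  proof
    assume *: "0 < jump L s"
    show "\<exists>n\<in>J. \<tau> n = s"
    proof (rule ccontr)
      assume "\<not> (\<exists>n\<in>J. \<tau> n = s)"
      then have "{n. n \<in> J \<and> \<tau> n = s} = {}" by auto
      then show False using * unfolding jump by (simp only: sum.empty less_irrefl)
    qed
  next
    assume "\<exists>n\<in>J. \<tau> n = s" then show "0 < jump L s"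
      unfolding jump using fin' p by (intro sum_pos) auto
  qed
  have "{s. 0 \<le> s \<and> s \<le> t \<and> 0 < jump L s} = \<tau> ` {n\<in>J. \<tau> n \<le> t}"
    unfolding pos using nonneg by auto
  moreover have "inj_on \<tau> {n\<in>J. \<tau> n \<le> t}" by (rule inj_on_subset[OF inj]) auto
  ultimately show ?thesis
    unfolding transaction_costs_def by (simp add: card_image)
qed

text \<open>The interval up to ruin selects exactly the payments satisfying \<open>paid\<close>.
  Each such amount is at least c2 - c1 > 0, so summability of the discounted amounts forces that of
  the discount factors, and the cost integral converges too.\<close>

theorem net_dividends_eq_suminf:
  assumes f: "good_path f" and c: "0 \<le> c1" "c1 < c2" and "0 \<le> \<beta>"
    and summable: "summable (\<lambda>n. if paid c1 c2 n f then exp (- q * paid_time c1 c2 n f) * paid_amount c1 c2 n f else 0)"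
  shows "net_dividends q \<beta> c1 c2 f =
    (\<Sum>n. if paid c1 c2 n f then exp (- q * paid_time c1 c2 n f) * (paid_amount c1 c2 n f - \<beta>) else 0)"
    and "summable (\<lambda>n. if paid c1 c2 n f then exp (- q * paid_time c1 c2 n f) else 0)"
proof -
  define T where "T = payment_time c1 c2 f"
  define J where "J = {n. T n < \<infinity>}"
  define \<tau> where "\<tau> n = real_of_ereal (T n)" for n
  define p where "p = payment c1 c2 f"
  define L where "L = dividends c1 c2 f"
  define I where "I = {t. 0 \<le> t \<and> ereal t \<le> ruin_time c1 c2 f}"
  have T: "T n = ereal (\<tau> n)" if "n \<in> J" for n
    using that payment_time_nonneg[of c1 c2 f n] unfolding J_def \<tau>_def T_def
    by (cases "payment_time c1 c2 f n") auto
  have T_J: "n \<in> J" if "T n \<le> ereal t" for n t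
    using that unfolding J_def by (cases "T n") auto
  have le: "{n\<in>J. \<tau> n \<le> t} = {n. T n \<le> ereal t}" for t
  proof (intro set_eqI iffI)
    fix n assume "n \<in> {n\<in>J. \<tau> n \<le> t}" then show "n \<in> {n. T n \<le> ereal t}" using T[of n] by simp
  next
    fix n assume *: "n \<in> {n. T n \<le> ereal t}" then have "n \<in> J" using T_J by simp
    then show "n \<in> {n\<in>J. \<tau> n \<le> t}" using T[of n] * by simp
  qed
  have fin: "finite {n\<in>J. \<tau> n \<le> t}" for t
    unfolding le unfolding T_def by (rule finite_payment_times[OF f c(2)])
  have L: "L t = (\<Sum>n | n \<in> J \<and> \<tau> n \<le> t. p n)" for t
    unfolding L_def dividends_def p_def using le[of t] by (simp add: T_def)
  have J_Suc: "n \<in> J" if "Suc n \<in> J" for n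
    using payment_time_less_Suc[of c1 c2 f n] that unfolding J_def T_def by auto
  have step: "\<tau> n < \<tau> (Suc n)" if "Suc n \<in> J" for n
    using payment_time_step(2)[OF f c(2), of n] T[OF that] T[OF J_Suc[OF that]] unfolding T_def by simp
  have lt: "\<tau> n < \<tau> (n + Suc k)" if "n + Suc k \<in> J" for n k
    using that
  proof (induction k)
    case (Suc k) then show ?case using step[of "n + Suc k"] J_Suc[of "n + Suc k"] by force
  qed (use step in simp)
  have inj: "inj_on \<tau> J"
  proof (rule linorder_inj_onI)
    fix x y assume *: "x < y" "x \<in> J" "y \<in> J"
    then obtain k where "y = x + Suc k" using less_imp_Suc_add[of x y] by auto
    then show "\<tau> x \<noteq> \<tau> y" using lt[of x k] * by simp
  qed auto
  have nonneg: "0 \<le> \<tau> n" for n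
    unfolding \<tau>_def T_def using payment_time_nonneg by (rule real_of_ereal_pos)
  have p_pos: "0 < p n" if "n \<in> J" for n
  proof (cases n)
    case 0
    then have "hits c2 f" using that payment_time_not_hits[of c2 f c1 0] unfolding J_def T_def by auto
    then show ?thesis
      using at_hit_time[OF f, of c2] payment_time_0_hits[OF f, of c2 c1] c unfolding p_def 0 by simp
  next
    case (Suc m)
    then show ?thesis
      using payment_time_step(3)[OF f c(2), of m "\<tau> m" "\<tau> n"] T[OF that] T[of m] J_Suc[of m] that c
      unfolding p_def T_def \<tau>_def Suc by simp
  qed
  have paid: "paid c1 c2 n f \<longleftrightarrow> n \<in> J \<and> \<tau> n \<in> I" for n
  proof (cases "n \<in> J")
    case True
    then show ?thesis
      using T[OF True] nonneg[of n] unfolding paid_iff[OF f c] I_def by (simp add: T_def)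
  next
    case False
    then show ?thesis unfolding paid_iff[OF f c] J_def T_def by simp
  qed
  have paid_t: "paid_time c1 c2 n f = \<tau> n" "paid_amount c1 c2 n f = p n" "c2 - c1 \<le> p n" if "n \<in> J \<and> \<tau> n \<in> I" for n
    using paid_eq[OF f c, of n] that paid[of n] T[of n] unfolding p_def T_def by auto
  have [measurable]: "I \<in> sets borel"
  proof -
    have "I = {0..} \<inter> ereal -` {..ruin_time c1 c2 f}" unfolding I_def by auto
    moreover have "ereal -` {..ruin_time c1 c2 f} \<inter> space borel \<in> sets borel"
      by (intro measurable_sets[OF borel_measurable_ereal[OF measurable_ident_sets[OF refl]]]) auto
    ultimately show ?thesis by auto
  qed
  have eq1: "(\<lambda>n. if paid c1 c2 n f then exp (- q * paid_time c1 c2 n f) * paid_amount c1 c2 n f else 0)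
      = (\<lambda>n. if n \<in> J \<and> \<tau> n \<in> I then exp (- q * \<tau> n) * p n else 0)" (is "_ = ?F")
    by (intro ext) (simp add: paid paid_t)
  have eq2: "(\<lambda>n. if paid c1 c2 n f then exp (- q * paid_time c1 c2 n f) else 0)
      = (\<lambda>n. if n \<in> J \<and> \<tau> n \<in> I then exp (- q * \<tau> n) else 0)" (is "_ = ?G")
    by (intro ext) (simp add: paid paid_t)
  have F: "summable ?F" using summable eq1 by simp
  have "norm (?G n) \<le> ?F n / (c2 - c1)" for n
  proof (cases "n \<in> J \<and> \<tau> n \<in> I")
    case True
    have "exp (- q * \<tau> n) * (c2 - c1) \<le> exp (- q * \<tau> n) * p n"
      using paid_t(3)[OF True] by (intro mult_left_mono) auto
    then show ?thesis using True c by (simp add: pos_le_divide_eq)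
  qed auto
  then show G: "summable (\<lambda>n. if paid c1 c2 n f then exp (- q * paid_time c1 c2 n f) else 0)"
    unfolding eq2 by (intro summable_comparison_test'[OF summable_divide[OF F, of "c2 - c1"], of 0]) auto
  have F_nonneg: "0 \<le> ?F n" for n using p_pos[of n] by auto
  have stL: "interval_measure L = distr (density (count_space J) (\<lambda>n. ennreal (p n))) borel \<tau>"
    by (rule interval_measure_step[OF fin _ L]) (simp add: less_imp_le p_pos)
  have stC: "interval_measure (transaction_costs \<beta> L) = distr (density (count_space J) (\<lambda>n. ennreal \<beta>)) borel \<tau>"
  proof (rule interval_measure_step[OF fin \<open>0 \<le> \<beta>\<close>])
    show "transaction_costs \<beta> L t = (\<Sum>n | n \<in> J \<and> \<tau> n \<le> t. \<beta>)" for t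
      by (rule transaction_costs_step[OF fin _ L inj nonneg]) (rule p_pos)
  qed
  have 1: "set_lebesgue_integral (interval_measure L) I (\<lambda>t. exp (- q * t)) = (\<Sum>n. ?F n)"
    unfolding stL
    by (rule integral_step_measure) (use F F_nonneg p_pos in \<open>auto intro: less_imp_le\<close>)
  have Gs: "summable ?G" using G eq2 by simp
  let ?B = "\<lambda>n. if n \<in> J \<and> \<tau> n \<in> I then exp (- q * \<tau> n) * \<beta> else 0"
  have "?B = (\<lambda>n. ?G n * \<beta>)" by auto
  then have B: "summable ?B" using summable_mult2[OF Gs, of \<beta>] by simp
  moreover have "(\<lambda>n. \<bar>?B n\<bar>) = ?B" using \<open>0 \<le> \<beta>\<close> by auto
  ultimately have Babs: "summable (\<lambda>n. \<bar>?B n\<bar>)" by simp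
  have 2: "set_lebesgue_integral (interval_measure (transaction_costs \<beta> L)) I (\<lambda>t. exp (- q * t)) = (\<Sum>n. ?B n)"
    unfolding stC
    by (rule integral_step_measure) (use Babs \<open>0 \<le> \<beta>\<close> in auto)
  have "(\<lambda>n. if paid c1 c2 n f then exp (- q * paid_time c1 c2 n f) * (paid_amount c1 c2 n f - \<beta>) else 0)
     = (\<lambda>n. ?F n - ?B n)"
    by (intro ext) (simp add: paid paid_t right_diff_distrib)
  then show "net_dividends q \<beta> c1 c2 f =
    (\<Sum>n. if paid c1 c2 n f then exp (- q * paid_time c1 c2 n f) * (paid_amount c1 c2 n f - \<beta>) else 0)"
    using suminf_diff[OF F B] 1 2
    unfolding net_dividends_def Let_def L_def I_def by simp
qed

section \<open>Processes with independent increments\<close>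

definition next_dyadic :: "nat \<Rightarrow> real \<Rightarrow> real" where
  "next_dyadic m t = real (Suc (nat \<lfloor>2 ^ m * t\<rfloor>)) / 2 ^ m"

lemma next_dyadic_bounds:
  assumes "0 \<le> t"
  shows "t < next_dyadic m t" "next_dyadic m t \<le> t + 1 / 2 ^ m"
proof -
  have "0 \<le> \<lfloor>2 ^ m * t\<rfloor>" using assms by simp
  then have eq: "real (Suc (nat \<lfloor>2 ^ m * t\<rfloor>)) = of_int \<lfloor>2 ^ m * t\<rfloor> + 1" by simp
  have "2 ^ m * t < of_int \<lfloor>2 ^ m * t\<rfloor> + 1" by linarith
  then show "t < next_dyadic m t"
    unfolding next_dyadic_def eq by (simp add: pos_less_divide_eq mult.commute)
  have "of_int \<lfloor>2 ^ m * t\<rfloor> + 1 \<le> 2 ^ m * t + 1" by simp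
  then have "(of_int \<lfloor>2 ^ m * t\<rfloor> + 1) / 2 ^ m \<le> (2 ^ m * t + 1) / 2 ^ m"
    by (intro divide_right_mono) auto
  then show "next_dyadic m t \<le> t + 1 / 2 ^ m"
    unfolding next_dyadic_def eq by (simp add: add_divide_distrib)
qed

text \<open>The rounded time lies strictly above t and is constant on half-open cells. Its value is
  therefore decided by events of the form {T < u}, which is all that a filtration without right
  continuity offers.\<close>

lemma next_dyadic_eq_iff:
  assumes "0 \<le> t"
  shows "next_dyadic m t = real (Suc j) / 2 ^ m \<longleftrightarrow> real j / 2 ^ m \<le> t \<and> t < real (Suc j) / 2 ^ m"
proof -
  have "next_dyadic m t = real (Suc j) / 2 ^ m \<longleftrightarrow> nat \<lfloor>2 ^ m * t\<rfloor> = j"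
    unfolding next_dyadic_def by simp
  also have "\<dots> \<longleftrightarrow> \<lfloor>2 ^ m * t\<rfloor> = int j" using assms by auto
  also have "\<dots> \<longleftrightarrow> real j \<le> 2 ^ m * t \<and> 2 ^ m * t < real j + 1" by (simp add: floor_eq_iff)
  also have "\<dots> \<longleftrightarrow> real j / 2 ^ m \<le> t \<and> t < real (Suc j) / 2 ^ m"
    by (simp add: pos_divide_le_eq pos_less_divide_eq mult.commute add.commute)
  finally show ?thesis .
qed

lemma inverse_power2_tendsto: "(\<lambda>m. 1 / 2 ^ m :: real) \<longlonglongrightarrow> 0"
  using LIMSEQ_realpow_zero[of "1/2::real"] by (simp add: power_one_over)

lemma filterlim_next_dyadic:
  assumes "0 \<le> t" shows "filterlim (\<lambda>m. next_dyadic m t) (at_right t) sequentially"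
  unfolding filterlim_at
proof (intro conjI always_eventually allI)
  show "(\<lambda>m. next_dyadic m t) \<longlonglongrightarrow> t"
  proof (rule tendsto_sandwich[of "\<lambda>_. t" _ _ "\<lambda>m. t + 1 / 2 ^ m"])
    show "(\<lambda>m. t + 1 / 2 ^ m) \<longlonglongrightarrow> t"
      using tendsto_add[OF tendsto_const inverse_power2_tendsto, of t] by simp
  qed (use next_dyadic_bounds[OF assms] in \<open>auto intro!: always_eventually less_imp_le\<close>)
  show "next_dyadic m t \<in> {t<..}" "next_dyadic m t \<noteq> t" for m
    using next_dyadic_bounds(1)[OF assms, of m] by simp_all
qed

lemma next_dyadic_measurable [measurable]: "next_dyadic m \<in> borel_measurable borel"
  unfolding next_dyadic_def by measurable

lemma next_dyadic_pos: "0 < next_dyadic m t"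
  unfolding next_dyadic_def by simp

text \<open>Right continuity reduces the claim to the rounded times, which take countably many
  values.\<close>

lemma measurable_at_random_time:
  fixes X :: "real \<Rightarrow> 'b \<Rightarrow> real"
  assumes X: "\<And>t. 0 \<le> t \<Longrightarrow> X t \<in> borel_measurable N"
    and right: "\<And>\<omega> t. \<omega> \<in> space N \<Longrightarrow> 0 \<le> t \<Longrightarrow> ((\<lambda>s. X s \<omega>) \<longlongrightarrow> X t \<omega>) (at_right t)"
    and T[measurable]: "T \<in> borel_measurable N" and T0: "\<And>\<omega>. \<omega> \<in> space N \<Longrightarrow> 0 \<le> T \<omega>"
  shows "(\<lambda>\<omega>. X (T \<omega>) \<omega>) \<in> borel_measurable N"
proof (rule borel_measurable_LIMSEQ_real)
  fix \<omega> assume \<omega>: "\<omega> \<in> space N"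
  show "(\<lambda>m. X (next_dyadic m (T \<omega>)) \<omega>) \<longlonglongrightarrow> X (T \<omega>) \<omega>"
    by (rule filterlim_compose[OF right[OF \<omega> T0[OF \<omega>]] filterlim_next_dyadic[OF T0[OF \<omega>]]])
next
  fix m
  have "(\<lambda>\<omega>. X (real (Suc (nat \<lfloor>2 ^ m * T \<omega>\<rfloor>)) / 2 ^ m) \<omega>) \<in> borel_measurable N"
    by (rule measurable_compose_countable'[where f="\<lambda>i. X (real (Suc i) / 2 ^ m)" and I=UNIV])
       (auto intro!: X)
  then show "(\<lambda>\<omega>. X (next_dyadic m (T \<omega>)) \<omega>) \<in> borel_measurable N"
    unfolding next_dyadic_def .
qed

text \<open>Regularity holds on the whole space rather than almost surely, so that pathwise lemmas
  remain available after a change of measure; \<open>good_version\<close> provides such a process.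
  The filtration is a parameter because the process restarted at a payment lives on a different
  one.\<close>

locale adapted_process =
  fixes M :: "'a measure" and X :: "real \<Rightarrow> 'a \<Rightarrow> real" and F :: "real \<Rightarrow> 'a measure"
  assumes good: "\<omega> \<in> space M \<Longrightarrow> good_path (\<lambda>t. X t \<omega>)"
    and X_0: "\<omega> \<in> space M \<Longrightarrow> X 0 \<omega> = 0"
    and subalg: "0 \<le> t \<Longrightarrow> subalgebra M (F t)"
    and F_mono: "0 \<le> s \<Longrightarrow> s \<le> t \<Longrightarrow> sets (F s) \<subseteq> sets (F t)"
    and adapted: "0 \<le> t \<Longrightarrow> X t \<in> borel_measurable (F t)"
begin

lemma space_F: "0 \<le> t \<Longrightarrow> space (F t) = space M"
  using subalg unfolding subalgebra_def by simp

lemma sets_F: "0 \<le> t \<Longrightarrow> A \<in> sets (F t) \<Longrightarrow> A \<in> sets M"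
  using subalg unfolding subalgebra_def by auto

lemma measurable_F: "0 \<le> t \<Longrightarrow> f \<in> measurable (F t) N \<Longrightarrow> f \<in> measurable M N"
  using subalg measurable_from_subalg by blast

lemma subalgebra_F: "0 \<le> s \<Longrightarrow> s \<le> t \<Longrightarrow> subalgebra (F t) (F s)"
  unfolding subalgebra_def using F_mono space_F by auto

lemma measurable_F_mono: "0 \<le> s \<Longrightarrow> s \<le> t \<Longrightarrow> f \<in> measurable (F s) N \<Longrightarrow> f \<in> measurable (F t) N"
  using subalgebra_F measurable_from_subalg by blast

lemma X_measurable: "0 \<le> t \<Longrightarrow> X t \<in> borel_measurable M"
  using adapted measurable_F by blast

lemma X_adapted: "0 \<le> s \<Longrightarrow> s \<le> t \<Longrightarrow> X s \<in> borel_measurable (F t)"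
  using adapted measurable_F_mono by blast

lemma X_right: "\<omega> \<in> space M \<Longrightarrow> 0 \<le> t \<Longrightarrow> ((\<lambda>s. X s \<omega>) \<longlongrightarrow> X t \<omega>) (at_right t)"
  by (rule good_path_right[OF good])

lemma X_jointly_measurable:
  "(\<lambda>(t, \<omega>). X (max 0 t) \<omega>) \<in> borel_measurable (borel \<Otimes>\<^sub>M M)"
proof -
  have "(\<lambda>z. X (max 0 (fst z)) (snd z)) \<in> borel_measurable (borel \<Otimes>\<^sub>M M)"
  proof (rule measurable_at_random_time[where X="\<lambda>t z. X t (snd z)" and T="\<lambda>z. max 0 (fst z)"])
    show "(\<lambda>z. X t (snd z)) \<in> borel_measurable (borel \<Otimes>\<^sub>M M)" if "0 \<le> t" for t
      by (intro measurable_compose[OF measurable_snd X_measurable[OF that]])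
  qed (auto simp: space_pair_measure intro!: X_right)
  then show ?thesis by (simp add: case_prod_beta)
qed

lemma X_at_random_time:
  assumes "T \<in> borel_measurable M" "\<And>\<omega>. \<omega> \<in> space M \<Longrightarrow> 0 \<le> T \<omega>"
  shows "(\<lambda>\<omega>. X (T \<omega>) \<omega>) \<in> borel_measurable M"
  by (rule measurable_at_random_time[OF X_measurable X_right assms])

text \<open>The path is frozen at u before it is evaluated, since the rounded times may exceed u and
  would then leave F u.\<close>

lemma X_at_bounded_time:
  assumes u: "0 \<le> u" and T: "T \<in> borel_measurable (F u)" "\<And>\<omega>. \<omega> \<in> space M \<Longrightarrow> 0 \<le> T \<omega> \<and> T \<omega> \<le> u"
  shows "(\<lambda>\<omega>. X (T \<omega>) \<omega>) \<in> borel_measurable (F u)"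
proof -
  have "(\<lambda>\<omega>. X (min (T \<omega>) u) \<omega>) \<in> borel_measurable (F u)"
  proof (rule measurable_at_random_time[where X="\<lambda>t. X (min t u)" and T=T])
    show "X (min t u) \<in> borel_measurable (F u)" if "0 \<le> t" for t
      using that u by (intro X_adapted) auto
    fix \<omega> t assume \<omega>: "\<omega> \<in> space (F u)" and t: "(0::real) \<le> t"
    have \<omega>': "\<omega> \<in> space M" using \<omega> space_F u by simp
    show "((\<lambda>s. X (min s u) \<omega>) \<longlongrightarrow> X (min t u) \<omega>) (at_right t)"
    proof (cases "t < u")
      case True
      have "eventually (\<lambda>s. X s \<omega> = X (min s u) \<omega>) (at_right t)"
        unfolding eventually_at_right_field using True by (intro exI[of _ u]) auto
      from Lim_transform_eventually[OF X_right[OF \<omega>' t] this] show ?thesis using True by simp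
    next
      case False
      have "eventually (\<lambda>s. X (min s u) \<omega> = X u \<omega>) (at_right t)"
        unfolding eventually_at_right_field using False by (intro exI[of _ "t + 1"]) (auto simp: min_def)
      then show ?thesis using False by (auto intro: tendsto_eventually simp: min_def)
    qed
  qed (use T u space_F in auto)
  moreover have "X (min (T \<omega>) u) \<omega> = X (T \<omega>) \<omega>" if "\<omega> \<in> space (F u)" for \<omega>
    using that T(2) space_F u by (simp add: min_absorb1)
  ultimately show ?thesis by (simp cong: measurable_cong)
qed

end

text \<open>K r is the law of an increment over a time span r. It is a parameter of its own because
  restarting at a payment changes the measure, the process and the filtration, but not K.\<close>

locale increment_process = adapted_process M X F + prob_space M
  for M :: "'a measure" and X F +
  fixes K :: "real \<Rightarrow> real measure"
  assumes K_prob: "0 \<le> r \<Longrightarrow> prob_space (K r)"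
    and K_sets: "0 \<le> r \<Longrightarrow> sets (K r) = sets borel"
    and indep_increment: "0 \<le> s \<Longrightarrow> 0 \<le> r \<Longrightarrow> A \<in> sets (F s) \<Longrightarrow> B \<in> sets borel \<Longrightarrow>
      emeasure M (A \<inter> {\<omega>\<in>space M. X (s + r) \<omega> - X s \<omega> \<in> B}) = emeasure M A * emeasure (K r) B"
begin

text \<open>Independence is recast as a product law of the pair (omega, increment), where omega is
  seen only through F s. Fubini then takes the place of conditional expectations given F s.\<close>

lemma distr_pair_increment:
  assumes s: "0 \<le> s" and r: "0 \<le> r"
  shows "restr_to_subalg M (F s) \<Otimes>\<^sub>M K r = distr M (F s \<Otimes>\<^sub>M borel) (\<lambda>\<omega>. (\<omega>, X (s + r) \<omega> - X s \<omega>))"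
proof (rule pair_measure_eqI)
  have [measurable]: "X (s + r) \<in> borel_measurable M" "X s \<in> borel_measurable M"
    using s r by (auto intro!: X_measurable)
  have id: "(\<lambda>\<omega>. \<omega>) \<in> measurable M (F s)"
    by (rule measurable_F[OF s measurable_ident_sets[OF refl]])
  note [measurable] = id
  show "sigma_finite_measure (restr_to_subalg M (F s))"
    using prob_space_restr_to_subalg[OF subalg[OF s]] prob_space_axioms prob_space_imp_sigma_finite by blast
  show "sigma_finite_measure (K r)" using K_prob[OF r] prob_space_imp_sigma_finite by blast
  show "sets (restr_to_subalg M (F s) \<Otimes>\<^sub>M K r) = sets (distr M (F s \<Otimes>\<^sub>M borel) (\<lambda>\<omega>. (\<omega>, X (s + r) \<omega> - X s \<omega>)))"
    by (simp, rule sets_pair_measure_cong) (auto simp: sets_restr_to_subalg[OF subalg[OF s]] K_sets[OF r])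
  fix A B assume "A \<in> sets (restr_to_subalg M (F s))" "B \<in> sets (K r)"
  then have A: "A \<in> sets (F s)" and B: "B \<in> sets borel"
    using sets_restr_to_subalg[OF subalg[OF s]] K_sets[OF r] by auto
  have "emeasure (distr M (F s \<Otimes>\<^sub>M borel) (\<lambda>\<omega>. (\<omega>, X (s + r) \<omega> - X s \<omega>))) (A \<times> B)
     = emeasure M (A \<inter> {\<omega>\<in>space M. X (s + r) \<omega> - X s \<omega> \<in> B})"
    using A B sets.sets_into_space[OF sets_F[OF s A]]
    by (subst emeasure_distr) (auto intro!: arg_cong[where f="emeasure M"])
  also have "\<dots> = emeasure M A * emeasure (K r) B"
    by (rule indep_increment[OF s r A B])
  also have "emeasure M A = emeasure (restr_to_subalg M (F s)) A"
    using emeasure_restr_to_subalg[OF subalg[OF s] A] by simp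
  finally show "emeasure (restr_to_subalg M (F s)) A * emeasure (K r) B =
    emeasure (distr M (F s \<Otimes>\<^sub>M borel) (\<lambda>\<omega>. (\<omega>, X (s + r) \<omega> - X s \<omega>))) (A \<times> B)" by simp
qed

lemma id_measurable_F: "0 \<le> s \<Longrightarrow> (\<lambda>\<omega>. \<omega>) \<in> measurable M (F s)"
  by (rule measurable_F[OF _ measurable_ident_sets[OF refl]])

lemma pair_increment_measurable:
  assumes "0 \<le> s" "0 \<le> r"
  shows "(\<lambda>\<omega>. (\<omega>, X (s + r) \<omega> - X s \<omega>)) \<in> measurable M (F s \<Otimes>\<^sub>M borel)"
  using assms by (intro measurable_Pair id_measurable_F borel_measurable_diff X_measurable) auto

lemma sets_pair_K:
  assumes "0 \<le> s" "0 \<le> r"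
  shows "sets (restr_to_subalg M (F s) \<Otimes>\<^sub>M K r) = sets (F s \<Otimes>\<^sub>M borel)"
  by (rule sets_pair_measure_cong) (auto simp: sets_restr_to_subalg[OF subalg] K_sets assms)

lemma nn_integral_increment:
  assumes s: "0 \<le> s" and r: "0 \<le> r" and g: "g \<in> borel_measurable (F s \<Otimes>\<^sub>M borel)"
  shows "(\<integral>\<^sup>+\<omega>. g (\<omega>, X (s + r) \<omega> - X s \<omega>) \<partial>M) = (\<integral>\<^sup>+\<omega>. \<integral>\<^sup>+z. g (\<omega>, z) \<partial>K r \<partial>M)"
proof -
  interpret Kr: prob_space "K r" by (rule K_prob[OF r])
  have g': "g \<in> borel_measurable (restr_to_subalg M (F s) \<Otimes>\<^sub>M K r)"
    using g sets_pair_K[OF s r] by (simp cong: measurable_cong_sets)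
  have gK: "g \<in> borel_measurable (F s \<Otimes>\<^sub>M K r)"
    using g measurable_cong_sets[OF sets_pair_measure_cong[OF refl K_sets[OF r]] refl] by blast
  have "(\<integral>\<^sup>+\<omega>. g (\<omega>, X (s + r) \<omega> - X s \<omega>) \<partial>M) = (\<integral>\<^sup>+p. g p \<partial>distr M (F s \<Otimes>\<^sub>M borel) (\<lambda>\<omega>. (\<omega>, X (s + r) \<omega> - X s \<omega>)))"
    by (subst nn_integral_distr[OF pair_increment_measurable[OF s r]]) (use g in auto)
  also have "\<dots> = (\<integral>\<^sup>+p. g p \<partial>(restr_to_subalg M (F s) \<Otimes>\<^sub>M K r))"
    by (simp add: distr_pair_increment[OF s r])
  also have "\<dots> = (\<integral>\<^sup>+\<omega>. \<integral>\<^sup>+z. g (\<omega>, z) \<partial>K r \<partial>restr_to_subalg M (F s))"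
    using Kr.nn_integral_fst[OF g'] by simp
  also have "\<dots> = (\<integral>\<^sup>+\<omega>. \<integral>\<^sup>+z. g (\<omega>, z) \<partial>K r \<partial>M)"
    by (rule nn_integral_subalgebra2[OF subalg[OF s]])
       (use Kr.borel_measurable_nn_integral_fst[OF gK] in simp)
  finally show ?thesis .
qed

lemma integral_increment:
  fixes g :: "'a \<times> real \<Rightarrow> real"
  assumes s: "0 \<le> s" and r: "0 \<le> r" and g: "g \<in> borel_measurable (F s \<Otimes>\<^sub>M borel)"
    and int: "integrable M (\<lambda>\<omega>. g (\<omega>, X (s + r) \<omega> - X s \<omega>))"
  shows "(\<integral>\<omega>. g (\<omega>, X (s + r) \<omega> - X s \<omega>) \<partial>M) = (\<integral>\<omega>. \<integral>z. g (\<omega>, z) \<partial>K r \<partial>M)"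
    and "integrable M (\<lambda>\<omega>. \<integral>z. g (\<omega>, z) \<partial>K r)"
    and "AE \<omega> in M. integrable (K r) (\<lambda>z. g (\<omega>, z))"
proof -
  interpret Kr: prob_space "K r" by (rule K_prob[OF r])
  interpret R: prob_space "restr_to_subalg M (F s)"
    by (rule prob_space_restr_to_subalg[OF subalg[OF s]]) unfold_locales
  interpret P: pair_sigma_finite "restr_to_subalg M (F s)" "K r" ..
  have gK: "g \<in> borel_measurable (F s \<Otimes>\<^sub>M K r)"
    using g measurable_cong_sets[OF sets_pair_measure_cong[OF refl K_sets[OF r]] refl] by blast
  have *: "(\<lambda>\<omega>. \<integral>z. g (\<omega>, z) \<partial>K r) \<in> borel_measurable (F s)"
    by (rule Kr.borel_measurable_lebesgue_integral) (use gK in simp)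
  have i: "integrable (restr_to_subalg M (F s) \<Otimes>\<^sub>M K r) g"
    unfolding distr_pair_increment[OF s r]
    using int integrable_distr_eq[OF pair_increment_measurable[OF s r] g] by simp
  have "(\<integral>\<omega>. g (\<omega>, X (s + r) \<omega> - X s \<omega>) \<partial>M) = (\<integral>p. g p \<partial>distr M (F s \<Otimes>\<^sub>M borel) (\<lambda>\<omega>. (\<omega>, X (s + r) \<omega> - X s \<omega>)))"
    by (subst integral_distr[OF pair_increment_measurable[OF s r] g]) simp
  also have "\<dots> = (\<integral>p. g p \<partial>(restr_to_subalg M (F s) \<Otimes>\<^sub>M K r))"
    by (simp add: distr_pair_increment[OF s r])
  also have "\<dots> = (\<integral>\<omega>. \<integral>z. g (\<omega>, z) \<partial>K r \<partial>restr_to_subalg M (F s))"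
    using P.integral_fst'[OF i] by simp
  also have "\<dots> = (\<integral>\<omega>. \<integral>z. g (\<omega>, z) \<partial>K r \<partial>M)"
    by (rule integral_subalgebra2[OF subalg[OF s] *])
  finally show "(\<integral>\<omega>. g (\<omega>, X (s + r) \<omega> - X s \<omega>) \<partial>M) = (\<integral>\<omega>. \<integral>z. g (\<omega>, z) \<partial>K r \<partial>M)" .
  show "integrable M (\<lambda>\<omega>. \<integral>z. g (\<omega>, z) \<partial>K r)"
    by (rule integrable_from_subalg[OF subalg[OF s] P.integrable_fst'[OF i]])
  show "AE \<omega> in M. integrable (K r) (\<lambda>z. g (\<omega>, z))"
    by (rule AE_restr_to_subalg[OF subalg[OF s] P.AE_integrable_fst'[OF i]])
qed

lemma distr_X: "0 \<le> t \<Longrightarrow> distr M borel (X t) = K t"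
proof (rule measure_eqI)
  assume t: "0 \<le> t"
  show "sets (distr M borel (X t)) = sets (K t)" using K_sets[OF t] by simp
  fix B assume "B \<in> sets (distr M borel (X t))"
  then have B: "B \<in> sets borel" by simp
  have "space M \<in> sets (F 0)" using space_F[of 0] sets.top[of "F 0"] by simp
  from indep_increment[OF order_refl t this B]
  have "emeasure M (space M \<inter> {\<omega> \<in> space M. X t \<omega> - X 0 \<omega> \<in> B}) = emeasure (K t) B"
    by (simp add: emeasure_space_1)
  moreover have "space M \<inter> {\<omega> \<in> space M. X t \<omega> - X 0 \<omega> \<in> B} = X t -` B \<inter> space M" using X_0 by auto
  ultimately show "emeasure (distr M borel (X t)) B = emeasure (K t) B"
    using emeasure_distr[OF X_measurable[OF t] B] by simp
qed

lemma nn_integral_K: "0 \<le> t \<Longrightarrow> g \<in> borel_measurable borel \<Longrightarrow> (\<integral>\<^sup>+z. g z \<partial>K t) = (\<integral>\<^sup>+\<omega>. g (X t \<omega>) \<partial>M)"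
  by (subst distr_X[symmetric]) (auto intro!: nn_integral_distr X_measurable)

lemma integral_K:
  fixes g :: "real \<Rightarrow> real"
  shows "0 \<le> t \<Longrightarrow> g \<in> borel_measurable borel \<Longrightarrow> (\<integral>z. g z \<partial>K t) = (\<integral>\<omega>. g (X t \<omega>) \<partial>M)"
  by (subst distr_X[symmetric]) (auto intro!: integral_distr X_measurable)

lemma integrable_K:
  fixes g :: "real \<Rightarrow> real"
  shows "0 \<le> t \<Longrightarrow> g \<in> borel_measurable borel \<Longrightarrow> integrable (K t) g \<longleftrightarrow> integrable M (\<lambda>\<omega>. g (X t \<omega>))"
  by (subst distr_X[symmetric]) (auto intro!: integrable_distr_eq X_measurable)

text \<open>Used with \<open>\<epsilon> = 1\<close> and \<open>\<epsilon> = -1\<close>, to control the process from above and from below.\<close>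

primrec running_max :: "real \<Rightarrow> real \<Rightarrow> nat \<Rightarrow> 'a \<Rightarrow> real" where
  "running_max \<epsilon> \<delta> 0 = (\<lambda>\<omega>. 0)"
| "running_max \<epsilon> \<delta> (Suc k) = (\<lambda>\<omega>. max (running_max \<epsilon> \<delta> k \<omega>) (\<epsilon> * X (real (Suc k) * \<delta>) \<omega>))"

lemma running_max_adapted:
  assumes "0 \<le> \<delta>" "real k * \<delta> \<le> t" shows "running_max \<epsilon> \<delta> k \<in> borel_measurable (F t)"
  using assms(2)
proof (induction k)
  case (Suc k)
  have "real k * \<delta> \<le> real (Suc k) * \<delta>" using assms(1) by (simp add: mult_right_mono)
  then have [measurable]: "running_max \<epsilon> \<delta> k \<in> borel_measurable (F t)" using Suc by simp
  have [measurable]: "X (real (Suc k) * \<delta>) \<in> borel_measurable (F t)"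
    using Suc.prems assms(1) by (intro X_adapted) auto
  show ?case unfolding running_max.simps by measurable
qed simp

lemma running_max_ge:
  assumes "\<omega> \<in> space M"
  shows "j \<le> k \<Longrightarrow> \<epsilon> * X (real j * \<delta>) \<omega> \<le> running_max \<epsilon> \<delta> k \<omega>"
proof (induction k)
  case 0 then show ?case using X_0[OF assms] by simp
next
  case (Suc k) then show ?case by (cases "j = Suc k") (auto intro: le_max_iff_disj[THEN iffD2])
qed

lemma running_max_attained:
  assumes "\<omega> \<in> space M"
  shows "\<exists>j\<le>k. running_max \<epsilon> \<delta> k \<omega> = \<epsilon> * X (real j * \<delta>) \<omega>"
proof (induction k)
  case 0 then show ?case using X_0[OF assms] by simp
next
  case (Suc k)
  then obtain j where "j \<le> k" "running_max \<epsilon> \<delta> k \<omega> = \<epsilon> * X (real j * \<delta>) \<omega>" by auto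
  then show ?case
    by (cases "running_max \<epsilon> \<delta> k \<omega> \<le> \<epsilon> * X (real (Suc k) * \<delta>) \<omega>")
       (auto intro: exI[of _ "Suc k"] exI[of _ j] simp: max_def)
qed

text \<open>Ottaviani's inequality, in integrated form: each time the running maximum increases, the
  process ends at most \<open>c\<close> below that level with conditional probability at least \<open>p\<close>; summing the
  increments of \<open>\<phi>\<close> of the running maximum over these events telescopes.\<close>

lemma ottaviani:
  fixes \<phi> :: "real \<Rightarrow> real"
  assumes \<delta>: "0 \<le> \<delta>" and p: "0 \<le> p"
    and \<phi>: "mono \<phi>" "\<And>x. 0 \<le> \<phi> x"
    and K: "\<And>r. 0 \<le> r \<Longrightarrow> r \<le> real n * \<delta> \<Longrightarrow> p \<le> measure (K r) {z. - c \<le> \<epsilon> * z}"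
  shows "ennreal p * (\<integral>\<^sup>+\<omega>. ennreal (\<phi> (running_max \<epsilon> \<delta> n \<omega>) - \<phi> 0) \<partial>M)
    \<le> (\<integral>\<^sup>+\<omega>. ennreal (\<phi> (\<epsilon> * X (real n * \<delta>) \<omega> + c)) \<partial>M)"
proof -
  define R where "R k \<omega> = running_max \<epsilon> \<delta> k \<omega>" for k \<omega>
  define d where "d k \<omega> = \<phi> (R (Suc k) \<omega>) - \<phi> (R k \<omega>)" for k \<omega>
  define v where "v \<omega> = \<epsilon> * X (real n * \<delta>) \<omega> + c" for \<omega>
  have [measurable]: "\<phi> \<in> borel_measurable borel" by (rule borel_measurable_mono[OF \<phi>(1)])
  have Rm: "R k \<in> borel_measurable (F (real l * \<delta>))" if "k \<le> l" for k l
    unfolding R_def using that \<delta> by (intro running_max_adapted mult_right_mono) auto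
  have dm: "d k \<in> borel_measurable (F (real (Suc k) * \<delta>))" for k
    unfolding d_def using Rm[of k "Suc k"] Rm[of "Suc k" "Suc k"] by measurable
  have dM[measurable]: "d k \<in> borel_measurable M" for k
    by (rule measurable_F[OF _ dm]) (use \<delta> in simp)
  have RM[measurable]: "R k \<in> borel_measurable M" for k
    by (rule measurable_F[OF _ Rm[of k k]]) (use \<delta> in auto)
  have XM[measurable]: "X (real k * \<delta>) \<in> borel_measurable M" for k
    using \<delta> by (intro X_measurable) auto
  have step: "ennreal p * (\<integral>\<^sup>+\<omega>. ennreal (d k \<omega>) \<partial>M)
      \<le> (\<integral>\<^sup>+\<omega>. ennreal (\<phi> (min (R (Suc k) \<omega>) (v \<omega>)) - \<phi> (min (R k \<omega>) (v \<omega>))) \<partial>M)" if "k < n" for k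
  proof -
    let ?s = "real (Suc k) * \<delta>" and ?r = "real (n - Suc k) * \<delta>"
    let ?C = "{z. - c \<le> \<epsilon> * z}"
    have s: "0 \<le> ?s" and r: "0 \<le> ?r" "?r \<le> real n * \<delta>" using \<delta> by (auto intro!: mult_right_mono)
    have sr: "?s + ?r = real n * \<delta>" using that by (simp add: distrib_right[symmetric] of_nat_diff)
    interpret Kr: prob_space "K ?r" by (rule K_prob[OF r(1)])
    note [measurable] = dm[of k] and [measurable_cong] = K_sets[OF r(1)]
    have C[measurable]: "?C \<in> sets borel" by measurable
    have "ennreal p * (\<integral>\<^sup>+\<omega>. ennreal (d k \<omega>) \<partial>M) = (\<integral>\<^sup>+\<omega>. ennreal (d k \<omega>) * ennreal p \<partial>M)"
      by (subst nn_integral_multc) (auto simp: mult.commute)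
    also have "\<dots> \<le> (\<integral>\<^sup>+\<omega>. ennreal (d k \<omega>) * emeasure (K ?r) ?C \<partial>M)"
      using K[OF r] by (intro nn_integral_mono mult_left_mono) (auto simp: Kr.emeasure_eq_measure)
    also have "\<dots> = (\<integral>\<^sup>+\<omega>. \<integral>\<^sup>+z. ennreal (d k \<omega>) * indicator ?C z \<partial>K ?r \<partial>M)"
      by (intro nn_integral_cong) (subst nn_integral_cmult_indicator, auto simp: K_sets[OF r(1)])
    also have "\<dots> = (\<integral>\<^sup>+\<omega>. ennreal (d k \<omega>) * indicator ?C (X (?s + ?r) \<omega> - X ?s \<omega>) \<partial>M)"
    proof -
      have "(\<lambda>(\<omega>, z). ennreal (d k \<omega>) * indicator ?C z) \<in> borel_measurable (F ?s \<Otimes>\<^sub>M borel)"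
        by measurable
      from nn_integral_increment[OF s r(1) this] show ?thesis by (simp only: case_prod_conv)
    qed
    also have "\<dots> \<le> (\<integral>\<^sup>+\<omega>. ennreal (\<phi> (min (R (Suc k) \<omega>) (v \<omega>)) - \<phi> (min (R k \<omega>) (v \<omega>))) \<partial>M)"
    \<comment> \<open>If the running maximum increases at this step, its new value is the process
      itself at that time, and on the event \<open>?C\<close> the final level v lies above it.
      Capping both terms at v then changes nothing.\<close>
    proof (intro nn_integral_mono)
      fix \<omega> assume \<omega>: "\<omega> \<in> space M"
      show "ennreal (d k \<omega>) * indicator ?C (X (?s + ?r) \<omega> - X ?s \<omega>)
        \<le> ennreal (\<phi> (min (R (Suc k) \<omega>) (v \<omega>)) - \<phi> (min (R k \<omega>) (v \<omega>)))"
      proof (cases "X (?s + ?r) \<omega> - X ?s \<omega> \<in> ?C \<and> R k \<omega> < R (Suc k) \<omega>")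
        case True
        then have "R (Suc k) \<omega> = \<epsilon> * X ?s \<omega>"
          unfolding R_def running_max.simps by (simp add: less_max_iff_disj max_absorb2 less_imp_le)
        then have "R (Suc k) \<omega> \<le> v \<omega>" using True unfolding v_def sr by (auto simp: algebra_simps)
        then show ?thesis using True unfolding d_def by (simp add: min_absorb1)
      next
        case False
        have "R k \<omega> \<le> R (Suc k) \<omega>" unfolding R_def by simp
        then have "R k \<omega> = R (Suc k) \<omega> \<or> R k \<omega> < R (Suc k) \<omega>" by linarith
        then show ?thesis using False unfolding d_def by auto
      qed
    qed
    finally show ?thesis .
  qed
  have tele: "ennreal (f n - f 0) = (\<Sum>k<n. ennreal (f (Suc k) - f k))" if "\<And>k. f k \<le> f (Suc k)" for f :: "nat \<Rightarrow> real"
    using that by (subst sum_ennreal) (auto simp: sum_lessThan_telescope)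
  have R_le: "R k \<omega> \<le> R (Suc k) \<omega>" for k \<omega> unfolding R_def by simp
  have "ennreal p * (\<integral>\<^sup>+\<omega>. ennreal (\<phi> (R n \<omega>) - \<phi> (R 0 \<omega>)) \<partial>M) = (\<Sum>k<n. ennreal p * (\<integral>\<^sup>+\<omega>. ennreal (d k \<omega>) \<partial>M))"
    using monoD[OF \<phi>(1)] R_le
    by (subst tele) (auto simp: nn_integral_sum sum_distrib_left d_def[symmetric])
  also have "\<dots> \<le> (\<Sum>k<n. (\<integral>\<^sup>+\<omega>. ennreal (\<phi> (min (R (Suc k) \<omega>) (v \<omega>)) - \<phi> (min (R k \<omega>) (v \<omega>))) \<partial>M))"
    by (intro sum_mono step) auto
  also have "\<dots> = (\<integral>\<^sup>+\<omega>. (\<Sum>k<n. ennreal (\<phi> (min (R (Suc k) \<omega>) (v \<omega>)) - \<phi> (min (R k \<omega>) (v \<omega>)))) \<partial>M)"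
    unfolding v_def by (subst nn_integral_sum) auto
  also have "\<dots> = (\<integral>\<^sup>+\<omega>. ennreal (\<phi> (min (R n \<omega>) (v \<omega>)) - \<phi> (min (R 0 \<omega>) (v \<omega>))) \<partial>M)"
    using monoD[OF \<phi>(1)] min.mono[OF R_le order_refl] by (intro nn_integral_cong) (subst tele, auto)
  also have "\<dots> \<le> (\<integral>\<^sup>+\<omega>. ennreal (\<phi> (v \<omega>)) \<partial>M)"
  proof (intro nn_integral_mono ennreal_leI)
    fix \<omega>
    have "\<phi> (min (R n \<omega>) (v \<omega>)) \<le> \<phi> (v \<omega>)" by (intro monoD[OF \<phi>(1)]) simp
    then show "\<phi> (min (R n \<omega>) (v \<omega>)) - \<phi> (min (R 0 \<omega>) (v \<omega>)) \<le> \<phi> (v \<omega>)"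
      using \<phi>(2)[of "min (R 0 \<omega>) (v \<omega>)"] by linarith
  qed
  finally show ?thesis unfolding v_def R_def by simp
qed

text \<open>D is the supremum over dyadic grids of the growth of \<phi> along the running maximum.
  Refinement of the grid increases it, so \<open>ottaviani\<close> passes to the limit by monotone
  convergence; the factor 2 is the inverse of the probability 1/2. Openness of the superlevel sets
  of \<phi> lets a value at s be seen at grid points slightly to its right, which stay within the
  grid because s < t.\<close>

lemma sup_bound:
  fixes \<phi> :: "real \<Rightarrow> real"
  assumes t: "0 < t" and \<phi>: "mono \<phi>" "\<And>x. 0 \<le> \<phi> x" "\<And>v. open {x. v < \<phi> x}"
    and K: "\<And>r. 0 \<le> r \<Longrightarrow> r \<le> t \<Longrightarrow> 1/2 \<le> measure (K r) {z. - c \<le> \<epsilon> * z}"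
  obtains D :: "'a \<Rightarrow> ennreal" where "D \<in> borel_measurable M"
    "(\<integral>\<^sup>+\<omega>. D \<omega> \<partial>M) \<le> 2 * (\<integral>\<^sup>+\<omega>. ennreal (\<phi> (\<epsilon> * X t \<omega> + c)) \<partial>M)"
    "\<And>\<omega> s. \<omega> \<in> space M \<Longrightarrow> 0 \<le> s \<Longrightarrow> s < t \<Longrightarrow> ennreal (\<phi> (\<epsilon> * X s \<omega>) - \<phi> 0) \<le> D \<omega>"
proof -
  define G where "G m \<omega> = ennreal (\<phi> (running_max \<epsilon> (t / 2 ^ m) (2 ^ m) \<omega>) - \<phi> 0)" for m \<omega>
  have [measurable]: "\<phi> \<in> borel_measurable borel" by (rule borel_measurable_mono[OF \<phi>(1)])
  have [measurable]: "running_max \<epsilon> (t / 2 ^ m) (2 ^ m) \<in> borel_measurable M" for m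
    by (rule measurable_F[of t]) (use t in \<open>auto intro!: running_max_adapted\<close>)
  have G[measurable]: "G m \<in> borel_measurable M" for m unfolding G_def by measurable
  have inc: "G m \<omega> \<le> G (Suc m) \<omega>" if \<omega>: "\<omega> \<in> space M" for m \<omega>
  proof -
    obtain j where j: "j \<le> 2 ^ m" "running_max \<epsilon> (t / 2 ^ m) (2 ^ m) \<omega> = \<epsilon> * X (real j * (t / 2 ^ m)) \<omega>"
      using running_max_attained[OF \<omega>] by blast
    have "\<epsilon> * X (real (2 * j) * (t / 2 ^ Suc m)) \<omega> \<le> running_max \<epsilon> (t / 2 ^ Suc m) (2 ^ Suc m) \<omega>"
      by (rule running_max_ge[OF \<omega>]) (use j in simp)
    then show ?thesis unfolding G_def j(2) by (intro ennreal_leI diff_right_mono monoD[OF \<phi>(1)]) simp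
  qed
  have G_le: "(\<integral>\<^sup>+\<omega>. G m \<omega> \<partial>M) \<le> 2 * (\<integral>\<^sup>+\<omega>. ennreal (\<phi> (\<epsilon> * X t \<omega> + c)) \<partial>M)" for m
  proof -
    have "ennreal (1/2) * (\<integral>\<^sup>+\<omega>. G m \<omega> \<partial>M) \<le> (\<integral>\<^sup>+\<omega>. ennreal (\<phi> (\<epsilon> * X t \<omega> + c)) \<partial>M)"
      using ottaviani[of "t / 2 ^ m" "1/2" \<phi> "2 ^ m" c \<epsilon>] t \<phi> K unfolding G_def by simp
    then have "2 * (ennreal (1/2) * (\<integral>\<^sup>+\<omega>. G m \<omega> \<partial>M)) \<le> 2 * (\<integral>\<^sup>+\<omega>. ennreal (\<phi> (\<epsilon> * X t \<omega> + c)) \<partial>M)"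
      by (intro mult_left_mono) auto
    moreover have "2 * (ennreal (1/2) * x) = x" for x
    proof -
      have "2 * ennreal (1/2) = 1" using ennreal_mult[of 2 "1/2", symmetric] by simp
      then show ?thesis by (simp add: mult.assoc[symmetric])
    qed
    ultimately show ?thesis by simp
  qed
  show ?thesis
  proof (rule that[of "\<lambda>\<omega>. SUP m. G m \<omega>"])
    show "(\<lambda>\<omega>. SUP m. G m \<omega>) \<in> borel_measurable M" by measurable
    have "(\<integral>\<^sup>+\<omega>. (SUP m. G m \<omega>) \<partial>M) = (SUP m. (\<integral>\<^sup>+\<omega>. G m \<omega> \<partial>M))"
      by (rule nn_integral_monotone_convergence_SUP_AE) (auto intro: inc)
    also have "\<dots> \<le> 2 * (\<integral>\<^sup>+\<omega>. ennreal (\<phi> (\<epsilon> * X t \<omega> + c)) \<partial>M)"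
      by (intro SUP_least G_le)
    finally show "(\<integral>\<^sup>+\<omega>. (SUP m. G m \<omega>) \<partial>M) \<le> 2 * (\<integral>\<^sup>+\<omega>. ennreal (\<phi> (\<epsilon> * X t \<omega> + c)) \<partial>M)" .
  next
    fix \<omega> s assume \<omega>: "\<omega> \<in> space M" and s: "0 \<le> s" "s < t"
    show "ennreal (\<phi> (\<epsilon> * X s \<omega>) - \<phi> 0) \<le> (SUP m. G m \<omega>)"
    proof (rule ccontr)
      assume "\<not> ?thesis"
      then have less: "(SUP m. G m \<omega>) < ennreal (\<phi> (\<epsilon> * X s \<omega>) - \<phi> 0)" by simp
      then obtain u where u: "0 \<le> u" "(SUP m. G m \<omega>) = ennreal u"
        by (cases "SUP m. G m \<omega>") auto
      then have u': "u + \<phi> 0 < \<phi> (\<epsilon> * X s \<omega>)" using less by (auto simp: ennreal_less_iff)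
      \<comment> \<open>The grid is t times a dyadic grid, so time is rescaled to s / t before it is
        rounded up.\<close>
      have "((\<lambda>s'. \<epsilon> * X (t * s') \<omega>) \<longlongrightarrow> \<epsilon> * X s \<omega>) (at_right (s / t))"
      proof (intro tendsto_intros)
        have "filterlim (\<lambda>s'. t * s') (at_right s) (at_right (s / t))"
          unfolding filterlim_at
        proof
          have "((\<lambda>s'. t * s') \<longlongrightarrow> t * (s / t)) (at_right (s / t))" by (intro tendsto_intros)
          then show "((\<lambda>s'. t * s') \<longlongrightarrow> s) (at_right (s / t))" using t by simp
          show "eventually (\<lambda>s'. t * s' \<in> {s<..} \<and> t * s' \<noteq> s) (at_right (s / t))"
            unfolding eventually_at_filter using t by (auto simp: pos_divide_less_eq mult.commute intro!: always_eventually)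
        qed
        then show "((\<lambda>s'. X (t * s') \<omega>) \<longlongrightarrow> X s \<omega>) (at_right (s / t))"
          by (rule filterlim_compose[OF X_right[OF \<omega> s(1)]])
      qed
      from filterlim_compose[OF this filterlim_next_dyadic]
      have lim: "(\<lambda>m. \<epsilon> * X (t * next_dyadic m (s / t)) \<omega>) \<longlonglongrightarrow> \<epsilon> * X s \<omega>" using s t by simp
      have "eventually (\<lambda>m. \<epsilon> * X (t * next_dyadic m (s / t)) \<omega> \<in> {x. u + \<phi> 0 < \<phi> x}) sequentially"
        using lim \<phi>(3)[of "u + \<phi> 0"] u' by (intro topological_tendstoD) auto
      then obtain m where m: "u + \<phi> 0 < \<phi> (\<epsilon> * X (t * next_dyadic m (s / t)) \<omega>)"
        unfolding eventually_sequentially by auto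
      let ?j = "Suc (nat \<lfloor>2 ^ m * (s / t)\<rfloor>)"
      have "2 ^ m * (s / t) < 2 ^ m" using s t by (simp add: pos_divide_less_eq)
      then have "\<lfloor>2 ^ m * (s / t)\<rfloor> < 2 ^ m" by (simp add: floor_less_iff)
      then have j: "?j \<le> 2 ^ m" using s t by (simp add: Suc_le_eq nat_less_iff)
      have "\<epsilon> * X (real ?j * (t / 2 ^ m)) \<omega> \<le> running_max \<epsilon> (t / 2 ^ m) (2 ^ m) \<omega>"
        by (rule running_max_ge[OF \<omega> j])
      moreover have "real ?j * (t / 2 ^ m) = t * next_dyadic m (s / t)" unfolding next_dyadic_def by simp
      ultimately have "\<phi> (\<epsilon> * X (t * next_dyadic m (s / t)) \<omega>) \<le> \<phi> (running_max \<epsilon> (t / 2 ^ m) (2 ^ m) \<omega>)"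
        by (intro monoD[OF \<phi>(1)]) simp
      then have "u < \<phi> (running_max \<epsilon> (t / 2 ^ m) (2 ^ m) \<omega>) - \<phi> 0" using m by simp
      then have "ennreal u < G m \<omega>" unfolding G_def using u(1) by (simp add: ennreal_less_iff)
      also have "\<dots> \<le> (SUP m. G m \<omega>)" by (rule SUP_upper) simp
      finally show False using u(2) by simp
    qed
  qed
qed

end

section \<open>Measurability of hitting and exit times\<close>

text \<open>Upper semicontinuity with a margin: the bound b < a holds on a whole neighbourhood, and
  the margin survives the passage to a finite subcover in \<open>hit_by_iff\<close>.\<close>

lemma open_interval_below:
  assumes f: "good_path f" and s: "0 \<le> s" "f s < a"
  shows "\<exists>l r b. l < s \<and> s < r \<and> b < a \<and> (\<forall>x. l < x \<and> x < r \<and> 0 \<le> x \<longrightarrow> f x < b)"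
proof -
  define b where "b = (f s + a) / 2"
  have b: "f s < b" "b < a" using s(2) unfolding b_def by auto
  have "eventually (\<lambda>x. f x < b) (at_right s)"
    using good_path_right[OF f s(1)] b(1) by (rule order_tendstoD)
  then obtain r where r: "s < r" "\<And>x. s < x \<Longrightarrow> x < r \<Longrightarrow> f x < b"
    unfolding eventually_at_right_field by auto
  obtain l where l: "l < s" "\<And>x. l < x \<Longrightarrow> x < s \<Longrightarrow> 0 \<le> x \<Longrightarrow> f x < b"
  proof (cases "s = 0")
    case True then show ?thesis using that[of "-1"] by auto
  next
    case False
    then obtain v where v: "v \<le> f s" "(f \<longlongrightarrow> v) (at_left s)" using good_path_left[OF f, of s] s(1) by auto
    have "eventually (\<lambda>x. f x < b) (at_left s)"
      using v(2) le_less_trans[OF v(1) b(1)] by (rule order_tendstoD)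
    then show ?thesis using that unfolding eventually_at_left_field by auto
  qed
  have "f x < b" if "l < x" "x < r" "0 \<le> x" for x
    using l(2)[of x] r(2)[of x] that b(1) by (cases "x = s") (auto simp: neq_iff)
  then show ?thesis using l(1) r(1) b(2) by blast
qed

text \<open>Without negative jumps a path is upper semicontinuous, so it attains its supremum over a
  compact interval.\<close>

lemma hit_by_iff:
  assumes f: "good_path f" and u: "0 \<le> u"
  shows "(\<exists>s. 0 \<le> s \<and> s \<le> u \<and> a \<le> f s) \<longleftrightarrow>
    (\<forall>n::nat. \<exists>s\<in>insert u ({0..u} \<inter> \<rat>). a - 1 / real (Suc n) < f s)"
proof
  assume "\<exists>s. 0 \<le> s \<and> s \<le> u \<and> a \<le> f s"
  then obtain s where s: "0 \<le> s" "s \<le> u" "a \<le> f s" by auto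
  show "\<forall>n::nat. \<exists>s\<in>insert u ({0..u} \<inter> \<rat>). a - 1 / real (Suc n) < f s"
  proof
    fix n
    have lt: "a - 1 / real (Suc n) < f s" using s(3) by (simp add: less_le_trans[of _ a])
    show "\<exists>s\<in>insert u ({0..u} \<inter> \<rat>). a - 1 / real (Suc n) < f s"
    proof (cases "s = u")
      case False
      have "eventually (\<lambda>x. a - 1 / real (Suc n) < f x) (at_right s)"
        using good_path_right[OF f s(1)] lt by (rule order_tendstoD)
      then obtain b where b: "s < b" "\<And>x. s < x \<Longrightarrow> x < b \<Longrightarrow> a - 1 / real (Suc n) < f x"
        unfolding eventually_at_right_field by auto
      obtain x where "x \<in> \<rat>" "s < x" "x < min b u"
        using Rats_dense_in_real[of s "min b u"] b(1) False s(2) by auto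
      then show ?thesis using b(2)[of x] s(1) by (intro bexI[of _ x]) auto
    qed (use lt in auto)
  qed
next
  assume *: "\<forall>n::nat. \<exists>s\<in>insert u ({0..u} \<inter> \<rat>). a - 1 / real (Suc n) < f s"
  show "\<exists>s. 0 \<le> s \<and> s \<le> u \<and> a \<le> f s"
  proof (rule ccontr)
    assume nh: "\<not> ?thesis"
    have "\<forall>s\<in>{0..u}. \<exists>l r b. l < s \<and> s < r \<and> b < a \<and> (\<forall>x. l < x \<and> x < r \<and> 0 \<le> x \<longrightarrow> f x < b)"
    proof
      fix s assume s: "s \<in> {0..u}"
      then have "f s < a" using nh not_le[of a "f s"] by (metis atLeastAtMost_iff)
      then show "\<exists>l r b. l < s \<and> s < r \<and> b < a \<and> (\<forall>x. l < x \<and> x < r \<and> 0 \<le> x \<longrightarrow> f x < b)"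
        using open_interval_below[OF f, of s a] s by simp
    qed
    then obtain l r b where lrb: "\<And>s. s \<in> {0..u} \<Longrightarrow> l s < s \<and> s < r s \<and> b s < a \<and> (\<forall>x. l s < x \<and> x < r s \<and> 0 \<le> x \<longrightarrow> f x < b s)"
      by metis
    obtain D where D: "D \<subseteq> {0..u}" "finite D" "{0..u} \<subseteq> (\<Union>s\<in>D. {l s<..<r s})"
    proof (rule compactE_image[of "{0..u}" "{0..u}" "\<lambda>s. {l s<..<r s}"])
      show "{0..u} \<subseteq> (\<Union>s\<in>{0..u}. {l s<..<r s})" using lrb by fastforce
    qed auto
    have "D \<noteq> {}" using D(3) u by auto
    define B where "B = Max (b ` D)"
    have "B \<in> b ` D" unfolding B_def using D(2) \<open>D \<noteq> {}\<close> by (intro Max_in) auto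
    then have "B < a" using lrb D(1) by auto
    then obtain n where n: "1 / real (Suc n) < a - B"
      using reals_Archimedean[of "a - B"] by (auto simp: inverse_eq_divide)
    obtain s where "s \<in> insert u ({0..u} \<inter> \<rat>)" and s2: "a - 1 / real (Suc n) < f s"
      using * by blast
    then have "s \<in> {0..u}" using u by auto
    note s = this s2
    obtain d where d: "d \<in> D" "l d < s" "s < r d" using D(3) s(1) by auto
    then have "f s < b d" using lrb[of d] D(1) s(1) by auto
    also have "b d \<le> B" unfolding B_def using D(2) d(1) by auto
    finally show False using s(2) n by simp
  qed
qed

section \<open>Exit from the strip between ruin and payment\<close>

definition exit_set :: "real \<Rightarrow> (real \<Rightarrow> real) \<Rightarrow> real set" where
  "exit_set a f = {s. 0 \<le> s \<and> (a \<le> f s \<or> 0 < s \<and> f s < 0)}"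

text \<open>The cap N makes the exit time bounded and the set nonempty. It is removed only in
  \<open>first_payment\<close>, by letting N tend to infinity.\<close>

definition exit_time :: "real \<Rightarrow> real \<Rightarrow> (real \<Rightarrow> real) \<Rightarrow> real" where
  "exit_time a N f = Inf (insert N (exit_set a f))"

lemma exit_set_nonneg: "s \<in> exit_set a f \<Longrightarrow> 0 \<le> s"
  unfolding exit_set_def by auto

lemma bdd_below_exit:
  assumes "0 < N" shows "bdd_below (insert N (exit_set a f))"
proof (rule bdd_belowI[of _ 0])
  fix s assume "s \<in> insert N (exit_set a f)"
  then show "0 \<le> s" using exit_set_nonneg[of s a f] assms by auto
qed

text \<open>The strict comparison is the measurable one: an infimum below u has a witness before u,
  whereas deciding {exit \<le> u} could require a look beyond u.\<close>

lemma exit_time_less_iff: "0 < N \<Longrightarrow> exit_time a N f < u \<longleftrightarrow> N < u \<or> (\<exists>s\<in>exit_set a f. s < u)"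
  unfolding exit_time_def by (subst cInf_less_iff[OF _ bdd_below_exit]) auto

lemma exit_time_bounds:
  assumes "0 < N" shows "0 \<le> exit_time a N f" "exit_time a N f \<le> N"
  unfolding exit_time_def using assms
  by (auto intro!: cInf_greatest cInf_lower bdd_below_exit dest: exit_set_nonneg)

lemma before_exit_time:
  assumes "0 < N" "0 \<le> f 0" "0 \<le> s" "s < exit_time a N f"
  shows "0 \<le> f s" "f s < a"
proof -
  have "s \<notin> exit_set a f"
    using assms(1,4) exit_time_less_iff[of N a f "exit_time a N f"] by auto
  then show "0 \<le> f s" "f s < a"
    using assms(2,3) unfolding exit_set_def by (cases "s = 0"; auto simp: not_le not_less)+
qed

lemma exit_time_first_paid:
  assumes f: "good_path f" and fp: "first_paid a f" "hit_time a f \<le> N" "0 < N" "0 \<le> f 0"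
  shows "exit_time a N f = hit_time a f"
proof (rule antisym)
  have h: "hits a f" "\<And>t. 0 < t \<Longrightarrow> t < hit_time a f \<Longrightarrow> 0 \<le> f t" using fp(1) unfolding first_paid_def by auto
  have "hit_time a f \<in> exit_set a f"
    unfolding exit_set_def using at_hit_time[OF f h(1)] hit_time_nonneg by auto
  then show "exit_time a N f \<le> hit_time a f"
    unfolding exit_time_def by (intro cInf_lower bdd_below_exit fp(3)) simp
  show "hit_time a f \<le> exit_time a N f"
    unfolding exit_time_def
  proof (rule cInf_greatest)
    fix s assume "s \<in> insert N (exit_set a f)"
    then show "hit_time a f \<le> s"
    proof
      assume s: "s \<in> exit_set a f"
      show ?thesis
      proof (rule ccontr)
        assume "\<not> hit_time a f \<le> s"
        then have "f s < a" using before_hit_time[of s a f] s unfolding exit_set_def by auto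
        then show False using s h(2)[of s] \<open>\<not> hit_time a f \<le> s\<close> unfolding exit_set_def by auto
      qed
    qed (use fp(2) in auto)
  qed simp
qed

text \<open>Without downward jumps the path cannot leap below 0, so it is nonnegative at the exit. A
  value strictly between 0 and a before time N would persist by right continuity and contradict the
  infimum. So ruin before N happens at level 0 exactly, where the boundary condition on h
  applies.\<close>

lemma exit_time_not_paid:
  assumes f: "good_path f" and N: "0 < N" and f0: "0 \<le> f 0"
    and np: "\<not> (first_paid a f \<and> hit_time a f \<le> N)"
  shows "f (exit_time a N f) = 0 \<or> exit_time a N f = N \<and> 0 \<le> f N \<and> f N < a"
proof -
  let ?s = "exit_time a N f"
  note bounds = exit_time_bounds[OF N, of a f]
  note before = before_exit_time[where f = f and a = a, OF N f0]
  \<comment> \<open>Otherwise the exit would be the first hit of a, with no ruin before it, and the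
    payment would have been made.\<close>
  have lt: "f ?s < a"
  proof (rule ccontr)
    assume "\<not> f ?s < a"
    then have a: "a \<le> f ?s" by simp
    then have h: "hits a f" unfolding hits_def using bounds by auto
    have "hit_time a f = ?s"
    proof (rule antisym)
      show "hit_time a f \<le> ?s" by (rule hit_time_le[where f=f, OF bounds(1) a])
      show "?s \<le> hit_time a f"
        using before(2)[OF hit_time_nonneg, of a f] at_hit_time[OF f h] by (auto simp: not_less[symmetric])
    qed
    then have "first_paid a f \<and> hit_time a f \<le> N"
      using bounds h before(1) unfolding first_paid_def by auto
    then show False using np by blast
  qed
  have nonneg: "0 \<le> f ?s"
  proof (cases "?s = 0")
    case False
    then have pos: "0 < ?s" using bounds by auto
    obtain l where l: "l \<le> f ?s" "(f \<longlongrightarrow> l) (at_left ?s)" using good_path_left[OF f pos] by blast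
    have "eventually (\<lambda>x. 0 \<le> f x) (at_left ?s)"
      unfolding eventually_at_left_field using pos before(1) by (intro exI[of _ 0]) auto
    then have "0 \<le> l" by (intro tendsto_lowerbound[OF l(2)]) auto
    then show ?thesis using l(1) by simp
  qed (use f0 in simp)
  show ?thesis
  proof (cases "?s = N")
    case True then show ?thesis using lt nonneg by simp
  next
    case False
    then have sN: "?s < N" using bounds by auto
    have "\<not> 0 < f ?s"
    proof
      assume pos: "0 < f ?s"
      have "eventually (\<lambda>x. 0 < f x) (at_right ?s)" "eventually (\<lambda>x. f x < a) (at_right ?s)"
        using good_path_right[OF f bounds(1)] pos lt by (auto intro: order_tendstoD)
      then have "eventually (\<lambda>x. 0 < f x \<and> f x < a) (at_right ?s)" by (rule eventually_conj)
      then obtain b where b: "?s < b" "\<And>x. ?s < x \<Longrightarrow> x < b \<Longrightarrow> 0 < f x \<and> f x < a"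
        unfolding eventually_at_right_field by auto
      have "min b N \<le> ?s"
        unfolding exit_time_def
      proof (rule cInf_greatest)
        fix s assume s: "s \<in> insert N (exit_set a f)"
        show "min b N \<le> s"
        proof (cases "s = N")
          case False
          then have s: "s \<in> exit_set a f" using s by simp
          have "?s \<le> s" unfolding exit_time_def by (intro cInf_lower bdd_below_exit N) (use s in simp)
          moreover have "s \<noteq> ?s" using s pos lt unfolding exit_set_def by auto
          ultimately show ?thesis using b(2)[of s] s unfolding exit_set_def by force
        qed simp
      qed simp
      then show False using b(1) sN by simp
    qed
    then show ?thesis using nonneg by simp
  qed
qed

section \<open>Events decided before a given time\<close>

context adapted_process begin

lemma good_shifted: "\<omega> \<in> space M \<Longrightarrow> good_path (\<lambda>t. x + X t \<omega>)"
  using good_path_shift[OF good order_refl, of \<omega> x 0] by simp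

lemma hit_by_measurable:
  assumes u: "0 \<le> u"
  shows "{\<omega>\<in>space M. \<exists>s. 0 \<le> s \<and> s \<le> u \<and> a \<le> x + X s \<omega>} \<in> sets (F u)"
proof -
  have "{\<omega>\<in>space M. \<exists>s. 0 \<le> s \<and> s \<le> u \<and> a \<le> x + X s \<omega>} =
    {\<omega>\<in>space (F u). \<forall>n::nat. \<exists>s\<in>insert u ({0..u} \<inter> \<rat>). a - 1 / real (Suc n) < x + X s \<omega>}"
    unfolding space_F[OF u]
    by (intro Collect_cong conj_cong refl hit_by_iff[OF good_shifted u])
  also have "\<dots> \<in> sets (F u)"
  proof (rule sets.sets_Collect_countable_All)
    fix n
    have "{\<omega>\<in>space (F u). \<exists>s\<in>insert u ({0..u} \<inter> \<rat>). a - 1 / real (Suc n) < x + X s \<omega>}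
      = (\<Union>s\<in>insert u ({0..u} \<inter> \<rat>). {\<omega>\<in>space (F u). a - 1 / real (Suc n) < x + X s \<omega>})" by blast
    also have "\<dots> \<in> sets (F u)"
    proof (rule sets.countable_UN'')
      show "countable (insert u ({0..u} \<inter> \<rat>))" by (intro countable_insert countable_Int2 countable_rat)
      fix s assume "s \<in> insert u ({0..u} \<inter> \<rat>)"
      then have [measurable]: "X s \<in> borel_measurable (F u)" using u by (intro X_adapted) auto
      show "{\<omega>\<in>space (F u). a - 1 / real (Suc n) < x + X s \<omega>} \<in> sets (F u)" by measurable
    qed
    finally show "{\<omega>\<in>space (F u). \<exists>s\<in>insert u ({0..u} \<inter> \<rat>). a - 1 / real (Suc n) < x + X s \<omega>} \<in> sets (F u)" .
  qed
  finally show ?thesis .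
qed

lemma hit_before_measurable:
  assumes u: "0 \<le> u"
  shows "{\<omega>\<in>space M. \<exists>s. 0 \<le> s \<and> s < u \<and> a \<le> x + X s \<omega>} \<in> sets (F u)"
proof -
  have "{\<omega>\<in>space M. \<exists>s. 0 \<le> s \<and> s < u \<and> a \<le> x + X s \<omega>} =
     (\<Union>r\<in>{0..<u} \<inter> \<rat>. {\<omega>\<in>space M. \<exists>s. 0 \<le> s \<and> s \<le> r \<and> a \<le> x + X s \<omega>})" (is "?A = ?B")
  proof (intro set_eqI iffI)
    fix \<omega> assume "\<omega> \<in> ?A"
    then obtain s where s: "\<omega> \<in> space M" "0 \<le> s" "s < u" "a \<le> x + X s \<omega>" by auto
    obtain r where "r \<in> \<rat>" "s < r" "r < u" using Rats_dense_in_real[OF s(3)] by auto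
    then show "\<omega> \<in> ?B" using s by (auto intro!: bexI[of _ r] exI[of _ s])
  next
    fix \<omega> assume "\<omega> \<in> ?B" then show "\<omega> \<in> ?A" by (auto intro: le_less_trans)
  qed
  also have "\<dots> \<in> sets (F u)"
  proof (intro sets.countable_UN'' countable_Int2 countable_rat)
    fix r assume "r \<in> {0..<u} \<inter> \<rat>"
    then have "0 \<le> r" "r \<le> u" by auto
    then show "{\<omega>\<in>space M. \<exists>s. 0 \<le> s \<and> s \<le> r \<and> a \<le> x + X s \<omega>} \<in> sets (F u)"
      using hit_by_measurable F_mono by blast
  qed
  finally show ?thesis .
qed

lemma negative_before_measurable:
  assumes u: "0 \<le> u"
  shows "{\<omega>\<in>space M. \<exists>s. 0 < s \<and> s < u \<and> x + X s \<omega> < 0} \<in> sets (F u)"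
proof -
  have "{\<omega>\<in>space M. \<exists>s. 0 < s \<and> s < u \<and> x + X s \<omega> < 0} =
     (\<Union>r\<in>{0<..<u} \<inter> \<rat>. {\<omega>\<in>space (F u). x + X r \<omega> < 0})" (is "?A = ?B")
  proof (intro set_eqI iffI)
    fix \<omega> assume "\<omega> \<in> ?A"
    then obtain s where s: "\<omega> \<in> space M" "0 < s" "s < u" "x + X s \<omega> < 0" by auto
    have "eventually (\<lambda>r. x + X r \<omega> < 0) (at_right s)"
      using good_path_right[OF good_shifted[OF s(1)], of s x] s by (intro order_tendstoD(2)) auto
    then obtain b where b: "s < b" "\<And>r. s < r \<Longrightarrow> r < b \<Longrightarrow> x + X r \<omega> < 0"
      unfolding eventually_at_right_field by auto
    obtain r where "r \<in> \<rat>" "s < r" "r < min b u" using Rats_dense_in_real[of s "min b u"] s b by auto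
    then show "\<omega> \<in> ?B" using s b space_F[OF u] by (auto intro!: bexI[of _ r])
  next
    fix \<omega> assume "\<omega> \<in> ?B" then show "\<omega> \<in> ?A" using space_F[OF u] by auto
  qed
  also have "\<dots> \<in> sets (F u)"
  proof (intro sets.countable_UN'' countable_Int2 countable_rat)
    fix r assume "r \<in> {0<..<u} \<inter> \<rat>"
    then have [measurable]: "X r \<in> borel_measurable (F u)" by (intro X_adapted) auto
    show "{\<omega>\<in>space (F u). x + X r \<omega> < 0} \<in> sets (F u)" by measurable
  qed
  finally show ?thesis .
qed

lemma exit_time_measurable:
  assumes u: "0 \<le> u" and N: "0 < N"
  shows "{\<omega>\<in>space M. exit_time a N (\<lambda>t. x + X t \<omega>) < u} \<in> sets (F u)"
proof (cases "N < u")
  case True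
  then have "{\<omega>\<in>space M. exit_time a N (\<lambda>t. x + X t \<omega>) < u} = space (F u)"
    using exit_time_less_iff[OF N] space_F[OF u] by auto
  then show ?thesis by simp
next
  case False
  then have "{\<omega>\<in>space M. exit_time a N (\<lambda>t. x + X t \<omega>) < u} =
    {\<omega>\<in>space M. \<exists>s. 0 \<le> s \<and> s < u \<and> a \<le> x + X s \<omega>} \<union> {\<omega>\<in>space M. \<exists>s. 0 < s \<and> s < u \<and> x + X s \<omega> < 0}"
    unfolding exit_time_less_iff[OF N] exit_set_def by (auto intro: less_imp_le)
  then show ?thesis using hit_before_measurable[OF u] negative_before_measurable[OF u] by auto
qed

lemma exit_time_borel:
  assumes N: "0 < N"
  shows "(\<lambda>\<omega>. exit_time a N (\<lambda>t. x + X t \<omega>)) \<in> borel_measurable M"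
proof (rule borel_measurable_iff_less[THEN iffD2], rule allI)
  fix u
  show "{\<omega>\<in>space M. exit_time a N (\<lambda>t. x + X t \<omega>) < u} \<in> sets M"
  proof (cases "0 \<le> u")
    case True then show ?thesis using exit_time_measurable[OF True N] sets_F[OF True] by blast
  next
    case False
    then have "{\<omega>\<in>space M. exit_time a N (\<lambda>t. x + X t \<omega>) < u} = {}"
      using exit_time_bounds(1)[OF N, of a] by (auto simp: not_less intro: order_trans[of u 0])
    then show ?thesis by (simp only: sets.empty_sets)
  qed
qed

text \<open>Given a hit before u, ruin before that hit shows as a negative value at some rational r
  by which a has not been reached; both conditions are decided by time r < u. Rational times suffice
  by right continuity.\<close>

lemma first_paid_before_measurable:
  assumes u: "0 \<le> u"
  shows "{\<omega>\<in>space M. first_paid a (\<lambda>t. x + X t \<omega>) \<and> hit_time a (\<lambda>t. x + X t \<omega>) < u} \<in> sets (F u)"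
proof -
  let ?f = "\<lambda>\<omega> t. x + X t \<omega>"
  let ?H = "\<lambda>r. {\<omega>\<in>space M. \<exists>s. 0 \<le> s \<and> s \<le> r \<and> a \<le> x + X s \<omega>}"
  have hit_iff: "hits a (?f \<omega>) \<and> hit_time a (?f \<omega>) \<le> r \<longleftrightarrow> \<omega> \<in> ?H r" if "\<omega> \<in> space M" for \<omega> r
  proof
    assume "hits a (?f \<omega>) \<and> hit_time a (?f \<omega>) \<le> r"
    then show "\<omega> \<in> ?H r"
      using at_hit_time[OF good_shifted[OF that], of a x] hit_time_nonneg[of a "?f \<omega>"] that by auto
  next
    assume "\<omega> \<in> ?H r"
    then show "hits a (?f \<omega>) \<and> hit_time a (?f \<omega>) \<le> r"
      using hit_time_le[of _ a "?f \<omega>"] unfolding hits_def by (auto intro: order_trans)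
  qed
  have "{\<omega>\<in>space M. first_paid a (?f \<omega>) \<and> hit_time a (?f \<omega>) < u} =
    {\<omega>\<in>space M. \<exists>s. 0 \<le> s \<and> s < u \<and> a \<le> x + X s \<omega>} -
    (\<Union>r\<in>{0<..<u} \<inter> \<rat>. {\<omega>\<in>space (F u). x + X r \<omega> < 0} - ?H r)" (is "?A = ?B - ?C")
  proof (intro set_eqI iffI)
    fix \<omega> assume \<omega>: "\<omega> \<in> ?A"
    then have \<omega>': "\<omega> \<in> space M" and fp: "hits a (?f \<omega>)" "\<And>t. 0 < t \<Longrightarrow> t < hit_time a (?f \<omega>) \<Longrightarrow> 0 \<le> ?f \<omega> t"
      and lt: "hit_time a (?f \<omega>) < u"
      unfolding first_paid_def by auto
    have "\<omega> \<in> ?B"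
      using at_hit_time[OF good_shifted[OF \<omega>'] fp(1)] hit_time_nonneg[of a "?f \<omega>"] \<omega>' lt by auto
    moreover have "\<omega> \<notin> ?C"
    proof
      assume "\<omega> \<in> ?C"
      then obtain r where r: "0 < r" "x + X r \<omega> < 0" "\<omega> \<notin> ?H r" by auto
      then have "r < hit_time a (?f \<omega>)" using hit_iff[OF \<omega>', of r] fp(1) by auto
      then show False using fp(2)[of r] r by auto
    qed
    ultimately show "\<omega> \<in> ?B - ?C" by blast
  next
    fix \<omega> assume \<omega>: "\<omega> \<in> ?B - ?C"
    then obtain s where \<omega>': "\<omega> \<in> space M" and s: "0 \<le> s" "s < u" "a \<le> x + X s \<omega>" by auto
    have h: "hits a (?f \<omega>)" "hit_time a (?f \<omega>) \<le> s" using s hit_time_le[of s a "?f \<omega>"] unfolding hits_def by auto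
    have "0 \<le> ?f \<omega> t" if t: "0 < t" "t < hit_time a (?f \<omega>)" for t
    proof (rule ccontr)
      assume "\<not> 0 \<le> ?f \<omega> t"
      then have "eventually (\<lambda>r. x + X r \<omega> < 0) (at_right t)"
        using good_path_right[OF good_shifted[OF \<omega>'], of t x] t by (intro order_tendstoD(2)) auto
      then obtain b where b: "t < b" "\<And>r. t < r \<Longrightarrow> r < b \<Longrightarrow> x + X r \<omega> < 0"
        unfolding eventually_at_right_field by auto
      obtain r where r: "r \<in> \<rat>" "t < r" "r < min b (hit_time a (?f \<omega>))"
        using Rats_dense_in_real[of t "min b (hit_time a (?f \<omega>))"] t b by auto
      have "\<omega> \<notin> ?H r" using hit_iff[OF \<omega>', of r] r by auto
      then have "\<omega> \<in> ?C" using r t s h b(2)[of r] \<omega>' space_F[OF u] by (auto intro!: bexI[of _ r])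
      then show False using \<omega> by blast
    qed
    then show "\<omega> \<in> ?A" using \<omega>' h s unfolding first_paid_def by auto
  qed
  also have "\<dots> \<in> sets (F u)"
  proof (intro sets.Diff hit_before_measurable[OF u] sets.countable_UN'' countable_Int2 countable_rat)
    fix r assume "r \<in> {0<..<u} \<inter> \<rat>"
    then have r: "0 \<le> r" "r \<le> u" by auto
    then have [measurable]: "X r \<in> borel_measurable (F u)" by (intro X_adapted) auto
    show "{\<omega>\<in>space (F u). x + X r \<omega> < 0} \<in> sets (F u)" by measurable
    show "?H r \<in> sets (F u)" using hit_by_measurable[OF r(1)] F_mono[OF r] by blast
  qed
  finally show ?thesis .
qed

lemma first_paid_measurable: "{\<omega>\<in>space M. first_paid a (\<lambda>t. x + X t \<omega>)} \<in> sets M"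
proof -
  have "{\<omega>\<in>space M. first_paid a (\<lambda>t. x + X t \<omega>)} =
    (\<Union>n::nat. {\<omega>\<in>space M. first_paid a (\<lambda>t. x + X t \<omega>) \<and> hit_time a (\<lambda>t. x + X t \<omega>) < real n})"
    using reals_Archimedean2 by auto
  also have "\<dots> \<in> sets M"
    using sets_F[OF of_nat_0_le_iff first_paid_before_measurable[OF of_nat_0_le_iff]] by auto
  finally show ?thesis .
qed

lemma hit_time_measurable: "(\<lambda>\<omega>. hit_time a (\<lambda>t. x + X t \<omega>)) \<in> borel_measurable M"
proof (rule borel_measurable_iff_less[THEN iffD2], rule allI)
  fix u :: real
  let ?f = "\<lambda>\<omega> t. x + X t \<omega>"
  let ?B = "\<lambda>u. {\<omega>\<in>space M. \<exists>s. 0 \<le> s \<and> s < u \<and> a \<le> x + X s \<omega>}"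
  have B: "?B u \<in> sets M" if "0 \<le> u" for u
    using hit_before_measurable[OF that] sets_F[OF that] by blast
  have hits: "{\<omega>\<in>space M. hits a (?f \<omega>)} = (\<Union>n::nat. ?B (real n))"
  proof (intro set_eqI iffI)
    fix \<omega> assume "\<omega> \<in> {\<omega>\<in>space M. hits a (?f \<omega>)}"
    then obtain s where s: "\<omega> \<in> space M" "0 \<le> s" "a \<le> x + X s \<omega>" unfolding hits_def by auto
    obtain n :: nat where "s < real n" using reals_Archimedean2 by blast
    then have "\<omega> \<in> ?B (real n)" using s by auto
    then show "\<omega> \<in> (\<Union>n::nat. ?B (real n))" by blast
  qed (auto simp: hits_def)
  have hitsM: "{\<omega>\<in>space M. hits a (?f \<omega>)} \<in> sets M"
    unfolding hits using B by auto
  show "{\<omega>\<in>space M. hit_time a (?f \<omega>) < u} \<in> sets M"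
  proof (cases "0 < u")
    case True
    have "{\<omega>\<in>space M. hit_time a (?f \<omega>) < u} = ?B u \<union> (space M - {\<omega>\<in>space M. hits a (?f \<omega>)})" (is "?L = ?R")
    proof (intro set_eqI iffI)
      fix \<omega> assume "\<omega> \<in> ?L"
      then show "\<omega> \<in> ?R"
        using at_hit_time[OF good_shifted, of \<omega> a x] hit_time_nonneg[of a "?f \<omega>"] by auto
    next
      fix \<omega> assume \<omega>: "\<omega> \<in> ?R"
      then show "\<omega> \<in> ?L"
      proof
        assume "\<omega> \<in> ?B u"
        then show ?thesis using hit_time_le[of _ a "?f \<omega>"] by (auto intro: le_less_trans)
      next
        assume "\<omega> \<in> space M - {\<omega>\<in>space M. hits a (?f \<omega>)}"
        then show ?thesis using True by (auto simp: hit_time_def)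
      qed
    qed
    then show ?thesis using B[of u] hitsM True by auto
  next
    case False
    then have "{\<omega>\<in>space M. hit_time a (?f \<omega>) < u} = {}"
      using hit_time_nonneg[of a] by (auto simp: not_less intro: order_trans[of u 0])
    then show ?thesis by (simp only: sets.empty_sets)
  qed
qed

end

section \<open>Optional stopping\<close>

lemma integral_pull_const:
  fixes f g :: "'b \<Rightarrow> real"
  shows "(\<integral>x. f x * (c * g x) \<partial>N) = c * (\<integral>x. f x * g x \<partial>N)"
proof -
  have "(\<integral>x. f x * (c * g x) \<partial>N) = (\<integral>x. c * (f x * g x) \<partial>N)"
    by (intro Bochner_Integration.integral_cong refl) (rule mult.left_commute)
  then show ?thesis by (simp only: integral_mult_right_zero)
qed

text \<open>By \<open>harmonic\<close>, discounted h has drift - q k, which \<open>k_zero\<close>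
  switches off while the surplus is at most the barrier. Large arguments of h are low values of the
  process, so its exponential growth is matched by \<open>K_exp\<close>, while linear growth in the
  other direction is matched by \<open>K_int\<close>. \<open>K_abs_bound\<close> gives the uniform
  tails for Ottaviani's inequality, and \<open>K_small\<close> makes the mean discount of a climb
  smaller than 1.\<close>

locale harmonic_kernel =
  fixes K :: "real \<Rightarrow> real measure" and q \<Lambda> C :: real and h k :: "real \<Rightarrow> real"
  assumes q_pos: "0 < q" and \<Lambda>_pos: "0 < \<Lambda>" and C_nonneg: "0 \<le> C"
    and h_cont: "continuous_on UNIV h" and k_borel: "k \<in> borel_measurable borel"
    and h_bound: "\<bar>h y\<bar> \<le> C * (1 + exp (\<Lambda> * y) + \<bar>y\<bar>)"
    and k_bound: "\<bar>k y\<bar> \<le> C * (1 + \<bar>y\<bar>)"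
    and k_zero: "0 \<le> y \<Longrightarrow> k y = 0"
    and K_exp: "0 \<le> r \<Longrightarrow> integrable (K r) (\<lambda>z. exp (- \<Lambda> * z))"
    and K_int: "0 \<le> r \<Longrightarrow> integrable (K r) (\<lambda>z. z)"
    and K_abs_bound: "0 \<le> t \<Longrightarrow> \<exists>B. \<forall>r. 0 \<le> r \<and> r \<le> t \<longrightarrow> (\<integral>z. \<bar>z\<bar> \<partial>K r) \<le> B"
    and K_small: "0 < e \<Longrightarrow> \<exists>\<delta>>0. \<forall>r. 0 \<le> r \<and> r \<le> \<delta> \<longrightarrow> measure (K r) {z. e < \<bar>z\<bar>} \<le> 1/8"
    and harmonic: "0 \<le> t \<Longrightarrow> exp (- q * t) * (\<integral>z. h (y - z) \<partial>K t) =
      h y - q * (\<integral>r. indicator {0..<t} r * (exp (- q * r) * (\<integral>z. k (y - z) \<partial>K r)) \<partial>lborel)"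

locale harmonic_process = increment_process M X F K + harmonic_kernel K q \<Lambda> C h k
  for M :: "'a measure" and X F K q \<Lambda> C h k
begin

section \<open>Integrable bounds over a finite time horizon\<close>

lemma h_borel [measurable]: "h \<in> borel_measurable borel"
  by (rule borel_measurable_continuous_onI[OF h_cont])

lemmas [measurable] = k_borel

lemma X_exp: "0 \<le> r \<Longrightarrow> integrable M (\<lambda>\<omega>. exp (- \<Lambda> * X r \<omega>))"
  by (rule integrable_K[of r "\<lambda>z. exp (- \<Lambda> * z)", THEN iffD1, OF _ _ K_exp]) simp_all

lemma X_int: "0 \<le> r \<Longrightarrow> integrable M (X r)"
  by (rule integrable_K[of r "\<lambda>z. z", THEN iffD1]) (simp_all add: K_int)

text \<open>Markov's inequality for the absolute value. The constant 2 * \<bar>B\<bar> + 1 is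
  positive whatever the sign of B and bounds the excess probability by 1/2.\<close>

lemma K_tail:
  assumes t: "0 \<le> t"
  obtains c where "\<And>r. 0 \<le> r \<Longrightarrow> r \<le> t \<Longrightarrow> 1/2 \<le> measure (K r) {z. \<bar>z\<bar> \<le> c}"
proof -
  obtain B where "\<forall>r. 0 \<le> r \<and> r \<le> t \<longrightarrow> (\<integral>z. \<bar>z\<bar> \<partial>K r) \<le> B" using K_abs_bound[OF t] ..
  then have B: "(\<integral>z. \<bar>z\<bar> \<partial>K r) \<le> B" if "0 \<le> r" "r \<le> t" for r using that by simp
  have "1/2 \<le> measure (K r) {z. \<bar>z\<bar> \<le> 2 * \<bar>B\<bar> + 1}" if r: "0 \<le> r" "r \<le> t" for r
  proof -
    interpret Kr: prob_space "K r" by (rule K_prob[OF r(1)])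
    note [measurable_cong] = K_sets[OF r(1)]
    have sp: "space (K r) = UNIV" using sets_eq_imp_space_eq[OF K_sets[OF r(1)]] by simp
    let ?c = "2 * \<bar>B\<bar> + 1"
    have "measure (K r) {z\<in>space (K r). ?c \<le> \<bar>z\<bar>} \<le> (\<integral>z. \<bar>z\<bar> \<partial>K r) / ?c"
    proof (rule integral_Markov_inequality_measure[where A="{}"])
      show "integrable (K r) (\<lambda>z. \<bar>z\<bar>)" using K_int[OF r(1)] by (rule integrable_abs)
      show "AE z in K r. 0 \<le> \<bar>z\<bar>" by simp
    qed simp_all
    also have "\<dots> \<le> \<bar>B\<bar> / ?c" using B[OF r] by (intro divide_right_mono) auto
    also have "\<dots> \<le> 1/2" by (subst pos_divide_le_eq) auto
    finally have 1: "measure (K r) {z. ?c \<le> \<bar>z\<bar>} \<le> 1/2" using sp by simp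
    have "1 = measure (K r) (space (K r))" using Kr.prob_space by simp
    also have "\<dots> \<le> measure (K r) ({z. \<bar>z\<bar> \<le> ?c} \<union> {z. ?c \<le> \<bar>z\<bar>})"
    proof (rule Kr.finite_measure_mono)
      show "space (K r) \<subseteq> {z. \<bar>z\<bar> \<le> ?c} \<union> {z. ?c \<le> \<bar>z\<bar>}" by force
      show "{z. \<bar>z\<bar> \<le> ?c} \<union> {z. ?c \<le> \<bar>z\<bar>} \<in> sets (K r)" by measurable
    qed
    also have "\<dots> \<le> measure (K r) {z. \<bar>z\<bar> \<le> ?c} + measure (K r) {z. ?c \<le> \<bar>z\<bar>}"
      by (rule measure_Un_le) measurable
    finally show ?thesis using 1 by simp
  qed
  then show ?thesis by (rule that)
qed

text \<open>Two applications of \<open>sup_bound\<close>. The exponential with \<epsilon> = -1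
  controls exp(-\<Lambda> X) and also, through z \<le> exp z, the downward excursions of X; the
  positive part with \<epsilon> = 1 controls the upward ones.\<close>

lemma dominating:
  assumes t: "0 < t"
  obtains D where "integrable M D"
    "AE \<omega> in M. \<forall>s. 0 \<le> s \<and> s < t \<longrightarrow> exp (- \<Lambda> * X s \<omega>) \<le> D \<omega> \<and> \<bar>X s \<omega>\<bar> \<le> D \<omega>"
proof -
  obtain c where c: "\<And>r. 0 \<le> r \<Longrightarrow> r \<le> t \<Longrightarrow> 1/2 \<le> measure (K r) {z. \<bar>z\<bar> \<le> c}"
    using K_tail[of t] t by auto
  have tail: "1/2 \<le> measure (K r) {z. - c \<le> \<epsilon> * z}" if "0 \<le> r" "r \<le> t" "\<epsilon> = 1 \<or> \<epsilon> = -1" for r \<epsilon>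
  proof -
    interpret Kr: prob_space "K r" by (rule K_prob[OF that(1)])
    note [measurable_cong] = K_sets[OF that(1)]
    have "measure (K r) {z. \<bar>z\<bar> \<le> c} \<le> measure (K r) {z. - c \<le> \<epsilon> * z}"
      using that(3) by (intro Kr.finite_measure_mono) (auto simp: K_sets[OF that(1)])
    then show ?thesis using c[OF that(1,2)] by simp
  qed
  have t0: "0 \<le> t" using t by simp
  note [measurable] = X_measurable[OF t0]
  have op1: "open {x. v < exp (\<Lambda> * x)}" and op2: "open {x. v < max 0 x}" for v :: real
    by (intro open_Collect_less continuous_intros)+
  have mono1: "mono (\<lambda>x. exp (\<Lambda> * x))" and mono2: "mono (\<lambda>x::real. max 0 x)"
    using \<Lambda>_pos by (auto intro!: monoI)
  obtain D1 where D1: "D1 \<in> borel_measurable M"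
    "(\<integral>\<^sup>+\<omega>. D1 \<omega> \<partial>M) \<le> 2 * (\<integral>\<^sup>+\<omega>. ennreal (exp (\<Lambda> * (-1 * X t \<omega> + c))) \<partial>M)"
    "\<And>\<omega> s. \<omega> \<in> space M \<Longrightarrow> 0 \<le> s \<Longrightarrow> s < t \<Longrightarrow> ennreal (exp (\<Lambda> * (-1 * X s \<omega>)) - exp (\<Lambda> * 0)) \<le> D1 \<omega>"
    by (rule sup_bound[OF t mono1 _ op1 tail[of _ "-1"]]) auto
  obtain D2 where D2: "D2 \<in> borel_measurable M"
    "(\<integral>\<^sup>+\<omega>. D2 \<omega> \<partial>M) \<le> 2 * (\<integral>\<^sup>+\<omega>. ennreal (max 0 (1 * X t \<omega> + c)) \<partial>M)"
    "\<And>\<omega> s. \<omega> \<in> space M \<Longrightarrow> 0 \<le> s \<Longrightarrow> s < t \<Longrightarrow> ennreal (max 0 (1 * X s \<omega>) - max 0 0) \<le> D2 \<omega>"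
    by (rule sup_bound[OF t mono2 _ op2 tail[of _ 1]]) auto
  note [measurable] = D1(1) D2(1)
  have "integrable M (\<lambda>\<omega>. exp (\<Lambda> * c) * exp (- \<Lambda> * X t \<omega>))" using X_exp[OF t0] by simp
  also have "(\<lambda>\<omega>. exp (\<Lambda> * c) * exp (- \<Lambda> * X t \<omega>)) = (\<lambda>\<omega>. exp (\<Lambda> * (-1 * X t \<omega> + c)))"
    by (simp add: mult_exp_exp algebra_simps)
  finally have "(\<integral>\<^sup>+\<omega>. ennreal (exp (\<Lambda> * (-1 * X t \<omega> + c))) \<partial>M) < \<infinity>"
    by (subst nn_integral_eq_integral) auto
  then have "(\<integral>\<^sup>+\<omega>. D1 \<omega> \<partial>M) < \<infinity>" using D1(2) by (auto simp: ennreal_mult_less_top intro: le_less_trans)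
  moreover have "integrable M (\<lambda>\<omega>. max 0 (1 * X t \<omega> + c))" using X_int[OF t0] by simp
  then have "(\<integral>\<^sup>+\<omega>. ennreal (max 0 (1 * X t \<omega> + c)) \<partial>M) < \<infinity>"
    by (subst nn_integral_eq_integral) auto
  then have "(\<integral>\<^sup>+\<omega>. D2 \<omega> \<partial>M) < \<infinity>" using D2(2) by (auto simp: ennreal_mult_less_top intro: le_less_trans)
  ultimately have fin: "(\<integral>\<^sup>+\<omega>. D1 \<omega> + D2 \<omega> \<partial>M) < \<infinity>" by (subst nn_integral_add) auto
  then have AE_fin: "AE \<omega> in M. D1 \<omega> + D2 \<omega> \<noteq> \<infinity>" by (intro nn_integral_noteq_infinite) auto
  define E where "E \<omega> = enn2real (D1 \<omega> + D2 \<omega>)" for \<omega>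
  have E: "integrable M E"
  proof (rule integrableI_nonneg)
    have "(\<integral>\<^sup>+\<omega>. ennreal (E \<omega>) \<partial>M) \<le> (\<integral>\<^sup>+\<omega>. D1 \<omega> + D2 \<omega> \<partial>M)"
      unfolding E_def by (intro nn_integral_mono) (simp add: ennreal_enn2real_if)
    then show "(\<integral>\<^sup>+\<omega>. ennreal (E \<omega>) \<partial>M) < \<infinity>" using fin by (rule le_less_trans)
    show "E \<in> borel_measurable M" unfolding E_def by measurable
  qed (auto simp: E_def)
  show ?thesis
  proof (rule that[of "\<lambda>\<omega>. 1 + E \<omega> + (1 + E \<omega>) / \<Lambda>"])
    show "integrable M (\<lambda>\<omega>. 1 + E \<omega> + (1 + E \<omega>) / \<Lambda>)" using E by simp
    show "AE \<omega> in M. \<forall>s. 0 \<le> s \<and> s < t \<longrightarrow>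
      exp (- \<Lambda> * X s \<omega>) \<le> 1 + E \<omega> + (1 + E \<omega>) / \<Lambda> \<and> \<bar>X s \<omega>\<bar> \<le> 1 + E \<omega> + (1 + E \<omega>) / \<Lambda>"
      using AE_fin AE_space
    proof eventually_elim
      case (elim \<omega>)
      have DE: "D1 \<omega> + D2 \<omega> = ennreal (E \<omega>)" and E0: "0 \<le> E \<omega>"
        unfolding E_def using elim by (auto simp: ennreal_enn2real_if)
      have le: "D1 \<omega> \<le> ennreal (E \<omega>)" "D2 \<omega> \<le> ennreal (E \<omega>)"
        unfolding DE[symmetric] by (auto simp: add_increasing add_increasing2)
      show ?case
      proof (intro allI impI)
        fix s assume s: "0 \<le> s \<and> s < t"
        have "ennreal (exp (\<Lambda> * (-1 * X s \<omega>)) - exp (\<Lambda> * 0)) \<le> ennreal (E \<omega>)"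
          using D1(3)[of \<omega> s] elim s le(1) order_trans by blast
        then have 1: "exp (- \<Lambda> * X s \<omega>) \<le> 1 + E \<omega>" using E0 by (simp add: ennreal_le_iff)
        have "ennreal (max 0 (1 * X s \<omega>) - max 0 0) \<le> ennreal (E \<omega>)"
          using D2(3)[of \<omega> s] elim s le(2) order_trans by blast
        then have 2: "X s \<omega> \<le> E \<omega>" using E0 by (simp add: ennreal_le_iff)
        have "- \<Lambda> * X s \<omega> \<le> exp (- \<Lambda> * X s \<omega>)" using exp_ge_add_one_self[of "- \<Lambda> * X s \<omega>"] by simp
        then have "- \<Lambda> * X s \<omega> \<le> 1 + E \<omega>" using 1 by simp
        then have 3: "- X s \<omega> \<le> (1 + E \<omega>) / \<Lambda>" using \<Lambda>_pos by (simp add: pos_le_divide_eq algebra_simps)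
        have 4: "0 \<le> (1 + E \<omega>) / \<Lambda>" using E0 \<Lambda>_pos by simp
        show "exp (- \<Lambda> * X s \<omega>) \<le> 1 + E \<omega> + (1 + E \<omega>) / \<Lambda> \<and> \<bar>X s \<omega>\<bar> \<le> 1 + E \<omega> + (1 + E \<omega>) / \<Lambda>"
          using 1 2 3 4 E0 by auto
      qed
    qed
  qed
qed

lemma dominating_hk:
  assumes t: "0 < t"
  obtains D where "integrable M D"
    "AE \<omega> in M. \<forall>s. 0 \<le> s \<and> s < t \<longrightarrow> \<bar>h (y - X s \<omega>)\<bar> \<le> D \<omega> \<and> \<bar>k (y - X s \<omega>)\<bar> \<le> D \<omega>"
proof -
  obtain D where D: "integrable M D"
    "AE \<omega> in M. \<forall>s. 0 \<le> s \<and> s < t \<longrightarrow> exp (- \<Lambda> * X s \<omega>) \<le> D \<omega> \<and> \<bar>X s \<omega>\<bar> \<le> D \<omega>"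
    using dominating[OF t] .
  let ?D = "\<lambda>\<omega>. C * (1 + exp (\<Lambda> * y) * D \<omega> + (\<bar>y\<bar> + D \<omega>))"
  show ?thesis
  proof (rule that[of ?D])
    show "integrable M ?D" using D(1) by simp
    show "AE \<omega> in M. \<forall>s. 0 \<le> s \<and> s < t \<longrightarrow> \<bar>h (y - X s \<omega>)\<bar> \<le> ?D \<omega> \<and> \<bar>k (y - X s \<omega>)\<bar> \<le> ?D \<omega>"
      using D(2)
    proof eventually_elim
      case (elim \<omega>)
      show ?case
      proof (intro allI impI)
        fix s assume "0 \<le> s \<and> s < t"
        then have 1: "exp (- \<Lambda> * X s \<omega>) \<le> D \<omega>" and 2: "\<bar>X s \<omega>\<bar> \<le> D \<omega>" using elim by auto
        have "exp (\<Lambda> * (y - X s \<omega>)) = exp (\<Lambda> * y) * exp (- \<Lambda> * X s \<omega>)"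
          by (simp add: mult_exp_exp algebra_simps)
        also have "\<dots> \<le> exp (\<Lambda> * y) * D \<omega>" using 1 by simp
        finally have 3: "exp (\<Lambda> * (y - X s \<omega>)) \<le> exp (\<Lambda> * y) * D \<omega>" .
        have 4: "\<bar>y - X s \<omega>\<bar> \<le> \<bar>y\<bar> + D \<omega>" using 2 by linarith
        have 5: "0 \<le> exp (\<Lambda> * y) * D \<omega>" using 3 exp_gt_zero[of "\<Lambda> * (y - X s \<omega>)"] by linarith
        have "\<bar>h (y - X s \<omega>)\<bar> \<le> ?D \<omega>"
          by (rule order_trans[OF h_bound]) (intro mult_left_mono C_nonneg, use 3 4 in linarith)
        moreover have "\<bar>k (y - X s \<omega>)\<bar> \<le> ?D \<omega>"
          by (rule order_trans[OF k_bound]) (intro mult_left_mono C_nonneg, use 5 4 in linarith)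
        ultimately show "\<bar>h (y - X s \<omega>)\<bar> \<le> ?D \<omega> \<and> \<bar>k (y - X s \<omega>)\<bar> \<le> ?D \<omega>" by blast
      qed
    qed
  qed
qed

lemma integrable_hk:
  assumes s: "0 \<le> s"
  shows "integrable M (\<lambda>\<omega>. h (y - X s \<omega>))" "integrable M (\<lambda>\<omega>. k (y - X s \<omega>))"
proof -
  have s1: "0 < s + 1" using s by simp
  obtain D where D: "integrable M D"
    "AE \<omega> in M. \<forall>r. 0 \<le> r \<and> r < s + 1 \<longrightarrow> \<bar>h (y - X r \<omega>)\<bar> \<le> D \<omega> \<and> \<bar>k (y - X r \<omega>)\<bar> \<le> D \<omega>"
    using dominating_hk[OF s1] .
  note [measurable] = X_measurable[OF s]
  have "AE \<omega> in M. norm (h (y - X s \<omega>)) \<le> norm (D \<omega>) \<and> norm (k (y - X s \<omega>)) \<le> norm (D \<omega>)"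
    using D(2)
  proof eventually_elim
    case (elim \<omega>)
    then have "\<bar>h (y - X s \<omega>)\<bar> \<le> D \<omega> \<and> \<bar>k (y - X s \<omega>)\<bar> \<le> D \<omega>" using s by simp
    then show ?case by auto
  qed
  then have "AE \<omega> in M. norm (h (y - X s \<omega>)) \<le> norm (D \<omega>)" "AE \<omega> in M. norm (k (y - X s \<omega>)) \<le> norm (D \<omega>)"
    by auto
  then show "integrable M (\<lambda>\<omega>. h (y - X s \<omega>))" "integrable M (\<lambda>\<omega>. k (y - X s \<omega>))"
    by (auto intro!: Bochner_Integration.integrable_bound[OF D(1)])
qed

lemma integral_indicator_increment:
  fixes g :: "real \<Rightarrow> real"
  assumes s: "0 \<le> s" and r: "0 \<le> r" and A: "A \<in> sets (F s)"
    and g[measurable]: "g \<in> borel_measurable borel" and int: "integrable M (\<lambda>\<omega>. g (y - X (s + r) \<omega>))"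
  shows "(\<integral>\<omega>. indicator A \<omega> * g (y - X (s + r) \<omega>) \<partial>M) = (\<integral>\<omega>. indicator A \<omega> * (\<integral>z. g (y - X s \<omega> - z) \<partial>K r) \<partial>M)"
proof -
  note [measurable] = adapted[OF s]
  let ?g = "\<lambda>(\<omega>, z). indicator A \<omega> * g (y - X s \<omega> - z)"
  have "(\<lambda>x. indicator A (fst x) :: real) \<in> borel_measurable (F s \<Otimes>\<^sub>M borel)"
    by (rule measurable_compose[OF measurable_fst borel_measurable_indicator[OF A]])
  moreover have "(\<lambda>x. g (y - X s (fst x) - snd x)) \<in> borel_measurable (F s \<Otimes>\<^sub>M borel)"
    by (rule measurable_compose[OF _ g]) measurable
  ultimately have m: "?g \<in> borel_measurable (F s \<Otimes>\<^sub>M borel)"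
    unfolding case_prod_beta by (rule borel_measurable_times)
  have eq: "y - X s \<omega> - (X (s + r) \<omega> - X s \<omega>) = y - X (s + r) \<omega>" for \<omega> by simp
  have "integrable M (\<lambda>\<omega>. indicator A \<omega> *\<^sub>R g (y - X (s + r) \<omega>))"
    by (rule integrable_mult_indicator[OF sets_F[OF s A] int])
  then have i: "integrable M (\<lambda>\<omega>. ?g (\<omega>, X (s + r) \<omega> - X s \<omega>))" by (simp add: eq)
  show ?thesis using integral_increment(1)[OF s r m i] by (simp add: eq)
qed

text \<open>The kernel identity is carried to the time span after s, on an event A known at time s.
  The work lies in Fubini's theorem: the integral of k against K r must be jointly measurable in r
  and in the position.\<close>

lemma h_increment:
  assumes s: "0 \<le> s" and d: "0 \<le> \<delta>" and A: "A \<in> sets (F s)"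
  shows "(\<integral>\<omega>. indicator A \<omega> * (exp (- q * (s + \<delta>)) * h (y - X (s + \<delta>) \<omega>)) \<partial>M) =
    (\<integral>\<omega>. indicator A \<omega> * (exp (- q * s) * h (y - X s \<omega>)) \<partial>M)
    - q * (\<integral>r. indicator {0..<\<delta>} r * (exp (- q * (s + r)) * (\<integral>\<omega>. indicator A \<omega> * k (y - X (s + r) \<omega>) \<partial>M)) \<partial>lborel)"
proof -
  \<comment> \<open>\<open>max 0 r\<close> extends the time parameter to the whole line, as in
    \<open>X_jointly_measurable\<close>.\<close>
  define I where "I r v = (\<integral>\<omega>. k (v - X (max 0 r) \<omega>) \<partial>M)" for r v
  have I_eq: "(\<integral>z. k (v - z) \<partial>K r) = I r v" if "0 \<le> r" for r v
    unfolding I_def using that by (subst integral_K) auto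
  have [measurable]: "(\<lambda>(r, \<omega>). X (max 0 r) \<omega>) \<in> borel_measurable (borel \<Otimes>\<^sub>M M)"
    by (rule X_jointly_measurable)
  have "(\<lambda>(p, \<omega>). k (snd p - X (max 0 (fst p)) \<omega>)) \<in> borel_measurable ((borel \<Otimes>\<^sub>M borel) \<Otimes>\<^sub>M M)"
    by measurable
  then have "(\<lambda>p. \<integral>\<omega>. k (snd p - X (max 0 (fst p)) \<omega>) \<partial>M) \<in> borel_measurable (borel \<Otimes>\<^sub>M borel)"
    by (rule borel_measurable_lebesgue_integral)
  then have Im: "(\<lambda>p. I (fst p) (snd p)) \<in> borel_measurable (borel \<Otimes>\<^sub>M borel)" unfolding I_def .
  note [measurable] = X_measurable[OF s] sets_F[OF s A]
  define \<Phi> where "\<Phi> \<omega> r = indicator A \<omega> * (indicator {0..<\<delta>} r * (exp (- q * r) * I r (y - X s \<omega>)))" for \<omega> r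
  have "(\<lambda>z. I (snd z) (y - X s (fst z))) \<in> borel_measurable (M \<Otimes>\<^sub>M lborel)"
    using measurable_compose[OF _ Im, of "\<lambda>z. (snd z, y - X s (fst z))" "M \<Otimes>\<^sub>M lborel"] by simp
  note [measurable] = this
  have \<Phi>m[measurable]: "(\<lambda>(\<omega>, r). \<Phi> \<omega> r) \<in> borel_measurable (M \<Otimes>\<^sub>M lborel)"
    unfolding \<Phi>_def case_prod_beta by measurable
  obtain B where "\<forall>r. 0 \<le> r \<and> r \<le> \<delta> \<longrightarrow> (\<integral>z. \<bar>z\<bar> \<partial>K r) \<le> B" using K_abs_bound[OF d] ..
  then have B: "(\<integral>z. \<bar>z\<bar> \<partial>K r) \<le> B" if "0 \<le> r" "r \<le> \<delta>" for r using that by simp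
  define c where "c \<omega> = C * (1 + (\<bar>y\<bar> + \<bar>X s \<omega>\<bar>) + B)" for \<omega>
  have I_bound: "\<bar>I r (y - X s \<omega>)\<bar> \<le> c \<omega>" if r: "0 \<le> r" "r \<le> \<delta>" for r \<omega>
  proof -
    interpret Kr: prob_space "K r" by (rule K_prob[OF r(1)])
    have i: "integrable (K r) (\<lambda>z. \<bar>z\<bar>)" using K_int[OF r(1)] by simp
    have "\<bar>I r (y - X s \<omega>)\<bar> \<le> (\<integral>z. C * (1 + (\<bar>y\<bar> + \<bar>X s \<omega>\<bar>) + \<bar>z\<bar>) \<partial>K r)"
      unfolding I_eq[OF r(1), symmetric]
    proof (rule integral_abs_bound[THEN order_trans], rule integral_mono')
      show "integrable (K r) (\<lambda>z. C * (1 + (\<bar>y\<bar> + \<bar>X s \<omega>\<bar>) + \<bar>z\<bar>))" using i by simp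
      fix z
      show "\<bar>k (y - X s \<omega> - z)\<bar> \<le> C * (1 + (\<bar>y\<bar> + \<bar>X s \<omega>\<bar>) + \<bar>z\<bar>)"
        by (rule order_trans[OF k_bound]) (intro mult_left_mono C_nonneg, linarith)
    qed (intro mult_nonneg_nonneg C_nonneg, simp)
    also have "\<dots> = C * (1 + (\<bar>y\<bar> + \<bar>X s \<omega>\<bar>) + (\<integral>z. \<bar>z\<bar> \<partial>K r))"
      using i by (simp add: Kr.prob_space)
    also have "\<dots> \<le> c \<omega>" unfolding c_def using B[OF r] by (intro mult_left_mono C_nonneg) auto
    finally show ?thesis .
  qed
  have c0: "0 \<le> c \<omega>" for \<omega> using I_bound[of 0 \<omega>] d by linarith
  have \<Phi>_bound: "\<bar>\<Phi> \<omega> r\<bar> \<le> c \<omega> * indicator {0..<\<delta>} r" for \<omega> r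
  proof (cases "r \<in> {0..<\<delta>} \<and> \<omega> \<in> A")
    case True
    then have "\<bar>\<Phi> \<omega> r\<bar> = exp (- q * r) * \<bar>I r (y - X s \<omega>)\<bar>" unfolding \<Phi>_def by (simp add: abs_mult)
    also have "\<dots> \<le> 1 * c \<omega>" using True q_pos I_bound[of r \<omega>] by (intro mult_mono) auto
    finally show ?thesis using True by simp
  qed (auto simp: \<Phi>_def c0 split: split_indicator)
  have ind_int: "integrable lborel (\<lambda>r. c \<omega> * indicator {0..<\<delta>} r :: real)" for \<omega>
    using d by (intro integrable_mult_right integrable_real_indicator) auto
  have \<Phi>_int: "integrable lborel (\<Phi> \<omega>)" if "\<omega> \<in> space M" for \<omega>
  proof (rule Bochner_Integration.integrable_bound[OF ind_int[of \<omega>]])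
    show "\<Phi> \<omega> \<in> borel_measurable lborel" using measurable_Pair2[OF \<Phi>m that] by simp
    show "AE r in lborel. norm (\<Phi> \<omega> r) \<le> norm (c \<omega> * indicator {0..<\<delta>} r)"
      using \<Phi>_bound c0 by (auto intro!: AE_I2 simp: abs_mult)
  qed
  interpret P: pair_sigma_finite M lborel ..
  have c_int: "integrable M c" unfolding c_def using X_int[OF s] by simp
  have \<Phi>_integrable: "integrable (M \<Otimes>\<^sub>M lborel) (\<lambda>(\<omega>, r). \<Phi> \<omega> r)"
  proof (rule P.Fubini_integrable[OF \<Phi>m])
    show "integrable M (\<lambda>\<omega>. \<integral>r. norm (case (\<omega>, r) of (\<omega>, r) \<Rightarrow> \<Phi> \<omega> r) \<partial>lborel)"
    proof (rule Bochner_Integration.integrable_bound)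
      show "integrable M (\<lambda>\<omega>. c \<omega> * \<delta>)" using c_int by simp
      show "(\<lambda>\<omega>. \<integral>r. norm (case (\<omega>, r) of (\<omega>, r) \<Rightarrow> \<Phi> \<omega> r) \<partial>lborel) \<in> borel_measurable M"
        by (intro lborel.borel_measurable_lebesgue_integral) (use \<Phi>m in measurable)
      show "AE \<omega> in M. norm (\<integral>r. norm (case (\<omega>, r) of (\<omega>, r) \<Rightarrow> \<Phi> \<omega> r) \<partial>lborel) \<le> norm (c \<omega> * \<delta>)"
      proof (rule AE_I2)
        fix \<omega> assume \<omega>: "\<omega> \<in> space M"
        have "(\<integral>r. \<bar>\<Phi> \<omega> r\<bar> \<partial>lborel) \<le> (\<integral>r. c \<omega> * indicator {0..<\<delta>} r \<partial>lborel)"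
          by (rule integral_mono[OF _ ind_int \<Phi>_bound]) (use \<Phi>_int[OF \<omega>] in simp)
        also have "\<dots> = c \<omega> * \<delta>" using d by simp
        finally show "norm (\<integral>r. norm (case (\<omega>, r) of (\<omega>, r) \<Rightarrow> \<Phi> \<omega> r) \<partial>lborel) \<le> norm (c \<omega> * \<delta>)"
          by simp
      qed
    qed
    show "AE \<omega> in M. integrable lborel (\<lambda>r. case (\<omega>, r) of (\<omega>, r) \<Rightarrow> \<Phi> \<omega> r)"
      using \<Phi>_int by (auto intro!: AE_I2)
  qed
  have hI: "integrable M (\<lambda>\<omega>. indicator A \<omega> * h (y - X s \<omega>))"
    using integrable_mult_indicator[OF sets_F[OF s A] integrable_hk(1)[OF s, of y]] by simp
  have \<Phi>I: "integrable M (\<lambda>\<omega>. \<integral>r. \<Phi> \<omega> r \<partial>lborel)"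
    using P.integrable_fst[OF \<Phi>_integrable] by simp
  have "(\<integral>\<omega>. indicator A \<omega> * (exp (- q * (s + \<delta>)) * h (y - X (s + \<delta>) \<omega>)) \<partial>M)
    = exp (- q * s) * (exp (- q * \<delta>) * (\<integral>\<omega>. indicator A \<omega> * h (y - X (s + \<delta>) \<omega>) \<partial>M))"
    unfolding integral_pull_const by (simp add: mult.assoc[symmetric] mult_exp_exp distrib_left)
  also have "(\<integral>\<omega>. indicator A \<omega> * h (y - X (s + \<delta>) \<omega>) \<partial>M)
    = (\<integral>\<omega>. indicator A \<omega> * (\<integral>z. h (y - X s \<omega> - z) \<partial>K \<delta>) \<partial>M)"
    by (rule integral_indicator_increment[OF s d A]) (use integrable_hk s d in auto)
  also have "exp (- q * \<delta>) * \<dots> = (\<integral>\<omega>. indicator A \<omega> * (exp (- q * \<delta>) * (\<integral>z. h (y - X s \<omega> - z) \<partial>K \<delta>)) \<partial>M)"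
    by (rule integral_pull_const[symmetric])
  also have "\<dots> = (\<integral>\<omega>. indicator A \<omega> * h (y - X s \<omega>) - q * (\<integral>r. \<Phi> \<omega> r \<partial>lborel) \<partial>M)"
  proof (rule Bochner_Integration.integral_cong[OF refl])
    fix \<omega>
    have "(\<integral>r. indicator {0..<\<delta>} r * (exp (- q * r) * (\<integral>z. k (y - X s \<omega> - z) \<partial>K r)) \<partial>lborel)
      = (\<integral>r. indicator {0..<\<delta>} r * (exp (- q * r) * I r (y - X s \<omega>)) \<partial>lborel)"
      by (intro Bochner_Integration.integral_cong refl) (auto simp: I_eq split: split_indicator)
    then show "indicator A \<omega> * (exp (- q * \<delta>) * (\<integral>z. h (y - X s \<omega> - z) \<partial>K \<delta>))
      = indicator A \<omega> * h (y - X s \<omega>) - q * (\<integral>r. \<Phi> \<omega> r \<partial>lborel)"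
      unfolding harmonic[OF d] \<Phi>_def by (simp add: algebra_simps)
  qed
  also have "\<dots> = (\<integral>\<omega>. indicator A \<omega> * h (y - X s \<omega>) \<partial>M) - q * (\<integral>\<omega>. \<integral>r. \<Phi> \<omega> r \<partial>lborel \<partial>M)"
    using hI \<Phi>I by simp
  also have "(\<integral>\<omega>. \<integral>r. \<Phi> \<omega> r \<partial>lborel \<partial>M) = (\<integral>r. \<integral>\<omega>. \<Phi> \<omega> r \<partial>M \<partial>lborel)"
    using P.Fubini_integral[OF \<Phi>_integrable] by simp
  also have "\<dots> = (\<integral>r. indicator {0..<\<delta>} r * (exp (- q * r) * (\<integral>\<omega>. indicator A \<omega> * k (y - X (s + r) \<omega>) \<partial>M)) \<partial>lborel)"
  proof (rule Bochner_Integration.integral_cong[OF refl])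
    fix r :: real
    show "(\<integral>\<omega>. \<Phi> \<omega> r \<partial>M) = indicator {0..<\<delta>} r * (exp (- q * r) * (\<integral>\<omega>. indicator A \<omega> * k (y - X (s + r) \<omega>) \<partial>M))"
    proof (cases "r \<in> {0..<\<delta>}")
      case True
      then have r: "0 \<le> r" by simp
      have "(\<integral>\<omega>. indicator A \<omega> * k (y - X (s + r) \<omega>) \<partial>M) = (\<integral>\<omega>. indicator A \<omega> * I r (y - X s \<omega>) \<partial>M)"
        unfolding I_eq[OF r, symmetric]
        by (rule integral_indicator_increment[OF s r A]) (use integrable_hk s r in auto)
      moreover have "(\<integral>\<omega>. \<Phi> \<omega> r \<partial>M) = exp (- q * r) * (\<integral>\<omega>. indicator A \<omega> * I r (y - X s \<omega>) \<partial>M)"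
        unfolding \<Phi>_def using True by (simp add: integral_pull_const)
      ultimately show ?thesis using True by simp
    qed (simp add: \<Phi>_def)
  qed
  finally have *: "(\<integral>\<omega>. indicator A \<omega> * (exp (- q * (s + \<delta>)) * h (y - X (s + \<delta>) \<omega>)) \<partial>M) =
    exp (- q * s) * ((\<integral>\<omega>. indicator A \<omega> * h (y - X s \<omega>) \<partial>M)
      - q * (\<integral>r. indicator {0..<\<delta>} r * (exp (- q * r) * (\<integral>\<omega>. indicator A \<omega> * k (y - X (s + r) \<omega>) \<partial>M)) \<partial>lborel))" .
  have 1: "exp (- q * s) * (\<integral>\<omega>. indicator A \<omega> * h (y - X s \<omega>) \<partial>M) = (\<integral>\<omega>. indicator A \<omega> * (exp (- q * s) * h (y - X s \<omega>)) \<partial>M)"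
    by (rule integral_pull_const[symmetric])
  have 2: "exp (- q * s) * (\<integral>r. indicator {0..<\<delta>} r * (exp (- q * r) * (\<integral>\<omega>. indicator A \<omega> * k (y - X (s + r) \<omega>) \<partial>M)) \<partial>lborel)
    = (\<integral>r. indicator {0..<\<delta>} r * (exp (- q * (s + r)) * (\<integral>\<omega>. indicator A \<omega> * k (y - X (s + r) \<omega>) \<partial>M)) \<partial>lborel)"
    by (subst integral_mult_right_zero[symmetric], intro Bochner_Integration.integral_cong refl)
       (simp add: exp_add exp_minus exp_diff distrib_left divide_inverse)
  show ?thesis unfolding * right_diff_distrib 1 by (simp only: mult.left_commute[of _ q] 2)
qed

end

section \<open>Stopping at the exit and at the first payment\<close>

context harmonic_process begin

text \<open>The exit is rounded up to a grid of mesh d, and the stopped value telescopes over the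
  events A j. Each step costs an integral of k over one cell. If the exit comes after that cell, the
  surplus stays below a there and k vanishes; so only the cell B j containing the exit contributes.
  These events are disjoint in j, whence a total error of at most q d times the mean of D, which
  tends to 0 with d.\<close>

lemma optional_stopping:
  assumes N: "0 < N" and x: "0 \<le> x"
  shows "(\<integral>\<omega>. exp (- q * exit_time a (real N) (\<lambda>t. x + X t \<omega>)) *
      h (a - (x + X (exit_time a (real N) (\<lambda>t. x + X t \<omega>)) \<omega>)) \<partial>M) = h (a - x)" (is ?eq)
    and "integrable M (\<lambda>\<omega>. exp (- q * exit_time a (real N) (\<lambda>t. x + X t \<omega>)) *
      h (a - (x + X (exit_time a (real N) (\<lambda>t. x + X t \<omega>)) \<omega>)))" (is ?int)
proof -
  define \<sigma> where "\<sigma> \<omega> = exit_time a (real N) (\<lambda>t. x + X t \<omega>)" for \<omega>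
  define y where "y = a - x"
  have N': "0 < real N" using N by simp
  have yX: "a - (x + X t \<omega>) = y - X t \<omega>" for t \<omega> unfolding y_def by simp
  have \<sigma>_nonneg: "0 \<le> \<sigma> \<omega>" and \<sigma>_le: "\<sigma> \<omega> \<le> real N" for \<omega>
    unfolding \<sigma>_def using exit_time_bounds[OF N'] by auto
  have [measurable]: "\<sigma> \<in> borel_measurable M" unfolding \<sigma>_def by (rule exit_time_borel[OF N'])
  define V where "V t \<omega> = exp (- q * t) * h (y - X t \<omega>)" for t \<omega>
  have Vm[measurable]: "V t \<in> borel_measurable M" if "0 \<le> t" for t
    unfolding V_def using X_measurable[OF that] by measurable
  have Vint: "integrable M (V t)" if "0 \<le> t" for t
    unfolding V_def using integrable_hk(1)[OF that] by simp
  \<comment> \<open>Rounded exit times reach up to N + 1, and the domination holds strictly before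
    its horizon.\<close>
  have T0: "0 < real N + 2" by simp
  obtain D where D: "integrable M D"
    and Db: "AE \<omega> in M. \<forall>s. 0 \<le> s \<and> s < real N + 2 \<longrightarrow> \<bar>h (y - X s \<omega>)\<bar> \<le> D \<omega> \<and> \<bar>k (y - X s \<omega>)\<bar> \<le> D \<omega>"
    using dominating_hk[OF T0] .
  have D0: "AE \<omega> in M. 0 \<le> D \<omega>"
    using Db
  proof eventually_elim
    case (elim \<omega>)
    then have "\<bar>h (y - X 0 \<omega>)\<bar> \<le> D \<omega>" by simp
    then show ?case using abs_ge_zero order_trans by blast
  qed
  have [measurable]: "D \<in> borel_measurable M" using D by simp
  have bound: "\<bar>(\<integral>\<omega>. V (next_dyadic m (\<sigma> \<omega>)) \<omega> \<partial>M) - h y\<bar> \<le> q * (1 / 2 ^ m * (\<integral>\<omega>. D \<omega> \<partial>M))" for m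
  proof -
    define d :: real where "d = 1 / 2 ^ m"
    have d: "0 < d" "0 \<le> d" "d \<le> 1" unfolding d_def by auto
    define t where "t j = real j * d" for j
    have t: "0 \<le> t j" "t (Suc j) = t j + d" for j unfolding t_def using d by (auto simp: distrib_right)
    have t_mono: "t i \<le> t j" if "i \<le> j" for i j unfolding t_def using that d by (intro mult_right_mono) auto
    \<comment> \<open>The grid runs to N + 1, so that the cell of the exit has an index below n even
      when the exit equals N.\<close>
    define n where "n = (N + 1) * 2 ^ m"
    have tn: "t n = real N + 1" unfolding t_def n_def d_def by (simp add: add_divide_distrib)
    define A where "A j = {\<omega>\<in>space M. t j \<le> \<sigma> \<omega>}" for j
    define B where "B j = {\<omega>\<in>space M. t j \<le> \<sigma> \<omega> \<and> \<sigma> \<omega> < t (Suc j)}" for j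
    have A: "A j \<in> sets (F (t j))" for j
    proof -
      have "A j = space (F (t j)) - {\<omega>\<in>space M. \<sigma> \<omega> < t j}"
        unfolding A_def using space_F[OF t(1)] by auto
      then show ?thesis using exit_time_measurable[OF t(1) N', of a x j] unfolding \<sigma>_def by auto
    qed
    have AM[measurable]: "A j \<in> sets M" for j using sets_F[OF t(1) A] .
    have BM[measurable]: "B j \<in> sets M" for j unfolding B_def by measurable
    have tele: "V (next_dyadic m (\<sigma> \<omega>)) \<omega> = V 0 \<omega> + (\<Sum>j<n. indicator (A j) \<omega> * (V (t (Suc j)) \<omega> - V (t j) \<omega>))"
      if \<omega>: "\<omega> \<in> space M" for \<omega>
    proof -
      define i where "i = nat \<lfloor>2 ^ m * \<sigma> \<omega>\<rfloor>"
      have S: "next_dyadic m (\<sigma> \<omega>) = t (Suc i)"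
        unfolding next_dyadic_def t_def i_def d_def by simp
      have i: "t i \<le> \<sigma> \<omega>" "\<sigma> \<omega> < t (Suc i)"
        using next_dyadic_eq_iff[OF \<sigma>_nonneg[of \<omega>], of m i] S unfolding t_def d_def by auto
      have "t i < t n" using i(1) \<sigma>_le[of \<omega>] tn by simp
      then have "i < n" using t_mono[of n i] by force
      \<comment> \<open>Exactly the events up to and including the cell i of the exit occur, so the
        sum telescopes to the rounded time t (Suc i).\<close>
      have ind: "indicator (A j) \<omega> = (if j < Suc i then 1 else 0 :: real)" for j
        using \<omega> i t_mono[of j i] t_mono[of "Suc i" j] unfolding A_def by (auto simp: indicator_def)
      have "(\<Sum>j<n. indicator (A j) \<omega> * (V (t (Suc j)) \<omega> - V (t j) \<omega>))
        = (\<Sum>j<n. if j < Suc i then V (t (Suc j)) \<omega> - V (t j) \<omega> else 0)"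
        by (intro sum.cong refl) (simp add: ind)
      also have "\<dots> = (\<Sum>j<Suc i. V (t (Suc j)) \<omega> - V (t j) \<omega>)"
        using \<open>i < n\<close> by (intro sum.mono_neutral_cong_right) auto
      also have "\<dots> = V (t (Suc i)) \<omega> - V (t 0) \<omega>" by (rule sum_lessThan_telescope)
      finally show ?thesis unfolding S by (simp add: t_def)
    qed
    define J where "J j = (\<integral>r. indicator {0..<d} r * (exp (- q * (t j + r)) * (\<integral>\<omega>. indicator (A j) \<omega> * k (y - X (t j + r) \<omega>) \<partial>M)) \<partial>lborel)" for j
    have iV: "integrable M (\<lambda>\<omega>. indicator (A j) \<omega> * V (t i) \<omega>)" for i j
      using integrable_mult_indicator[OF AM[of j] Vint[OF t(1)[of i]]] by simp
    have step: "(\<integral>\<omega>. indicator (A j) \<omega> * (V (t (Suc j)) \<omega> - V (t j) \<omega>) \<partial>M) = - q * J j" for j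
    proof -
      have "(\<integral>\<omega>. indicator (A j) \<omega> * (V (t (Suc j)) \<omega> - V (t j) \<omega>) \<partial>M)
        = (\<integral>\<omega>. indicator (A j) \<omega> * V (t (Suc j)) \<omega> \<partial>M) - (\<integral>\<omega>. indicator (A j) \<omega> * V (t j) \<omega> \<partial>M)"
        unfolding right_diff_distrib by (rule Bochner_Integration.integral_diff[OF iV iV])
      then show ?thesis
        using h_increment[OF t(1)[of j] d(2) A[of j], of y] unfolding V_def t(2) J_def by simp
    qed
    have J_bound: "\<bar>J j\<bar> \<le> d * (\<integral>\<omega>. indicator (B j) \<omega> * D \<omega> \<partial>M)" if j: "j < n" for j
    proof -
      have iB: "integrable M (\<lambda>\<omega>. indicator (B j) \<omega> * D \<omega>)"
        using integrable_mult_indicator[OF BM D] by simp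
      have tj: "t j < real N + 1"
        using j d(1) tn unfolding t_def by (metis mult_strict_right_mono of_nat_less_iff)
      have B0: "0 \<le> (\<integral>\<omega>. indicator (B j) \<omega> * D \<omega> \<partial>M)"
        using D0 by (intro integral_nonneg_AE) (auto elim!: eventually_mono)
      have inner: "\<bar>(\<integral>\<omega>. indicator (A j) \<omega> * k (y - X (t j + r) \<omega>) \<partial>M)\<bar> \<le> (\<integral>\<omega>. indicator (B j) \<omega> * D \<omega> \<partial>M)"
        if r: "0 \<le> r" "r < d" for r
      proof -
        have tr: "0 \<le> t j + r" using t(1)[of j] r(1) by simp
        have iA: "integrable M (\<lambda>\<omega>. indicator (A j) \<omega> * k (y - X (t j + r) \<omega>))"
          using integrable_mult_indicator[OF AM[of j] integrable_hk(2)[OF tr, of y]] by simp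
        have "AE \<omega> in M. norm (indicator (A j) \<omega> * k (y - X (t j + r) \<omega>)) \<le> indicator (B j) \<omega> * D \<omega>"
          using Db D0 AE_space
        proof eventually_elim
          case (elim \<omega>)
          show ?case
          proof (cases "\<omega> \<in> A j")
            case True
            show ?thesis
            proof (cases "\<sigma> \<omega> < t (Suc j)")
              case True
              have "\<bar>k (y - X (t j + r) \<omega>)\<bar> \<le> D \<omega>"
                using elim tr tj r d(3) by auto
              then show ?thesis using \<open>\<omega> \<in> A j\<close> True unfolding A_def B_def by simp
            next
              case False
              then have "t j + r < \<sigma> \<omega>" using r t(2)[of j] by simp
              from before_exit_time(2)[OF N' _ tr this[unfolded \<sigma>_def]] x X_0[OF \<open>\<omega> \<in> space M\<close>]
              have "x + X (t j + r) \<omega> < a" by simp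
              then have "k (y - X (t j + r) \<omega>) = 0" unfolding y_def by (intro k_zero) simp
              then show ?thesis using elim by simp
            qed
          qed (use elim in simp)
        qed
        from order_trans[OF integral_norm_bound integral_mono_AE[OF integrable_norm[OF iA] iB this]]
        show ?thesis by simp
      qed
      have "\<bar>J j\<bar> \<le> (\<integral>r. (\<integral>\<omega>. indicator (B j) \<omega> * D \<omega> \<partial>M) * indicator {0..<d} r \<partial>lborel)"
        unfolding J_def
      proof (rule integral_abs_bound[THEN order_trans], rule integral_mono')
        show "integrable lborel (\<lambda>r. (\<integral>\<omega>. indicator (B j) \<omega> * D \<omega> \<partial>M) * indicator {0..<d} r)"
          using d(2) by (intro integrable_mult_right integrable_real_indicator) auto
        fix r :: real
        show "\<bar>indicator {0..<d} r * (exp (- q * (t j + r)) * (\<integral>\<omega>. indicator (A j) \<omega> * k (y - X (t j + r) \<omega>) \<partial>M))\<bar>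
          \<le> (\<integral>\<omega>. indicator (B j) \<omega> * D \<omega> \<partial>M) * indicator {0..<d} r"
        proof (cases "r \<in> {0..<d}")
          case True
          then have r: "0 \<le> r" "r < d" by auto
          have "exp (- q * (t j + r)) \<le> 1" using q_pos t(1)[of j] r by simp
          then have "exp (- q * (t j + r)) * \<bar>(\<integral>\<omega>. indicator (A j) \<omega> * k (y - X (t j + r) \<omega>) \<partial>M)\<bar>
            \<le> 1 * (\<integral>\<omega>. indicator (B j) \<omega> * D \<omega> \<partial>M)"
            using inner[OF r] B0 by (intro mult_mono) auto
          then show ?thesis using True by (simp add: abs_mult)
        qed simp
      qed (use B0 in simp)
      also have "\<dots> = d * (\<integral>\<omega>. indicator (B j) \<omega> * D \<omega> \<partial>M)" using d(2) by simp
      finally show ?thesis .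
    qed
    have "(\<integral>\<omega>. V (next_dyadic m (\<sigma> \<omega>)) \<omega> \<partial>M)
      = (\<integral>\<omega>. V 0 \<omega> + (\<Sum>j<n. indicator (A j) \<omega> * (V (t (Suc j)) \<omega> - V (t j) \<omega>)) \<partial>M)"
      by (intro Bochner_Integration.integral_cong refl tele)
    also have "\<dots> = (\<integral>\<omega>. V 0 \<omega> \<partial>M) + (\<Sum>j<n. (\<integral>\<omega>. indicator (A j) \<omega> * (V (t (Suc j)) \<omega> - V (t j) \<omega>) \<partial>M))"
    proof -
      have i: "integrable M (\<lambda>\<omega>. indicator (A j) \<omega> * (V (t (Suc j)) \<omega> - V (t j) \<omega>))" for j
        unfolding right_diff_distrib by (intro Bochner_Integration.integrable_diff iV)
      show ?thesis
        by (subst Bochner_Integration.integral_add[OF Vint[OF order_refl] Bochner_Integration.integrable_sum[OF i]])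
           (simp only: Bochner_Integration.integral_sum[OF i])
    qed
    also have "(\<integral>\<omega>. V 0 \<omega> \<partial>M) = (\<integral>\<omega>. h y \<partial>M)"
      by (intro Bochner_Integration.integral_cong refl) (simp add: V_def X_0)
    also have "\<dots> = h y" by (simp add: prob_space)
    finally have "(\<integral>\<omega>. V (next_dyadic m (\<sigma> \<omega>)) \<omega> \<partial>M) - h y = - q * (\<Sum>j<n. J j)"
      by (simp add: step sum_distrib_left sum_negf)
    then have "\<bar>(\<integral>\<omega>. V (next_dyadic m (\<sigma> \<omega>)) \<omega> \<partial>M) - h y\<bar> = q * \<bar>\<Sum>j<n. J j\<bar>"
      using q_pos by (simp add: abs_mult)
    also have "\<dots> \<le> q * (\<Sum>j<n. d * (\<integral>\<omega>. indicator (B j) \<omega> * D \<omega> \<partial>M))"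
      using q_pos by (intro mult_left_mono order_trans[OF sum_abs] sum_mono J_bound) auto
    also have "(\<Sum>j<n. d * (\<integral>\<omega>. indicator (B j) \<omega> * D \<omega> \<partial>M)) = d * (\<integral>\<omega>. (\<Sum>j<n. indicator (B j) \<omega> * D \<omega>) \<partial>M)"
    proof -
      have iB: "integrable M (\<lambda>\<omega>. indicator (B j) \<omega> * D \<omega>)" for j
        using integrable_mult_indicator[OF BM D] by simp
      show ?thesis by (simp only: Bochner_Integration.integral_sum[OF iB] sum_distrib_left)
    qed
    finally have upper: "\<bar>(\<integral>\<omega>. V (next_dyadic m (\<sigma> \<omega>)) \<omega> \<partial>M) - h y\<bar>
      \<le> q * (d * (\<integral>\<omega>. (\<Sum>j<n. indicator (B j) \<omega> * D \<omega>) \<partial>M))" .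
    have "(\<integral>\<omega>. (\<Sum>j<n. indicator (B j) \<omega> * D \<omega>) \<partial>M) \<le> (\<integral>\<omega>. D \<omega> \<partial>M)"
    proof (rule integral_mono_AE)
      have iB: "integrable M (\<lambda>\<omega>. indicator (B j) \<omega> * D \<omega>)" for j
        using integrable_mult_indicator[OF BM D] by simp
      show "integrable M (\<lambda>\<omega>. \<Sum>j<n. indicator (B j) \<omega> * D \<omega>)" by (intro Bochner_Integration.integrable_sum iB)
      show "integrable M D" by fact
      show "AE \<omega> in M. (\<Sum>j<n. indicator (B j) \<omega> * D \<omega>) \<le> D \<omega>"
        using D0
      proof eventually_elim
        case (elim \<omega>)
        have "disjoint_family_on B {..<n}"
          unfolding disjoint_family_on_def
        proof (intro ballI impI)
          fix i j :: nat assume "i \<noteq> j"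
          then have "Suc i \<le> j \<or> Suc j \<le> i" by arith
          then show "B i \<inter> B j = {}" using t_mono[of "Suc i" j] t_mono[of "Suc j" i] unfolding B_def by auto
        qed
        then have "(\<Sum>j<n. indicator (B j) \<omega> :: real) = indicator (\<Union>j<n. B j) \<omega>"
          by (intro indicator_UN_disjoint[symmetric]) auto
        then have "(\<Sum>j<n. indicator (B j) \<omega> * D \<omega>) = indicator (\<Union>j<n. B j) \<omega> * D \<omega>"
          by (simp only: sum_distrib_right[symmetric])
        also have "\<dots> \<le> D \<omega>" using elim by (simp add: indicator_def)
        finally show ?case .
      qed
    qed
    then have "q * (d * (\<integral>\<omega>. (\<Sum>j<n. indicator (B j) \<omega> * D \<omega>) \<partial>M)) \<le> q * (d * (\<integral>\<omega>. D \<omega> \<partial>M))"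
      using q_pos d by (intro mult_left_mono) auto
    from order_trans[OF upper this] show ?thesis unfolding d_def .
  qed
  have Vn: "(\<lambda>m. \<integral>\<omega>. V (next_dyadic m (\<sigma> \<omega>)) \<omega> \<partial>M) \<longlonglongrightarrow> h y"
  proof (rule LIM_zero_cancel, rule Lim_null_comparison)
    show "eventually (\<lambda>m. norm ((\<integral>\<omega>. V (next_dyadic m (\<sigma> \<omega>)) \<omega> \<partial>M) - h y) \<le> q * (1 / 2 ^ m * (\<integral>\<omega>. D \<omega> \<partial>M))) sequentially"
      using bound by (intro always_eventually allI) simp
    show "(\<lambda>m. q * (1 / 2 ^ m * (\<integral>\<omega>. D \<omega> \<partial>M))) \<longlonglongrightarrow> 0"
      by (intro tendsto_mult_right_zero tendsto_mult_left_zero inverse_power2_tendsto)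
  qed
  have V_lim: "(\<lambda>m. V (next_dyadic m (\<sigma> \<omega>)) \<omega>) \<longlonglongrightarrow> V (\<sigma> \<omega>) \<omega>" if \<omega>: "\<omega> \<in> space M" for \<omega>
  proof -
    note fl = filterlim_next_dyadic[OF \<sigma>_nonneg[of \<omega>]]
    have 1: "(\<lambda>m. X (next_dyadic m (\<sigma> \<omega>)) \<omega>) \<longlonglongrightarrow> X (\<sigma> \<omega>) \<omega>"
      by (rule filterlim_compose[OF X_right[OF \<omega> \<sigma>_nonneg] fl])
    have 2: "(\<lambda>m. next_dyadic m (\<sigma> \<omega>)) \<longlonglongrightarrow> \<sigma> \<omega>"
      using fl unfolding filterlim_at by simp
    have "(\<lambda>m. h (y - X (next_dyadic m (\<sigma> \<omega>)) \<omega>)) \<longlonglongrightarrow> h (y - X (\<sigma> \<omega>) \<omega>)"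
      by (rule isCont_tendsto_compose) (use h_cont 1 in \<open>auto simp: continuous_on_eq_continuous_at intro!: tendsto_intros\<close>)
    then show ?thesis unfolding V_def by (intro tendsto_intros 2)
  qed
  have nm: "next_dyadic m (\<sigma> \<omega>) < real N + 2" "0 \<le> next_dyadic m (\<sigma> \<omega>)" for m \<omega>
  proof -
    have "1 / 2 ^ m \<le> (1::real)" by simp
    then show "next_dyadic m (\<sigma> \<omega>) < real N + 2"
      using next_dyadic_bounds(2)[OF \<sigma>_nonneg[of \<omega>], of m] \<sigma>_le[of \<omega>] by linarith
  qed (simp add: less_imp_le next_dyadic_pos)
  have mX: "(\<lambda>\<omega>. X (T \<omega>) \<omega>) \<in> borel_measurable M"
    if "T \<in> borel_measurable M" "\<And>\<omega>. 0 \<le> T \<omega>" for T using that by (intro X_at_random_time) auto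
  have "(\<lambda>m. \<integral>\<omega>. V (next_dyadic m (\<sigma> \<omega>)) \<omega> \<partial>M) \<longlonglongrightarrow> (\<integral>\<omega>. V (\<sigma> \<omega>) \<omega> \<partial>M)"
  proof (rule integral_dominated_convergence[where w = D])
    note [measurable] = mX[of \<sigma>, OF _ \<sigma>_nonneg]
    show "(\<lambda>\<omega>. V (\<sigma> \<omega>) \<omega>) \<in> borel_measurable M" unfolding V_def by measurable
    show "(\<lambda>\<omega>. V (next_dyadic m (\<sigma> \<omega>)) \<omega>) \<in> borel_measurable M" for m
    proof -
      note [measurable] = mX[of "\<lambda>\<omega>. next_dyadic m (\<sigma> \<omega>)", OF _ nm(2)]
      show ?thesis unfolding V_def by measurable
    qed
    show "integrable M D" by fact
    show "AE \<omega> in M. (\<lambda>m. V (next_dyadic m (\<sigma> \<omega>)) \<omega>) \<longlonglongrightarrow> V (\<sigma> \<omega>) \<omega>"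
      using V_lim by (rule AE_I2)
    fix m
    show "AE \<omega> in M. norm (V (next_dyadic m (\<sigma> \<omega>)) \<omega>) \<le> D \<omega>"
      using Db D0
    proof eventually_elim
      case (elim \<omega>)
      have 1: "\<bar>h (y - X (next_dyadic m (\<sigma> \<omega>)) \<omega>)\<bar> \<le> D \<omega>" using elim nm[of m \<omega>] by simp
      have "exp (- q * next_dyadic m (\<sigma> \<omega>)) \<le> 1" using q_pos nm(2)[of m \<omega>] by simp
      then have "exp (- q * next_dyadic m (\<sigma> \<omega>)) * \<bar>h (y - X (next_dyadic m (\<sigma> \<omega>)) \<omega>)\<bar> \<le> 1 * D \<omega>"
        using 1 elim by (intro mult_mono) auto
      then show ?case unfolding V_def by (simp add: abs_mult)
    qed
  qed
  from LIMSEQ_unique[OF this Vn] show ?eq unfolding V_def \<sigma>_def yX y_def .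
  have "integrable M (\<lambda>\<omega>. V (\<sigma> \<omega>) \<omega>)"
  proof (rule Bochner_Integration.integrable_bound[OF D])
    note [measurable] = mX[of \<sigma>, OF _ \<sigma>_nonneg]
    show "(\<lambda>\<omega>. V (\<sigma> \<omega>) \<omega>) \<in> borel_measurable M" unfolding V_def by measurable
    show "AE \<omega> in M. norm (V (\<sigma> \<omega>) \<omega>) \<le> norm (D \<omega>)"
      using Db D0
    proof eventually_elim
      case (elim \<omega>)
      have 1: "\<bar>h (y - X (\<sigma> \<omega>) \<omega>)\<bar> \<le> D \<omega>" using elim(1) \<sigma>_nonneg[of \<omega>] \<sigma>_le[of \<omega>] by simp
      have "exp (- q * \<sigma> \<omega>) \<le> 1" using q_pos \<sigma>_nonneg[of \<omega>] by simp
      then have "exp (- q * \<sigma> \<omega>) * \<bar>h (y - X (\<sigma> \<omega>) \<omega>)\<bar> \<le> 1 * D \<omega>"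
        using 1 elim by (intro mult_mono) auto
      then show ?case unfolding V_def using elim by (simp add: abs_mult)
    qed
  qed
  then show ?int unfolding V_def \<sigma>_def yX y_def .
qed

text \<open>The identity stopped at the capped exit is split by outcome. On a payment h is h0 plus
  the overshoot; at ruin it is h a = 0; on survival up to N it is bounded and carries the factor
  exp(-q N). Integrability of the overshoot in the limit is not known in advance, so that part is
  treated by monotone convergence and the h0 part by dominated convergence.\<close>

theorem first_payment:
  assumes x: "0 \<le> x" and ha: "h a = 0" and a: "0 < a" and h_neg: "\<And>y. y \<le> 0 \<Longrightarrow> h y = h0 - y"
  defines "V \<equiv> \<lambda>\<omega>. if first_paid a (\<lambda>t. x + X t \<omega>)
    then exp (- q * hit_time a (\<lambda>t. x + X t \<omega>)) * h (a - (x + X (hit_time a (\<lambda>t. x + X t \<omega>)) \<omega>)) else 0"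
  shows "integrable M V" "(\<integral>\<omega>. V \<omega> \<partial>M) = h (a - x)"
proof -
  define f where "f \<omega> t = x + X t \<omega>" for \<omega> t
  define T where "T \<omega> = hit_time a (f \<omega>)" for \<omega>
  define P where "P \<omega> \<longleftrightarrow> first_paid a (f \<omega>)" for \<omega>
  have T0: "0 \<le> T \<omega>" for \<omega> unfolding T_def by (rule hit_time_nonneg)
  have V_eq: "V = (\<lambda>\<omega>. if P \<omega> then exp (- q * T \<omega>) * h (a - f \<omega> (T \<omega>)) else 0)"
    unfolding V_def P_def T_def f_def by simp
  have good_f: "good_path (f \<omega>)" if "\<omega> \<in> space M" for \<omega>
    unfolding f_def using good_shifted[OF that] .
  have f0: "f \<omega> 0 = x" if "\<omega> \<in> space M" for \<omega> unfolding f_def using X_0[OF that] by simp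
  have [measurable]: "T \<in> borel_measurable M" unfolding T_def f_def by (rule hit_time_measurable)
  have [measurable]: "Measurable.pred M P"
    unfolding P_def f_def pred_def by (rule first_paid_measurable)
  have [measurable]: "(\<lambda>\<omega>. f \<omega> (T \<omega>)) \<in> borel_measurable M"
    unfolding f_def using X_at_random_time[of T] T0 by simp
  have fT: "a \<le> f \<omega> (T \<omega>)" if "\<omega> \<in> space M" "P \<omega>" for \<omega>
    using at_hit_time[OF good_f[OF that(1)]] that(2) unfolding P_def T_def first_paid_def by blast
  have "integrable M V \<and> (\<integral>\<omega>. V \<omega> \<partial>M) = h (a - x)"
  proof (cases "a \<le> x")
    case True
    have "V \<omega> = h (a - x)" if \<omega>: "\<omega> \<in> space M" for \<omega>
    proof -
      have h0: "a \<le> f \<omega> 0" using True f0[OF \<omega>] by simp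
      have "T \<omega> \<le> 0" unfolding T_def by (rule hit_time_le[where f="f \<omega>", OF order_refl h0])
      then have "T \<omega> = 0" using T0[of \<omega>] by simp
      moreover have "P \<omega>"
        using h0 \<open>T \<omega> = 0\<close> unfolding P_def first_paid_def hits_def T_def by auto
      ultimately show ?thesis unfolding V_eq using f0[OF \<omega>] by simp
    qed
    then have "integrable M V \<longleftrightarrow> integrable M (\<lambda>_. h (a - x))" "(\<integral>\<omega>. V \<omega> \<partial>M) = (\<integral>\<omega>. h (a - x) \<partial>M)"
      by (intro Bochner_Integration.integrable_cong Bochner_Integration.integral_cong refl, simp)+
    then show ?thesis by (simp add: prob_space)
  next
    case False
    \<comment> \<open>Inside the strip the surplus lies in [0, a], and so does the argument a minus
      surplus of h.\<close>
    have "compact (h ` {0..a})"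
      by (intro compact_continuous_image continuous_on_subset[OF h_cont]) auto
    then have "bounded (h ` {0..a})" by (rule compact_imp_bounded)
    then obtain H where "\<forall>z\<in>h ` {0..a}. norm z \<le> H"
      unfolding bounded_iff ..
    then have H: "\<bar>h y\<bar> \<le> H" if "y \<in> {0..a}" for y using that by simp
    have H0: "0 \<le> H" using H[of a] ha a by simp
    define p where "p N \<omega> = (if P \<omega> \<and> T \<omega> \<le> real N then exp (- q * T \<omega>) * (f \<omega> (T \<omega>) - a) else 0)" for N \<omega>
    define u where "u N \<omega> = (if P \<omega> \<and> T \<omega> \<le> real N then exp (- q * T \<omega>) else 0)" for N \<omega>
    define e where "e \<omega> = (if P \<omega> then exp (- q * T \<omega>) else 0)" for \<omega>
    define E where "E N \<omega> = exp (- q * exit_time a (real N) (f \<omega>)) * h (a - f \<omega> (exit_time a (real N) (f \<omega>)))" for N \<omega>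
    have pm[measurable]: "p N \<in> borel_measurable M" "u N \<in> borel_measurable M" "e \<in> borel_measurable M" for N
      unfolding p_def u_def e_def by measurable
    have u_bound: "\<bar>u N \<omega>\<bar> \<le> 1" and e_bound: "\<bar>e \<omega>\<bar> \<le> 1" for N \<omega>
      unfolding u_def e_def using q_pos T0[of \<omega>] by auto
    have ui: "integrable M (u N)" and ei: "integrable M e" for N
      using u_bound e_bound by (auto intro!: integrable_const_bound[where B=1])
    have p_nonneg: "0 \<le> p N \<omega>" if "\<omega> \<in> space M" for N \<omega>
      unfolding p_def using fT[OF that] by auto
    have E_diff: "\<bar>E N \<omega> - (p N \<omega> + h0 * u N \<omega>)\<bar> \<le> H * exp (- q * real N)" if N: "0 < N" and \<omega>: "\<omega> \<in> space M" for N \<omega>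
    proof (cases "P \<omega> \<and> T \<omega> \<le> real N")
      case True
      have 1: "exit_time a (real N) (f \<omega>) = T \<omega>"
        unfolding T_def using True N x f0[OF \<omega>]
        by (intro exit_time_first_paid good_f[OF \<omega>]) (auto simp: P_def T_def)
      have 2: "h (a - f \<omega> (T \<omega>)) = h0 - (a - f \<omega> (T \<omega>))"
        using fT[OF \<omega>] True by (intro h_neg) simp
      have "E N \<omega> = p N \<omega> + h0 * u N \<omega>"
        unfolding E_def p_def u_def 1 2 using True by (simp add: algebra_simps)
      then show ?thesis using H0 by simp
    next
      case False
      then have pu: "p N \<omega> = 0" "u N \<omega> = 0" unfolding p_def u_def by auto
      have "f \<omega> (exit_time a (real N) (f \<omega>)) = 0 \<or> exit_time a (real N) (f \<omega>) = real N \<and> 0 \<le> f \<omega> (real N) \<and> f \<omega> (real N) < a"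
        using False N x f0[OF \<omega>] unfolding P_def T_def
        by (intro exit_time_not_paid good_f[OF \<omega>]) auto
      then show ?thesis
      proof
        assume "f \<omega> (exit_time a (real N) (f \<omega>)) = 0"
        then show ?thesis unfolding E_def pu using ha H0 by simp
      next
        assume *: "exit_time a (real N) (f \<omega>) = real N \<and> 0 \<le> f \<omega> (real N) \<and> f \<omega> (real N) < a"
        then have "\<bar>h (a - f \<omega> (real N))\<bar> \<le> H" by (intro H) auto
        then have "exp (- q * real N) * \<bar>h (a - f \<omega> (real N))\<bar> \<le> exp (- q * real N) * H"
          by (intro mult_left_mono) auto
        then show ?thesis unfolding E_def pu using * by (simp add: abs_mult mult.commute)
      qed
    qed
    have E_int: "(\<integral>\<omega>. E N \<omega> \<partial>M) = h (a - x)" if "0 < N" for N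
      unfolding E_def f_def by (rule optional_stopping[OF that x])
    have E_integrable: "integrable M (E N)" if "0 < N" for N
      unfolding E_def f_def by (rule optional_stopping(2)[OF that x])
    have p_integrable: "integrable M (p N)" if N: "0 < N" for N
    proof -
      have "integrable M (\<lambda>\<omega>. E N \<omega> - (p N \<omega> + h0 * u N \<omega>))"
      proof (rule integrable_const_bound[where B="H * exp (- q * real N)"])
        show "AE \<omega> in M. norm (E N \<omega> - (p N \<omega> + h0 * u N \<omega>)) \<le> H * exp (- q * real N)"
          using E_diff[OF N] by (intro AE_I2) simp
        show "(\<lambda>\<omega>. E N \<omega> - (p N \<omega> + h0 * u N \<omega>)) \<in> borel_measurable M"
          using E_integrable[OF N] by measurable
      qed
      then have "integrable M (\<lambda>\<omega>. E N \<omega> - (E N \<omega> - (p N \<omega> + h0 * u N \<omega>)) - h0 * u N \<omega>)"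
        by (rule Bochner_Integration.integrable_diff[OF Bochner_Integration.integrable_diff[OF E_integrable[OF N]] integrable_mult_right[OF ui]])
      then show ?thesis by simp
    qed
    have u_lim: "(\<lambda>N. \<integral>\<omega>. u (Suc N) \<omega> \<partial>M) \<longlonglongrightarrow> (\<integral>\<omega>. e \<omega> \<partial>M)"
    proof (rule integral_dominated_convergence[where w="\<lambda>_. 1"])
      show "AE \<omega> in M. (\<lambda>N. u (Suc N) \<omega>) \<longlonglongrightarrow> e \<omega>"
      proof (rule AE_I2, rule tendsto_eventually)
        fix \<omega>
        show "eventually (\<lambda>N. u (Suc N) \<omega> = e \<omega>) sequentially"
          using eventually_ge_at_top[of "nat \<lceil>T \<omega>\<rceil>"]
          by eventually_elim (auto simp: u_def e_def)
      qed
    qed (use u_bound in auto)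
    have pu_int: "(\<integral>\<omega>. E N \<omega> - (p N \<omega> + h0 * u N \<omega>) \<partial>M) = h (a - x) - (\<integral>\<omega>. p N \<omega> \<partial>M) - h0 * (\<integral>\<omega>. u N \<omega> \<partial>M)" if "0 < N" for N
      using E_integrable[OF that] p_integrable[OF that] ui E_int[OF that] by simp
    have p_lim: "(\<lambda>N. \<integral>\<omega>. p (Suc N) \<omega> \<partial>M) \<longlonglongrightarrow> h (a - x) - h0 * (\<integral>\<omega>. e \<omega> \<partial>M)"
    proof -
      have "(\<lambda>N. \<integral>\<omega>. E (Suc N) \<omega> - (p (Suc N) \<omega> + h0 * u (Suc N) \<omega>) \<partial>M) \<longlonglongrightarrow> 0"
      proof (rule Lim_null_comparison)
        show "eventually (\<lambda>N. norm (\<integral>\<omega>. E (Suc N) \<omega> - (p (Suc N) \<omega> + h0 * u (Suc N) \<omega>) \<partial>M) \<le> H * exp (- q * real (Suc N))) sequentially"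
        proof (intro always_eventually allI)
          fix N
          have i: "integrable M (\<lambda>\<omega>. E (Suc N) \<omega> - (p (Suc N) \<omega> + h0 * u (Suc N) \<omega>))"
            using E_integrable[of "Suc N"] p_integrable[of "Suc N"] ui by simp
          have "norm (\<integral>\<omega>. E (Suc N) \<omega> - (p (Suc N) \<omega> + h0 * u (Suc N) \<omega>) \<partial>M) \<le> (\<integral>\<omega>. norm (E (Suc N) \<omega> - (p (Suc N) \<omega> + h0 * u (Suc N) \<omega>)) \<partial>M)"
            by (rule integral_norm_bound)
          also have "\<dots> \<le> (\<integral>\<omega>. H * exp (- q * real (Suc N)) \<partial>M)"
            by (rule integral_mono[OF integrable_norm[OF i]]) (use E_diff[of "Suc N"] in auto)
          finally show "norm (\<integral>\<omega>. E (Suc N) \<omega> - (p (Suc N) \<omega> + h0 * u (Suc N) \<omega>) \<partial>M) \<le> H * exp (- q * real (Suc N))"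
            by (simp add: prob_space)
        qed
        have "(\<lambda>N. exp (- q) ^ Suc N) \<longlonglongrightarrow> 0"
          using q_pos by (intro LIMSEQ_Suc LIMSEQ_realpow_zero) auto
        then have "(\<lambda>N. H * exp (- q) ^ Suc N) \<longlonglongrightarrow> 0" by (rule tendsto_mult_right_zero)
        then show "(\<lambda>N. H * exp (- q * real (Suc N))) \<longlonglongrightarrow> 0"
          by (simp only: exp_of_nat2_mult)
      qed
      from tendsto_diff[OF tendsto_diff[OF tendsto_const this] tendsto_mult_left[OF u_lim]]
      have "(\<lambda>N. h (a - x) - (\<integral>\<omega>. E (Suc N) \<omega> - (p (Suc N) \<omega> + h0 * u (Suc N) \<omega>) \<partial>M) - h0 * (\<integral>\<omega>. u (Suc N) \<omega> \<partial>M))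
        \<longlonglongrightarrow> h (a - x) - 0 - h0 * (\<integral>\<omega>. e \<omega> \<partial>M)" .
      then show ?thesis by (simp add: pu_int)
    qed
    define p_inf where "p_inf \<omega> = (if P \<omega> then exp (- q * T \<omega>) * (f \<omega> (T \<omega>) - a) else 0)" for \<omega>
    have p_infm: "p_inf \<in> borel_measurable M" unfolding p_inf_def by measurable
    have mono_p: "AE \<omega> in M. mono (\<lambda>N. p (Suc N) \<omega>)"
    proof (rule AE_I2, rule monoI)
      fix \<omega> and N N' :: nat assume \<omega>: "\<omega> \<in> space M" and "N \<le> N'"
      then show "p (Suc N) \<omega> \<le> p (Suc N') \<omega>"
        using p_nonneg[OF \<omega>, of "Suc N'"] by (cases "P \<omega> \<and> T \<omega> \<le> real (Suc N)") (auto simp: p_def)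
    qed
    have lim_p: "AE \<omega> in M. (\<lambda>N. p (Suc N) \<omega>) \<longlonglongrightarrow> p_inf \<omega>"
    proof (rule AE_I2, rule tendsto_eventually)
      fix \<omega>
      show "eventually (\<lambda>N. p (Suc N) \<omega> = p_inf \<omega>) sequentially"
        using eventually_ge_at_top[of "nat \<lceil>T \<omega>\<rceil>"]
        by eventually_elim (auto simp: p_def p_inf_def)
    qed
    have pi: "integrable M (p (Suc N))" for N by (rule p_integrable) simp
    have 1: "integrable M p_inf" by (rule integrable_monotone_convergence[OF pi mono_p lim_p p_lim p_infm])
    have 2: "(\<integral>\<omega>. p_inf \<omega> \<partial>M) = h (a - x) - h0 * (\<integral>\<omega>. e \<omega> \<partial>M)"
      by (rule integral_monotone_convergence[OF pi mono_p lim_p p_lim p_infm])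
    have V_split: "V \<omega> = p_inf \<omega> + h0 * e \<omega>" if \<omega>: "\<omega> \<in> space M" for \<omega>
    proof (cases "P \<omega>")
      case True
      have 2: "h (a - f \<omega> (T \<omega>)) = h0 - (a - f \<omega> (T \<omega>))"
        using fT[OF \<omega> True] by (intro h_neg) simp
      show ?thesis unfolding V_eq p_inf_def e_def 2 using True by (simp add: algebra_simps)
    qed (simp add: V_eq p_inf_def e_def)
    have "integrable M V \<longleftrightarrow> integrable M (\<lambda>\<omega>. p_inf \<omega> + h0 * e \<omega>)" "(\<integral>\<omega>. V \<omega> \<partial>M) = (\<integral>\<omega>. p_inf \<omega> + h0 * e \<omega> \<partial>M)"
      by (intro Bochner_Integration.integrable_cong Bochner_Integration.integral_cong refl V_split, assumption)+
    then show ?thesis using 1 2 ei by simp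
  qed
  then show "integrable M V" "(\<integral>\<omega>. V \<omega> \<partial>M) = h (a - x)" by auto
qed

text \<open>Climbing from x to a within time \<delta> has probability at most 1/4; off that event
  the discount is at most exp(-q \<delta>). With d = a - x, Ottaviani's inequality for the indicator
  of (d/2, \<infinity>) with slack d/4 leads to the event that X at time \<delta> exceeds d/4. Its
  probability is at most 1/8, and the factor 2 makes it 1/4.\<close>

lemma first_payment_discount:
  assumes \<delta>: "0 < \<delta>" and small: "\<And>r. 0 \<le> r \<Longrightarrow> r \<le> \<delta> \<Longrightarrow> measure (K r) {z. (a - x) / 4 < \<bar>z\<bar>} \<le> 1/8" and xa: "x < a"
  shows "(\<integral>\<omega>. (if first_paid a (\<lambda>t. x + X t \<omega>) then exp (- q * hit_time a (\<lambda>t. x + X t \<omega>)) else 0) \<partial>M)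
    \<le> exp (- q * \<delta>) + (1 - exp (- q * \<delta>)) / 4"
proof -
  define d where "d = a - x"
  have d: "0 < d" unfolding d_def using xa by simp
  define f where "f \<omega> t = x + X t \<omega>" for \<omega> t
  define B where "B = {\<omega>\<in>space M. \<exists>s. 0 \<le> s \<and> s < \<delta> \<and> a \<le> x + X s \<omega>}"
  have \<delta>0: "0 \<le> \<delta>" using \<delta> by simp
  have B[measurable]: "B \<in> sets M" unfolding B_def using hit_before_measurable[OF \<delta>0] sets_F[OF \<delta>0] by blast
  let ?\<phi> = "\<lambda>z. indicator {d/2<..} z :: real"
  have mono: "mono ?\<phi>" by (auto intro!: monoI simp: indicator_def)
  have op: "open {z. v < ?\<phi> z}" for v
  proof (cases "v < 0")
    case True then have "{z. v < ?\<phi> z} = UNIV" by (auto intro: less_le_trans[of v 0])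
    then show ?thesis by simp
  next
    case False
    then have "{z. v < ?\<phi> z} = (if v < 1 then {d/2<..} else {})" by (auto simp: indicator_def split: if_splits)
    then show ?thesis by simp
  qed
  have tail: "1/2 \<le> measure (K r) {z. - (d/4) \<le> 1 * z}" if r: "0 \<le> r" "r \<le> \<delta>" for r
  proof -
    interpret Kr: prob_space "K r" by (rule K_prob[OF r(1)])
    note [measurable_cong] = K_sets[OF r(1)]
    have "1 = measure (K r) (space (K r))" using Kr.prob_space by simp
    also have "\<dots> \<le> measure (K r) ({z. - (d/4) \<le> 1 * z} \<union> {z. d / 4 < \<bar>z\<bar>})"
    proof (rule Kr.finite_measure_mono)
      show "space (K r) \<subseteq> {z. - (d/4) \<le> 1 * z} \<union> {z. d / 4 < \<bar>z\<bar>}" by force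
      show "{z. - (d/4) \<le> 1 * z} \<union> {z. d / 4 < \<bar>z\<bar>} \<in> sets (K r)" by measurable
    qed
    also have "\<dots> \<le> measure (K r) {z. - (d/4) \<le> 1 * z} + measure (K r) {z. d / 4 < \<bar>z\<bar>}"
      by (rule measure_Un_le) measurable
    finally show ?thesis using small[OF r] unfolding d_def[symmetric] by simp
  qed
  obtain D where D: "D \<in> borel_measurable M"
    "(\<integral>\<^sup>+\<omega>. D \<omega> \<partial>M) \<le> 2 * (\<integral>\<^sup>+\<omega>. ennreal (?\<phi> (1 * X \<delta> \<omega> + d/4)) \<partial>M)"
    "\<And>\<omega> s. \<omega> \<in> space M \<Longrightarrow> 0 \<le> s \<Longrightarrow> s < \<delta> \<Longrightarrow> ennreal (?\<phi> (1 * X s \<omega>) - ?\<phi> 0) \<le> D \<omega>"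
    by (rule sup_bound[OF \<delta> mono _ op tail]) auto
  interpret Kd: prob_space "K \<delta>" by (rule K_prob[OF \<delta>0])
  note [measurable_cong] = K_sets[OF \<delta>0]
  have "(\<integral>\<^sup>+\<omega>. ennreal (?\<phi> (1 * X \<delta> \<omega> + d/4)) \<partial>M) = (\<integral>\<^sup>+z. ennreal (?\<phi> (1 * z + d/4)) \<partial>K \<delta>)"
    by (subst nn_integral_K[OF \<delta>0]) auto
  also have "\<dots> \<le> (\<integral>\<^sup>+z. indicator {z. d / 4 < \<bar>z\<bar>} z \<partial>K \<delta>)"
    by (intro nn_integral_mono) (auto simp: indicator_def)
  also have "\<dots> = ennreal (measure (K \<delta>) {z. d / 4 < \<bar>z\<bar>})"
    by (subst nn_integral_indicator) (auto simp: Kd.emeasure_eq_measure K_sets[OF \<delta>0])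
  also have "\<dots> \<le> ennreal (1/8)" using small[OF \<delta>0 order_refl] unfolding d_def by (intro ennreal_leI)
  finally have "2 * (\<integral>\<^sup>+\<omega>. ennreal (?\<phi> (1 * X \<delta> \<omega> + d/4)) \<partial>M) \<le> 2 * ennreal (1/8)"
    by (intro mult_left_mono) auto
  then have D4: "(\<integral>\<^sup>+\<omega>. D \<omega> \<partial>M) \<le> ennreal (1/4)"
    using D(2) ennreal_mult[of 2 "1/8", symmetric] by simp
  have "emeasure M B = (\<integral>\<^sup>+\<omega>. indicator B \<omega> \<partial>M)" by simp
  also have "\<dots> \<le> (\<integral>\<^sup>+\<omega>. D \<omega> \<partial>M)"
  proof (rule nn_integral_mono)
    fix \<omega> assume \<omega>: "\<omega> \<in> space M"
    show "indicator B \<omega> \<le> D \<omega>"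
    proof (cases "\<omega> \<in> B")
      case True
      then obtain s where s: "0 \<le> s" "s < \<delta>" "d \<le> X s \<omega>" unfolding B_def d_def by auto
      then have "?\<phi> (1 * X s \<omega>) - ?\<phi> 0 = 1" using d by (simp add: indicator_def)
      then show ?thesis using D(3)[OF \<omega> s(1,2)] True by simp
    qed simp
  qed
  also note D4
  finally have PB: "measure M B \<le> 1/4" by (simp add: emeasure_eq_measure)
  have [measurable]: "(\<lambda>\<omega>. hit_time a (f \<omega>)) \<in> borel_measurable M" unfolding f_def by (rule hit_time_measurable)
  have [measurable]: "Measurable.pred M (\<lambda>\<omega>. first_paid a (f \<omega>))"
    unfolding f_def pred_def by (rule first_paid_measurable)
  have "(\<integral>\<omega>. (if first_paid a (f \<omega>) then exp (- q * hit_time a (f \<omega>)) else 0) \<partial>M)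
    \<le> (\<integral>\<omega>. exp (- q * \<delta>) + (1 - exp (- q * \<delta>)) * indicator B \<omega> \<partial>M)"
  proof (rule integral_mono)
    show "integrable M (\<lambda>\<omega>. if first_paid a (f \<omega>) then exp (- q * hit_time a (f \<omega>)) else 0)"
      using q_pos hit_time_nonneg by (intro integrable_const_bound[where B=1]) auto
    show "integrable M (\<lambda>\<omega>. exp (- q * \<delta>) + (1 - exp (- q * \<delta>)) * indicator B \<omega>)"
      by (intro Bochner_Integration.integrable_add integrable_mult_right integrable_real_indicator) (auto simp: emeasure_eq_measure)
    fix \<omega> assume \<omega>: "\<omega> \<in> space M"
    show "(if first_paid a (f \<omega>) then exp (- q * hit_time a (f \<omega>)) else 0) \<le> exp (- q * \<delta>) + (1 - exp (- q * \<delta>)) * indicator B \<omega>"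
    proof (cases "first_paid a (f \<omega>)")
      case True
      show ?thesis
      proof (cases "hit_time a (f \<omega>) < \<delta>")
        case lt: True
        have "good_path (f \<omega>)" unfolding f_def by (rule good_shifted[OF \<omega>])
        then have "a \<le> f \<omega> (hit_time a (f \<omega>))" using at_hit_time True unfolding first_paid_def by blast
        then have "\<omega> \<in> B" unfolding B_def f_def[symmetric] using \<omega> lt hit_time_nonneg by blast
        then show ?thesis using q_pos hit_time_nonneg[of a "f \<omega>"] True by simp
      next
        case False
        then have "exp (- q * hit_time a (f \<omega>)) \<le> exp (- q * \<delta>)" using q_pos by simp
        moreover have "exp (- q * \<delta>) \<le> 1" using q_pos \<delta>0 by simp
        then have "0 \<le> (1 - exp (- q * \<delta>)) * indicator B \<omega>" by simp
        ultimately have "exp (- q * hit_time a (f \<omega>)) \<le> exp (- q * \<delta>) + (1 - exp (- q * \<delta>)) * indicator B \<omega>"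
          by linarith
        then show ?thesis using True by simp
      qed
    next
      case False
      moreover have "exp (- q * \<delta>) \<le> 1" using q_pos \<delta>0 by simp
      then have "0 \<le> (1 - exp (- q * \<delta>)) * indicator B \<omega>" by simp
      ultimately show ?thesis by (simp add: add_nonneg_nonneg)
    qed
  qed
  also have "\<dots> = exp (- q * \<delta>) + (1 - exp (- q * \<delta>)) * measure M B"
    by (subst Bochner_Integration.integral_add)
       (auto simp: prob_space emeasure_eq_measure intro!: integrable_real_indicator)
  also have "\<dots> \<le> exp (- q * \<delta>) + (1 - exp (- q * \<delta>)) * (1/4)"
    using PB q_pos \<delta>0 by (intro add_left_mono mult_left_mono) auto
  finally show ?thesis unfolding f_def by simp
qed

end

section \<open>The strong Markov property\<close>

definition discounted_payment :: "real \<Rightarrow> real \<Rightarrow> real \<Rightarrow> nat \<Rightarrow> (real \<Rightarrow> real) \<Rightarrow> real" where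
  "discounted_payment q c1 c2 n f = (if paid c1 c2 n f then exp (- q * paid_time c1 c2 n f) else 0)"

lemma discounted_payment_Suc:
  "discounted_payment q c1 c2 (Suc n) f = discounted_payment q c1 c2 0 f * discounted_payment q c1 c2 n (restart c1 c2 f)"
  by (simp add: discounted_payment_def mult_exp_exp distrib_left)

lemma discounted_payment_nonneg: "0 \<le> discounted_payment q c1 c2 n f"
  by (simp add: discounted_payment_def)

lemma discounted_payment_0_le_1: "0 < q \<Longrightarrow> discounted_payment q c1 c2 0 f \<le> 1"
  using hit_time_nonneg[of c2 f] by (simp add: discounted_payment_def)

lemma discounted_payment_le_1: "0 < q \<Longrightarrow> discounted_payment q c1 c2 n f \<le> 1"
proof (induction n arbitrary: f)
  case 0 then show ?case by (rule discounted_payment_0_le_1)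
next
  case (Suc n)
  show ?case unfolding discounted_payment_Suc[of q c1 c2 n]
    using mult_mono[OF discounted_payment_0_le_1[OF Suc.prems] Suc.IH[OF Suc.prems] zero_le_one discounted_payment_nonneg]
    by simp
qed

section \<open>The process after its first payment\<close>

context adapted_process begin

definition shift_time :: "real \<Rightarrow> real \<Rightarrow> 'a \<Rightarrow> real" where
  "shift_time a x \<omega> = hit_time a (\<lambda>t. x + X t \<omega>)"

definition shifted :: "real \<Rightarrow> real \<Rightarrow> real \<Rightarrow> 'a \<Rightarrow> real" where
  "shifted a x t \<omega> = X (shift_time a x \<omega> + t) \<omega> - X (shift_time a x \<omega>) \<omega>"

lemma shift_time_nonneg: "0 \<le> shift_time a x \<omega>"
  unfolding shift_time_def by (rule hit_time_nonneg)

lemma shift_time_measurable [measurable]: "shift_time a x \<in> borel_measurable M"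
  unfolding shift_time_def by (rule hit_time_measurable)

lemma restart_eq_shifted: "restart c1 c2 (\<lambda>t. x + X t \<omega>) = (\<lambda>t. c1 + shifted c2 x t \<omega>)"
  unfolding restart_def shifted_def shift_time_def by (intro ext) simp

lemma good_shifted_path: "\<omega> \<in> space M \<Longrightarrow> good_path (\<lambda>t. shifted a x t \<omega>)"
  unfolding shifted_def
  using good_path_shift[OF good shift_time_nonneg[of a x \<omega>], of \<omega> 0] by simp

lemma shifted_0: "shifted a x 0 \<omega> = 0"
  unfolding shifted_def by simp

lemma shifted_measurable: "0 \<le> t \<Longrightarrow> shifted a x t \<in> borel_measurable M"
  unfolding shifted_def
  by (intro borel_measurable_diff X_at_random_time) (auto simp: shift_time_nonneg)

text \<open>The constant filtration M serves the measurability of the payments of the restarted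
  process. The filtration for independence is built later, as
  \<open>stopped_filtration\<close>.\<close>

lemma adapted_process_shifted: "adapted_process M (shifted a x) (\<lambda>_. M)"
  by unfold_locales (auto simp: good_shifted_path shifted_0 shifted_measurable subalgebra_def)

end

text \<open>The induction leaves process and filtration arbitrary, because its step passes to the
  process restarted at the first payment.\<close>

lemma paid_measurable:
  assumes "adapted_process M X F"
  shows "Measurable.pred M (\<lambda>\<omega>. paid c1 c2 n (\<lambda>t. x + X t \<omega>))
    \<and> (\<lambda>\<omega>. paid_time c1 c2 n (\<lambda>t. x + X t \<omega>)) \<in> borel_measurable M
    \<and> (\<lambda>\<omega>. paid_amount c1 c2 n (\<lambda>t. x + X t \<omega>)) \<in> borel_measurable M"
  using assms
proof (induction n arbitrary: X F x)
  case 0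
  interpret adapted_process M X F by fact
  have "(\<lambda>\<omega>. X (hit_time c2 (\<lambda>t. x + X t \<omega>)) \<omega>) \<in> borel_measurable M"
    by (intro X_at_random_time hit_time_measurable hit_time_nonneg)
  then show ?case
    using first_paid_measurable[of c2 x] hit_time_measurable[of c2 x]
    by (simp add: pred_def)
next
  case (Suc n)
  interpret adapted_process M X F by fact
  note IH = Suc.IH[OF adapted_process_shifted[of c2 x], of c1]
  have [measurable]: "Measurable.pred M (\<lambda>\<omega>. first_paid c2 (\<lambda>t. x + X t \<omega>))"
    "(\<lambda>\<omega>. hit_time c2 (\<lambda>t. x + X t \<omega>)) \<in> borel_measurable M"
    using first_paid_measurable[of c2 x] hit_time_measurable[of c2 x] by (simp_all add: pred_def)
  show ?case
    unfolding paid.simps paid_time.simps paid_amount.simps restart_eq_shifted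
    using IH by (auto intro!: borel_measurable_add pred_intros_logic)
qed

lemma discounted_payment_measurable:
  assumes "adapted_process M X F"
  shows "(\<lambda>\<omega>. discounted_payment q c1 c2 n (\<lambda>t. x + X t \<omega>)) \<in> borel_measurable M"
proof -
  note [measurable] = paid_measurable[OF assms, THEN conjunct1] paid_measurable[OF assms, THEN conjunct2, THEN conjunct1]
  show ?thesis unfolding discounted_payment_def by measurable
qed

text \<open>S is an optional time through the condition that \<zeta> restricted to {S < u} is known
  at time u. After S is rounded up, \<zeta> splits into cell weights known at the grid times, and
  independence of increments applies to each cell. Continuity of g and right continuity of paths
  lead back from the rounded time to S.\<close>

lemma (in increment_process) strong_markov_continuous:
  fixes S \<zeta> :: "'a \<Rightarrow> real" and g :: "real \<Rightarrow> real"
  assumes S: "S \<in> borel_measurable M" "\<And>\<omega>. 0 \<le> S \<omega>" and r: "0 \<le> r"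
    and \<zeta>: "\<zeta> \<in> borel_measurable M" "\<And>\<omega>. 0 \<le> \<zeta> \<omega>" "\<And>\<omega>. \<zeta> \<omega> \<le> 1"
    and adapt: "\<And>u. 0 < u \<Longrightarrow> (\<lambda>\<omega>. if S \<omega> < u then \<zeta> \<omega> else 0) \<in> borel_measurable (F u)"
    and g: "continuous_on UNIV g" "\<And>z. 0 \<le> g z" "\<And>z. g z \<le> 1"
  shows "(\<integral>\<^sup>+\<omega>. ennreal (\<zeta> \<omega> * g (X (S \<omega> + r) \<omega> - X (S \<omega>) \<omega>)) \<partial>M) = (\<integral>\<^sup>+\<omega>. ennreal (\<zeta> \<omega>) \<partial>M) * (\<integral>\<^sup>+z. ennreal (g z) \<partial>K r)"
proof -
  have gm[measurable]: "g \<in> borel_measurable borel" by (rule borel_measurable_continuous_onI[OF g(1)])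
  note [measurable] = S(1) \<zeta>(1)
  have XS: "(\<lambda>\<omega>. X (T \<omega>) \<omega>) \<in> borel_measurable M" if "T \<in> borel_measurable M" "\<And>\<omega>. 0 \<le> T \<omega>" for T
    using that by (intro X_at_random_time) auto
  have dy: "(\<integral>\<^sup>+\<omega>. ennreal (\<zeta> \<omega> * g (X (next_dyadic m (S \<omega>) + r) \<omega> - X (next_dyadic m (S \<omega>)) \<omega>)) \<partial>M)
     = (\<integral>\<^sup>+\<omega>. ennreal (\<zeta> \<omega>) \<partial>M) * (\<integral>\<^sup>+z. ennreal (g z) \<partial>K r)" for m
  proof -
    define t where "t j = real j / 2 ^ m" for j
    have t: "0 \<le> t j" "0 < t (Suc j)" "t j \<le> t (Suc j)" for j unfolding t_def by (auto intro!: divide_right_mono)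
    define \<eta> where "\<eta> j \<omega> = (if t j \<le> S \<omega> \<and> S \<omega> < t (Suc j) then \<zeta> \<omega> else 0)" for j \<omega>
    have \<eta>F: "\<eta> j \<in> borel_measurable (F (t (Suc j)))" for j
    \<comment> \<open>The first cell is separate: adaptedness is assumed for u > 0, while t 0 = 0.
      For the other cells the weight is a difference of two truncations.\<close>
    proof (cases "j = 0")
      case True
      then have "\<eta> j = (\<lambda>\<omega>. if S \<omega> < t (Suc j) then \<zeta> \<omega> else 0)"
        unfolding \<eta>_def using S(2) by (auto simp: t_def)
      then show ?thesis using adapt[OF t(2)] by simp
    next
      case False
      then have tj: "0 < t j" unfolding t_def by simp
      have "\<eta> j = (\<lambda>\<omega>. (if S \<omega> < t (Suc j) then \<zeta> \<omega> else 0) - (if S \<omega> < t j then \<zeta> \<omega> else 0))"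
        unfolding \<eta>_def using t(3)[of j] by (auto simp: fun_eq_iff)
      moreover have "(\<lambda>\<omega>. if S \<omega> < t j then \<zeta> \<omega> else 0) \<in> borel_measurable (F (t (Suc j)))"
        using measurable_F_mono[OF t(1) t(3) adapt[OF tj]] .
      ultimately show ?thesis using adapt[OF t(2)[of j]] by (simp add: borel_measurable_diff)
    qed
    have \<eta>M[measurable]: "\<eta> j \<in> borel_measurable M" for j
      using measurable_F[OF less_imp_le[OF t(2)] \<eta>F] .
    have \<eta>0: "0 \<le> \<eta> j \<omega>" for j \<omega> unfolding \<eta>_def using \<zeta>(2) by simp
    have cell: "\<exists>i. t i \<le> S \<omega> \<and> S \<omega> < t (Suc i) \<and> next_dyadic m (S \<omega>) = t (Suc i) \<and> (\<forall>j. j \<noteq> i \<longrightarrow> \<eta> j \<omega> = 0) \<and> \<eta> i \<omega> = \<zeta> \<omega>" for \<omega>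
    proof -
      define i where "i = nat \<lfloor>2 ^ m * S \<omega>\<rfloor>"
      have nd: "next_dyadic m (S \<omega>) = t (Suc i)" unfolding next_dyadic_def t_def i_def by simp
      then have i: "t i \<le> S \<omega>" "S \<omega> < t (Suc i)"
        using next_dyadic_eq_iff[OF S(2)[of \<omega>], of m i] unfolding t_def by auto
      have "\<eta> j \<omega> = 0" if "j \<noteq> i" for j
      proof (rule ccontr)
        assume "\<eta> j \<omega> \<noteq> 0"
        then have "t j \<le> S \<omega> \<and> S \<omega> < t (Suc j)" unfolding \<eta>_def by (auto split: if_splits)
        then have "next_dyadic m (S \<omega>) = t (Suc j)"
          using next_dyadic_eq_iff[OF S(2)[of \<omega>], of m j] unfolding t_def by auto
        then show False using nd that unfolding t_def by simp
      qed
      then show ?thesis using i nd unfolding \<eta>_def by (intro exI[of _ i]) auto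
    qed
    have sum1: "ennreal (\<zeta> \<omega> * g (X (next_dyadic m (S \<omega>) + r) \<omega> - X (next_dyadic m (S \<omega>)) \<omega>))
      = (\<Sum>j. ennreal (\<eta> j \<omega> * g (X (t (Suc j) + r) \<omega> - X (t (Suc j)) \<omega>)))" for \<omega>
    proof -
      obtain i where i: "next_dyadic m (S \<omega>) = t (Suc i)" "\<forall>j. j \<noteq> i \<longrightarrow> \<eta> j \<omega> = 0" "\<eta> i \<omega> = \<zeta> \<omega>"
        using cell[of \<omega>] by auto
      have "(\<Sum>j. ennreal (\<eta> j \<omega> * g (X (t (Suc j) + r) \<omega> - X (t (Suc j)) \<omega>)))
        = (\<Sum>j\<in>{i}. ennreal (\<eta> j \<omega> * g (X (t (Suc j) + r) \<omega> - X (t (Suc j)) \<omega>)))"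
        using i(2) by (intro suminf_finite) auto
      then show ?thesis using i by simp
    qed
    have sum2: "ennreal (\<zeta> \<omega>) = (\<Sum>j. ennreal (\<eta> j \<omega>))" for \<omega>
    proof -
      obtain i where i: "\<forall>j. j \<noteq> i \<longrightarrow> \<eta> j \<omega> = 0" "\<eta> i \<omega> = \<zeta> \<omega>" using cell[of \<omega>] by auto
      have "(\<Sum>j. ennreal (\<eta> j \<omega>)) = (\<Sum>j\<in>{i}. ennreal (\<eta> j \<omega>))"
        using i(1) by (intro suminf_finite) auto
      then show ?thesis using i by simp
    qed
    have Xt[measurable]: "X (t (Suc j)) \<in> borel_measurable M" "X (t (Suc j) + r) \<in> borel_measurable M" for j
      using t(2)[of j] r by (auto intro!: X_measurable)
    have cell_integral: "(\<integral>\<^sup>+\<omega>. ennreal (\<eta> j \<omega> * g (X (t (Suc j) + r) \<omega> - X (t (Suc j)) \<omega>)) \<partial>M)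
      = (\<integral>\<^sup>+\<omega>. ennreal (\<eta> j \<omega>) \<partial>M) * (\<integral>\<^sup>+z. ennreal (g z) \<partial>K r)" for j
    proof -
      note [measurable] = \<eta>F[of j]
      note [measurable_cong] = K_sets[OF r]
      have m: "(\<lambda>(\<omega>, z). ennreal (\<eta> j \<omega> * g z)) \<in> borel_measurable (F (t (Suc j)) \<Otimes>\<^sub>M borel)" by measurable
      have "(\<integral>\<^sup>+\<omega>. ennreal (\<eta> j \<omega> * g (X (t (Suc j) + r) \<omega> - X (t (Suc j)) \<omega>)) \<partial>M)
        = (\<integral>\<^sup>+\<omega>. \<integral>\<^sup>+z. ennreal (\<eta> j \<omega> * g z) \<partial>K r \<partial>M)"
        using nn_integral_increment[OF less_imp_le[OF t(2)] r m] by (simp only: case_prod_conv)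
      also have "\<dots> = (\<integral>\<^sup>+\<omega>. ennreal (\<eta> j \<omega>) * (\<integral>\<^sup>+z. ennreal (g z) \<partial>K r) \<partial>M)"
        using \<eta>0 g(2) by (intro nn_integral_cong) (simp add: ennreal_mult nn_integral_cmult)
      also have "\<dots> = (\<integral>\<^sup>+\<omega>. ennreal (\<eta> j \<omega>) \<partial>M) * (\<integral>\<^sup>+z. ennreal (g z) \<partial>K r)"
        by (rule nn_integral_multc) measurable
      finally show ?thesis .
    qed
    have "(\<integral>\<^sup>+\<omega>. ennreal (\<zeta> \<omega> * g (X (next_dyadic m (S \<omega>) + r) \<omega> - X (next_dyadic m (S \<omega>)) \<omega>)) \<partial>M)
      = (\<Sum>j. (\<integral>\<^sup>+\<omega>. ennreal (\<eta> j \<omega> * g (X (t (Suc j) + r) \<omega> - X (t (Suc j)) \<omega>)) \<partial>M))"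
      unfolding sum1 by (rule nn_integral_suminf) measurable
    also have "\<dots> = (\<Sum>j. (\<integral>\<^sup>+\<omega>. ennreal (\<eta> j \<omega>) \<partial>M)) * (\<integral>\<^sup>+z. ennreal (g z) \<partial>K r)"
      unfolding cell_integral by (rule ennreal_suminf_multc)
    also have "(\<Sum>j. (\<integral>\<^sup>+\<omega>. ennreal (\<eta> j \<omega>) \<partial>M)) = (\<integral>\<^sup>+\<omega>. ennreal (\<zeta> \<omega>) \<partial>M)"
      unfolding sum2 by (rule nn_integral_suminf[symmetric]) measurable
    finally show ?thesis .
  qed
  have nd0: "0 \<le> next_dyadic m s" for m s using next_dyadic_pos[of m s] by simp
  have "(\<lambda>m. (\<integral>\<^sup>+\<omega>. ennreal (\<zeta> \<omega> * g (X (next_dyadic m (S \<omega>) + r) \<omega> - X (next_dyadic m (S \<omega>)) \<omega>)) \<partial>M))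
    \<longlonglongrightarrow> (\<integral>\<^sup>+\<omega>. ennreal (\<zeta> \<omega> * g (X (S \<omega> + r) \<omega> - X (S \<omega>) \<omega>)) \<partial>M)"
  proof (rule nn_integral_dominated_convergence[where w="\<lambda>_. 1"])
    show "(\<lambda>\<omega>. ennreal (\<zeta> \<omega> * g (X (S \<omega> + r) \<omega> - X (S \<omega>) \<omega>))) \<in> borel_measurable M"
    proof -
      have "(\<lambda>\<omega>. X (S \<omega>) \<omega>) \<in> borel_measurable M" "(\<lambda>\<omega>. X (S \<omega> + r) \<omega>) \<in> borel_measurable M"
        using S(2) r by (auto intro!: XS)
      note [measurable] = this
      show ?thesis by measurable
    qed
    show "(\<lambda>\<omega>. ennreal (\<zeta> \<omega> * g (X (next_dyadic m (S \<omega>) + r) \<omega> - X (next_dyadic m (S \<omega>)) \<omega>))) \<in> borel_measurable M" for m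
    proof -
      have "(\<lambda>\<omega>. X (next_dyadic m (S \<omega>)) \<omega>) \<in> borel_measurable M" "(\<lambda>\<omega>. X (next_dyadic m (S \<omega>) + r) \<omega>) \<in> borel_measurable M"
        using nd0[of m] r by (auto intro!: XS)
      note [measurable] = this
      show ?thesis by measurable
    qed
    show "AE \<omega> in M. (\<lambda>m. ennreal (\<zeta> \<omega> * g (X (next_dyadic m (S \<omega>) + r) \<omega> - X (next_dyadic m (S \<omega>)) \<omega>)))
       \<longlonglongrightarrow> ennreal (\<zeta> \<omega> * g (X (S \<omega> + r) \<omega> - X (S \<omega>) \<omega>))"
    proof (rule AE_I2)
      fix \<omega> assume \<omega>: "\<omega> \<in> space M"
      note fl = filterlim_next_dyadic[OF S(2)[of \<omega>]]
      have 1: "(\<lambda>m. X (next_dyadic m (S \<omega>)) \<omega>) \<longlonglongrightarrow> X (S \<omega>) \<omega>"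
        by (rule filterlim_compose[OF X_right[OF \<omega> S(2)] fl])
      have "(\<lambda>m. X (r + next_dyadic m (S \<omega>)) \<omega>) \<longlonglongrightarrow> X (r + S \<omega>) \<omega>"
        by (rule filterlim_compose[OF X_right[OF \<omega>] filterlim_compose[OF filterlim_add_at_right fl]]) (use S(2) r in simp)
      then have 2: "(\<lambda>m. X (next_dyadic m (S \<omega>) + r) \<omega>) \<longlonglongrightarrow> X (S \<omega> + r) \<omega>" by (simp add: add.commute)
      have "(\<lambda>m. g (X (next_dyadic m (S \<omega>) + r) \<omega> - X (next_dyadic m (S \<omega>)) \<omega>)) \<longlonglongrightarrow> g (X (S \<omega> + r) \<omega> - X (S \<omega>) \<omega>)"
        by (rule isCont_tendsto_compose[OF _ tendsto_diff[OF 2 1]]) (use g(1) in \<open>simp add: continuous_on_eq_continuous_at\<close>)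
      then show "(\<lambda>m. ennreal (\<zeta> \<omega> * g (X (next_dyadic m (S \<omega>) + r) \<omega> - X (next_dyadic m (S \<omega>)) \<omega>)))
       \<longlonglongrightarrow> ennreal (\<zeta> \<omega> * g (X (S \<omega> + r) \<omega> - X (S \<omega>) \<omega>))"
        by (intro tendsto_ennrealI tendsto_mult tendsto_const)
    qed
    show "AE \<omega> in M. ennreal (\<zeta> \<omega> * g (X (next_dyadic m (S \<omega>) + r) \<omega> - X (next_dyadic m (S \<omega>)) \<omega>)) \<le> 1" for m
    proof (rule AE_I2)
      fix \<omega>
      have "\<zeta> \<omega> * g (X (next_dyadic m (S \<omega>) + r) \<omega> - X (next_dyadic m (S \<omega>)) \<omega>) \<le> 1 * 1"
        using \<zeta> g by (intro mult_mono) auto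
      then show "ennreal (\<zeta> \<omega> * g (X (next_dyadic m (S \<omega>) + r) \<omega> - X (next_dyadic m (S \<omega>)) \<omega>)) \<le> 1"
        by (simp add: ennreal_le_1)
    qed
  qed (auto simp: emeasure_space_1)
  from LIMSEQ_unique[OF this] show ?thesis unfolding dy by simp
qed

text \<open>Indicators of the rays {c<..} are increasing limits of continuous functions, and a
  finite measure on the line is determined by its values on these rays.\<close>

lemma (in increment_process) strong_markov:
  fixes S \<zeta> :: "'a \<Rightarrow> real"
  assumes S: "S \<in> borel_measurable M" "\<And>\<omega>. 0 \<le> S \<omega>" and r: "0 \<le> r"
    and \<zeta>: "\<zeta> \<in> borel_measurable M" "\<And>\<omega>. 0 \<le> \<zeta> \<omega>" "\<And>\<omega>. \<zeta> \<omega> \<le> 1"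
    and adapt: "\<And>u. 0 < u \<Longrightarrow> (\<lambda>\<omega>. if S \<omega> < u then \<zeta> \<omega> else 0) \<in> borel_measurable (F u)"
    and B: "B \<in> sets borel"
  shows "(\<integral>\<^sup>+\<omega>. ennreal (\<zeta> \<omega>) * indicator B (X (S \<omega> + r) \<omega> - X (S \<omega>) \<omega>) \<partial>M) = (\<integral>\<^sup>+\<omega>. ennreal (\<zeta> \<omega>) \<partial>M) * emeasure (K r) B"
proof -
  note [measurable] = S(1) \<zeta>(1)
  interpret Kr: prob_space "K r" by (rule K_prob[OF r])
  note [measurable_cong] = K_sets[OF r]
  define \<Delta> where "\<Delta> \<omega> = X (S \<omega> + r) \<omega> - X (S \<omega>) \<omega>" for \<omega>
  have [measurable]: "\<Delta> \<in> borel_measurable M"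
    unfolding \<Delta>_def using S r by (intro borel_measurable_diff X_at_random_time) auto
  let ?N = "distr (density M (\<lambda>\<omega>. ennreal (\<zeta> \<omega>))) borel \<Delta>"
  let ?z = "\<integral>\<^sup>+\<omega>. ennreal (\<zeta> \<omega>) \<partial>M"
  have zfin: "?z < \<infinity>"
  proof -
    have "?z \<le> (\<integral>\<^sup>+\<omega>. 1 \<partial>M)" using \<zeta>(3) by (intro nn_integral_mono) (simp add: ennreal_le_1)
    then show ?thesis by (simp add: emeasure_space_1 le_less_trans[of _ 1])
  qed
  have N_eq: "emeasure ?N B = (\<integral>\<^sup>+\<omega>. ennreal (\<zeta> \<omega>) * indicator B (\<Delta> \<omega>) \<partial>M)" if "B \<in> sets borel" for B
  proof -
    have "emeasure ?N B = emeasure (density M (\<lambda>\<omega>. ennreal (\<zeta> \<omega>))) (\<Delta> -` B \<inter> space M)"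
      using that by (subst emeasure_distr) auto
    also have "\<dots> = (\<integral>\<^sup>+\<omega>. ennreal (\<zeta> \<omega>) * indicator (\<Delta> -` B \<inter> space M) \<omega> \<partial>M)"
      using that by (subst emeasure_density) auto
    also have "\<dots> = (\<integral>\<^sup>+\<omega>. ennreal (\<zeta> \<omega>) * indicator B (\<Delta> \<omega>) \<partial>M)"
      by (intro nn_integral_cong) (auto simp: indicator_def)
    finally show ?thesis .
  qed
  have main: "emeasure ?N {c<..} = ?z * emeasure (K r) {c<..}" for c
  proof -
    define g where "g n z = min 1 (max 0 (real n * (z - c)))" for n and z :: real
    have g: "continuous_on UNIV (g n)" "0 \<le> g n z" "g n z \<le> 1" for n z
      unfolding g_def by (auto intro!: continuous_intros)
    have [measurable]: "g n \<in> borel_measurable borel" for n by (rule borel_measurable_continuous_onI[OF g(1)])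
    have inc: "g n z \<le> g (Suc n) z" for n z
    proof (cases "z \<le> c")
      case True then show ?thesis unfolding g_def by (simp add: mult_nonneg_nonpos)
    next
      case False
      then have "real n * (z - c) \<le> real (Suc n) * (z - c)" by (intro mult_right_mono) auto
      then show ?thesis unfolding g_def by (intro min.mono max.mono) auto
    qed
    have sup: "(SUP n. ennreal (g n z)) = indicator {c<..} z" for z
    proof (rule LIMSEQ_unique[OF LIMSEQ_SUP])
      show "incseq (\<lambda>n. ennreal (g n z))" by (intro incseq_SucI ennreal_leI inc)
      show "(\<lambda>n. ennreal (g n z)) \<longlonglongrightarrow> indicator {c<..} z"
      proof (cases "c < z")
        case True
        obtain n0 :: nat where n0: "1 / (z - c) < real n0" using reals_Archimedean2 by blast
        have "g n z = 1" if "n0 \<le> n" for n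
        proof -
          have "1 / (z - c) \<le> real n" using n0 that by linarith
          then have "1 \<le> real n * (z - c)" using True by (simp add: pos_divide_le_eq)
          then show ?thesis unfolding g_def by simp
        qed
        then have "eventually (\<lambda>n. ennreal (g n z) = 1) sequentially"
          unfolding eventually_sequentially by (intro exI[of _ n0]) simp
        then show ?thesis using True by (simp add: tendsto_eventually)
      next
        case False
        then have "g n z = 0" for n unfolding g_def by (simp add: mult_nonneg_nonpos)
        then show ?thesis using False by simp
      qed
    qed
    have "emeasure ?N {c<..} = (\<integral>\<^sup>+\<omega>. (SUP n. ennreal (\<zeta> \<omega> * g n (\<Delta> \<omega>))) \<partial>M)"
      unfolding N_eq[OF borel_open[OF open_greaterThan]] sup[symmetric]
      using \<zeta>(2) g(2) by (intro nn_integral_cong) (simp add: ennreal_mult SUP_mult_left_ennreal)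
    also have "\<dots> = (SUP n. \<integral>\<^sup>+\<omega>. ennreal (\<zeta> \<omega> * g n (\<Delta> \<omega>)) \<partial>M)"
    proof (rule nn_integral_monotone_convergence_SUP)
      show "incseq (\<lambda>n \<omega>. ennreal (\<zeta> \<omega> * g n (\<Delta> \<omega>)))"
        using \<zeta>(2) inc by (intro incseq_SucI le_funI ennreal_leI mult_left_mono) auto
    qed measurable
    also have "\<dots> = (SUP n. ?z * (\<integral>\<^sup>+z. ennreal (g n z) \<partial>K r))"
      unfolding \<Delta>_def by (intro SUP_cong refl strong_markov_continuous[OF S r \<zeta> adapt g])
    also have "\<dots> = ?z * (SUP n. \<integral>\<^sup>+z. ennreal (g n z) \<partial>K r)" by (rule SUP_mult_left_ennreal[symmetric])
    also have "(SUP n. \<integral>\<^sup>+z. ennreal (g n z) \<partial>K r) = (\<integral>\<^sup>+z. (SUP n. ennreal (g n z)) \<partial>K r)"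
    proof (rule nn_integral_monotone_convergence_SUP[symmetric])
      show "incseq (\<lambda>n z. ennreal (g n z))" using inc by (intro incseq_SucI le_funI ennreal_leI) auto
    qed measurable
    also have "\<dots> = emeasure (K r) {c<..}"
      unfolding sup by (subst nn_integral_indicator) (auto simp: K_sets[OF r])
    finally show ?thesis .
  qed
  have N2: "emeasure (density (K r) (\<lambda>_. ?z)) B = ?z * emeasure (K r) B" if "B \<in> sets borel" for B
    using that by (subst emeasure_density) (auto simp: nn_integral_cmult_indicator K_sets[OF r])
  have "?N = density (K r) (\<lambda>_. ?z)"
  proof (rule measure_eqI_lessThan)
    fix c :: real
    have gt: "{c<..} \<in> sets borel" by simp
    show "emeasure ?N {c<..} = emeasure (density (K r) (\<lambda>_. ?z)) {c<..}" unfolding main N2[OF gt] ..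
    show "emeasure ?N {c<..} < \<infinity>"
      unfolding main using zfin by (simp add: ennreal_mult_less_top Kr.emeasure_eq_measure)
  qed (simp_all add: K_sets[OF r])
  then show ?thesis using N_eq[OF B] N2[OF B] unfolding \<Delta>_def by simp
qed

section \<open>The sigma-algebra at the first payment\<close>

context increment_process begin

definition paid_event :: "real \<Rightarrow> real \<Rightarrow> 'a set" where
  "paid_event a x = {\<omega>\<in>space M. first_paid a (\<lambda>t. x + X t \<omega>)}"

text \<open>The sigma-algebra of the optional time \<open>shift_time\<close> plus t, with a strict
  inequality because F need not be right continuous. Outside \<open>paid_event\<close> a set only
  has to lie in \<open>sets M\<close>; the restarted measure does not charge that region.\<close>

definition stopped_sets :: "real \<Rightarrow> real \<Rightarrow> real \<Rightarrow> 'a set set" where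
  "stopped_sets a x t = {B\<in>sets M. \<forall>u>0. B \<inter> {\<omega>\<in>paid_event a x. shift_time a x \<omega> + t < u} \<in> sets (F u)}"

lemma paid_event_before:
  assumes u: "0 < u" and t: "0 \<le> t"
  shows "{\<omega>\<in>paid_event a x. shift_time a x \<omega> < v} \<inter> {\<omega>\<in>paid_event a x. shift_time a x \<omega> + t < u} \<in> sets (F u)"
proof -
  have eq: "{\<omega>\<in>paid_event a x. shift_time a x \<omega> < v} \<inter> {\<omega>\<in>paid_event a x. shift_time a x \<omega> + t < u}
    = {\<omega>\<in>paid_event a x. shift_time a x \<omega> < min v (u - t)}" by auto
  show ?thesis
  proof (cases "0 \<le> min v (u - t)")
    case True
    have "{\<omega>\<in>paid_event a x. shift_time a x \<omega> < min v (u - t)} \<in> sets (F (min v (u - t)))"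
      using first_paid_before_measurable[OF True, of a x] unfolding paid_event_def shift_time_def by simp
    moreover have "min v (u - t) \<le> u" using t by auto
    ultimately show ?thesis unfolding eq using F_mono[OF True] by blast
  next
    case False
    have "\<not> shift_time a x \<omega> < min v (u - t)" for \<omega>
      using False shift_time_nonneg[of a x \<omega>] by linarith
    then have "{\<omega>\<in>paid_event a x. shift_time a x \<omega> < min v (u - t)} = {}" by blast
    then show ?thesis unfolding eq by (simp only: sets.empty_sets)
  qed
qed

lemma paid_event_less:
  assumes u: "0 < u" and t: "0 \<le> t"
  shows "{\<omega>\<in>paid_event a x. shift_time a x \<omega> + t < u} \<in> sets (F u)"
proof -
  have "{\<omega>\<in>paid_event a x. shift_time a x \<omega> + t < u}
    = {\<omega>\<in>paid_event a x. shift_time a x \<omega> < u} \<inter> {\<omega>\<in>paid_event a x. shift_time a x \<omega> + t < u}"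
    using t by auto
  then show ?thesis using paid_event_before[OF u t, of a x u] by simp
qed

lemma paid_event_sets [measurable]: "paid_event a x \<in> sets M"
  unfolding paid_event_def by (rule first_paid_measurable)

lemma sigma_algebra_stopped:
  assumes t: "0 \<le> t"
  shows "sigma_algebra (space M) (stopped_sets a x t)"
  unfolding sigma_algebra_iff2
proof (intro conjI ballI allI impI)
  show "stopped_sets a x t \<subseteq> Pow (space M)" unfolding stopped_sets_def using sets.sets_into_space by auto
  show "{} \<in> stopped_sets a x t" unfolding stopped_sets_def by simp
  show "space M - B \<in> stopped_sets a x t" if B: "B \<in> stopped_sets a x t" for B
  proof -
    have "(space M - B) \<inter> {\<omega>\<in>paid_event a x. shift_time a x \<omega> + t < u} \<in> sets (F u)" if u: "0 < u" for u
    proof -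
      have "(space M - B) \<inter> {\<omega>\<in>paid_event a x. shift_time a x \<omega> + t < u}
        = {\<omega>\<in>paid_event a x. shift_time a x \<omega> + t < u} - B \<inter> {\<omega>\<in>paid_event a x. shift_time a x \<omega> + t < u}"
        unfolding paid_event_def by auto
      also have "\<dots> \<in> sets (F u)" using paid_event_less[OF u t] B u unfolding stopped_sets_def by (intro sets.Diff) auto
      finally show ?thesis .
    qed
    then show ?thesis using B unfolding stopped_sets_def by auto
  qed
  show "(\<Union>i. A i) \<in> stopped_sets a x t" if A: "range A \<subseteq> stopped_sets a x t" for A :: "nat \<Rightarrow> 'a set"
  proof -
    have "(\<Union>i. A i) \<inter> {\<omega>\<in>paid_event a x. shift_time a x \<omega> + t < u} \<in> sets (F u)" if u: "0 < u" for u
    proof -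
      have "(\<Union>i. A i) \<inter> {\<omega>\<in>paid_event a x. shift_time a x \<omega> + t < u}
        = (\<Union>i. A i \<inter> {\<omega>\<in>paid_event a x. shift_time a x \<omega> + t < u})" by auto
      also have "\<dots> \<in> sets (F u)"
        using A u unfolding stopped_sets_def by (intro sets.countable_UN) blast
      finally show ?thesis .
    qed
    moreover have "(\<Union>i. A i) \<in> sets M"
      using A unfolding stopped_sets_def by (intro sets.countable_UN) blast
    ultimately show ?thesis unfolding stopped_sets_def by simp
  qed
qed

definition stopped_filtration :: "real \<Rightarrow> real \<Rightarrow> real \<Rightarrow> 'a measure" where
  "stopped_filtration a x t = sigma (space M) (stopped_sets a x t)"

lemma sets_stopped_filtration: "0 \<le> t \<Longrightarrow> sets (stopped_filtration a x t) = stopped_sets a x t"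
  unfolding stopped_filtration_def
  using sigma_algebra.sets_measure_of_eq[OF sigma_algebra_stopped] by simp

lemma space_stopped_filtration: "space (stopped_filtration a x t) = space M"
  unfolding stopped_filtration_def by (simp add: space_measure_of_conv)

lemma stopped_time_measurable:
  assumes u: "0 < u" and t: "0 \<le> t"
  shows "(\<lambda>\<omega>. if \<omega> \<in> paid_event a x \<and> shift_time a x \<omega> + t < u then shift_time a x \<omega> else 0) \<in> borel_measurable (F u)"
    (is "?T \<in> _")
proof (rule borel_measurable_iff_less[THEN iffD2], rule allI)
  fix v :: real
  let ?S = "{\<omega>\<in>paid_event a x. shift_time a x \<omega> + t < u}"
  have S: "?S \<in> sets (F u)" by (rule paid_event_less[OF u t])
  have sp: "space (F u) = space M" using space_F[of u] u by simp
  have "{\<omega>\<in>space (F u). ?T \<omega> < v} = ({\<omega>\<in>paid_event a x. shift_time a x \<omega> < v} \<inter> ?S) \<union> (if 0 < v then space (F u) - ?S else {})"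
    unfolding sp by (auto simp: paid_event_def)
  also have "\<dots> \<in> sets (F u)" using paid_event_before[OF u t, of a x v] S by auto
  finally show "{\<omega>\<in>space (F u). ?T \<omega> < v} \<in> sets (F u)" .
qed

text \<open>Below u both evaluation times are bounded by u and known at time u; elsewhere they are
  replaced by 0, and the intersection with the event removes that part. This brings the increment
  within reach of \<open>X_at_bounded_time\<close>.\<close>

lemma shifted_stopped_measurable:
  assumes t: "0 \<le> t"
  shows "shifted a x t \<in> borel_measurable (stopped_filtration a x t)"
proof (rule measurableI)
  fix C :: "real set" assume C: "C \<in> sets borel"
  let ?V = "shifted a x t -` C \<inter> space M"
  have "?V \<inter> {\<omega>\<in>paid_event a x. shift_time a x \<omega> + t < u} \<in> sets (F u)" if u: "0 < u" for u
  proof -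
    let ?S = "{\<omega>\<in>paid_event a x. shift_time a x \<omega> + t < u}"
    define T where "T \<omega> = (if \<omega> \<in> paid_event a x \<and> shift_time a x \<omega> + t < u then shift_time a x \<omega> else 0)" for \<omega>
    define T' where "T' \<omega> = T \<omega> + (if \<omega> \<in> ?S then t else 0)" for \<omega>
    have u0: "0 \<le> u" using u by simp
    have S: "?S \<in> sets (F u)" by (rule paid_event_less[OF u t])
    have Tm: "T \<in> borel_measurable (F u)" unfolding T_def by (rule stopped_time_measurable[OF u t])
    have "(\<lambda>\<omega>. if \<omega> \<in> ?S then t else 0) \<in> borel_measurable (F u)"
    proof (rule measurable_If_set)
      show "?S \<inter> space (F u) \<in> sets (F u)" using S by (rule sets.Int) simp
    qed simp_all
    then have T'm: "T' \<in> borel_measurable (F u)" unfolding T'_def using Tm by (intro borel_measurable_add)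
    have m: "(\<lambda>\<omega>. X (T' \<omega>) \<omega> - X (T \<omega>) \<omega>) \<in> borel_measurable (F u)"
      by (intro borel_measurable_diff X_at_bounded_time u0 Tm T'm)
         (use t u shift_time_nonneg in \<open>auto simp: T_def T'_def intro: order_trans\<close>)
    have "?V \<inter> ?S = ((\<lambda>\<omega>. X (T' \<omega>) \<omega> - X (T \<omega>) \<omega>) -` C \<inter> space (F u)) \<inter> ?S"
      unfolding space_F[OF u0] T'_def T_def shifted_def by auto
    also have "\<dots> \<in> sets (F u)" using measurable_sets[OF m C] S by (rule sets.Int)
    finally show ?thesis .
  qed
  moreover have "?V \<in> sets M" by (rule measurable_sets[OF shifted_measurable[OF t] C])
  ultimately show "shifted a x t -` C \<inter> space (stopped_filtration a x t) \<in> sets (stopped_filtration a x t)"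
    unfolding space_stopped_filtration sets_stopped_filtration[OF t] stopped_sets_def by simp
qed simp

section \<open>Discounting as a change of measure\<close>

definition discount :: "real \<Rightarrow> real \<Rightarrow> real \<Rightarrow> 'a \<Rightarrow> real" where
  "discount q a x \<omega> = (if \<omega> \<in> paid_event a x then exp (- q * shift_time a x \<omega>) else 0)"

lemma discount_measurable [measurable]: "discount q a x \<in> borel_measurable M"
  unfolding discount_def by measurable

lemma discount_bounds: "0 \<le> q \<Longrightarrow> 0 \<le> discount q a x \<omega> \<and> discount q a x \<omega> \<le> 1"
  unfolding discount_def using shift_time_nonneg by auto

lemma integrable_discount: "0 \<le> q \<Longrightarrow> integrable M (discount q a x)"
  using discount_bounds by (intro integrable_const_bound[where B=1]) auto

text \<open>The discount factor up to the first payment is absorbed into the measure: under the normalised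
  density the process after that payment is again an \<open>increment_process\<close> with the same kernels, so the
  expected value of later payments follows by induction without conditional expectations.\<close>

definition restarted_measure :: "real \<Rightarrow> real \<Rightarrow> real \<Rightarrow> 'a measure" where
  "restarted_measure q a x = density M (\<lambda>\<omega>. ennreal (discount q a x \<omega> / (\<integral>\<omega>. discount q a x \<omega> \<partial>M)))"

lemma sets_restarted_measure: "sets (restarted_measure q a x) = sets M"
  unfolding restarted_measure_def by simp

lemma emeasure_restarted:
  assumes q: "0 \<le> q" and pos: "0 < (\<integral>\<omega>. discount q a x \<omega> \<partial>M)" and B: "B \<in> sets M"
  shows "emeasure (restarted_measure q a x) B = (\<integral>\<^sup>+\<omega>. ennreal (discount q a x \<omega>) * indicator B \<omega> \<partial>M) / ennreal (\<integral>\<omega>. discount q a x \<omega> \<partial>M)"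
proof -
  have "emeasure (restarted_measure q a x) B = (\<integral>\<^sup>+\<omega>. ennreal (discount q a x \<omega> / (\<integral>\<omega>. discount q a x \<omega> \<partial>M)) * indicator B \<omega> \<partial>M)"
    unfolding restarted_measure_def using B by (subst emeasure_density) auto
  also have "\<dots> = (\<integral>\<^sup>+\<omega>. (ennreal (discount q a x \<omega>) * indicator B \<omega>) / ennreal (\<integral>\<omega>. discount q a x \<omega> \<partial>M) \<partial>M)"
    using discount_bounds[OF q, of a x] pos by (intro nn_integral_cong) (auto simp: divide_ennreal indicator_def)
  also have "\<dots> = (\<integral>\<^sup>+\<omega>. ennreal (discount q a x \<omega>) * indicator B \<omega> \<partial>M) / ennreal (\<integral>\<omega>. discount q a x \<omega> \<partial>M)"
    using B by (intro nn_integral_divide) auto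
  finally show ?thesis .
qed

text \<open>The content is the independence of increments under the new measure: for B in the
  stopped sigma-algebra, \<open>strong_markov\<close> is applied with the discount times the
  indicator of B as weight, and both sides are divided by the mean discount.\<close>

theorem restarted_process:
  assumes q: "0 \<le> q" and pos: "0 < (\<integral>\<omega>. discount q a x \<omega> \<partial>M)"
  shows "increment_process (restarted_measure q a x) (shifted a x) (stopped_filtration a x) K"
proof -
  let ?M = "restarted_measure q a x" and ?a = "\<integral>\<omega>. discount q a x \<omega> \<partial>M"
  have sp: "space ?M = space M" unfolding restarted_measure_def by simp
  have a_eq: "(\<integral>\<^sup>+\<omega>. ennreal (discount q a x \<omega>) \<partial>M) = ennreal ?a"
    using discount_bounds[OF q] by (intro nn_integral_eq_integral integrable_discount[OF q]) auto
  have prob: "emeasure ?M (space ?M) = 1"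
    unfolding sp emeasure_restarted[OF q pos sets.top]
    using pos a_eq by (simp add: divide_ennreal cong: nn_integral_cong_simp)
  show ?thesis
  proof (intro increment_process.intro adapted_process.intro increment_process_axioms.intro)
    show "prob_space ?M" by (rule prob_spaceI) (rule prob)
    show "good_path (\<lambda>t. shifted a x t \<omega>)" if "\<omega> \<in> space ?M" for \<omega>
      using that good_shifted_path unfolding sp by blast
    show "shifted a x 0 \<omega> = 0" for \<omega> by (rule shifted_0)
    show "subalgebra ?M (stopped_filtration a x t)" if "0 \<le> t" for t
      unfolding subalgebra_def space_stopped_filtration sets_stopped_filtration[OF that] sets_restarted_measure sp
      unfolding stopped_sets_def by auto
    show "sets (stopped_filtration a x s) \<subseteq> sets (stopped_filtration a x t)" if st: "0 \<le> s" "s \<le> t" for s t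
    proof
      have t: "0 \<le> t" using st by simp
      fix B assume "B \<in> sets (stopped_filtration a x s)"
      then have B: "B \<in> sets M" "\<And>u. 0 < u \<Longrightarrow> B \<inter> {\<omega>\<in>paid_event a x. shift_time a x \<omega> + s < u} \<in> sets (F u)"
        unfolding sets_stopped_filtration[OF st(1)] stopped_sets_def by auto
      have "B \<inter> {\<omega>\<in>paid_event a x. shift_time a x \<omega> + t < u} \<in> sets (F u)" if u: "0 < u" for u
      proof -
        have eq: "{\<omega>\<in>paid_event a x. shift_time a x \<omega> + t < u} = {\<omega>\<in>paid_event a x. shift_time a x \<omega> + s < u - (t - s)}" by auto
        show ?thesis
        proof (cases "0 < u - (t - s)")
          case True
          then show ?thesis unfolding eq using B(2)[OF True] F_mono[of "u - (t - s)" u] st by auto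
        next
          case False
          have "\<not> shift_time a x \<omega> + s < u - (t - s)" for \<omega>
            using False shift_time_nonneg[of a x \<omega>] st(1) by linarith
          then have "{\<omega>\<in>paid_event a x. shift_time a x \<omega> + s < u - (t - s)} = {}" by blast
          then show ?thesis unfolding eq by (simp only: Int_empty_right sets.empty_sets)
        qed
      qed
      then show "B \<in> sets (stopped_filtration a x t)"
        unfolding sets_stopped_filtration[OF t] stopped_sets_def using B(1) by simp
    qed
    show "shifted a x t \<in> borel_measurable (stopped_filtration a x t)" if "0 \<le> t" for t
      by (rule shifted_stopped_measurable[OF that])
    show "prob_space (K r)" "sets (K r) = sets borel" if "0 \<le> r" for r
      using K_prob[OF that] K_sets[OF that] by auto
    show "emeasure ?M (B \<inter> {\<omega>\<in>space ?M. shifted a x (s + r) \<omega> - shifted a x s \<omega> \<in> C}) = emeasure ?M B * emeasure (K r) C"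
      if s: "0 \<le> s" and r: "0 \<le> r" and "B \<in> sets (stopped_filtration a x s)" and C: "C \<in> sets borel" for s r B C
    proof -
      have B: "B \<in> sets M" "\<And>u. 0 < u \<Longrightarrow> B \<inter> {\<omega>\<in>paid_event a x. shift_time a x \<omega> + s < u} \<in> sets (F u)"
        using \<open>B \<in> sets (stopped_filtration a x s)\<close> unfolding sets_stopped_filtration[OF s] stopped_sets_def by auto
      note [measurable] = B(1)
      let ?S = "\<lambda>\<omega>. shift_time a x \<omega> + s"
      let ?\<zeta> = "\<lambda>\<omega>. discount q a x \<omega> * indicator B \<omega>"
      have diff: "shifted a x (s + r) \<omega> - shifted a x s \<omega> = X (?S \<omega> + r) \<omega> - X (?S \<omega>) \<omega>" for \<omega>
        unfolding shifted_def by (simp add: add.assoc)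
      have [measurable]: "(\<lambda>\<omega>. shifted a x (s + r) \<omega> - shifted a x s \<omega>) \<in> borel_measurable M"
        using s r by (intro borel_measurable_diff shifted_measurable) auto
      have sm: "(\<integral>\<^sup>+\<omega>. ennreal (?\<zeta> \<omega>) * indicator C (X (?S \<omega> + r) \<omega> - X (?S \<omega>) \<omega>) \<partial>M) = (\<integral>\<^sup>+\<omega>. ennreal (?\<zeta> \<omega>) \<partial>M) * emeasure (K r) C"
      proof (rule strong_markov[OF _ _ r _ _ _ _ C])
        show "?S \<in> borel_measurable M" by measurable
        show "0 \<le> ?S \<omega>" for \<omega> using shift_time_nonneg[of a x \<omega>] s by simp
        show "?\<zeta> \<in> borel_measurable M" by measurable
        show "0 \<le> ?\<zeta> \<omega>" "?\<zeta> \<omega> \<le> 1" for \<omega> using discount_bounds[OF q, of a x \<omega>] by (auto simp: indicator_def)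
        fix u :: real assume u: "0 < u"
        \<comment> \<open>On the event in question T is the payment time itself, so there the
          discount is a function of a variable known at time u.\<close>
        define T where "T \<omega> = (if \<omega> \<in> paid_event a x \<and> shift_time a x \<omega> + s < u then shift_time a x \<omega> else 0)" for \<omega>
        have Tm: "T \<in> borel_measurable (F u)" unfolding T_def by (rule stopped_time_measurable[OF u s])
        have ind: "(indicator (B \<inter> {\<omega>\<in>paid_event a x. shift_time a x \<omega> + s < u}) :: 'a \<Rightarrow> real) \<in> borel_measurable (F u)"
          by (rule borel_measurable_indicator[OF B(2)[OF u]])
        have "(\<lambda>\<omega>. if ?S \<omega> < u then ?\<zeta> \<omega> else 0) = (\<lambda>\<omega>. exp (- q * T \<omega>) * indicator (B \<inter> {\<omega>\<in>paid_event a x. shift_time a x \<omega> + s < u}) \<omega>)"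
          unfolding T_def discount_def by (auto simp: fun_eq_iff indicator_def)
        also have "\<dots> \<in> borel_measurable (F u)"
          using Tm ind by (intro borel_measurable_times borel_measurable_exp[THEN measurable_compose[rotated]] borel_measurable_const) auto
        finally show "(\<lambda>\<omega>. if ?S \<omega> < u then ?\<zeta> \<omega> else 0) \<in> borel_measurable (F u)" .
      qed
      have \<zeta>: "ennreal (?\<zeta> \<omega>) = ennreal (discount q a x \<omega>) * indicator B \<omega>" for \<omega>
        by (simp add: indicator_def)
      have D: "B \<inter> {\<omega>\<in>space M. shifted a x (s + r) \<omega> - shifted a x s \<omega> \<in> C} \<in> sets M"
        using C by measurable
      have "emeasure ?M (B \<inter> {\<omega>\<in>space ?M. shifted a x (s + r) \<omega> - shifted a x s \<omega> \<in> C})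
        = (\<integral>\<^sup>+\<omega>. ennreal (discount q a x \<omega>) * indicator (B \<inter> {\<omega>\<in>space M. shifted a x (s + r) \<omega> - shifted a x s \<omega> \<in> C}) \<omega> \<partial>M) / ennreal ?a"
        unfolding sp by (rule emeasure_restarted[OF q pos D])
      also have "(\<integral>\<^sup>+\<omega>. ennreal (discount q a x \<omega>) * indicator (B \<inter> {\<omega>\<in>space M. shifted a x (s + r) \<omega> - shifted a x s \<omega> \<in> C}) \<omega> \<partial>M)
        = (\<integral>\<^sup>+\<omega>. ennreal (?\<zeta> \<omega>) * indicator C (X (?S \<omega> + r) \<omega> - X (?S \<omega>) \<omega>) \<partial>M)"
        unfolding diff[symmetric] by (intro nn_integral_cong) (auto simp: indicator_def)
      also have "\<dots> / ennreal ?a = (\<integral>\<^sup>+\<omega>. ennreal (?\<zeta> \<omega>) \<partial>M) / ennreal ?a * emeasure (K r) C"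
        unfolding sm by (simp add: divide_ennreal_def mult.assoc mult.commute mult.left_commute)
      also have "(\<integral>\<^sup>+\<omega>. ennreal (?\<zeta> \<omega>) \<partial>M) / ennreal ?a = emeasure ?M B"
        unfolding \<zeta> by (rule emeasure_restarted[OF q pos B(1), symmetric])
      finally show ?thesis .
    qed
  qed
qed

lemma integral_restarted:
  fixes g :: "'a \<Rightarrow> real"
  assumes q: "0 \<le> q" and pos: "0 < (\<integral>\<omega>. discount q a x \<omega> \<partial>M)" and g: "g \<in> borel_measurable M"
  shows "(\<integral>\<omega>. discount q a x \<omega> * g \<omega> \<partial>M) = (\<integral>\<omega>. discount q a x \<omega> \<partial>M) * (\<integral>\<omega>. g \<omega> \<partial>restarted_measure q a x)"
    and "integrable (restarted_measure q a x) g \<Longrightarrow> integrable M (\<lambda>\<omega>. discount q a x \<omega> * g \<omega>)"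
proof -
  let ?a = "\<integral>\<omega>. discount q a x \<omega> \<partial>M"
  note [measurable] = g
  have nn: "AE \<omega> in M. 0 \<le> discount q a x \<omega> / ?a" using discount_bounds[OF q, of a x] pos by auto
  have eq: "(\<integral>\<omega>. g \<omega> \<partial>restarted_measure q a x) = (\<integral>\<omega>. (discount q a x \<omega> / ?a) *\<^sub>R g \<omega> \<partial>M)"
    unfolding restarted_measure_def by (rule integral_density[OF g _ nn]) measurable
  have "\<dots> = (\<integral>\<omega>. (1 / ?a) * (discount q a x \<omega> * g \<omega>) \<partial>M)" by (intro Bochner_Integration.integral_cong) auto
  also have "\<dots> = (1 / ?a) * (\<integral>\<omega>. discount q a x \<omega> * g \<omega> \<partial>M)" by (rule integral_mult_right_zero)
  finally show "(\<integral>\<omega>. discount q a x \<omega> * g \<omega> \<partial>M) = ?a * (\<integral>\<omega>. g \<omega> \<partial>restarted_measure q a x)"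
    unfolding eq using pos by simp
  assume "integrable (restarted_measure q a x) g"
  then have "integrable M (\<lambda>\<omega>. (discount q a x \<omega> / ?a) *\<^sub>R g \<omega>)"
    unfolding restarted_measure_def by (subst (asm) integrable_density[OF g _ nn]) measurable
  then have "integrable M (\<lambda>\<omega>. ?a * ((discount q a x \<omega> / ?a) *\<^sub>R g \<omega>))" by (rule integrable_mult_right)
  then show "integrable M (\<lambda>\<omega>. discount q a x \<omega> * g \<omega>)" using pos by simp
qed

lemma discounted_payment_0_eq: "\<omega> \<in> space M \<Longrightarrow> discounted_payment q c1 c2 0 (\<lambda>t. x + X t \<omega>) = discount q c2 x \<omega>"
  unfolding discounted_payment_def discount_def paid_event_def shift_time_def by simp

end

section \<open>The expected net dividends\<close>

context increment_process begin

lemma discounted_payment_Suc_eq: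
  "\<omega> \<in> space M \<Longrightarrow> discounted_payment q c1 c2 (Suc n) (\<lambda>t. x + X t \<omega>) =
    discount q c2 x \<omega> * discounted_payment q c1 c2 n (\<lambda>t. c1 + shifted c2 x t \<omega>)"
  using discounted_payment_Suc[of q c1 c2 n "\<lambda>t. x + X t \<omega>"] discounted_payment_0_eq[of \<omega> q c1 c2 x]
  unfolding restart_eq_shifted by simp

lemma integrable_discounted_payment:
  "0 < q \<Longrightarrow> integrable M (\<lambda>\<omega>. discounted_payment q c1 c2 n (\<lambda>t. x + X t \<omega>))"
  using discounted_payment_nonneg[of q c1 c2 n] discounted_payment_le_1[of q c1 c2 n]
  by (intro integrable_const_bound[where B=1] discounted_payment_measurable[OF adapted_process_axioms]) auto

lemma integral_discounted_payment_0:
  "(\<integral>\<omega>. discounted_payment q c1 c2 0 (\<lambda>t. x + X t \<omega>) \<partial>M) = (\<integral>\<omega>. discount q c2 x \<omega> \<partial>M)"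
  by (intro Bochner_Integration.integral_cong refl discounted_payment_0_eq)

lemma discount_AE_zero:
  assumes "0 \<le> q" "\<not> 0 < (\<integral>\<omega>. discount q a x \<omega> \<partial>M)"
  shows "AE \<omega> in M. discount q a x \<omega> = 0"
proof -
  have "0 \<le> (\<integral>\<omega>. discount q a x \<omega> \<partial>M)" using discount_bounds[OF assms(1)] by (intro integral_nonneg_AE) auto
  then have "(\<integral>\<omega>. discount q a x \<omega> \<partial>M) = 0" using assms(2) by linarith
  then show ?thesis
    using discount_bounds[OF assms(1)] by (subst (asm) integral_nonneg_eq_0_iff_AE[OF integrable_discount[OF assms(1)]]) auto
qed

text \<open>If the mean discount is 0, the weighted measure cannot be normalised; but then almost
  surely not even the first payment is made before ruin, and all these expectations vanish.\<close>

lemma integral_discounted_payment_Suc: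
  assumes q: "0 < q"
  shows "0 < (\<integral>\<omega>. discount q c2 x \<omega> \<partial>M) \<Longrightarrow> (\<integral>\<omega>. discounted_payment q c1 c2 (Suc n) (\<lambda>t. x + X t \<omega>) \<partial>M)
      = (\<integral>\<omega>. discount q c2 x \<omega> \<partial>M) * (\<integral>\<omega>. discounted_payment q c1 c2 n (\<lambda>t. c1 + shifted c2 x t \<omega>) \<partial>restarted_measure q c2 x)"
    and "\<not> 0 < (\<integral>\<omega>. discount q c2 x \<omega> \<partial>M) \<Longrightarrow> (\<integral>\<omega>. discounted_payment q c1 c2 n (\<lambda>t. x + X t \<omega>) \<partial>M) = 0"
proof -
  have q0: "0 \<le> q" using q by simp
  have eq: "(\<integral>\<omega>. discounted_payment q c1 c2 (Suc n) (\<lambda>t. x + X t \<omega>) \<partial>M)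
    = (\<integral>\<omega>. discount q c2 x \<omega> * discounted_payment q c1 c2 n (\<lambda>t. c1 + shifted c2 x t \<omega>) \<partial>M)" for n
    by (intro Bochner_Integration.integral_cong refl discounted_payment_Suc_eq)
  show "(\<integral>\<omega>. discounted_payment q c1 c2 (Suc n) (\<lambda>t. x + X t \<omega>) \<partial>M)
      = (\<integral>\<omega>. discount q c2 x \<omega> \<partial>M) * (\<integral>\<omega>. discounted_payment q c1 c2 n (\<lambda>t. c1 + shifted c2 x t \<omega>) \<partial>restarted_measure q c2 x)"
    if pos: "0 < (\<integral>\<omega>. discount q c2 x \<omega> \<partial>M)"
    unfolding eq by (rule integral_restarted(1)[OF q0 pos discounted_payment_measurable[OF adapted_process_shifted]])
  assume n: "\<not> 0 < (\<integral>\<omega>. discount q c2 x \<omega> \<partial>M)"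
  show "(\<integral>\<omega>. discounted_payment q c1 c2 n (\<lambda>t. x + X t \<omega>) \<partial>M) = 0"
  proof (rule integral_eq_zero_AE)
    show "AE \<omega> in M. discounted_payment q c1 c2 n (\<lambda>t. x + X t \<omega>) = 0"
      using discount_AE_zero[OF q0 n] AE_space
    proof eventually_elim
      case (elim \<omega>)
      then show ?case
        by (cases n) (simp_all only: discounted_payment_0_eq discounted_payment_Suc_eq mult_zero_left)
    qed
  qed
qed

end

text \<open>A payment brings the surplus down to c1, so c2 - c1 - amount is c2 minus the surplus
  just before payment n. This is the argument of h in \<open>first_payment\<close>.\<close>

definition discounted_reward :: "real \<Rightarrow> real \<Rightarrow> real \<Rightarrow> (real \<Rightarrow> real) \<Rightarrow> nat \<Rightarrow> (real \<Rightarrow> real) \<Rightarrow> real" where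
  "discounted_reward q c1 c2 h n f = discounted_payment q c1 c2 n f * h (c2 - c1 - paid_amount c1 c2 n f)"

lemma discounted_reward_Suc:
  "discounted_reward q c1 c2 h (Suc n) f = discounted_payment q c1 c2 0 f * discounted_reward q c1 c2 h n (restart c1 c2 f)"
  unfolding discounted_reward_def discounted_payment_Suc[of q c1 c2 n] by simp

lemma discounted_reward_measurable:
  assumes "adapted_process M X F" and h: "h \<in> borel_measurable borel"
  shows "(\<lambda>\<omega>. discounted_reward q c1 c2 h n (\<lambda>t. x + X t \<omega>)) \<in> borel_measurable M"
proof -
  note [measurable] = discounted_payment_measurable[OF assms(1)] h paid_measurable[OF assms(1), THEN conjunct2, THEN conjunct2]
  show ?thesis unfolding discounted_reward_def by measurable
qed

text \<open>The analytic assumptions concern K alone, and K survives the restart.\<close>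

lemma harmonic_process_restarted:
  assumes "harmonic_process M X F K q \<Lambda> C h k"
    and pos: "0 < (\<integral>\<omega>. increment_process.discount M X q a x \<omega> \<partial>M)"
  shows "harmonic_process (increment_process.restarted_measure M X q a x) (adapted_process.shifted X a x)
     (increment_process.stopped_filtration M X F a x) K q \<Lambda> C h k"
proof -
  interpret harmonic_process M X F K q \<Lambda> C h k by fact
  show ?thesis
    by (intro harmonic_process.intro restarted_process[OF less_imp_le[OF q_pos] pos] harmonic_kernel_axioms)
qed

text \<open>The bound \<open>\<rho>\<close> is assumed for every process with these kernels, because
  each restart produces a new one. From c1 every payment contributes a factor \<open>\<rho>\<close>;
  from x the first payment contributes a factor at most 1, hence the exponent n instead of n +
  1.\<close>

lemma expected_discount_bound:
  assumes hp: "harmonic_process M X F K q \<Lambda> C h k"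
    and \<rho>: "0 \<le> \<rho>" "\<And>(M :: 'a measure) X F. harmonic_process M X F K q \<Lambda> C h k \<Longrightarrow>
      (\<integral>\<omega>. discounted_payment q c1 c2 0 (\<lambda>t. c1 + X t \<omega>) \<partial>M) \<le> \<rho>"
  shows "(\<integral>\<omega>. discounted_payment q c1 c2 n (\<lambda>t. x + X t \<omega>) \<partial>(M :: 'a measure)) \<le> \<rho> ^ n"
proof -
  have c1: "(\<integral>\<omega>. discounted_payment q c1 c2 n (\<lambda>t. c1 + X t \<omega>) \<partial>M) \<le> \<rho> ^ Suc n"
    if "harmonic_process M X F K q \<Lambda> C h k" for M :: "'a measure" and X F n
    using that
  proof (induction n arbitrary: M X F)
    case 0 then show ?case using \<rho>(2) by simp
  next
    case (Suc n)
    interpret harmonic_process M X F K q \<Lambda> C h k by fact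
    let ?a = "\<integral>\<omega>. discount q c2 c1 \<omega> \<partial>M"
    show ?case
    proof (cases "0 < ?a")
      case True
      have "?a \<le> \<rho>" using \<rho>(2)[OF Suc.prems] unfolding integral_discounted_payment_0 .
      moreover have "(\<integral>\<omega>. discounted_payment q c1 c2 n (\<lambda>t. c1 + shifted c2 c1 t \<omega>) \<partial>restarted_measure q c2 c1) \<le> \<rho> ^ Suc n"
        by (rule Suc.IH[OF harmonic_process_restarted[OF Suc.prems True]])
      ultimately have "?a * (\<integral>\<omega>. discounted_payment q c1 c2 n (\<lambda>t. c1 + shifted c2 c1 t \<omega>) \<partial>restarted_measure q c2 c1) \<le> \<rho> * \<rho> ^ Suc n"
        using \<rho>(1) discounted_payment_nonneg by (intro mult_mono integral_nonneg_AE AE_I2) auto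
      then show ?thesis unfolding integral_discounted_payment_Suc(1)[OF q_pos True] by simp
    next
      case False
      then show ?thesis using integral_discounted_payment_Suc(2)[OF q_pos False, of c1 "Suc n"] \<rho>(1) by simp
    qed
  qed
  interpret harmonic_process M X F K q \<Lambda> C h k by fact
  let ?a = "\<integral>\<omega>. discount q c2 x \<omega> \<partial>M"
  have a1: "?a \<le> 1"
    using integral_mono[OF integrable_discount[of q c2 x] integrable_const[of 1]] discount_bounds[of q c2 x] q_pos
    by (simp add: prob_space)
  show ?thesis
  proof (cases n)
    case 0
    then show ?thesis using a1 unfolding 0 integral_discounted_payment_0 by simp
  next
    case (Suc m)
    show ?thesis
    proof (cases "0 < ?a")
      case True
      have "(\<integral>\<omega>. discounted_payment q c1 c2 m (\<lambda>t. c1 + shifted c2 x t \<omega>) \<partial>restarted_measure q c2 x) \<le> \<rho> ^ Suc m"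
        by (rule c1[OF harmonic_process_restarted[OF hp True]])
      then have "?a * (\<integral>\<omega>. discounted_payment q c1 c2 m (\<lambda>t. c1 + shifted c2 x t \<omega>) \<partial>restarted_measure q c2 x) \<le> 1 * \<rho> ^ Suc m"
        using a1 discounted_payment_nonneg by (intro mult_mono integral_nonneg_AE AE_I2) auto
      then show ?thesis unfolding Suc integral_discounted_payment_Suc(1)[OF q_pos True] by simp
    next
      case False
      then show ?thesis using integral_discounted_payment_Suc(2)[OF q_pos False, of c1 n] \<rho>(1) by simp
    qed
  qed
qed

text \<open>Payment m + 1 is the first payment of the process restarted at payment m, and that
  process starts at c1. Hence \<open>first_payment\<close> contributes h (c2 - c1), and the weights
  of the restarts multiply to the mean discount of payment m.\<close>

lemma expected_reward:
  assumes hp: "harmonic_process M X F K q \<Lambda> C h k" and x: "0 \<le> x"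
    and c: "0 \<le> c1" "c1 < c2" and hc: "h c2 = 0" and h_neg: "\<And>y. y \<le> 0 \<Longrightarrow> h y = h0 - y"
  shows "integrable M (\<lambda>\<omega>. discounted_reward q c1 c2 h n (\<lambda>t. x + X t \<omega>)) \<and>
    (\<integral>\<omega>. discounted_reward q c1 c2 h n (\<lambda>t. x + X t \<omega>) \<partial>M) =
      (case n of 0 \<Rightarrow> h (c2 - x) | Suc m \<Rightarrow> (\<integral>\<omega>. discounted_payment q c1 c2 m (\<lambda>t. x + X t \<omega>) \<partial>M) * h (c2 - c1))"
  using hp x
proof (induction n arbitrary: M X F x)
  case 0
  interpret harmonic_process M X F K q \<Lambda> C h k by fact
  have c2: "0 < c2" using c by simp
  have eq: "discounted_reward q c1 c2 h 0 f = (if first_paid c2 f then exp (- q * hit_time c2 f) * h (c2 - f (hit_time c2 f)) else 0)" for f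
    unfolding discounted_reward_def discounted_payment_def by (simp add: algebra_simps)
  show ?case
    using first_payment[OF 0(2) hc c2 h_neg] unfolding eq by simp
next
  case (Suc n)
  interpret harmonic_process M X F K q \<Lambda> C h k by fact
  let ?a = "\<integral>\<omega>. discount q c2 x \<omega> \<partial>M"
  have q0: "0 \<le> q" using q_pos by simp
  have eq: "discounted_reward q c1 c2 h (Suc n) (\<lambda>t. x + X t \<omega>) = discount q c2 x \<omega> * discounted_reward q c1 c2 h n (\<lambda>t. c1 + shifted c2 x t \<omega>)"
    if "\<omega> \<in> space M" for \<omega>
    unfolding discounted_reward_Suc restart_eq_shifted discounted_payment_0_eq[OF that] ..
  show ?case
  proof (cases "0 < ?a")
    case True
    note hp' = harmonic_process_restarted[OF Suc.prems(1) True]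
    note IH = Suc.IH[OF hp' c(1)]
    note R = integral_restarted[OF q0 True discounted_reward_measurable[OF adapted_process_shifted h_borel], of q c1 c2 n c1 c2 x]
    have "integrable M (\<lambda>\<omega>. discount q c2 x \<omega> * discounted_reward q c1 c2 h n (\<lambda>t. c1 + shifted c2 x t \<omega>))"
      by (rule R(2)) (use IH in blast)
    then have i: "integrable M (\<lambda>\<omega>. discounted_reward q c1 c2 h (Suc n) (\<lambda>t. x + X t \<omega>))"
      by (subst Bochner_Integration.integrable_cong[OF refl eq])
    have "(\<integral>\<omega>. discounted_reward q c1 c2 h (Suc n) (\<lambda>t. x + X t \<omega>) \<partial>M)
      = (\<integral>\<omega>. discount q c2 x \<omega> * discounted_reward q c1 c2 h n (\<lambda>t. c1 + shifted c2 x t \<omega>) \<partial>M)"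
      by (intro Bochner_Integration.integral_cong refl eq)
    also have "\<dots> = ?a * (\<integral>\<omega>. discounted_reward q c1 c2 h n (\<lambda>t. c1 + shifted c2 x t \<omega>) \<partial>restarted_measure q c2 x)"
      by (rule R(1))
    also have "\<dots> = (\<integral>\<omega>. discounted_payment q c1 c2 n (\<lambda>t. x + X t \<omega>) \<partial>M) * h (c2 - c1)"
    proof (cases n)
      case 0
      then show ?thesis using IH unfolding 0 integral_discounted_payment_0 by simp
    next
      case (Suc m)
      then show ?thesis using IH unfolding Suc integral_discounted_payment_Suc(1)[OF q_pos True] by simp
    qed
    finally show ?thesis using i by simp
  next
    case False
    have z: "AE \<omega> in M. discounted_reward q c1 c2 h (Suc n) (\<lambda>t. x + X t \<omega>) = 0"
      using discount_AE_zero[OF q0 False] AE_space by eventually_elim (simp only: eq mult_zero_left)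
    have m: "(\<lambda>\<omega>. discounted_reward q c1 c2 h (Suc n) (\<lambda>t. x + X t \<omega>)) \<in> borel_measurable M"
      by (rule discounted_reward_measurable[OF adapted_process_axioms h_borel])
    have "integrable M (\<lambda>\<omega>. discounted_reward q c1 c2 h (Suc n) (\<lambda>t. x + X t \<omega>))"
      using z by (intro integrable_cong_AE_imp[OF integrable_zero m]) auto
    moreover have "(\<integral>\<omega>. discounted_reward q c1 c2 h (Suc n) (\<lambda>t. x + X t \<omega>) \<partial>M) = 0"
      by (rule integral_eq_zero_AE[OF z])
    ultimately show ?thesis using integral_discounted_payment_Suc(2)[OF q_pos False, of c1 n] by simp
  qed
qed

text \<open>At a payment h equals v - \<beta> + amount, so a discounted net payment is the reward
  minus v times the discount factor. Summing expectations gives h (c2 - x) + h (c2 - c1) A - v A.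
  Here v is a free number; that it is the value at c1 enters only in
  \<open>mainTheorem3\<close>.\<close>

theorem expected_net_dividends:
  assumes hp: "harmonic_process M X F K q \<Lambda> C h k" and x: "0 \<le> x"
    and c: "0 \<le> c1" "c1 < c2" and hc: "h c2 = 0" and h_neg: "\<And>y. y \<le> 0 \<Longrightarrow> h y = v + c2 - c1 - \<beta> - y" and \<beta>: "0 \<le> \<beta>"
  defines "A \<equiv> \<lambda>x. \<Sum>n. \<integral>\<omega>. discounted_payment q c1 c2 n (\<lambda>t. x + X t \<omega>) \<partial>M"
  obtains g where "g \<in> borel_measurable M" "AE \<omega> in M. net_dividends q \<beta> c1 c2 (\<lambda>t. x + X t \<omega>) = g \<omega>"
    "(\<integral>\<omega>. g \<omega> \<partial>M) = h (c2 - x) + (h (c2 - c1) - v) * A x" "0 \<le> A x"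
proof -
  interpret harmonic_process M X F K q \<Lambda> C h k by fact
  let ?f = "\<lambda>\<omega> t. x + X t \<omega>"
  define dp where "dp n \<omega> = discounted_payment q c1 c2 n (?f \<omega>)" for n \<omega>
  define rw where "rw n \<omega> = discounted_reward q c1 c2 h n (?f \<omega>)" for n \<omega>
  define a where "a n = (\<integral>\<omega>. dp n \<omega> \<partial>M)" for n
  define e where "e n = (\<integral>\<omega>. rw n \<omega> \<partial>M)" for n
  define amt where "amt n \<omega> = paid_amount c1 c2 n (?f \<omega>)" for n \<omega>
  have d: "0 < (c2 - c1) / 4" using c by simp
  obtain \<delta> where \<delta>: "0 < \<delta>" "\<forall>r. 0 \<le> r \<and> r \<le> \<delta> \<longrightarrow> measure (K r) {z. (c2 - c1) / 4 < \<bar>z\<bar>} \<le> 1/8"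
    using K_small[OF d] by auto
  have small: "measure (K r) {z. (c2 - c1) / 4 < \<bar>z\<bar>} \<le> 1/8" if "0 \<le> r" "r \<le> \<delta>" for r
    using \<delta>(2)[rule_format, OF conjI[OF that]] .
  \<comment> \<open>The bound of \<open>first_payment_discount\<close> for a start at c1 and barrier
    c2, which explains the threshold (c2 - c1) / 4 above.\<close>
  define \<rho> where "\<rho> = exp (- q * \<delta>) + (1 - exp (- q * \<delta>)) / 4"
  have e1: "0 < exp (- q * \<delta>)" "exp (- q * \<delta>) < 1" using q_pos \<delta>(1) by auto
  have "0 \<le> E + (1 - E) / 4 \<and> E + (1 - E) / 4 < 1" if "0 < E" "E < 1" for E :: real
    using that by (simp add: field_simps)
  from this[OF e1] have \<rho>: "0 \<le> \<rho>" "\<rho> < 1" unfolding \<rho>_def by blast+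
  have a_le: "a n \<le> \<rho> ^ n" for n
    unfolding a_def dp_def
  proof (rule expected_discount_bound[OF hp \<rho>(1)])
    fix M :: "'a measure" and X F assume "harmonic_process M X F K q \<Lambda> C h k"
    then interpret P: harmonic_process M X F K q \<Lambda> C h k .
    show "(\<integral>\<omega>. discounted_payment q c1 c2 0 (\<lambda>t. c1 + X t \<omega>) \<partial>M) \<le> \<rho>"
      unfolding \<rho>_def discounted_payment_def paid.simps paid_time.simps
      by (rule P.first_payment_discount[OF \<delta>(1) small c(2)])
  qed
  have a_nonneg: "0 \<le> a n" for n
    unfolding a_def dp_def using discounted_payment_nonneg by (intro integral_nonneg_AE AE_I2) auto
  have a_sum: "summable a"
    by (rule summable_comparison_test'[OF summable_geometric[of \<rho>], of 0]) (use \<rho> a_le a_nonneg in auto)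
  have A: "A x = suminf a" unfolding A_def a_def dp_def ..
  have dp_int: "integrable M (dp n)" for n
    unfolding dp_def by (rule integrable_discounted_payment[OF q_pos])
  have rw_int: "integrable M (rw n)" for n
    unfolding rw_def using expected_reward[OF hp x c hc h_neg, of n] by blast
  have e: "e 0 = h (c2 - x)" "e (Suc n) = a n * h (c2 - c1)" for n
    unfolding e_def rw_def a_def dp_def
    using expected_reward[OF hp x c hc h_neg, of 0] expected_reward[OF hp x c hc h_neg, of "Suc n"] by auto
  have rw_eq: "rw n \<omega> = dp n \<omega> * (v - \<beta> + amt n \<omega>)" "0 \<le> dp n \<omega> * amt n \<omega>" if "\<omega> \<in> space M" for n \<omega>
  proof -
    have "rw n \<omega> = dp n \<omega> * (v - \<beta> + amt n \<omega>) \<and> 0 \<le> dp n \<omega> * amt n \<omega>"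
    proof (cases "paid c1 c2 n (?f \<omega>)")
      case True
      have am: "c2 - c1 \<le> amt n \<omega>" unfolding amt_def by (rule paid_eq(3)[OF good_shifted[OF that] c True])
      then have h': "h (c2 - c1 - amt n \<omega>) = v + c2 - c1 - \<beta> - (c2 - c1 - amt n \<omega>)" by (intro h_neg) simp
      have "rw n \<omega> = dp n \<omega> * (v - \<beta> + amt n \<omega>)"
        unfolding rw_def discounted_reward_def dp_def[symmetric] amt_def[symmetric] h' by (simp add: algebra_simps)
      moreover have "0 \<le> dp n \<omega>" unfolding dp_def by (rule discounted_payment_nonneg)
      ultimately show ?thesis using am c by simp
    next
      case False
      then have "dp n \<omega> = 0" unfolding dp_def discounted_payment_def by simp
      then show ?thesis unfolding rw_def discounted_reward_def dp_def[symmetric] by simp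
    qed
    then show "rw n \<omega> = dp n \<omega> * (v - \<beta> + amt n \<omega>)" "0 \<le> dp n \<omega> * amt n \<omega>" by auto
  qed
  \<comment> \<open>On the sample space P is the discounted amount before costs. It is nonnegative,
    so finite expectations give almost sure summability, and the signed series S below inherits
    absolute summability from it.\<close>
  define P where "P n \<omega> = rw n \<omega> + (\<beta> - v) * dp n \<omega>" for n \<omega>
  have P_eq: "P n \<omega> = dp n \<omega> * amt n \<omega>" if "\<omega> \<in> space M" for n \<omega>
    unfolding P_def rw_eq(1)[OF that] by (simp add: algebra_simps)
  have P_nonneg: "0 \<le> P n \<omega>" if "\<omega> \<in> space M" for n \<omega>
    using P_eq[OF that] rw_eq(2)[OF that] by simp
  have P_int: "integrable M (P n)" for n
    unfolding P_def using rw_int dp_int by simp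
  have P_val: "(\<integral>\<omega>. P n \<omega> \<partial>M) = e n + (\<beta> - v) * a n" for n
    unfolding P_def e_def a_def using rw_int dp_int by simp
  have e_sum: "summable e"
    using summable_mult2[OF a_sum, of "h (c2 - c1)"] e(2) by (subst summable_Suc_iff[symmetric]) simp
  have P_sum: "summable (\<lambda>n. \<integral>\<omega>. P n \<omega> \<partial>M)"
    unfolding P_val by (intro summable_add e_sum summable_mult a_sum)
  have AE_sum: "AE \<omega> in M. summable (\<lambda>n. P n \<omega>)"
  proof -
    have [measurable]: "P n \<in> borel_measurable M" for n using P_int by simp
    have "(\<integral>\<^sup>+\<omega>. (\<Sum>n. ennreal (P n \<omega>)) \<partial>M) = (\<Sum>n. \<integral>\<^sup>+\<omega>. ennreal (P n \<omega>) \<partial>M)"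
      by (rule nn_integral_suminf) measurable
    also have "\<dots> = (\<Sum>n. ennreal (\<integral>\<omega>. P n \<omega> \<partial>M))"
      using P_nonneg by (intro suminf_cong nn_integral_eq_integral P_int AE_I2)
    also have "\<dots> = ennreal (\<Sum>n. \<integral>\<omega>. P n \<omega> \<partial>M)"
      using P_nonneg by (intro suminf_ennreal2 P_sum integral_nonneg_AE AE_I2)
    finally have "(\<integral>\<^sup>+\<omega>. (\<Sum>n. ennreal (P n \<omega>)) \<partial>M) \<noteq> \<infinity>" by simp
    then have "AE \<omega> in M. (\<Sum>n. ennreal (P n \<omega>)) \<noteq> \<infinity>" by (intro nn_integral_noteq_infinite) measurable
    then show ?thesis using AE_space
    proof eventually_elim
      case (elim \<omega>)
      then show ?case using P_nonneg by (intro summable_suminf_not_top) (auto simp: top_unique)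
    qed
  qed
  have dp_nonneg: "0 \<le> \<beta> * dp n \<omega>" for n \<omega>
    unfolding dp_def by (intro mult_nonneg_nonneg \<beta> discounted_payment_nonneg)
  define S where "S n \<omega> = rw n \<omega> - v * dp n \<omega>" for n \<omega>
  have S_P: "S n \<omega> = P n \<omega> - \<beta> * dp n \<omega>" for n \<omega> unfolding S_def P_def by (simp add: algebra_simps)
  have S_int: "integrable M (S n)" for n unfolding S_def using rw_int dp_int by simp
  have nd: "AE \<omega> in M. net_dividends q \<beta> c1 c2 (?f \<omega>) = (\<Sum>n. S n \<omega>) \<and> summable (\<lambda>n. norm (S n \<omega>))"
    using AE_sum AE_space
  proof eventually_elim
    case (elim \<omega>)
    have eq1: "(\<lambda>n. if paid c1 c2 n (?f \<omega>) then exp (- q * paid_time c1 c2 n (?f \<omega>)) * paid_amount c1 c2 n (?f \<omega>) else 0) = (\<lambda>n. P n \<omega>)"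
    proof
      fix n show "(if paid c1 c2 n (?f \<omega>) then exp (- q * paid_time c1 c2 n (?f \<omega>)) * paid_amount c1 c2 n (?f \<omega>) else 0) = P n \<omega>"
        unfolding P_eq[OF elim(2)] dp_def discounted_payment_def amt_def
        by (cases "paid c1 c2 n (?f \<omega>)") (simp_all only: if_True if_False mult_zero_left)
    qed
    have eq2: "(\<lambda>n. if paid c1 c2 n (?f \<omega>) then exp (- q * paid_time c1 c2 n (?f \<omega>)) * (paid_amount c1 c2 n (?f \<omega>) - \<beta>) else 0) = (\<lambda>n. S n \<omega>)"
    proof
      fix n show "(if paid c1 c2 n (?f \<omega>) then exp (- q * paid_time c1 c2 n (?f \<omega>)) * (paid_amount c1 c2 n (?f \<omega>) - \<beta>) else 0) = S n \<omega>"
        unfolding S_P P_eq[OF elim(2)] dp_def discounted_payment_def amt_def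
        by (cases "paid c1 c2 n (?f \<omega>)")
           (simp_all only: if_True if_False mult_zero_left mult_zero_right right_diff_distrib mult.commute[of \<beta>] diff_zero)
    qed
    have eq3: "(\<lambda>n. if paid c1 c2 n (?f \<omega>) then exp (- q * paid_time c1 c2 n (?f \<omega>)) else 0) = (\<lambda>n. dp n \<omega>)"
      unfolding dp_def discounted_payment_def ..
    have sm: "summable (\<lambda>n. if paid c1 c2 n (?f \<omega>) then exp (- q * paid_time c1 c2 n (?f \<omega>)) * paid_amount c1 c2 n (?f \<omega>) else 0)"
      unfolding eq1 by (rule elim(1))
    note nd = net_dividends_eq_suminf[OF good_shifted[OF elim(2)] c \<beta> sm]
    have "summable (\<lambda>n. P n \<omega> + \<beta> * dp n \<omega>)"
      using nd(2) unfolding eq3 by (rule summable_add[OF elim(1) summable_mult])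
    moreover have "norm (norm (S n \<omega>)) \<le> P n \<omega> + \<beta> * dp n \<omega>" for n
      unfolding S_P real_norm_def abs_idempotent using P_nonneg[OF elim(2), of n] dp_nonneg[of n \<omega>] by linarith
    ultimately have "summable (\<lambda>n. norm (S n \<omega>))"
      by (rule summable_comparison_test'[where N=0])
    then show ?case using nd(1) unfolding eq2 by (rule conjI[rotated])
  qed
  have norm_sum: "summable (\<lambda>n. \<integral>\<omega>. norm (S n \<omega>) \<partial>M)"
  proof (rule summable_comparison_test'[where N=0])
    show "summable (\<lambda>n. (\<integral>\<omega>. P n \<omega> \<partial>M) + \<beta> * a n)" by (intro summable_add P_sum summable_mult a_sum)
    fix n
    have "(\<integral>\<omega>. norm (S n \<omega>) \<partial>M) \<le> (\<integral>\<omega>. P n \<omega> + \<beta> * dp n \<omega> \<partial>M)"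
    proof (rule integral_mono)
      show "integrable M (\<lambda>\<omega>. norm (S n \<omega>))" using S_int by (rule integrable_norm)
      show "integrable M (\<lambda>\<omega>. P n \<omega> + \<beta> * dp n \<omega>)" using P_int dp_int by simp
      fix \<omega> assume "\<omega> \<in> space M"
      then show "norm (S n \<omega>) \<le> P n \<omega> + \<beta> * dp n \<omega>"
        unfolding S_P real_norm_def using P_nonneg[of \<omega> n] dp_nonneg[of n \<omega>] by linarith
    qed
    also have "\<dots> = (\<integral>\<omega>. P n \<omega> \<partial>M) + \<beta> * a n" unfolding a_def using P_int dp_int by simp
    finally show "norm (\<integral>\<omega>. norm (S n \<omega>) \<partial>M) \<le> (\<integral>\<omega>. P n \<omega> \<partial>M) + \<beta> * a n"
      by (simp add: abs_of_nonneg integral_nonneg_AE)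
  qed
  have AE_norm: "AE \<omega> in M. summable (\<lambda>n. norm (S n \<omega>))" using nd by auto
  show ?thesis
  proof (rule that[of "\<lambda>\<omega>. \<Sum>n. S n \<omega>"])
    show "(\<lambda>\<omega>. \<Sum>n. S n \<omega>) \<in> borel_measurable M"
      using integrable_suminf[OF S_int AE_norm norm_sum] by simp
    show "AE \<omega> in M. net_dividends q \<beta> c1 c2 (?f \<omega>) = (\<Sum>n. S n \<omega>)" using nd by auto
    show "0 \<le> A x" unfolding A by (rule suminf_nonneg[OF a_sum a_nonneg])
    have "(\<integral>\<omega>. (\<Sum>n. S n \<omega>) \<partial>M) = (\<Sum>n. \<integral>\<omega>. S n \<omega> \<partial>M)"
      by (rule integral_suminf[OF S_int AE_norm norm_sum])
    also have "\<dots> = (\<Sum>n. e n - v * a n)"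
      unfolding S_def e_def a_def using rw_int dp_int by simp
    also have "\<dots> = suminf e - v * suminf a"
      using suminf_diff[OF e_sum summable_mult[OF a_sum, of v]] suminf_mult[OF a_sum, of v] by simp
    also have "suminf e = e 0 + (\<Sum>n. e (Suc n))" using suminf_split_head[OF e_sum] by simp
    also have "(\<Sum>n. e (Suc n)) = suminf a * h (c2 - c1)" unfolding e(2) by (rule suminf_mult2[OF a_sum, symmetric])
    finally show "(\<integral>\<omega>. (\<Sum>n. S n \<omega>) \<partial>M) = h (c2 - x) + (h (c2 - c1) - v) * A x"
      unfolding A e(1) by (simp add: algebra_simps)
  qed
qed

section \<open>Laplace transforms\<close>

lemma norm_exp_minus_1_le: "norm (exp w - 1) \<le> norm w * exp (norm (w::complex))"
proof -
  have "norm (exp w - (\<Sum>k\<le>0. w ^ k / fact k)) \<le> exp \<bar>Re w\<bar> * norm w ^ Suc 0 / fact 0"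
    by (rule Taylor_exp)
  then have "norm (exp w - 1) \<le> exp \<bar>Re w\<bar> * norm w" by simp
  also have "\<dots> \<le> exp (norm w) * norm w" by (intro mult_right_mono) (auto simp: abs_Re_le_cmod)
  finally show ?thesis by (simp add: mult.commute)
qed

text \<open>Differentiation under the integral sign. The difference quotient costs a factor
  \<bar>y\<bar> exp(\<epsilon> \<bar>y\<bar>), at most exp(2 \<epsilon> \<bar>y\<bar>) / \<epsilon>,
  which is absorbed by moving Re z by 2 \<epsilon>, down for positive y and up for negative y. Both
  shifts stay in the half plane, as \<epsilon> is a quarter of the distance from Re z to s0.\<close>

lemma laplace_holomorphic:
  fixes A :: "real \<Rightarrow> real"
  assumes Am[measurable]: "A \<in> borel_measurable borel" and A0: "\<And>y. 0 \<le> A y"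
    and int: "\<And>s. s0 < s \<Longrightarrow> integrable lborel (\<lambda>y. exp (- s * y) * A y)"
  shows "(\<lambda>z. \<integral>y. exp (- z * complex_of_real y) * complex_of_real (A y) \<partial>lborel) holomorphic_on {z. s0 < Re z}"
    and "\<And>z. s0 < Re z \<Longrightarrow> integrable lborel (\<lambda>y. exp (- z * complex_of_real y) * complex_of_real (A y))"
proof -
  let ?F = "\<lambda>z. \<integral>y. exp (- z * complex_of_real y) * complex_of_real (A y) \<partial>lborel"
  have nrm: "norm (exp (- z * complex_of_real y) * complex_of_real (A y)) = exp (- Re z * y) * A y" for z y
    using A0[of y] by (simp add: norm_mult)
  show i: "integrable lborel (\<lambda>y. exp (- z * complex_of_real y) * complex_of_real (A y))" if "s0 < Re z" for z
    by (rule Bochner_Integration.integrable_bound[OF int[OF that]]) (auto simp: norm_mult A0 abs_of_nonneg)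
  show "?F holomorphic_on {z. s0 < Re z}"
    unfolding holomorphic_on_def
  proof
    fix z assume "z \<in> {z. s0 < Re z}"
    then have z: "s0 < Re z" by simp
    define \<epsilon> where "\<epsilon> = (Re z - s0) / 4"
    have \<epsilon>: "0 < \<epsilon>" "s0 < Re z - 2 * \<epsilon>" "s0 < Re z + 2 * \<epsilon>" using z unfolding \<epsilon>_def by (auto simp: field_simps)
    define w where "w y = (1 / \<epsilon>) * (exp (- (Re z - 2 * \<epsilon>) * y) * A y + exp (- (Re z + 2 * \<epsilon>) * y) * A y)" for y
    have w_int: "integrable lborel w"
      unfolding w_def by (intro integrable_mult_right Bochner_Integration.integrable_add int \<epsilon>)
    let ?D = "\<integral>y. - complex_of_real y * (exp (- z * complex_of_real y) * complex_of_real (A y)) \<partial>lborel"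
    have "(?F has_field_derivative ?D) (at z)"
      unfolding DERIV_def LIMSEQ_SEQ_conv[symmetric]
    proof (intro allI impI)
      fix S :: "nat \<Rightarrow> complex" assume "(\<forall>n. S n \<noteq> 0) \<and> S \<longlonglongrightarrow> 0"
      then have S: "\<And>n. S n \<noteq> 0" "S \<longlonglongrightarrow> 0" by auto
      have "eventually (\<lambda>n. norm (S n) < \<epsilon>) sequentially"
        using S(2) \<epsilon>(1) by (auto simp: tendsto_iff dist_norm)
      then obtain n0 where n0: "\<And>n. n0 \<le> n \<Longrightarrow> norm (S n) < \<epsilon>" unfolding eventually_sequentially by auto
      define G where "G n y = (exp (- (z + S (n + n0)) * complex_of_real y) * complex_of_real (A y)
          - exp (- z * complex_of_real y) * complex_of_real (A y)) / S (n + n0)" for n y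
      have G_eq: "G n y = ((exp (- S (n + n0) * complex_of_real y) - 1) / S (n + n0)) * (exp (- z * complex_of_real y) * complex_of_real (A y))" for n y
      proof -
        have "exp (- (z + S (n + n0)) * complex_of_real y) = exp (- S (n + n0) * complex_of_real y) * exp (- z * complex_of_real y)"
          unfolding mult_exp_exp by (simp add: algebra_simps)
        then show ?thesis unfolding G_def by (simp add: left_diff_distrib diff_divide_distrib)
      qed
      have "(\<lambda>n. \<integral>y. G n y \<partial>lborel) \<longlonglongrightarrow> ?D"
      proof (rule integral_dominated_convergence[where w = w])
        show "(\<lambda>y. - complex_of_real y * (exp (- z * complex_of_real y) * complex_of_real (A y))) \<in> borel_measurable lborel" by measurable
        show "G n \<in> borel_measurable lborel" for n unfolding G_def by measurable
        show "integrable lborel w" by fact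
        show "AE y in lborel. (\<lambda>n. G n y) \<longlonglongrightarrow> - complex_of_real y * (exp (- z * complex_of_real y) * complex_of_real (A y))"
        proof (rule AE_I2)
          fix y
          have "((\<lambda>h. exp (- h * complex_of_real y)) has_field_derivative - complex_of_real y) (at 0)"
            by (auto intro!: derivative_eq_intros)
          then have "(\<lambda>h. (exp (- h * complex_of_real y) - 1) / h) \<midarrow>0\<rightarrow> - complex_of_real y"
            unfolding DERIV_def by simp
          moreover have "filterlim (\<lambda>n. S (n + n0)) (at 0) sequentially"
            using LIMSEQ_ignore_initial_segment[OF S(2), of n0] S(1) by (simp add: filterlim_at)
          ultimately have "(\<lambda>n. (exp (- S (n + n0) * complex_of_real y) - 1) / S (n + n0)) \<longlonglongrightarrow> - complex_of_real y"
            by (rule filterlim_compose)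
          then show "(\<lambda>n. G n y) \<longlonglongrightarrow> - complex_of_real y * (exp (- z * complex_of_real y) * complex_of_real (A y))"
            unfolding G_eq by (intro tendsto_mult tendsto_const)
        qed
        fix n
        show "AE y in lborel. norm (G n y) \<le> w y"
        proof (rule AE_I2)
          fix y
          let ?h = "S (n + n0)"
          have h: "norm ?h < \<epsilon>" by (rule n0) simp
          have "norm ((exp (- ?h * complex_of_real y) - 1) / ?h) \<le> \<bar>y\<bar> * exp (\<epsilon> * \<bar>y\<bar>)"
          proof -
            have "norm (exp (- ?h * complex_of_real y) - 1) \<le> norm (- ?h * complex_of_real y) * exp (norm (- ?h * complex_of_real y))"
              by (rule norm_exp_minus_1_le)
            also have "\<dots> = norm ?h * (\<bar>y\<bar> * exp (norm ?h * \<bar>y\<bar>))" by (simp add: norm_mult)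
            also have "\<dots> \<le> norm ?h * (\<bar>y\<bar> * exp (\<epsilon> * \<bar>y\<bar>))"
              using h by (intro mult_left_mono) (auto intro!: mult_right_mono)
            finally show ?thesis using S(1)[of "n + n0"] by (simp add: norm_divide divide_le_eq mult.commute)
          qed
          also have "\<dots> \<le> (1 / \<epsilon>) * exp (\<epsilon> * \<bar>y\<bar>) * exp (\<epsilon> * \<bar>y\<bar>)"
          proof (rule mult_right_mono)
            have "\<epsilon> * \<bar>y\<bar> \<le> exp (\<epsilon> * \<bar>y\<bar>)" using exp_ge_add_one_self[of "\<epsilon> * \<bar>y\<bar>"] by linarith
            then show "\<bar>y\<bar> \<le> (1 / \<epsilon>) * exp (\<epsilon> * \<bar>y\<bar>)" using \<epsilon>(1) by (simp add: pos_le_divide_eq mult.commute)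
          qed simp
          also have "\<dots> = (1 / \<epsilon>) * exp (2 * \<epsilon> * \<bar>y\<bar>)" by (simp add: mult_exp_exp mult.assoc)
          finally have 1: "norm ((exp (- ?h * complex_of_real y) - 1) / ?h) \<le> (1 / \<epsilon>) * exp (2 * \<epsilon> * \<bar>y\<bar>)" .
          have 2: "exp (2 * \<epsilon> * \<bar>y\<bar>) * exp (- Re z * y) \<le> exp (- (Re z - 2 * \<epsilon>) * y) + exp (- (Re z + 2 * \<epsilon>) * y)"
          proof (cases "0 \<le> y")
            case True
            then have "exp (2 * \<epsilon> * \<bar>y\<bar>) * exp (- Re z * y) = exp (- (Re z - 2 * \<epsilon>) * y)"
              by (simp add: mult_exp_exp algebra_simps)
            then show ?thesis by simp
          next
            case False
            then have "exp (2 * \<epsilon> * \<bar>y\<bar>) * exp (- Re z * y) = exp (- (Re z + 2 * \<epsilon>) * y)"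
              by (simp add: mult_exp_exp algebra_simps)
            then show ?thesis by simp
          qed
          have "norm (G n y) = norm ((exp (- ?h * complex_of_real y) - 1) / ?h) * (exp (- Re z * y) * A y)"
            unfolding G_eq norm_mult[of "(exp (- ?h * complex_of_real y) - 1) / ?h"] nrm ..
          also have "\<dots> \<le> (1 / \<epsilon>) * exp (2 * \<epsilon> * \<bar>y\<bar>) * (exp (- Re z * y) * A y)"
            using 1 A0[of y] by (intro mult_right_mono) auto
          also have "\<dots> = (1 / \<epsilon>) * ((exp (2 * \<epsilon> * \<bar>y\<bar>) * exp (- Re z * y)) * A y)" by simp
          also have "\<dots> \<le> (1 / \<epsilon>) * ((exp (- (Re z - 2 * \<epsilon>) * y) + exp (- (Re z + 2 * \<epsilon>) * y)) * A y)"
            using 2 A0[of y] \<epsilon>(1) by (intro mult_left_mono mult_right_mono) auto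
          also have "\<dots> = w y" unfolding w_def by (simp add: distrib_right)
          finally show "norm (G n y) \<le> w y" .
        qed
      qed
      moreover have "(\<integral>y. G n y \<partial>lborel) = (?F (z + S (n + n0)) - ?F z) / S (n + n0)" for n
      proof -
        have "\<bar>Re (S (n + n0))\<bar> < \<epsilon>" using n0[of "n + n0"] abs_Re_le_cmod[of "S (n + n0)"] by simp
        then have zs: "s0 < Re (z + S (n + n0))" using \<epsilon> by simp
        show ?thesis
          unfolding G_def integral_divide_zero by (subst Bochner_Integration.integral_diff[OF i[OF zs] i[OF z]]) simp
      qed
      ultimately have "(\<lambda>n. (?F (z + S (n + n0)) - ?F z) / S (n + n0)) \<longlonglongrightarrow> ?D" by simp
      then show "(\<lambda>n. (?F (z + S n) - ?F z) / S n) \<longlonglongrightarrow> ?D"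
        by (rule LIMSEQ_offset)
    qed
    then show "?F field_differentiable at z within {z. s0 < Re z}"
      using field_differentiable_at_within field_differentiable_def by blast
  qed
qed

text \<open>The transforms extend holomorphically to a half plane, so they agree on the vertical line
  through \<open>s0 + 1\<close>, where they are characteristic functions of exponentially tilted measures.\<close>

theorem two_sided_laplace_unique:
  fixes A B :: "real \<Rightarrow> real"
  assumes Am[measurable]: "A \<in> borel_measurable borel" and A0: "\<And>y. 0 \<le> A y"
    and Bm[measurable]: "B \<in> borel_measurable borel" and B0: "\<And>y. 0 \<le> B y"
    and Aint: "\<And>s. s0 < s \<Longrightarrow> integrable lborel (\<lambda>y. exp (- s * y) * A y)"
    and Bint: "\<And>s. s0 < s \<Longrightarrow> integrable lborel (\<lambda>y. exp (- s * y) * B y)"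
    and eq: "\<And>s. s0 < s \<Longrightarrow> (\<integral>y. exp (- s * y) * A y \<partial>lborel) = (\<integral>y. exp (- s * y) * B y \<partial>lborel)"
  shows "AE y in lborel. A y = B y"
proof -
  define F where "F A z = (\<integral>y. exp (- z * complex_of_real y) * complex_of_real (A y) \<partial>lborel)" for A :: "real \<Rightarrow> real" and z
  define s1 where "s1 = s0 + 1"
  have s1: "s0 < s1" unfolding s1_def by simp
  have F_real: "F A (complex_of_real s) = complex_of_real (\<integral>y. exp (- s * y) * A y \<partial>lborel)" for A s
  proof -
    have "F A (complex_of_real s) = (\<integral>y. complex_of_real (exp (- s * y) * A y) \<partial>lborel)"
      unfolding F_def by (intro Bochner_Integration.integral_cong refl) (simp add: exp_of_real[symmetric])
    then show ?thesis by (simp only: integral_complex_of_real)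
  qed
  have hol: "(\<lambda>z. F A z - F B z) holomorphic_on {z. s0 < Re z}"
    unfolding F_def by (intro holomorphic_intros laplace_holomorphic assms)
  have F_eq: "F A z = F B z" if z: "s0 < Re z" for z
  proof -
    have "F A z - F B z = 0"
    proof (rule analytic_continuation[OF hol, where U = "complex_of_real ` {s0<..}" and \<xi> = "complex_of_real s1"])
      show "open {z. s0 < Re z}" by (rule open_halfspace_Re_gt)
      show "connected {z. s0 < Re z}" by (intro convex_connected convex_halfspace_Re_gt)
      show "complex_of_real ` {s0<..} \<subseteq> {z. s0 < Re z}" by auto
      show "complex_of_real s1 \<in> {z. s0 < Re z}" using s1 by simp
      show "complex_of_real s1 islimpt complex_of_real ` {s0<..}"
        unfolding islimpt_approachable
      proof (intro allI impI)
        fix e :: real assume e: "0 < e"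
        show "\<exists>x'\<in>complex_of_real ` {s0<..}. x' \<noteq> complex_of_real s1 \<and> dist x' (complex_of_real s1) < e"
        proof (rule bexI)
          show "complex_of_real (s1 + e / 2) \<in> complex_of_real ` {s0<..}" using e s1 by (intro imageI) simp
          have "dist (complex_of_real (s1 + e / 2)) (complex_of_real s1) = e / 2"
            unfolding dist_of_real using e by (simp add: dist_real_def)
          then show "complex_of_real (s1 + e / 2) \<noteq> complex_of_real s1 \<and> dist (complex_of_real (s1 + e / 2)) (complex_of_real s1) < e"
            using e by auto
        qed
      qed
      show "F A z - F B z = 0" if "z \<in> complex_of_real ` {s0<..}" for z
        using that eq by (auto simp: F_real)
      show "z \<in> {z. s0 < Re z}" using z by simp
    qed
    then show ?thesis by simp
  qed
  \<comment> \<open>The common mass of the two tilted functions. If it is 0, normalisation is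
    impossible, but then both functions vanish almost everywhere.\<close>
  define m where "m = (\<integral>y. exp (- s1 * y) * A y \<partial>lborel)"
  have mB: "m = (\<integral>y. exp (- s1 * y) * B y \<partial>lborel)" unfolding m_def by (rule eq[OF s1])
  have m0: "0 \<le> m" unfolding m_def using A0 by (intro integral_nonneg_AE) auto
  show ?thesis
  proof (cases "m = 0")
    case True
    have "AE y in lborel. exp (- s1 * y) * A y = 0"
      using integral_nonneg_eq_0_iff_AE[OF Aint[OF s1]] True A0 unfolding m_def by auto
    moreover have "AE y in lborel. exp (- s1 * y) * B y = 0"
      using integral_nonneg_eq_0_iff_AE[OF Bint[OF s1]] True B0 unfolding mB by auto
    ultimately show ?thesis by eventually_elim simp
  next
    case False
    then have m: "0 < m" using m0 by simp
    define N where "N A = density lborel (\<lambda>y. ennreal (exp (- s1 * y) * A y / m))" for A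
    have dist: "real_distribution (N A) \<and> (\<forall>t. char (N A) t = F A (complex_of_real s1 - \<i> * complex_of_real t) / complex_of_real m)"
      if [measurable]: "A \<in> borel_measurable borel" and A0: "\<And>y. 0 \<le> A y" and Aint: "integrable lborel (\<lambda>y. exp (- s1 * y) * A y)"
        and mA: "m = (\<integral>y. exp (- s1 * y) * A y \<partial>lborel)" for A
    proof
      have "emeasure (N A) UNIV = (\<integral>\<^sup>+y. ennreal (exp (- s1 * y) * A y / m) \<partial>lborel)"
        unfolding N_def by (subst emeasure_density) auto
      also have "\<dots> = ennreal (\<integral>y. exp (- s1 * y) * A y / m \<partial>lborel)"
        using Aint A0 m by (intro nn_integral_eq_integral) auto
      also have "\<dots> = 1" using mA m by simp
      finally have "emeasure (N A) UNIV = 1" .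
      then interpret p: prob_space "N A" by (intro prob_spaceI) (simp add: N_def)
      show "real_distribution (N A)"
        by (intro real_distribution.intro real_distribution_axioms.intro p.prob_space_axioms) (simp_all add: N_def)
      show "\<forall>t. char (N A) t = F A (complex_of_real s1 - \<i> * complex_of_real t) / complex_of_real m"
      proof
        fix t
        have "char (N A) t = (\<integral>y. (exp (- s1 * y) * A y / m) *\<^sub>R iexp (t * y) \<partial>lborel)"
          unfolding char_def N_def using A0 m by (subst integral_density) auto
        also have "\<dots> = (\<integral>y. (exp (- (complex_of_real s1 - \<i> * complex_of_real t) * complex_of_real y) * complex_of_real (A y)) / complex_of_real m \<partial>lborel)"
        proof (intro Bochner_Integration.integral_cong refl)
          fix y
          have "exp (- (complex_of_real s1 - \<i> * complex_of_real t) * complex_of_real y) = complex_of_real (exp (- s1 * y)) * iexp (t * y)"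
            by (simp add: exp_of_real[symmetric] exp_add[symmetric] left_diff_distrib exp_diff[symmetric] mult.assoc)
          then show "(exp (- s1 * y) * A y / m) *\<^sub>R iexp (t * y) = (exp (- (complex_of_real s1 - \<i> * complex_of_real t) * complex_of_real y) * complex_of_real (A y)) / complex_of_real m"
            by (simp add: scaleR_conv_of_real)
        qed
        also have "\<dots> = F A (complex_of_real s1 - \<i> * complex_of_real t) / complex_of_real m"
          unfolding F_def by (rule integral_divide_zero)
        finally show "char (N A) t = F A (complex_of_real s1 - \<i> * complex_of_real t) / complex_of_real m" .
      qed
    qed
    note dA = dist[OF Am A0 Aint[OF s1] m_def] and dB = dist[OF Bm B0 Bint[OF s1] mB]
    have "char (N A) = char (N B)"
    proof
      fix t
      have "s0 < Re (complex_of_real s1 - \<i> * complex_of_real t)" using s1 by simp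
      then show "char (N A) t = char (N B) t" using dA dB F_eq by simp
    qed
    then have "N A = N B" using dA dB by (intro Levy_uniqueness) auto
    then have "AE y in lborel. ennreal (exp (- s1 * y) * A y / m) = ennreal (exp (- s1 * y) * B y / m)"
      unfolding N_def by (subst (asm) sigma_finite_measure.density_unique_iff[OF lborel.sigma_finite_measure_axioms]) auto
    then show ?thesis
    proof eventually_elim
      case (elim y)
      then have "exp (- s1 * y) * A y / m = exp (- s1 * y) * B y / m"
        using A0[of y] B0[of y] m by (subst (asm) ennreal_inj) auto
      then show ?case using m by simp
    qed
  qed
qed

section \<open>Exponential and first moments\<close>

text \<open>Cauchy's functional equation. The defect g r = f r - r f 1 vanishes at each 1 / (m + 1),
  hence has that number as a period, and its lower bound near 0 holds on the whole half-line.
  Multiples n s then exclude negative values of g, and g r + g (n - r) = 0 excludes positive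
  ones.\<close>

lemma additive_bounded_below_linear:
  fixes f :: "real \<Rightarrow> real"
  assumes add: "\<And>s r. 0 \<le> s \<Longrightarrow> 0 \<le> r \<Longrightarrow> f (s + r) = f s + f r"
    and \<delta>: "0 < \<delta>" and below: "\<And>r. 0 \<le> r \<Longrightarrow> r \<le> \<delta> \<Longrightarrow> - B \<le> f r" and r: "0 \<le> r"
  shows "f r = r * f 1"
proof -
  define g where "g r = f r - r * f 1" for r
  have g_add: "g (s + r) = g s + g r" if "0 \<le> s" "0 \<le> r" for s r
    unfolding g_def using add[OF that] by (simp add: algebra_simps)
  have g1: "g 1 = 0" unfolding g_def by simp
  have g0: "g 0 = 0" using g_add[of 0 0] by simp
  have g_mult: "g (real n * s) = real n * g s" if "0 \<le> s" for n s
  proof (induction n)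
    case (Suc n)
    have "g (real (Suc n) * s) = g (real n * s + s)" by (simp add: distrib_right add.commute)
    also have "\<dots> = g (real n * s) + g s" using that by (intro g_add) auto
    finally show ?case using Suc by (simp add: distrib_right)
  qed (simp add: g0)
  define B' where "B' = B + \<delta> * \<bar>f 1\<bar>"
  have g_small: "- B' \<le> g s" if s: "0 \<le> s" "s \<le> \<delta>" for s
  proof -
    have "s * f 1 \<le> s * \<bar>f 1\<bar>" using s by (intro mult_left_mono) auto
    also have "\<dots> \<le> \<delta> * \<bar>f 1\<bar>" using s by (intro mult_right_mono) auto
    finally show ?thesis using below[OF s] unfolding g_def B'_def by linarith
  qed
  have g_below: "- B' \<le> g s" if s: "0 \<le> s" for s
  proof -
    obtain m where m: "1 / real (Suc m) < \<delta>" using reals_Archimedean[OF \<delta>] by (auto simp: inverse_eq_divide)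
    define k where "k = nat \<lfloor>s * real (Suc m)\<rfloor>"
    have k: "real k \<le> s * real (Suc m)" "s * real (Suc m) < real k + 1"
    proof -
      have "0 \<le> s * real (Suc m)" using s by simp
      then have "real k = of_int \<lfloor>s * real (Suc m)\<rfloor>" unfolding k_def by simp
      then show "real k \<le> s * real (Suc m)" "s * real (Suc m) < real k + 1" by linarith+
    qed
    define u where "u = s - real k * (1 / real (Suc m))"
    have u: "0 \<le> u" "u \<le> \<delta>"
    proof -
      have "real k / real (Suc m) \<le> s" using k(1) by (subst pos_divide_le_eq) auto
      then show "0 \<le> u" unfolding u_def by simp
      have "s < (real k + 1) / real (Suc m)" using k(2) by (subst pos_less_divide_eq) auto
      then have "s < real k / real (Suc m) + 1 / real (Suc m)" by (simp add: add_divide_distrib)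
      then show "u \<le> \<delta>" unfolding u_def using m by simp
    qed
    have "real (Suc m) * g (1 / real (Suc m)) = g (real (Suc m) * (1 / real (Suc m)))"
      by (rule g_mult[symmetric]) simp
    then have "real (Suc m) * g (1 / real (Suc m)) = 0" using g1 by simp
    then have "g (1 / real (Suc m)) = 0" by simp
    then have "g (real k * (1 / real (Suc m))) = 0" using g_mult[of "1 / real (Suc m)" k] by simp
    moreover have "g s = g (real k * (1 / real (Suc m)) + u)" unfolding u_def by simp
    ultimately have "g s = g u" using g_add[of "real k * (1 / real (Suc m))" u] u by simp
    then show ?thesis using g_small[OF u] by simp
  qed
  have g_nonneg: "0 \<le> g s" if s: "0 \<le> s" for s
  proof (rule ccontr)
    assume "\<not> 0 \<le> g s"
    then have neg: "0 < - g s" by simp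
    obtain n :: nat where "\<bar>B'\<bar> / (- g s) < real n" using reals_Archimedean2 by blast
    then have "\<bar>B'\<bar> < real n * (- g s)" unfolding pos_divide_less_eq[OF neg] .
    moreover have "- B' \<le> real n * g s" using g_below[of "real n * s"] g_mult[OF s, of n] s by simp
    ultimately show False by simp
  qed
  obtain n :: nat where n: "r < real n" using reals_Archimedean2 by blast
  have "g (r + (real n - r)) = g r + g (real n - r)" using n r by (intro g_add) auto
  moreover have "g (real n) = 0" using g_mult[of 1 n] g1 by simp
  ultimately have "g r = 0" using g_nonneg[OF r] g_nonneg[of "real n - r"] n by simp
  then show ?thesis unfolding g_def by simp
qed

section \<open>Moments at all times from moments at time 1\<close>

context increment_process begin

text \<open>A sequence of violating times would tend to 0, where the indicators converge to 0 by
  right continuity of the paths at 0; dominated convergence contradicts the lower bound 1/8.\<close>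

lemma K_small_near_0:
  assumes e: "0 < e"
  shows "\<exists>\<delta>>0. \<forall>r. 0 \<le> r \<and> r \<le> \<delta> \<longrightarrow> measure (K r) {z. e < \<bar>z\<bar>} \<le> 1/8"
proof (rule ccontr)
  assume n: "\<not> ?thesis"
  have "\<exists>r. 0 \<le> r \<and> r \<le> 1 / real (Suc n) \<and> 1/8 < measure (K r) {z. e < \<bar>z\<bar>}" for n
  proof -
    have "0 < 1 / real (Suc n)" by simp
    then have "\<not> (\<forall>r. 0 \<le> r \<and> r \<le> 1 / real (Suc n) \<longrightarrow> measure (K r) {z. e < \<bar>z\<bar>} \<le> 1/8)" using n by metis
    then show ?thesis by (auto simp: not_le)
  qed
  then obtain s where s: "\<And>n. 0 \<le> s n" "\<And>n. s n \<le> 1 / real (Suc n)" "\<And>n. 1/8 < measure (K (s n)) {z. e < \<bar>z\<bar>}"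
    by metis
  have Kp: "measure (K r) {z. e < \<bar>z\<bar>} = (\<integral>\<omega>. indicator {z. e < \<bar>z\<bar>} (X r \<omega>) \<partial>M)" if "0 \<le> r" for r
  proof -
    interpret Kr: prob_space "K r" by (rule K_prob[OF that])
    have "measure (K r) {z. e < \<bar>z\<bar>} = (\<integral>z. indicator {z. e < \<bar>z\<bar>} z \<partial>K r)"
      using K_sets[OF that] by simp
    then show ?thesis using integral_K[OF that, of "indicator {z. e < \<bar>z\<bar>}"] by simp
  qed
  have pos: "0 < s n" for n
  proof (rule ccontr)
    assume "\<not> 0 < s n"
    then have s0: "s n = 0" using s(1)[of n] by simp
    have "(\<integral>\<omega>. indicator {z. e < \<bar>z\<bar>} (X 0 \<omega>) \<partial>M) = (\<integral>\<omega>. (0::real) \<partial>M)"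
      using e by (intro Bochner_Integration.integral_cong refl) (simp add: X_0)
    then show False using s(3)[of n] unfolding s0 Kp[OF order_refl] by simp
  qed
  have s_lim: "filterlim s (at_right 0) sequentially"
    unfolding filterlim_at
  proof (intro conjI always_eventually allI)
    show "s \<longlonglongrightarrow> 0"
    proof (rule tendsto_sandwich[of "\<lambda>_. 0" _ _ "\<lambda>n. 1 / real (Suc n)"])
      show "(\<lambda>n. 1 / real (Suc n)) \<longlonglongrightarrow> 0" by (rule LIMSEQ_Suc[OF lim_1_over_n])
    qed (use s in auto)
    show "s n \<in> {0<..}" "s n \<noteq> 0" for n using pos[of n] by auto
  qed
  have "(\<lambda>n. \<integral>\<omega>. indicator {z. e < \<bar>z\<bar>} (X (s n) \<omega>) \<partial>M) \<longlonglongrightarrow> (\<integral>\<omega>. (0::real) \<partial>M)"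
  proof (rule integral_dominated_convergence[where w="\<lambda>_. 1"])
    show "(\<lambda>\<omega>. indicator {z. e < \<bar>z\<bar>} (X (s n) \<omega>)) \<in> borel_measurable M" for n
    proof -
      note [measurable] = X_measurable[OF s(1)[of n]]
      show ?thesis by measurable
    qed
    show "AE \<omega> in M. (\<lambda>n. indicator {z. e < \<bar>z\<bar>} (X (s n) \<omega>)) \<longlonglongrightarrow> (0::real)"
    proof (rule AE_I2)
      fix \<omega> assume \<omega>: "\<omega> \<in> space M"
      have "(\<lambda>n. X (s n) \<omega>) \<longlonglongrightarrow> 0"
        using filterlim_compose[OF X_right[OF \<omega> order_refl] s_lim] X_0[OF \<omega>] by simp
      then have "eventually (\<lambda>n. \<bar>X (s n) \<omega>\<bar> < e) sequentially"
        using e by (auto simp: tendsto_iff dist_real_def)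
      then show "(\<lambda>n. indicator {z. e < \<bar>z\<bar>} (X (s n) \<omega>)) \<longlonglongrightarrow> (0::real)"
        by (intro tendsto_eventually) (auto elim!: eventually_mono simp: indicator_def)
    qed
  qed (auto simp: indicator_def)
  then have "(\<lambda>n. measure (K (s n)) {z. e < \<bar>z\<bar>}) \<longlonglongrightarrow> 0" by (simp add: Kp[OF s(1)])
  then have "eventually (\<lambda>n. measure (K (s n)) {z. e < \<bar>z\<bar>} < 1/8) sequentially" by (rule order_tendstoD) simp
  then obtain n where "measure (K (s n)) {z. e < \<bar>z\<bar>} < 1/8" unfolding eventually_sequentially by auto
  then show False using s(3)[of n] by simp
qed

text \<open>Integrability is given at time 1. The expectation is multiplicative in time and never 0,
  so it is finite at integers, and at other times because it is a factor of a finite integer value.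
  Its logarithm is additive and bounded below near 0, since there \<bar>X s\<bar> \<le> 1 has
  probability at least 1/2; so it is linear.\<close>

lemma exp_moment:
  assumes e: "integrable M (\<lambda>\<omega>. exp (- l * X 1 \<omega>))" and l: "0 \<le> l" and r: "0 \<le> r"
  shows "integrable M (\<lambda>\<omega>. exp (- l * X r \<omega>))"
    and "(\<integral>\<omega>. exp (- l * X r \<omega>) \<partial>M) = exp (r * ln (\<integral>\<omega>. exp (- l * X 1 \<omega>) \<partial>M))"
proof -
  define m where "m r = (\<integral>\<^sup>+\<omega>. ennreal (exp (- l * X r \<omega>)) \<partial>M)" for r
  have m_mult: "m (s + r) = m s * m r" if s: "0 \<le> s" and r: "0 \<le> r" for s r
  proof -
    note [measurable] = adapted[OF s] X_measurable[OF s]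
    note [measurable_cong] = K_sets[OF r]
    have mm: "(\<lambda>(\<omega>, z). ennreal (exp (- l * X s \<omega>)) * ennreal (exp (- l * z))) \<in> borel_measurable (F s \<Otimes>\<^sub>M borel)" by measurable
    have "m (s + r) = (\<integral>\<^sup>+\<omega>. ennreal (exp (- l * X s \<omega>)) * ennreal (exp (- l * (X (s + r) \<omega> - X s \<omega>))) \<partial>M)"
      unfolding m_def by (intro nn_integral_cong) (simp add: ennreal_mult[symmetric] mult_exp_exp algebra_simps)
    also have "\<dots> = (\<integral>\<^sup>+\<omega>. \<integral>\<^sup>+z. ennreal (exp (- l * X s \<omega>)) * ennreal (exp (- l * z)) \<partial>K r \<partial>M)"
      using nn_integral_increment[OF s r mm] by (simp only: case_prod_conv)
    also have "\<dots> = (\<integral>\<^sup>+\<omega>. ennreal (exp (- l * X s \<omega>)) * m r \<partial>M)"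
      unfolding m_def by (intro nn_integral_cong) (subst nn_integral_cmult, auto simp: nn_integral_K[OF r])
    also have "\<dots> = m s * m r" unfolding m_def by (rule nn_integral_multc) measurable
    finally show ?thesis .
  qed
  have m_pos: "m r \<noteq> 0" if "0 \<le> r" for r
  proof
    note [measurable] = X_measurable[OF that]
    assume "m r = 0"
    then have "AE \<omega> in M. ennreal (exp (- l * X r \<omega>)) = 0" unfolding m_def by (subst (asm) nn_integral_0_iff_AE) auto
    then have "AE \<omega> in M. False" by eventually_elim simp
    then show False by simp
  qed
  have m1: "m 1 < \<infinity>" unfolding m_def using e by (subst nn_integral_eq_integral) auto
  have m_nat: "m (real n) < \<infinity>" for n
  proof (induction n)
    case 0 then show ?case unfolding m_def using X_0 by (simp add: emeasure_space_1 cong: nn_integral_cong)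
  next
    case (Suc n)
    have "m (real (Suc n)) = m (real n) * m 1" using m_mult[of "real n" 1] by (simp add: add.commute)
    then show ?case using Suc m1 by (simp add: ennreal_mult_less_top)
  qed
  have m_fin: "m r < \<infinity>" if r: "0 \<le> r" for r
  proof -
    obtain n :: nat where n: "r < real n" using reals_Archimedean2 by blast
    have "m (real n) = m (real n - r) * m r" using m_mult[of "real n - r" r] n r by simp
    then show ?thesis using m_nat[of n] m_pos[of "real n - r"] n by (auto simp: ennreal_mult_less_top)
  qed
  have int: "integrable M (\<lambda>\<omega>. exp (- l * X r \<omega>))" if "0 \<le> r" for r
  proof (rule integrableI_nonneg)
    note [measurable] = X_measurable[OF that]
    show "(\<lambda>\<omega>. exp (- l * X r \<omega>)) \<in> borel_measurable M" by measurable
    show "(\<integral>\<^sup>+\<omega>. ennreal (exp (- l * X r \<omega>)) \<partial>M) < \<infinity>" using m_fin[OF that] unfolding m_def .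
  qed simp
  define E where "E r = (\<integral>\<omega>. exp (- l * X r \<omega>) \<partial>M)" for r
  have E: "m r = ennreal (E r)" if "0 \<le> r" for r
    unfolding m_def E_def using int[OF that] by (intro nn_integral_eq_integral) auto
  have E_nonneg: "0 \<le> E r" for r unfolding E_def by (intro integral_nonneg_AE) auto
  have E_pos: "0 < E r" if "0 \<le> r" for r
    using m_pos[OF that] E[OF that] E_nonneg[of r] by (cases "E r = 0") auto
  have E_mult: "E (s + r) = E s * E r" if "0 \<le> s" "0 \<le> r" for s r
  proof -
    have "ennreal (E (s + r)) = ennreal (E s * E r)"
      using m_mult[OF that] E[OF that(1)] E[OF that(2)] E[of "s + r"] that E_nonneg by (simp add: ennreal_mult)
    then show ?thesis using E_nonneg by (subst (asm) ennreal_inj) auto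
  qed
  obtain \<delta> where \<delta>: "0 < \<delta>" "\<forall>r. 0 \<le> r \<and> r \<le> \<delta> \<longrightarrow> measure (K r) {z. 1 < \<bar>z\<bar>} \<le> 1/8"
    using K_small_near_0[of 1] by auto
  have low: "exp (- l) / 2 \<le> E s" if s: "0 \<le> s" "s \<le> \<delta>" for s
  proof -
    note [measurable] = X_measurable[OF s(1)]
    interpret Ks: prob_space "K s" by (rule K_prob[OF s(1)])
    have sp: "space (K s) = UNIV" using sets_eq_imp_space_eq[OF K_sets[OF s(1)]] by simp
    have small: "measure (K s) {z. 1 < \<bar>z\<bar>} \<le> 1/8" using \<delta>(2) s by simp
    have "{z. \<bar>z\<bar> \<le> (1::real)} = UNIV - {z. 1 < \<bar>z\<bar>}" by auto
    then have "measure (K s) {z. \<bar>z\<bar> \<le> 1} = 1 - measure (K s) {z. 1 < \<bar>z\<bar>}"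
      using Ks.prob_compl[of "{z. 1 < \<bar>z\<bar>}"] K_sets[OF s(1)] sp by simp
    then have "1/2 \<le> measure (K s) {z. \<bar>z\<bar> \<le> 1}" using small by simp
    then have "exp (- l) / 2 \<le> exp (- l) * measure (K s) {z. \<bar>z\<bar> \<le> 1}" by simp
    also have "\<dots> = exp (- l) * (\<integral>z. indicator {z. \<bar>z\<bar> \<le> 1} z \<partial>K s)" using K_sets[OF s(1)] by simp
    also have "\<dots> = (\<integral>\<omega>. exp (- l) * indicator {z. \<bar>z\<bar> \<le> 1} (X s \<omega>) \<partial>M)"
      using integral_K[OF s(1), of "indicator {z. \<bar>z\<bar> \<le> 1}"] by simp
    also have "\<dots> \<le> E s"
      unfolding E_def
    proof (rule integral_mono[OF _ int[OF s(1)]])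
      show "integrable M (\<lambda>\<omega>. exp (- l) * indicator {z. \<bar>z\<bar> \<le> 1} (X s \<omega>))"
        by (intro integrable_mult_right integrable_const_bound[where B=1]) (auto simp: indicator_def)
      fix \<omega>
      show "exp (- l) * indicator {z. \<bar>z\<bar> \<le> 1} (X s \<omega>) \<le> exp (- l * X s \<omega>)"
      proof (cases "\<bar>X s \<omega>\<bar> \<le> 1")
        case True
        then have "l * X s \<omega> \<le> l * 1" using l by (intro mult_left_mono) auto
        then show ?thesis using True by simp
      qed simp
    qed
    finally show ?thesis .
  qed
  have "ln (E r) = r * ln (E 1)"
  proof (rule additive_bounded_below_linear[where f = "\<lambda>r. ln (E r)" and B = "- ln (exp (- l) / 2)", OF _ \<delta>(1) _ r])
    show "ln (E (s + r)) = ln (E s) + ln (E r)" if "0 \<le> s" "0 \<le> r" for s r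
      unfolding E_mult[OF that] using E_pos that by (intro ln_mult_pos) auto
    show "- (- ln (exp (- l) / 2)) \<le> ln (E s)" if "0 \<le> s" "s \<le> \<delta>" for s
      using low[OF that] E_pos[OF that(1)] by (simp add: ln_le_cancel_iff)
  qed
  then have "E r = exp (r * ln (E 1))" using E_pos[OF r] by (metis exp_ln)
  then show "integrable M (\<lambda>\<omega>. exp (- l * X r \<omega>))"
    "(\<integral>\<omega>. exp (- l * X r \<omega>) \<partial>M) = exp (r * ln (\<integral>\<omega>. exp (- l * X 1 \<omega>) \<partial>M))"
    using int[OF r] unfolding E_def by auto
qed

text \<open>For r \<le> 1, X 1 is X (1 - r) plus an independent increment with law K r; by Fubini
  the increment is integrable once the first summand is fixed. Linearity in time follows from
  additivity, with the lower bound near 0 taken from z \<ge> - exp(-z) and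
  \<open>exp_moment\<close>.\<close>

lemma first_moment:
  assumes e: "integrable M (\<lambda>\<omega>. exp (- 1 * X 1 \<omega>))" and i: "integrable M (X 1)" and r: "0 \<le> r"
  shows "integrable M (X r)" and "(\<integral>\<omega>. X r \<omega> \<partial>M) = r * (\<integral>\<omega>. X 1 \<omega> \<partial>M)"
proof -
  have small: "integrable M (X r)" if r: "0 \<le> r" "r \<le> 1" for r
  proof -
    have r1: "0 \<le> 1 - r" using r by simp
    have "integrable (K r) (\<lambda>z. z)"
    proof -
      have "(\<lambda>(\<omega>, z). X (1 - r) \<omega> + z) \<in> borel_measurable (F (1 - r) \<Otimes>\<^sub>M borel)"
        using adapted[OF r1] by measurable
      from integral_increment(3)[OF r1 r(1) this]
      have ae: "AE \<omega> in M. integrable (K r) (\<lambda>z. X (1 - r) \<omega> + z)" using i by simp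
      interpret Kr: prob_space "K r" by (rule K_prob[OF r(1)])
      have "\<exists>\<omega>\<in>space M. integrable (K r) (\<lambda>z. X (1 - r) \<omega> + z)"
      proof (rule ccontr)
        assume n: "\<not> (\<exists>\<omega>\<in>space M. integrable (K r) (\<lambda>z. X (1 - r) \<omega> + z))"
        have "AE \<omega> in M. False" using ae AE_space
        proof eventually_elim
          case (elim \<omega>)
          have "\<exists>\<omega>\<in>space M. integrable (K r) (\<lambda>z. X (1 - r) \<omega> + z)"
            using elim by (intro bexI[where x = \<omega>])
          with n show False ..
        qed
        then show False by simp
      qed
      then obtain x where "integrable (K r) (\<lambda>z. x + z)" by auto
      then have "integrable (K r) (\<lambda>z. (x + z) - x)" by (intro Bochner_Integration.integrable_diff) auto
      then show ?thesis by simp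
    qed
    then show ?thesis using integrable_K[OF r(1), of "\<lambda>z. z"] by simp
  qed
  have sum: "integrable M (X (s + r)) \<and> (\<integral>\<omega>. X (s + r) \<omega> \<partial>M) = (\<integral>\<omega>. X s \<omega> \<partial>M) + (\<integral>\<omega>. X r \<omega> \<partial>M)"
    if s: "0 \<le> s" and r: "0 \<le> r" and iS: "integrable M (X s)" and ir: "integrable M (X r)" for s r
  proof -
    have Kd: "distr M borel (\<lambda>\<omega>. X (s + r) \<omega> - X s \<omega>) = K r"
    proof (rule measure_eqI)
      have [measurable]: "(\<lambda>\<omega>. X (s + r) \<omega> - X s \<omega>) \<in> borel_measurable M"
        using s r by (intro borel_measurable_diff X_measurable) auto
      show "sets (distr M borel (\<lambda>\<omega>. X (s + r) \<omega> - X s \<omega>)) = sets (K r)" using K_sets[OF r] by simp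
      fix B assume "B \<in> sets (distr M borel (\<lambda>\<omega>. X (s + r) \<omega> - X s \<omega>))"
      then have B: "B \<in> sets borel" by simp
      have "space M \<in> sets (F s)" using space_F[OF s] sets.top[of "F s"] by simp
      from indep_increment[OF s r this B]
      have "emeasure M (space M \<inter> {\<omega>\<in>space M. X (s + r) \<omega> - X s \<omega> \<in> B}) = emeasure (K r) B" by (simp add: emeasure_space_1)
      moreover have "space M \<inter> {\<omega>\<in>space M. X (s + r) \<omega> - X s \<omega> \<in> B} = (\<lambda>\<omega>. X (s + r) \<omega> - X s \<omega>) -` B \<inter> space M" by auto
      ultimately show "emeasure (distr M borel (\<lambda>\<omega>. X (s + r) \<omega> - X s \<omega>)) B = emeasure (K r) B"
        using B by (subst emeasure_distr) auto
    qed
    have m: "(\<lambda>\<omega>. X (s + r) \<omega> - X s \<omega>) \<in> borel_measurable M"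
      using s r by (intro borel_measurable_diff X_measurable) auto
    have id: "(\<lambda>z::real. z) \<in> borel_measurable borel" by simp
    have "integrable (K r) (\<lambda>z. z)" using integrable_K[OF r id] ir by simp
    then have i1: "integrable M (\<lambda>\<omega>. X (s + r) \<omega> - X s \<omega>)"
      unfolding Kd[symmetric] using integrable_distr_eq[OF m id] by simp
    have e1: "(\<integral>\<omega>. X (s + r) \<omega> - X s \<omega> \<partial>M) = (\<integral>\<omega>. X r \<omega> \<partial>M)"
      using integral_distr[OF m id] integral_K[OF r id] unfolding Kd by simp
    have "integrable M (\<lambda>\<omega>. (X (s + r) \<omega> - X s \<omega>) + X s \<omega>)" by (rule Bochner_Integration.integrable_add[OF i1 iS])
    then have "integrable M (X (s + r))" by simp
    then show ?thesis using e1 iS by simp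
  qed
  have int: "integrable M (X r)" if r: "0 \<le> r" for r
  proof -
    have "integrable M (X (real n + u))" if "0 \<le> u" "u \<le> 1" for n u
    proof (induction n)
      case 0 then show ?case using small[OF that] by simp
    next
      case (Suc n)
      then show ?case using sum[of "real n + u" 1] i that by (simp add: add.commute add.left_commute)
    qed
    from this[of "r - real (nat \<lfloor>r\<rfloor>)" "nat \<lfloor>r\<rfloor>"] show ?thesis using r by (simp add: of_nat_nat) linarith
  qed
  show "integrable M (X r)" by (rule int[OF r])
  define p where "p = ln (\<integral>\<omega>. exp (- 1 * X 1 \<omega>) \<partial>M)"
  show "(\<integral>\<omega>. X r \<omega> \<partial>M) = r * (\<integral>\<omega>. X 1 \<omega> \<partial>M)"
  proof (rule additive_bounded_below_linear[where f = "\<lambda>r. \<integral>\<omega>. X r \<omega> \<partial>M" and \<delta> = 1 and B = "exp \<bar>p\<bar>", OF _ zero_less_one _ r])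
    show "(\<integral>\<omega>. X (s + r) \<omega> \<partial>M) = (\<integral>\<omega>. X s \<omega> \<partial>M) + (\<integral>\<omega>. X r \<omega> \<partial>M)" if "0 \<le> s" "0 \<le> r" for s r
      using sum[OF that int int] that by blast
    fix s :: real assume s: "0 \<le> s" "s \<le> 1"
    note em = exp_moment[OF e _ s(1)]
    have "- exp \<bar>p\<bar> \<le> - exp (s * p)"
    proof -
      have "s * p \<le> s * \<bar>p\<bar>" using s by (intro mult_left_mono) auto
      also have "\<dots> \<le> 1 * \<bar>p\<bar>" using s by (intro mult_right_mono) auto
      finally show ?thesis by simp
    qed
    also have "- exp (s * p) = (\<integral>\<omega>. - exp (- 1 * X s \<omega>) \<partial>M)" using em(2) unfolding p_def by simp
    also have "\<dots> \<le> (\<integral>\<omega>. X s \<omega> \<partial>M)"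
    proof (rule integral_mono[OF _ int[OF s(1)]])
      show "integrable M (\<lambda>\<omega>. - exp (- 1 * X s \<omega>))" using em(1) by simp
      fix \<omega> show "- exp (- 1 * X s \<omega>) \<le> X s \<omega>" using exp_ge_add_one_self[of "- X s \<omega>"] by simp
    qed
    finally show "- exp \<bar>p\<bar> \<le> (\<integral>\<omega>. X s \<omega> \<partial>M)" .
  qed
qed

lemma abs_moment_bound:
  assumes e: "integrable M (\<lambda>\<omega>. exp (- 1 * X 1 \<omega>))" and i: "integrable M (X 1)" and t: "0 \<le> t"
  shows "\<exists>B. \<forall>r. 0 \<le> r \<and> r \<le> t \<longrightarrow> (\<integral>z. \<bar>z\<bar> \<partial>K r) \<le> B"
proof (intro exI allI impI)
  fix r assume r: "0 \<le> r \<and> r \<le> t"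
  then have r0: "0 \<le> r" by simp
  define p where "p = ln (\<integral>\<omega>. exp (- 1 * X 1 \<omega>) \<partial>M)"
  define \<mu> where "\<mu> = (\<integral>\<omega>. X 1 \<omega> \<partial>M)"
  note em = exp_moment[OF e _ r0] and fm = first_moment[OF e i r0]
  have "(\<integral>z. \<bar>z\<bar> \<partial>K r) = (\<integral>\<omega>. \<bar>X r \<omega>\<bar> \<partial>M)" by (rule integral_K[OF r0]) simp
  \<comment> \<open>The elementary bound \<bar>z\<bar> \<le> z + 2 exp(-z) reduces the absolute
    moment to moments that are known exactly.\<close>
  also have "\<dots> \<le> (\<integral>\<omega>. X r \<omega> + 2 * exp (- 1 * X r \<omega>) \<partial>M)"
  proof (rule integral_mono)
    show "integrable M (\<lambda>\<omega>. \<bar>X r \<omega>\<bar>)" using fm(1) by simp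
    show "integrable M (\<lambda>\<omega>. X r \<omega> + 2 * exp (- 1 * X r \<omega>))" using fm(1) em(1) by simp
    fix \<omega>
    show "\<bar>X r \<omega>\<bar> \<le> X r \<omega> + 2 * exp (- 1 * X r \<omega>)"
      using exp_ge_add_one_self[of "- X r \<omega>"] exp_gt_zero[of "- X r \<omega>"] by (simp add: abs_le_iff)
  qed
  also have "\<dots> = r * \<mu> + 2 * exp (r * p)" using fm em unfolding \<mu>_def p_def by simp
  also have "\<dots> \<le> t * \<bar>\<mu>\<bar> + 2 * exp (t * \<bar>p\<bar>)"
  proof -
    have le: "r * c \<le> t * \<bar>c\<bar>" for c
    proof -
      have "r * c \<le> r * \<bar>c\<bar>" using r by (intro mult_left_mono) auto
      also have "\<dots> \<le> t * \<bar>c\<bar>" using r by (intro mult_right_mono) auto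
      finally show ?thesis .
    qed
    have "exp (r * p) \<le> exp (t * \<bar>p\<bar>)" using le[of p] by simp
    then show ?thesis using le[of \<mu>] by linarith
  qed
  finally show "(\<integral>z. \<bar>z\<bar> \<partial>K r) \<le> t * \<bar>\<mu>\<bar> + 2 * exp (t * \<bar>p\<bar>)" unfolding \<mu>_def p_def .
qed

end

section \<open>The natural filtration\<close>

definition cylinder :: "'a measure \<Rightarrow> (real \<Rightarrow> 'a \<Rightarrow> real) \<Rightarrow> real set \<Rightarrow> (real \<Rightarrow> real set) \<Rightarrow> 'a set" where
  "cylinder M X J B = {\<omega>\<in>space M. \<forall>r\<in>J. X r \<omega> \<in> B r}"

definition cylinders :: "'a measure \<Rightarrow> (real \<Rightarrow> 'a \<Rightarrow> real) \<Rightarrow> real \<Rightarrow> 'a set set" where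
  "cylinders M X t = {cylinder M X J B | J B. finite J \<and> J \<subseteq> {0..t} \<and> (\<forall>r. B r \<in> sets borel)}"

definition natural_filtration :: "'a measure \<Rightarrow> (real \<Rightarrow> 'a \<Rightarrow> real) \<Rightarrow> real \<Rightarrow> 'a measure" where
  "natural_filtration M X t = sigma (space M) (cylinders M X t)"

lemma cylinders_Pow: "cylinders M X t \<subseteq> Pow (space M)"
  unfolding cylinders_def cylinder_def by auto

lemma sets_natural_filtration: "sets (natural_filtration M X t) = sigma_sets (space M) (cylinders M X t)"
  unfolding natural_filtration_def by (rule sets_measure_of[OF cylinders_Pow])

lemma space_natural_filtration: "space (natural_filtration M X t) = space M"
  unfolding natural_filtration_def by (rule space_measure_of[OF cylinders_Pow])

lemma cylinder_sets:
  assumes "finite J" "J \<subseteq> {0..t}" "\<And>r. B r \<in> sets borel" "\<And>r. 0 \<le> r \<Longrightarrow> X r \<in> borel_measurable M"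
  shows "cylinder M X J B \<in> sets M"
proof -
  have r: "X r -` B r \<inter> space M \<in> sets M" if "r \<in> J" for r
    using that assms(2) by (intro measurable_sets[OF assms(4) assms(3)]) auto
  have "cylinder M X J B = {\<omega>\<in>space M. \<forall>r\<in>J. \<omega> \<in> X r -` B r \<inter> space M}"
    unfolding cylinder_def by auto
  also have "\<dots> \<in> sets M"
  proof (rule sets.sets_Collect_finite_All[OF _ assms(1)])
    fix r assume "r \<in> J"
    then show "{\<omega>\<in>space M. \<omega> \<in> X r -` B r \<inter> space M} \<in> sets M"
      using r sets.sets_into_space by (simp add: Int_def conj_commute)
  qed
  finally show ?thesis .
qed

lemma Int_stable_cylinders: "Int_stable (cylinders M X t)"
proof (rule Int_stableI)
  fix a b assume "a \<in> cylinders M X t" "b \<in> cylinders M X t"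
  then obtain J B J' B' where *: "a = cylinder M X J B" "b = cylinder M X J' B'"
    "finite J" "J \<subseteq> {0..t}" "\<forall>r. B r \<in> sets borel" "finite J'" "J' \<subseteq> {0..t}" "\<forall>r. B' r \<in> sets borel"
    unfolding cylinders_def by auto
  let ?B = "\<lambda>r. (if r \<in> J then B r else UNIV) \<inter> (if r \<in> J' then B' r else UNIV)"
  have "a \<inter> b = cylinder M X (J \<union> J') ?B" unfolding * cylinder_def by auto
  moreover have "\<forall>r. ?B r \<in> sets borel" using *(5,8) by auto
  ultimately show "a \<inter> b \<in> cylinders M X t" unfolding cylinders_def using * by blast
qed

lemma cylinders_mono: "s \<le> t \<Longrightarrow> cylinders M X s \<subseteq> cylinders M X t"
proof
  fix A assume "s \<le> t" "A \<in> cylinders M X s"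
  then obtain J B where "A = cylinder M X J B" "finite J" and J: "J \<subseteq> {0..s}" and "\<forall>r. B r \<in> sets borel"
    unfolding cylinders_def by auto
  moreover have "J \<subseteq> {0..t}" using J \<open>s \<le> t\<close> by auto
  ultimately show "A \<in> cylinders M X t"
    unfolding cylinders_def by (intro CollectI exI[of _ J] exI[of _ B]) simp
qed

section \<open>From a Levy process to an increment process\<close>

context levy_process begin

text \<open>The Levy axioms speak of finitely many consecutive increments. The times in J together
  with 0 and s are sorted; since X 0 = 0 almost surely, the values of X there are partial sums of
  increments. The cylinder thus becomes an event of the first n increments, and the increment from s
  to s + r is the next one.\<close>

lemma cylinder_increment_indep:
  assumes J: "finite J" "J \<subseteq> {0..s}" and B: "\<And>r. B r \<in> sets borel" and C: "C \<in> sets borel"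
    and s: "0 \<le> s" and r: "0 \<le> r"
  shows "prob (cylinder M X J B \<inter> {\<omega>\<in>space M. X (s + r) \<omega> - X s \<omega> \<in> C}) = prob (cylinder M X J B) * prob {\<omega>\<in>space M. X r \<omega> \<in> C}"
proof -
  define l where "l = sorted_list_of_set (insert 0 (insert s J))"
  define n where "n = length l - 1"
  have fin: "finite (insert 0 (insert s J))" using J by simp
  have l: "set l = insert 0 (insert s J)" "sorted l" "distinct l" unfolding l_def
    by (rule set_sorted_list_of_set[OF fin] sorted_sorted_list_of_set distinct_sorted_list_of_set)+
  have len: "length l = Suc n" unfolding n_def using l(1) by (cases l) auto
  have nth_mono: "l ! i \<le> l ! j" if "i \<le> j" "j \<le> n" for i j
    using sorted_nth_mono[OF l(2)] that len by auto
  have l0: "l ! 0 = 0"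
  proof -
    obtain i where i: "i \<le> n" "l ! i = 0" using l(1) len by (metis in_set_conv_nth insertI1 less_Suc_eq_le)
    have "l ! 0 \<in> set l" using len by (intro nth_mem) simp
    then have "0 \<le> l ! 0" using l(1) J(2) s by auto
    then show ?thesis using nth_mono[of 0 i] i by simp
  qed
  have ln: "l ! n = s"
  proof -
    obtain i where i: "i \<le> n" "l ! i = s" using l(1) len by (metis in_set_conv_nth insertI1 insertI2 less_Suc_eq_le)
    have "l ! n \<in> set l" using len by (intro nth_mem) simp
    then have "l ! n \<le> s" using l(1) J(2) s by auto
    then show ?thesis using nth_mono[of i n] i by simp
  qed
  \<comment> \<open>Beyond the last grid point the sequence is constantly s + r, which keeps it
    monotone on all of nat and makes increment n the one after s.\<close>
  define \<rho> where "\<rho> i = (if i \<le> n then l ! i else s + r)" for i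
  have mono: "mono \<rho>"
  proof (rule monoI)
    fix i j :: nat assume "i \<le> j"
    then show "\<rho> i \<le> \<rho> j" using nth_mono[of i j] nth_mono[of i n] ln r unfolding \<rho>_def by auto
  qed
  define D where "D i \<omega> = X (\<rho> (Suc i)) \<omega> - X (\<rho> i) \<omega>" for i \<omega>
  have \<rho>0: "0 \<le> \<rho> i" for i using monoD[OF mono, of 0 i] l0 unfolding \<rho>_def by simp
  have ind: "indep_vars (\<lambda>_. borel) D {..<Suc n}"
    unfolding D_def using X_indep_increments[OF \<rho>0 mono, of "Suc n"] .
  have indep: "indep_var (PiM {..<n} (\<lambda>_. borel)) (\<lambda>\<omega>. restrict (\<lambda>i. D i \<omega>) {..<n}) (PiM {n} (\<lambda>_. borel)) (\<lambda>\<omega>. restrict (\<lambda>i. D i \<omega>) {n})"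
    by (rule indep_var_restrict[OF ind]) auto
  define P where "P = {d\<in>space (PiM {..<n} (\<lambda>_. borel :: real measure)). \<forall>j\<in>{..n}. l ! j \<in> J \<longrightarrow> (\<Sum>i<j. d i) \<in> B (l ! j)}"
  define Q where "Q = {d\<in>space (PiM {n} (\<lambda>_. borel :: real measure)). d n \<in> C}"
  have P: "P \<in> sets (PiM {..<n} (\<lambda>_. borel))"
    unfolding P_def
  proof (rule sets.sets_Collect_finite_All)
    fix j assume j: "j \<in> {..n}"
    have "(\<lambda>d. \<Sum>i<j. d i) \<in> borel_measurable (PiM {..<n} (\<lambda>_. borel :: real measure))"
      using j by (intro borel_measurable_sum measurable_component_singleton) auto
    from measurable_sets[OF this B[of "l ! j"]]
    have "{d\<in>space (PiM {..<n} (\<lambda>_. borel :: real measure)). (\<Sum>i<j. d i) \<in> B (l ! j)} \<in> sets (PiM {..<n} (\<lambda>_. borel))"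
      by (simp add: vimage_def Int_def conj_commute)
    then show "{d\<in>space (PiM {..<n} (\<lambda>_. borel :: real measure)). l ! j \<in> J \<longrightarrow> (\<Sum>i<j. d i) \<in> B (l ! j)} \<in> sets (PiM {..<n} (\<lambda>_. borel))"
      by (cases "l ! j \<in> J") auto
  qed simp
  have Q: "Q \<in> sets (PiM {n} (\<lambda>_. borel))"
  proof -
    have "(\<lambda>d. d n) \<in> borel_measurable (PiM {n} (\<lambda>_. borel :: real measure))"
      by (intro measurable_component_singleton) auto
    from measurable_sets[OF this C] show ?thesis unfolding Q_def by (simp add: vimage_def Int_def conj_commute)
  qed
  have Dm: "D i \<in> borel_measurable M" for i
    unfolding D_def using \<rho>0 by (intro borel_measurable_diff X_measurable) auto
  have XD: "AE \<omega> in M. \<forall>j\<le>n. X (l ! j) \<omega> = (\<Sum>i<j. D i \<omega>)"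
    using X_start
  proof eventually_elim
    case (elim \<omega>)
    show ?case
    proof (intro allI impI)
      fix j assume j: "j \<le> n"
      have "(\<Sum>i<j. D i \<omega>) = X (\<rho> j) \<omega> - X (\<rho> 0) \<omega>"
        unfolding D_def by (rule sum_lessThan_telescope[where f="\<lambda>i. X (\<rho> i) \<omega>"])
      then show "X (l ! j) \<omega> = (\<Sum>i<j. D i \<omega>)" using elim j l0 unfolding \<rho>_def by simp
    qed
  qed
  define PP where "PP = (\<lambda>\<omega>. restrict (\<lambda>i. D i \<omega>) {..<n}) -` P \<inter> space M"
  define QQ where "QQ = (\<lambda>\<omega>. restrict (\<lambda>i. D i \<omega>) {n}) -` Q \<inter> space M"
  have PP_sets: "PP \<in> sets M" unfolding PP_def
    by (rule measurable_sets[OF _ P]) (intro measurable_restrict Dm)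
  have PP_iff: "\<omega> \<in> PP \<longleftrightarrow> (\<forall>j\<le>n. l ! j \<in> J \<longrightarrow> (\<Sum>i<j. D i \<omega>) \<in> B (l ! j))" if "\<omega> \<in> space M" for \<omega>
  proof -
    have "(\<Sum>i<j. restrict (\<lambda>i. D i \<omega>) {..<n} i) = (\<Sum>i<j. D i \<omega>)" if "j \<le> n" for j
      using that by (intro sum.cong) auto
    then show ?thesis using that unfolding PP_def P_def by (auto simp: space_PiM)
  qed
  have Jl: "(\<forall>r\<in>J. X r \<omega> \<in> B r) \<longleftrightarrow> (\<forall>j\<le>n. l ! j \<in> J \<longrightarrow> X (l ! j) \<omega> \<in> B (l ! j))" for \<omega>
  proof
    assume *: "\<forall>j\<le>n. l ! j \<in> J \<longrightarrow> X (l ! j) \<omega> \<in> B (l ! j)"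
    show "\<forall>r\<in>J. X r \<omega> \<in> B r"
    proof
      fix u assume u: "u \<in> J"
      then have "u \<in> set l" using l(1) by simp
      then obtain j where "j < length l" "l ! j = u" by (auto simp: in_set_conv_nth)
      then show "X u \<omega> \<in> B u" using * u len by auto
    qed
  qed auto
  have cyl_AE: "AE \<omega> in M. \<omega> \<in> cylinder M X J B \<longleftrightarrow> \<omega> \<in> PP"
    using XD AE_space
  proof eventually_elim
    case (elim \<omega>)
    then show ?case unfolding cylinder_def PP_iff[OF elim(2)] using Jl[of \<omega>] by auto
  qed
  have D_n: "D n \<omega> = X (s + r) \<omega> - X s \<omega>" for \<omega> unfolding D_def \<rho>_def using ln by simp
  have QQ_eq: "QQ = {\<omega>\<in>space M. X (s + r) \<omega> - X s \<omega> \<in> C}"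
    unfolding QQ_def Q_def D_n[symmetric] by (auto simp: space_PiM)
  have cyl: "cylinder M X J B \<in> sets M" by (rule cylinder_sets[OF J B X_measurable])
  have QQ_sets: "QQ \<in> sets M"
    unfolding QQ_def by (rule measurable_sets[OF _ Q]) (intro measurable_restrict Dm)
  have "prob (cylinder M X J B \<inter> QQ) = prob (PP \<inter> QQ)"
    using cyl_AE by (intro finite_measure_eq_AE) (auto intro: cyl PP_sets QQ_sets)
  also have "PP \<inter> QQ = (\<lambda>\<omega>. (restrict (\<lambda>i. D i \<omega>) {..<n}, restrict (\<lambda>i. D i \<omega>) {n})) -` (P \<times> Q) \<inter> space M"
    unfolding PP_def QQ_def by auto
  also have "prob \<dots> = prob PP * prob QQ"
    unfolding PP_def QQ_def by (rule indep_varD[OF indep P Q])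
  also have "prob PP = prob (cylinder M X J B)"
    using cyl_AE by (intro finite_measure_eq_AE) (auto intro: cyl PP_sets)
  also have "prob QQ = prob {\<omega>\<in>space M. X r \<omega> \<in> C}"
  proof -
    have sr: "0 \<le> s + r" using s r by simp
    have "measure (distr M borel (\<lambda>\<omega>. X (s + r) \<omega> - X s \<omega>)) C = measure (distr M borel (X r)) C"
      using X_stationary_increments[of s "s + r"] s r by simp
    moreover have "measure (distr M borel (\<lambda>\<omega>. X (s + r) \<omega> - X s \<omega>)) C = prob QQ"
      unfolding QQ_eq using s sr C by (subst measure_distr) (auto intro!: borel_measurable_diff X_measurable arg_cong[where f=prob])
    moreover have "measure (distr M borel (X r)) C = prob {\<omega>\<in>space M. X r \<omega> \<in> C}"
      using r C by (subst measure_distr) (auto intro!: X_measurable arg_cong[where f=prob])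
    ultimately show ?thesis by simp
  qed
  finally show ?thesis unfolding QQ_eq .
qed

text \<open>Exceptional paths are replaced by the zero path, so that regularity holds everywhere.
  The filtration is generated by the modified process, because the exceptional set need not belong
  to the filtration of the original one. Independence spreads from cylinders to the generated
  sigma-algebra by a pi-lambda argument.\<close>

lemma good_version:
  assumes good: "AE \<omega> in M. good_path (\<lambda>t. X t \<omega>)"
  obtains X' where "increment_process M X' (natural_filtration M X') (\<lambda>r. distr M borel (X r))"
    "AE \<omega> in M. \<forall>t. X' t \<omega> = X t \<omega>"
proof -
  have "AE \<omega> in M. X 0 \<omega> = 0 \<and> good_path (\<lambda>t. X t \<omega>)" using X_start good by eventually_elim simp
  then obtain N where N: "{\<omega>\<in>space M. \<not> (X 0 \<omega> = 0 \<and> good_path (\<lambda>t. X t \<omega>))} \<subseteq> N" "emeasure M N = 0" "N \<in> sets M"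
    by (rule AE_E)
  define X' where "X' t \<omega> = (if \<omega> \<in> N then 0 else X t \<omega>)" for t \<omega>
  have ae: "AE \<omega> in M. \<forall>t. X' t \<omega> = X t \<omega>"
  proof -
    have "N \<in> null_sets M" using N(2,3) by (rule null_setsI)
    from AE_not_in[OF this] show ?thesis by eventually_elim (simp add: X'_def)
  qed
  have X'm: "X' t \<in> borel_measurable M" if "0 \<le> t" for t
    unfolding X'_def using X_measurable[OF that] N(3) by (intro measurable_If_set) auto
  have cyl_AE: "AE \<omega> in M. \<omega> \<in> cylinder M X' J B \<longleftrightarrow> \<omega> \<in> cylinder M X J B" for J B
    using ae by eventually_elim (simp add: cylinder_def)
  let ?F = "natural_filtration M X'"
  have cylM: "cylinders M X' t \<subseteq> sets M" for t
  proof
    fix A assume "A \<in> cylinders M X' t"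
    then obtain J B where *: "A = cylinder M X' J B" "finite J" "J \<subseteq> {0..t}" "\<forall>r. B r \<in> sets borel"
      unfolding cylinders_def by auto
    show "A \<in> sets M" unfolding *(1) by (rule cylinder_sets[OF *(2,3) *(4)[rule_format] X'm])
  qed
  have FM: "sets (?F t) \<subseteq> sets M" for t
    unfolding sets_natural_filtration by (rule sets.sigma_sets_subset[OF cylM])
  have "increment_process M X' ?F (\<lambda>r. distr M borel (X r))"
  proof (intro increment_process.intro adapted_process.intro increment_process_axioms.intro prob_space_axioms)
    show "good_path (\<lambda>t. X' t \<omega>)" if "\<omega> \<in> space M" for \<omega>
    proof (cases "\<omega> \<in> N")
      case True
      have "good_path (\<lambda>_. 0)" unfolding good_path_def by (auto intro!: exI[of _ 0])
      then show ?thesis using True by (simp add: X'_def)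
    next
      case False
      then have "good_path (\<lambda>t. X t \<omega>)" using N(1) that by blast
      then show ?thesis using False by (simp add: X'_def)
    qed
    show "X' 0 \<omega> = 0" if "\<omega> \<in> space M" for \<omega>
    proof (cases "\<omega> \<in> N")
      case False
      then have "X 0 \<omega> = 0" using N(1) that by blast
      then show ?thesis by (simp add: X'_def)
    qed (simp add: X'_def)
    show "subalgebra M (?F t)" for t
      unfolding subalgebra_def space_natural_filtration using FM by simp
    show "sets (?F s) \<subseteq> sets (?F t)" if "s \<le> t" for s t
      unfolding sets_natural_filtration using that by (intro sigma_sets_mono' cylinders_mono)
    show "X' t \<in> borel_measurable (?F t)" if t: "0 \<le> t" for t
    proof (rule measurableI)
      fix C :: "real set" assume C: "C \<in> sets borel"
      have "X' t -` C \<inter> space M = cylinder M X' {t} (\<lambda>_. C)" unfolding cylinder_def by auto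
      then have "X' t -` C \<inter> space M \<in> cylinders M X' t"
        unfolding cylinders_def using C t by (intro CollectI exI[of _ "{t}"] exI[of _ "\<lambda>_. C"]) simp
      then show "X' t -` C \<inter> space (?F t) \<in> sets (?F t)"
        unfolding space_natural_filtration sets_natural_filtration by (rule sigma_sets.Basic)
    qed simp
    show "prob_space (distr M borel (X r))" if "0 \<le> r" for r
      by (rule prob_space_distr[OF X_measurable[OF that]])
    show "sets (distr M borel (X r)) = sets borel" for r by simp
    show "emeasure M (A \<inter> {\<omega>\<in>space M. X' (s + r) \<omega> - X' s \<omega> \<in> C}) = emeasure M A * emeasure (distr M borel (X r)) C"
      if s: "0 \<le> s" and r: "0 \<le> r" and A: "A \<in> sets (?F s)" and C: "C \<in> sets borel" for s r A C
    proof -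
      define E where "E = {\<omega>\<in>space M. X' (s + r) \<omega> - X' s \<omega> \<in> C}"
      have E: "E \<in> sets M"
      proof -
        have "(\<lambda>\<omega>. X' (s + r) \<omega> - X' s \<omega>) \<in> borel_measurable M" using s r by (intro borel_measurable_diff X'm) auto
        from measurable_sets[OF this C] show ?thesis unfolding E_def by (simp add: vimage_def Int_def conj_commute)
      qed
      define c where "c = prob {\<omega>\<in>space M. X r \<omega> \<in> C}"
      have c: "emeasure (distr M borel (X r)) C = ennreal c"
        using C X_measurable[OF r] unfolding c_def
        by (subst emeasure_distr) (auto simp: emeasure_eq_measure intro!: arg_cong[where f=prob])
      have "prob (A \<inter> E) = prob A * c"
        using Int_stable_cylinders cylinders_Pow A[unfolded sets_natural_filtration]
      proof (induction rule: sigma_sets_induct_disjoint)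
        case (basic A)
        then obtain J B where A: "A = cylinder M X' J B" and J: "finite J" "J \<subseteq> {0..s}" and B: "\<And>r. B r \<in> sets borel"
          unfolding cylinders_def by auto
        have cM: "cylinder M X' J B \<in> sets M" "cylinder M X J B \<in> sets M"
          by (rule cylinder_sets[OF J B X'm], assumption) (rule cylinder_sets[OF J B X_measurable])
        have Em: "{\<omega>\<in>space M. X (s + r) \<omega> - X s \<omega> \<in> C} \<in> sets M"
        proof -
          have "(\<lambda>\<omega>. X (s + r) \<omega> - X s \<omega>) \<in> borel_measurable M" using s r by (intro borel_measurable_diff X_measurable) auto
          from measurable_sets[OF this C] show ?thesis by (simp add: vimage_def Int_def conj_commute)
        qed
        have "prob (A \<inter> E) = prob (cylinder M X J B \<inter> {\<omega>\<in>space M. X (s + r) \<omega> - X s \<omega> \<in> C})"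
        proof (rule finite_measure_eq_AE)
          show "AE \<omega> in M. \<omega> \<in> A \<inter> E \<longleftrightarrow> \<omega> \<in> cylinder M X J B \<inter> {\<omega>\<in>space M. X (s + r) \<omega> - X s \<omega> \<in> C}"
            using ae cyl_AE[of J B] by eventually_elim (simp add: A E_def)
        qed (use cM E Em A in auto)
        also have "\<dots> = prob (cylinder M X J B) * c"
          unfolding c_def by (rule cylinder_increment_indep[OF J B C s r])
        also have "prob (cylinder M X J B) = prob A"
          unfolding A using cyl_AE[of J B] cM by (intro finite_measure_eq_AE) auto
        finally show ?case .
      next
        case empty then show ?case by simp
      next
        case (compl A)
        then have AM: "A \<in> sets M" using FM[of s] unfolding sets_natural_filtration by auto
        have Ec: "prob E = c"
        proof -
          have "prob (cylinder M X {} (\<lambda>_. UNIV) \<inter> {\<omega>\<in>space M. X (s + r) \<omega> - X s \<omega> \<in> C}) = prob (cylinder M X {} (\<lambda>_. UNIV)) * c"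
            unfolding c_def by (rule cylinder_increment_indep[OF _ _ _ C s r]) auto
          moreover have "cylinder M X {} (\<lambda>_. UNIV) = space M" unfolding cylinder_def by auto
          moreover have "prob E = prob (space M \<inter> {\<omega>\<in>space M. X (s + r) \<omega> - X s \<omega> \<in> C})"
          proof (rule finite_measure_eq_AE)
            show "AE \<omega> in M. \<omega> \<in> E \<longleftrightarrow> \<omega> \<in> space M \<inter> {\<omega>\<in>space M. X (s + r) \<omega> - X s \<omega> \<in> C}"
              using ae by eventually_elim (auto simp: E_def)
            have "(\<lambda>\<omega>. X (s + r) \<omega> - X s \<omega>) \<in> borel_measurable M" using s r by (intro borel_measurable_diff X_measurable) auto
            from measurable_sets[OF this C] show "space M \<inter> {\<omega>\<in>space M. X (s + r) \<omega> - X s \<omega> \<in> C} \<in> sets M"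
              by (simp add: vimage_def Int_def conj_commute)
          qed (rule E)
          ultimately show ?thesis by (simp add: prob_space)
        qed
        have "prob ((space M - A) \<inter> E) = prob (E - A \<inter> E)"
          using sets.sets_into_space[OF E] by (intro arg_cong[where f=prob]) auto
        also have "\<dots> = prob E - prob (A \<inter> E)" using E AM by (intro finite_measure_Diff) auto
        also have "\<dots> = (1 - prob A) * c" using compl Ec by (simp add: algebra_simps)
        also have "1 - prob A = prob (space M - A)" using prob_compl[OF AM] by simp
        finally show ?case .
      next
        case (union A)
        have AM: "A i \<in> sets M" for i using union(2) FM[of s] unfolding sets_natural_filtration by auto
        have "(\<lambda>i. prob (A i \<inter> E)) sums prob (\<Union>i. A i \<inter> E)"
          using union(1) AM E by (intro finite_measure_UNION) (auto simp: disjoint_family_on_def)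
        moreover have "(\<Union>i. A i \<inter> E) = (\<Union>i. A i) \<inter> E" by auto
        ultimately have 1: "(\<lambda>i. prob (A i \<inter> E)) sums prob ((\<Union>i. A i) \<inter> E)" by simp
        have "(\<lambda>i. prob (A i)) sums prob (\<Union>i. A i)"
          using union(1) AM by (intro finite_measure_UNION) auto
        then have "(\<lambda>i. prob (A i) * c) sums (prob (\<Union>i. A i) * c)" by (rule sums_mult2)
        then have 2: "(\<lambda>i. prob (A i \<inter> E)) sums (prob (\<Union>i. A i) * c)" using union(3) by simp
        show ?case by (rule sums_unique2[OF 1 2])
      qed
      then show ?thesis
        unfolding E_def[symmetric] c by (simp add: emeasure_eq_measure ennreal_mult c_def)
    qed
  qed
  then show ?thesis using ae by (rule that)
qed

end

section \<open>Integrated scale functions\<close>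

text \<open>V is extended by 0 to the negative half-line, so that the one-sided transform is an
  integral over the whole line, as in \<open>two_sided_laplace_unique\<close>.\<close>

definition has_laplace :: "(real \<Rightarrow> real) \<Rightarrow> real \<Rightarrow> (real \<Rightarrow> real) \<Rightarrow> bool" where
  "has_laplace V s0 L \<longleftrightarrow> V \<in> borel_measurable borel \<and> (\<forall>y. 0 \<le> V y) \<and> (\<forall>y<0. V y = 0) \<and>
     (\<forall>s>s0. integrable lborel (\<lambda>y. exp (- s * y) * V y) \<and> (\<integral>y. exp (- s * y) * V y \<partial>lborel) = L s)"

definition primitive :: "(real \<Rightarrow> real) \<Rightarrow> real \<Rightarrow> real" where
  "primitive V x = (\<integral>y. indicator {0..x} y * V y \<partial>lborel)"

lemma nn_integral_exp_tail:
  assumes s: "0 < s"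
  shows "(\<integral>\<^sup>+x. ennreal (exp (- s * x)) * indicator {y..} x \<partial>lborel) = ennreal (exp (- s * y) / s)"
proof -
  have "(\<integral>\<^sup>+x. ennreal (exp (- s * x)) * indicator {y..} x \<partial>lborel) = ennreal (0 - (- exp (- s * y) / s))"
  proof (rule nn_integral_FTC_atLeast)
    show "((\<lambda>x. - exp (- s * x) / s) has_real_derivative exp (- s * x)) (at x)" for x
      using s by (auto intro!: derivative_eq_intros)
    have "((\<lambda>x. exp (- s * x)) \<longlongrightarrow> 0) at_top"
      by (rule filterlim_compose[OF exp_at_bot]) (use s in \<open>simp add: filterlim_uminus_at_bot filterlim_tendsto_pos_mult_at_top[OF tendsto_const _ filterlim_ident]\<close>)
    from tendsto_divide[OF tendsto_minus[OF this] tendsto_const[of s]]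
    show "((\<lambda>x. - exp (- s * x) / s) \<longlongrightarrow> 0) at_top" using s by simp
  qed auto
  then show ?thesis by simp
qed

lemma has_laplaceD:
  assumes "has_laplace V s0 L"
  shows "V \<in> borel_measurable borel" "0 \<le> V y" "y < 0 \<Longrightarrow> V y = 0"
    "s0 < s \<Longrightarrow> integrable lborel (\<lambda>y. exp (- s * y) * V y)" "s0 < s \<Longrightarrow> (\<integral>y. exp (- s * y) * V y \<partial>lborel) = L s"
  using assms unfolding has_laplace_def by auto

lemma has_laplace_nn:
  assumes "has_laplace V s0 L" "s0 < s"
  shows "(\<integral>\<^sup>+y. ennreal (exp (- s * y) * V y) \<partial>lborel) = ennreal (L s)"
  using has_laplaceD[OF assms(1)] assms(2) by (subst nn_integral_eq_integral) auto

lemma has_laplaceI: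
  assumes m: "V \<in> borel_measurable borel" and "\<And>y. 0 \<le> V y" "\<And>y. y < 0 \<Longrightarrow> V y = 0"
    and nn: "\<And>s. s0 < s \<Longrightarrow> (\<integral>\<^sup>+y. ennreal (exp (- s * y) * V y) \<partial>lborel) = ennreal (L s)" and L: "\<And>s. s0 < s \<Longrightarrow> 0 \<le> L s"
  shows "has_laplace V s0 L"
  unfolding has_laplace_def
proof (intro conjI allI impI)
  fix s assume s: "s0 < s"
  note [measurable] = m
  show i: "integrable lborel (\<lambda>y. exp (- s * y) * V y)"
    using nn[OF s] assms(2) by (intro integrableI_nonneg) auto
  show "(\<integral>y. exp (- s * y) * V y \<partial>lborel) = L s"
    using nn[OF s] assms(2) L[OF s] by (intro integral_eq_nn_integral[THEN trans]) auto
qed (use assms in auto)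

lemma indicator_primitive_integrable:
  assumes V: "has_laplace V s0 L"
  shows "integrable lborel (\<lambda>y. indicator {0..x} y * V y)"
proof -
  define s where "s = \<bar>s0\<bar> + 1"
  have s: "s0 < s" "0 \<le> s" unfolding s_def by auto
  note [measurable] = has_laplaceD(1)[OF V]
  show ?thesis
  proof (rule Bochner_Integration.integrable_bound[OF integrable_mult_right[OF has_laplaceD(4)[OF V s(1)], of "exp (s * x)"]])
    show "AE y in lborel. norm (indicator {0..x} y * V y) \<le> norm (exp (s * x) * (exp (- s * y) * V y))"
    proof (rule AE_I2)
      fix y
      show "norm (indicator {0..x} y * V y) \<le> norm (exp (s * x) * (exp (- s * y) * V y))"
      proof (cases "y \<in> {0..x}")
        case True
        then have "s * y \<le> s * x" using s by (intro mult_left_mono) auto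
        then have "1 \<le> exp (s * x) * exp (- s * y)" by (simp add: mult_exp_exp)
        then have "1 * V y \<le> (exp (s * x) * exp (- s * y)) * V y" using has_laplaceD(2)[OF V] by (intro mult_right_mono) auto
        then show ?thesis using True has_laplaceD(2)[OF V, of y] by (simp add: abs_mult mult.assoc)
      qed simp
    qed
  qed measurable
qed

text \<open>Integration divides the transform by s, by Tonelli's theorem. It also yields
  monotonicity and continuity, the regularity that \<open>smoothing_identity\<close> asks of
  V.\<close>

lemma primitive_facts:
  assumes V: "has_laplace V s0 L" and s0: "0 \<le> s0"
  shows "mono (primitive V)" "continuous_on UNIV (primitive V)" "has_laplace (primitive V) s0 (\<lambda>s. L s / s)"
proof -
  note [measurable] = has_laplaceD(1)[OF V]
  note V0 = has_laplaceD(2)[OF V]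
  note int = indicator_primitive_integrable[OF V]
  show mono: "mono (primitive V)"
    unfolding primitive_def
    by (intro monoI integral_mono int) (auto simp: indicator_def V0)
  have m[measurable]: "primitive V \<in> borel_measurable borel" by (rule borel_measurable_mono[OF mono])
  show "continuous_on UNIV (primitive V)"
    unfolding continuous_on_eq_continuous_at[OF open_UNIV]
  proof
    fix x :: real
    show "isCont (primitive V) x"
      unfolding continuous_at_sequentially comp_def
    proof (intro allI impI)
      fix u assume u: "u \<longlonglongrightarrow> x"
      have "eventually (\<lambda>n. u n < x + 1) sequentially" using u by (rule order_tendstoD) simp
      then obtain n0 where n0: "\<And>n. n0 \<le> n \<Longrightarrow> u n < x + 1" unfolding eventually_sequentially by auto
      have "(\<lambda>n. primitive V (u (n + n0))) \<longlonglongrightarrow> primitive V x"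
        unfolding primitive_def
      proof (rule integral_dominated_convergence[where w = "\<lambda>y. indicator {0..x+1} y * V y"])
        show "integrable lborel (\<lambda>y. indicator {0..x+1} y * V y)" by (rule int)
        show "AE y in lborel. (\<lambda>n. indicator {0..u (n + n0)} y * V y) \<longlonglongrightarrow> indicator {0..x} y * V y"
          using AE_lborel_singleton[of x]
        proof eventually_elim
          case (elim y)
          have u': "(\<lambda>n. u (n + n0)) \<longlonglongrightarrow> x" by (rule LIMSEQ_ignore_initial_segment[OF u])
          have "eventually (\<lambda>n. indicator {0..u (n + n0)} y = (indicator {0..x} y :: real)) sequentially"
          proof (cases "y < x")
            case True
            then have "eventually (\<lambda>n. y < u (n + n0)) sequentially" using order_tendstoD(1)[OF u'] by simp
            then show ?thesis by eventually_elim (use True in \<open>auto simp: indicator_def\<close>)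
          next
            case False
            then have "x < y" using elim by simp
            then have "eventually (\<lambda>n. u (n + n0) < y) sequentially" using order_tendstoD(2)[OF u'] by simp
            then show ?thesis by eventually_elim (use \<open>x < y\<close> in \<open>auto simp: indicator_def\<close>)
          qed
          then show ?case by (rule tendsto_mult[OF tendsto_eventually tendsto_const])
        qed
        show "AE y in lborel. norm (indicator {0..u (n + n0)} y * V y) \<le> indicator {0..x+1} y * V y" for n
          using n0[of "n + n0"] V0 by (intro AE_I2) (auto simp: indicator_def)
      qed measurable
      then show "(\<lambda>n. primitive V (u n)) \<longlonglongrightarrow> primitive V x" by (rule LIMSEQ_offset)
    qed
  qed
  show "has_laplace (primitive V) s0 (\<lambda>s. L s / s)"
  proof (rule has_laplaceI[OF m])
    show "0 \<le> primitive V y" for y unfolding primitive_def using V0 by (intro integral_nonneg_AE) auto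
    show "primitive V y = 0" if "y < 0" for y unfolding primitive_def using that by simp
    fix s assume s: "s0 < s"
    then have s_pos: "0 < s" using s0 by simp
    have Ls: "0 \<le> L s"
      unfolding has_laplaceD(5)[OF V s, symmetric] using V0 by (intro integral_nonneg_AE AE_I2) simp
    then show "0 \<le> L s / s" using s_pos by simp
    have nn: "ennreal (primitive V x) = (\<integral>\<^sup>+y. ennreal (indicator {0..x} y * V y) \<partial>lborel)" for x
      unfolding primitive_def using V0 by (intro nn_integral_eq_integral[symmetric] int) auto
    have "(\<integral>\<^sup>+x. ennreal (exp (- s * x) * primitive V x) \<partial>lborel)
      = (\<integral>\<^sup>+x. \<integral>\<^sup>+y. ennreal (exp (- s * x)) * ennreal (indicator {0..x} y * V y) \<partial>lborel \<partial>lborel)"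
    proof (rule nn_integral_cong)
      fix x
      have "0 \<le> primitive V x" unfolding primitive_def using V0 by (intro integral_nonneg_AE) auto
      then show "ennreal (exp (- s * x) * primitive V x) = (\<integral>\<^sup>+y. ennreal (exp (- s * x)) * ennreal (indicator {0..x} y * V y) \<partial>lborel)"
        by (subst nn_integral_cmult) (auto simp: ennreal_mult nn)
    qed
    also have "\<dots> = (\<integral>\<^sup>+x. \<integral>\<^sup>+y. (ennreal (exp (- s * x)) * indicator {y..} x) * ennreal (V y) \<partial>lborel \<partial>lborel)"
      using has_laplaceD(3)[OF V] by (intro nn_integral_cong) (auto simp: indicator_def not_le)
    also have "\<dots> = (\<integral>\<^sup>+y. \<integral>\<^sup>+x. (ennreal (exp (- s * x)) * indicator {y..} x) * ennreal (V y) \<partial>lborel \<partial>lborel)"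
    proof (rule lborel_pair.Fubini'[symmetric])
      have "(\<lambda>(x, y). (ennreal (exp (- s * x)) * indicator {z. snd z \<le> fst z} (x, y)) * ennreal (V y)) \<in> borel_measurable (lborel \<Otimes>\<^sub>M lborel)"
        by measurable
      also have "(\<lambda>(x, y). (ennreal (exp (- s * x)) * indicator {z. snd z \<le> fst z} (x, y)) * ennreal (V y)) = (\<lambda>(x, y). (ennreal (exp (- s * x)) * indicator {y..} x) * ennreal (V y))"
        by (auto simp: indicator_def fun_eq_iff)
      finally show "(\<lambda>(x, y). (ennreal (exp (- s * x)) * indicator {y..} x) * ennreal (V y)) \<in> borel_measurable (lborel \<Otimes>\<^sub>M lborel)" .
    qed
    also have "\<dots> = (\<integral>\<^sup>+y. ennreal (exp (- s * y) / s) * ennreal (V y) \<partial>lborel)"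
    proof (rule nn_integral_cong)
      fix y
      have "(\<integral>\<^sup>+x. (ennreal (exp (- s * x)) * indicator {y..} x) * ennreal (V y) \<partial>lborel)
        = (\<integral>\<^sup>+x. ennreal (exp (- s * x)) * indicator {y..} x \<partial>lborel) * ennreal (V y)"
        by (rule nn_integral_multc) measurable
      then show "(\<integral>\<^sup>+x. (ennreal (exp (- s * x)) * indicator {y..} x) * ennreal (V y) \<partial>lborel) = ennreal (exp (- s * y) / s) * ennreal (V y)"
        by (simp only: nn_integral_exp_tail[OF s_pos])
    qed
    also have "\<dots> = (\<integral>\<^sup>+y. ennreal (1 / s) * ennreal (exp (- s * y) * V y) \<partial>lborel)"
      using V0 s_pos by (intro nn_integral_cong) (auto simp: ennreal_mult[symmetric])
    also have "\<dots> = ennreal (1 / s) * ennreal (L s)"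
      unfolding has_laplace_nn[OF V s, symmetric] by (rule nn_integral_cmult) measurable
    also have "\<dots> = ennreal (L s / s)" using s_pos Ls by (simp add: ennreal_mult[symmetric])
    finally show "(\<integral>\<^sup>+x. ennreal (exp (- s * x) * primitive V x) \<partial>lborel) = ennreal (L s / s)" .
  qed
qed

text \<open>On [y, y + 1] monotonicity gives at least V y and the weight is at least exp(-l (y +
  1)), so the transform at l bounds V y from above.\<close>

lemma laplace_growth:
  assumes V: "has_laplace V s0 L" and mono: "mono V" and l: "s0 < l" "0 < l"
  shows "V y \<le> L l * exp l * exp (l * y)"
proof -
  have "V y * exp (- l * (y + 1)) = (\<integral>z. V y * exp (- l * (y + 1)) * indicator {y..y+1} z \<partial>lborel)" by simp
  also have "\<dots> \<le> (\<integral>z. exp (- l * z) * V z \<partial>lborel)"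
  proof (rule integral_mono)
    show "integrable lborel (\<lambda>z. V y * exp (- l * (y + 1)) * indicator {y..y+1} z)"
      by (intro integrable_mult_right integrable_real_indicator) auto
    show "integrable lborel (\<lambda>z. exp (- l * z) * V z)" by (rule has_laplaceD(4)[OF V l(1)])
    fix z
    show "V y * exp (- l * (y + 1)) * indicator {y..y+1} z \<le> exp (- l * z) * V z"
    proof (cases "z \<in> {y..y+1}")
      case True
      then have "l * z \<le> l * (y + 1)" using l by (intro mult_left_mono) auto
      then have "exp (- l * (y + 1)) * V y \<le> exp (- l * z) * V z"
        using True has_laplaceD(2)[OF V] monoD[OF mono, of y z] by (intro mult_mono) auto
      then show ?thesis using True by (simp add: mult.commute)
    qed (simp add: has_laplaceD(2)[OF V])
  qed
  also have "\<dots> = L l" by (rule has_laplaceD(5)[OF V l(1)])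
  finally have 1: "V y * exp (- l * (y + 1)) \<le> L l" .
  have "V y = V y * exp (- l * (y + 1)) * exp (l * (y + 1))"
    by (simp add: mult.assoc mult_exp_exp)
  also have "\<dots> \<le> L l * exp (l * (y + 1))" using 1 by (rule mult_right_mono) simp
  also have "exp (l * (y + 1)) = exp l * exp (l * y)" unfolding mult_exp_exp by (simp add: distrib_left add.commute)
  finally show ?thesis by (simp only: mult.assoc)
qed

lemma has_laplace_heaviside: "has_laplace (indicator {0..}) 0 (\<lambda>s. 1 / s)"
proof (rule has_laplaceI)
  fix s :: real assume s: "0 < s"
  have "(\<integral>\<^sup>+y. ennreal (exp (- s * y) * indicator {0..} y) \<partial>lborel) = (\<integral>\<^sup>+y. ennreal (exp (- s * y)) * indicator {0..} y \<partial>lborel)"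
    by (intro nn_integral_cong) (auto simp: indicator_def)
  then show "(\<integral>\<^sup>+y. ennreal (exp (- s * y) * indicator {0..} y) \<partial>lborel) = ennreal (1 / s)"
    using nn_integral_exp_tail[OF s, of 0] by simp
qed auto

lemma has_laplace_mono_abscissa: "has_laplace V s0 L \<Longrightarrow> s0 \<le> s1 \<Longrightarrow> has_laplace V s1 L"
  unfolding has_laplace_def by auto

lemma primitive_heaviside: "primitive (indicator {0..}) y = max 0 y"
proof -
  have "(\<integral>z. indicator {0..y} z * indicator {0..} z \<partial>lborel) = (\<integral>z. (indicator {0..y} z :: real) \<partial>lborel)"
    by (intro Bochner_Integration.integral_cong refl) (auto simp: indicator_def)
  then show ?thesis unfolding primitive_def by (cases "0 \<le> y") auto
qed

lemma nn_integral_exp_interval: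
  assumes c: "c \<noteq> 0" and t: "0 \<le> t"
  shows "(\<integral>\<^sup>+r. ennreal (exp (c * r)) * indicator {0..<t} r \<partial>lborel) = ennreal ((exp (c * t) - 1) / c)"
proof -
  have "(\<integral>\<^sup>+r. ennreal (exp (c * r)) * indicator {0..<t} r \<partial>lborel) = (\<integral>\<^sup>+r. ennreal (exp (c * r)) * indicator {0..t} r \<partial>lborel)"
    using AE_lborel_singleton[of t] by (intro nn_integral_cong_AE) (auto elim!: eventually_mono simp: indicator_def)
  also have "\<dots> = ennreal (exp (c * t) / c - exp (c * 0) / c)"
    using c t by (intro nn_integral_FTC_Icc) (auto intro!: derivative_eq_intros)
  finally show ?thesis by (simp add: diff_divide_distrib)
qed

lemma AE_lborel_dense:
  assumes "AE y in lborel. P y" "a < (b::real)"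
  shows "\<exists>y. a < y \<and> y < b \<and> P y"
proof (rule ccontr)
  assume n: "\<not> ?thesis"
  have "AE y in lborel. \<not> y \<in> {a<..<b}" using assms(1) by eventually_elim (use n in auto)
  then have "emeasure lborel {y\<in>space lborel. y \<in> {a<..<b}} = 0" by (rule emeasure_eq_0_AE)
  moreover have "{y\<in>space lborel. y \<in> {a<..<b}} = {a<..<b}" by auto
  ultimately have "emeasure lborel {a<..<b} = 0" by (simp only:)
  then show False using assms(2) by simp
qed

section \<open>The semigroup acting on Laplace transforms\<close>

context increment_process begin

text \<open>Translation by X r multiplies the transform by exp(-s X r), whose mean is exponential in
  r by \<open>exp_moment\<close>.\<close>

lemma nn_integral_laplace_shift:
  assumes V: "has_laplace V s0 L" and s: "s0 < s" "0 \<le> s" and r: "0 \<le> r"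
    and e: "integrable M (\<lambda>\<omega>. exp (- s * X 1 \<omega>))"
  shows "(\<integral>\<^sup>+y. ennreal (exp (- s * y)) * (\<integral>\<^sup>+\<omega>. ennreal (V (y - X r \<omega>)) \<partial>M) \<partial>lborel)
    = ennreal (exp (r * ln (\<integral>\<omega>. exp (- s * X 1 \<omega>) \<partial>M)) * L s)"
proof -
  interpret P: pair_sigma_finite lborel M ..
  note [measurable] = has_laplaceD(1)[OF V] X_measurable[OF r]
  have inner: "(\<integral>\<^sup>+y. ennreal (exp (- s * y)) * ennreal (V (y - x)) \<partial>lborel) = ennreal (exp (- s * x)) * ennreal (L s)" for x
  proof -
    have "(\<integral>\<^sup>+y. ennreal (exp (- s * y)) * ennreal (V (y - x)) \<partial>lborel)
      = (\<integral>\<^sup>+u. ennreal (exp (- s * (x + 1 * u))) * ennreal (V ((x + 1 * u) - x)) \<partial>lborel)"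
      by (subst nn_integral_real_affine[where c=1 and t=x]) auto
    also have "\<dots> = (\<integral>\<^sup>+u. ennreal (exp (- s * x)) * ennreal (exp (- s * u) * V u) \<partial>lborel)"
    proof (rule nn_integral_cong)
      fix u
      have "exp (- s * (x + 1 * u)) = exp (- s * x) * exp (- s * u)" unfolding mult_exp_exp by (simp add: algebra_simps)
      then show "ennreal (exp (- s * (x + 1 * u))) * ennreal (V ((x + 1 * u) - x)) = ennreal (exp (- s * x)) * ennreal (exp (- s * u) * V u)"
        using has_laplaceD(2)[OF V, of u] by (simp add: ennreal_mult mult.assoc)
    qed
    also have "\<dots> = ennreal (exp (- s * x)) * ennreal (L s)"
      unfolding has_laplace_nn[OF V s(1), symmetric] by (rule nn_integral_cmult) measurable
    finally show ?thesis .
  qed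
  have "(\<integral>\<^sup>+y. ennreal (exp (- s * y)) * (\<integral>\<^sup>+\<omega>. ennreal (V (y - X r \<omega>)) \<partial>M) \<partial>lborel)
    = (\<integral>\<^sup>+y. \<integral>\<^sup>+\<omega>. ennreal (exp (- s * y)) * ennreal (V (y - X r \<omega>)) \<partial>M \<partial>lborel)"
    by (intro nn_integral_cong nn_integral_cmult[symmetric]) measurable
  also have "\<dots> = (\<integral>\<^sup>+\<omega>. \<integral>\<^sup>+y. ennreal (exp (- s * y)) * ennreal (V (y - X r \<omega>)) \<partial>lborel \<partial>M)"
    by (rule P.Fubini'[symmetric]) measurable
  also have "\<dots> = (\<integral>\<^sup>+\<omega>. ennreal (exp (- s * X r \<omega>)) * ennreal (L s) \<partial>M)" unfolding inner ..
  also have "\<dots> = (\<integral>\<^sup>+\<omega>. ennreal (exp (- s * X r \<omega>)) \<partial>M) * ennreal (L s)" by (rule nn_integral_multc) measurable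
  also have "(\<integral>\<^sup>+\<omega>. ennreal (exp (- s * X r \<omega>)) \<partial>M) = ennreal (exp (r * ln (\<integral>\<omega>. exp (- s * X 1 \<omega>) \<partial>M)))"
    using exp_moment[OF e s(2) r] by (subst nn_integral_eq_integral) auto
  finally show ?thesis by (simp add: ennreal_mult')
qed

text \<open>Both sides have the two-sided Laplace transform \<open>exp ((\<psi> s - q) t) * Ll s / (\<psi> s - q)\<close>; right
  continuity upgrades the almost everywhere equality.\<close>

lemma smoothing_identity:
  fixes V l :: "real \<Rightarrow> real"
  assumes e: "\<forall>s\<ge>0. integrable M (\<lambda>\<omega>. exp (- s * X 1 \<omega>))"
  defines "\<psi> \<equiv> \<lambda>s. ln (\<integral>\<omega>. exp (- s * X 1 \<omega>) \<partial>M)"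
  assumes q: "0 < q" and s0: "0 \<le> s0" and \<psi>q: "\<forall>s>s0. q < \<psi> s"
    and V: "has_laplace V s0 (\<lambda>s. Ll s / (\<psi> s - q))" "mono V" "continuous_on UNIV V"
    and l: "has_laplace l s0 Ll" "mono l" "\<And>y. (l \<longlongrightarrow> l y) (at_right y)"
    and t: "0 \<le> t"
  shows "exp (- q * t) * (\<integral>\<omega>. V (y - X t \<omega>) \<partial>M) =
    V y + (\<integral>r. indicator {0..<t} r * (exp (- q * r) * (\<integral>\<omega>. l (y - X r \<omega>) \<partial>M)) \<partial>lborel)"
    and "integrable lborel (\<lambda>r. indicator {0..<t} r * (exp (- q * r) * (\<integral>\<omega>. l (y - X r \<omega>) \<partial>M)))"
    and "\<And>r. 0 \<le> r \<Longrightarrow> integrable M (\<lambda>\<omega>. V (y - X r \<omega>))"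
    and "\<And>r. 0 \<le> r \<Longrightarrow> integrable M (\<lambda>\<omega>. l (y - X r \<omega>))"
proof -
  note e = e[rule_format] and \<psi>q = \<psi>q[rule_format]
  define \<Lambda> where "\<Lambda> = s0 + 1"
  have \<Lambda>: "s0 < \<Lambda>" "0 < \<Lambda>" "0 \<le> \<Lambda>" unfolding \<Lambda>_def using s0 by auto
  note [measurable] = has_laplaceD(1)[OF V(1)] has_laplaceD(1)[OF l(1)]
  note V0 = has_laplaceD(2)[OF V(1)] and l0 = has_laplaceD(2)[OF l(1)]
  have intg: "integrable M (\<lambda>\<omega>. g (y - X r \<omega>))" and bnd: "(\<integral>\<omega>. g (y - X r \<omega>) \<partial>M) \<le> L \<Lambda> * exp \<Lambda> * exp (\<Lambda> * y) * exp (r * \<psi> \<Lambda>)"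
    if g: "has_laplace g s0 L" "mono g" and r: "0 \<le> r" for g L y r
  proof -
    note [measurable] = X_measurable[OF r] has_laplaceD(1)[OF g(1)]
    have i: "integrable M (\<lambda>\<omega>. L \<Lambda> * exp \<Lambda> * exp (\<Lambda> * y) * exp (- \<Lambda> * X r \<omega>))"
      by (rule integrable_mult_right[OF exp_moment(1)[OF e[OF \<Lambda>(3)] \<Lambda>(3) r]])
    have le: "g (y - X r \<omega>) \<le> L \<Lambda> * exp \<Lambda> * exp (\<Lambda> * y) * exp (- \<Lambda> * X r \<omega>)" for \<omega>
    proof -
      have "exp (\<Lambda> * (y - X r \<omega>)) = exp (\<Lambda> * y) * exp (- \<Lambda> * X r \<omega>)" unfolding mult_exp_exp by (simp add: algebra_simps)
      then show ?thesis using laplace_growth[OF g \<Lambda>(1,2), of "y - X r \<omega>"] by (simp only: mult.assoc)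
    qed
    show i2: "integrable M (\<lambda>\<omega>. g (y - X r \<omega>))"
    proof (rule Bochner_Integration.integrable_bound[OF i])
      show "AE \<omega> in M. norm (g (y - X r \<omega>)) \<le> norm (L \<Lambda> * exp \<Lambda> * exp (\<Lambda> * y) * exp (- \<Lambda> * X r \<omega>))"
        using order_trans[OF le abs_ge_self] has_laplaceD(2)[OF g(1)] by (intro AE_I2) (simp only: real_norm_def abs_of_nonneg)
    qed measurable
    have "(\<integral>\<omega>. g (y - X r \<omega>) \<partial>M) \<le> (\<integral>\<omega>. L \<Lambda> * exp \<Lambda> * exp (\<Lambda> * y) * exp (- \<Lambda> * X r \<omega>) \<partial>M)"
      by (rule integral_mono[OF i2 i le])
    also have "\<dots> = L \<Lambda> * exp \<Lambda> * exp (\<Lambda> * y) * exp (r * \<psi> \<Lambda>)"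
      unfolding integral_mult_right_zero exp_moment(2)[OF e[OF \<Lambda>(3)] \<Lambda>(3) r] \<psi>_def ..
    finally show "(\<integral>\<omega>. g (y - X r \<omega>) \<partial>M) \<le> L \<Lambda> * exp \<Lambda> * exp (\<Lambda> * y) * exp (r * \<psi> \<Lambda>)" .
  qed
  show "integrable M (\<lambda>\<omega>. V (y - X r \<omega>))" if "0 \<le> r" for r by (rule intg[OF V(1,2) that])
  show "integrable M (\<lambda>\<omega>. l (y - X r \<omega>))" if "0 \<le> r" for r by (rule intg[OF l(1,2) that])
  define I where "I r y = (\<integral>\<omega>. l (y - X (max 0 r) \<omega>) \<partial>M)" for r y
  have I_eq: "I r y = (\<integral>\<omega>. l (y - X r \<omega>) \<partial>M)" if "0 \<le> r" for r y unfolding I_def using that by simp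
  have I0: "0 \<le> I r y" for r y unfolding I_def using l0 by (intro integral_nonneg_AE AE_I2)
  have [measurable]: "(\<lambda>(r, \<omega>). X (max 0 r) \<omega>) \<in> borel_measurable (borel \<Otimes>\<^sub>M M)" by (rule X_jointly_measurable)
  have "(\<lambda>(p, \<omega>). l (snd p - X (max 0 (fst p)) \<omega>)) \<in> borel_measurable ((borel \<Otimes>\<^sub>M borel) \<Otimes>\<^sub>M M)" by measurable
  then have "(\<lambda>p. \<integral>\<omega>. l (snd p - X (max 0 (fst p)) \<omega>) \<partial>M) \<in> borel_measurable (borel \<Otimes>\<^sub>M borel)"
    by (rule borel_measurable_lebesgue_integral)
  then have Im: "(\<lambda>p. I (fst p) (snd p)) \<in> borel_measurable (borel \<Otimes>\<^sub>M borel)" unfolding I_def .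
  have Im1[measurable]: "(\<lambda>r. I r y) \<in> borel_measurable borel" for y
    using measurable_compose[OF _ Im, of "\<lambda>r. (r, y)" borel] by simp
  have Im2[measurable]: "(\<lambda>(y, r). I r y) \<in> borel_measurable (lborel \<Otimes>\<^sub>M lborel)"
    using measurable_compose[OF _ Im, of "\<lambda>z. (snd z, fst z)" "lborel \<Otimes>\<^sub>M lborel"] by (simp add: case_prod_beta)
  define J where "J y r = indicator {0..<t} r * (exp (- q * r) * I r y)" for y r
  have J0: "0 \<le> J y r" for y r unfolding J_def using I0 by simp
  have J_int: "integrable lborel (J y)" for y
  proof -
    define c where "c = Ll \<Lambda> * exp \<Lambda> * exp (\<Lambda> * y) * exp (t * \<bar>\<psi> \<Lambda>\<bar>)"
    have Lc: "0 \<le> Ll \<Lambda>" unfolding has_laplaceD(5)[OF l(1) \<Lambda>(1), symmetric] using l0 by (intro integral_nonneg_AE AE_I2) simp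
    have c0: "0 \<le> c" unfolding c_def using Lc by simp
    show ?thesis
    proof (rule Bochner_Integration.integrable_bound)
      show "integrable lborel (\<lambda>r. c * indicator {0..<t} r)"
        using t by (intro integrable_mult_right integrable_real_indicator) auto
      show "J y \<in> borel_measurable lborel" unfolding J_def by measurable
      show "AE r in lborel. norm (J y r) \<le> norm (c * indicator {0..<t} r)"
      proof (rule AE_I2)
        fix r
        show "norm (J y r) \<le> norm (c * indicator {0..<t} r)"
        proof (cases "r \<in> {0..<t}")
          case True
          then have r: "0 \<le> r" "r \<le> t" by auto
          have "r * \<psi> \<Lambda> \<le> t * \<bar>\<psi> \<Lambda>\<bar>"
          proof -
            have "r * \<psi> \<Lambda> \<le> r * \<bar>\<psi> \<Lambda>\<bar>" using r by (intro mult_left_mono) auto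
            also have "\<dots> \<le> t * \<bar>\<psi> \<Lambda>\<bar>" using r by (intro mult_right_mono) auto
            finally show ?thesis .
          qed
          then have "Ll \<Lambda> * exp \<Lambda> * exp (\<Lambda> * y) * exp (r * \<psi> \<Lambda>) \<le> c"
            unfolding c_def using Lc by (intro mult_left_mono) auto
          then have "I r y \<le> c" using bnd[OF l(1,2) r(1), of y] unfolding I_eq[OF r(1)] by linarith
          moreover have "exp (- q * r) \<le> 1" using q r by simp
          ultimately have "exp (- q * r) * I r y \<le> 1 * c" using I0 by (intro mult_mono) auto
          then have "J y r \<le> c" unfolding J_def using True by simp
          then show ?thesis using J0[of y r] c0 True by simp
        qed (simp add: J_def)
      qed
    qed
  qed
  have J_eq: "(\<lambda>r. indicator {0..<t} r * (exp (- q * r) * (\<integral>\<omega>. l (y - X r \<omega>) \<partial>M))) = J y" for y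
    unfolding J_def by (auto simp: fun_eq_iff indicator_def I_eq)
  show "integrable lborel (\<lambda>r. indicator {0..<t} r * (exp (- q * r) * (\<integral>\<omega>. l (y - X r \<omega>) \<partial>M)))"
    unfolding J_eq by (rule J_int)
  define A where "A y = exp (- q * t) * (\<integral>\<omega>. V (y - X t \<omega>) \<partial>M)" for y
  define B where "B y = V y + (\<integral>r. J y r \<partial>lborel)" for y
  note [measurable] = X_measurable[OF t]
  have Am: "A \<in> borel_measurable borel"
  proof -
    have "(\<lambda>(y, \<omega>). V (y - X t \<omega>)) \<in> borel_measurable (borel \<Otimes>\<^sub>M M)" by measurable
    then have "(\<lambda>y. \<integral>\<omega>. V (y - X t \<omega>) \<partial>M) \<in> borel_measurable borel" by (rule borel_measurable_lebesgue_integral)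
    then show ?thesis unfolding A_def by measurable
  qed
  have Bm: "B \<in> borel_measurable borel"
  proof -
    have "(\<lambda>(y, r). J y r) \<in> borel_measurable (borel \<Otimes>\<^sub>M lborel)"
      using Im2 unfolding J_def by measurable
    then have "(\<lambda>y. \<integral>r. J y r \<partial>lborel) \<in> borel_measurable borel" by (rule lborel.borel_measurable_lebesgue_integral)
    then show ?thesis unfolding B_def by measurable
  qed
  have A0: "0 \<le> A y" for y unfolding A_def using V0 by (intro mult_nonneg_nonneg integral_nonneg_AE AE_I2) auto
  have JI0: "0 \<le> (\<integral>r. J y r \<partial>lborel)" for y using J0 by (intro integral_nonneg_AE AE_I2)
  have B0: "0 \<le> B y" for y unfolding B_def using V0[of y] JI0[of y] by simp
  \<comment> \<open>On the right-hand side the integral over r contributes (exp ((\<psi> s - q) t) -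
    1) / (\<psi> s - q) times Ll s, and its subtracted term cancels the transform of V.\<close>
  define T where "T s = exp ((\<psi> s - q) * t) * (Ll s / (\<psi> s - q))" for s
  have Ll0: "0 \<le> Ll s" if s: "s0 < s" for s
    unfolding has_laplaceD(5)[OF l(1) s, symmetric] using l0 by (intro integral_nonneg_AE AE_I2) simp
  have T0: "0 \<le> T s" if s: "s0 < s" for s
    unfolding T_def using Ll0[OF s] \<psi>q[OF s] by simp
  have nnA: "(\<integral>\<^sup>+y. ennreal (exp (- s * y) * A y) \<partial>lborel) = ennreal (T s)" if s: "s0 < s" for s
  proof -
    have s': "0 \<le> s" using s s0 by simp
    have eqA: "ennreal (exp (- s * y) * A y) = ennreal (exp (- q * t)) * (ennreal (exp (- s * y)) * (\<integral>\<^sup>+\<omega>. ennreal (V (y - X t \<omega>)) \<partial>M))" for y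
    proof -
      have "(\<integral>\<^sup>+\<omega>. ennreal (V (y - X t \<omega>)) \<partial>M) = ennreal (\<integral>\<omega>. V (y - X t \<omega>) \<partial>M)"
        using V0 by (intro nn_integral_eq_integral intg[OF V(1,2) t] AE_I2)
      moreover have "0 \<le> (\<integral>\<omega>. V (y - X t \<omega>) \<partial>M)" using V0 by (intro integral_nonneg_AE AE_I2)
      ultimately show ?thesis unfolding A_def by (simp add: ennreal_mult mult.left_commute)
    qed
    have "(\<lambda>(y, \<omega>). ennreal (V (y - X t \<omega>))) \<in> borel_measurable (lborel \<Otimes>\<^sub>M M)" by measurable
    then have [measurable]: "(\<lambda>y. \<integral>\<^sup>+\<omega>. ennreal (V (y - X t \<omega>)) \<partial>M) \<in> borel_measurable lborel"
      by (rule borel_measurable_nn_integral)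
    have "(\<integral>\<^sup>+y. ennreal (exp (- s * y) * A y) \<partial>lborel)
      = ennreal (exp (- q * t)) * (\<integral>\<^sup>+y. ennreal (exp (- s * y)) * (\<integral>\<^sup>+\<omega>. ennreal (V (y - X t \<omega>)) \<partial>M) \<partial>lborel)"
      unfolding eqA by (rule nn_integral_cmult) measurable
    also have "\<dots> = ennreal (exp (- q * t)) * ennreal (exp (t * \<psi> s) * (Ll s / (\<psi> s - q)))"
      unfolding nn_integral_laplace_shift[OF V(1) s s' t e[OF s']] \<psi>_def ..
    also have "\<dots> = ennreal (exp (- q * t) * exp (t * \<psi> s) * (Ll s / (\<psi> s - q)))"
      by (simp add: ennreal_mult'[symmetric] mult.assoc)
    also have "exp (- q * t) * exp (t * \<psi> s) = exp ((\<psi> s - q) * t)" unfolding mult_exp_exp by (simp add: algebra_simps)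
    finally show ?thesis unfolding T_def .
  qed
  have nnB: "(\<integral>\<^sup>+y. ennreal (exp (- s * y) * B y) \<partial>lborel) = ennreal (T s)" if s: "s0 < s" for s
  proof -
    have s': "0 \<le> s" using s s0 by simp
    have d: "\<psi> s - q \<noteq> 0" "0 < \<psi> s - q" using \<psi>q[OF s] by auto
    have eqB: "ennreal (exp (- s * y) * B y) = ennreal (exp (- s * y) * V y) + (\<integral>\<^sup>+r. ennreal (exp (- s * y)) * ennreal (J y r) \<partial>lborel)" for y
    proof -
      have "(\<integral>\<^sup>+r. ennreal (J y r) \<partial>lborel) = ennreal (\<integral>r. J y r \<partial>lborel)"
        using J0 by (intro nn_integral_eq_integral J_int AE_I2)
      moreover have "(\<integral>\<^sup>+r. ennreal (exp (- s * y)) * ennreal (J y r) \<partial>lborel) = ennreal (exp (- s * y)) * (\<integral>\<^sup>+r. ennreal (J y r) \<partial>lborel)"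
        by (rule nn_integral_cmult) (simp add: J_def)
      moreover have "ennreal (exp (- s * y) * B y) = ennreal (exp (- s * y) * V y) + ennreal (exp (- s * y) * (\<integral>r. J y r \<partial>lborel))"
        unfolding B_def distrib_left using V0[of y] JI0[of y] by (intro ennreal_plus) auto
      ultimately show ?thesis using JI0[of y] by (simp add: ennreal_mult)
    qed
    have Jm: "(\<lambda>(y, r). ennreal (exp (- s * y)) * ennreal (J y r)) \<in> borel_measurable (lborel \<Otimes>\<^sub>M lborel)"
      using Im2 unfolding J_def by measurable
    have Jm': "(\<lambda>(r, y). ennreal (exp (- s * y)) * ennreal (J y r)) \<in> borel_measurable (lborel \<Otimes>\<^sub>M lborel)"
      using measurable_compose[OF _ Jm, of "\<lambda>z. (snd z, fst z)" "lborel \<Otimes>\<^sub>M lborel"] by (simp add: case_prod_beta)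
    have [measurable]: "(\<lambda>y. \<integral>\<^sup>+r. ennreal (exp (- s * y)) * ennreal (J y r) \<partial>lborel) \<in> borel_measurable lborel"
      by (rule lborel.borel_measurable_nn_integral[OF Jm])
    have inner: "(\<integral>\<^sup>+y. ennreal (exp (- s * y)) * ennreal (J y r) \<partial>lborel) = ennreal (exp ((\<psi> s - q) * r)) * indicator {0..<t} r * ennreal (Ll s)" for r
    proof (cases "r \<in> {0..<t}")
      case True
      then have r: "0 \<le> r" by simp
      note [measurable] = X_measurable[OF r]
      have "(\<lambda>(y, \<omega>). ennreal (l (y - X r \<omega>))) \<in> borel_measurable (lborel \<Otimes>\<^sub>M M)" by measurable
      then have [measurable]: "(\<lambda>y. \<integral>\<^sup>+\<omega>. ennreal (l (y - X r \<omega>)) \<partial>M) \<in> borel_measurable lborel"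
        by (rule borel_measurable_nn_integral)
      have eq: "ennreal (J y r) = ennreal (exp (- q * r)) * (\<integral>\<^sup>+\<omega>. ennreal (l (y - X r \<omega>)) \<partial>M)" for y
      proof -
        have "(\<integral>\<^sup>+\<omega>. ennreal (l (y - X r \<omega>)) \<partial>M) = ennreal (I r y)"
          unfolding I_eq[OF r] using l0 by (intro nn_integral_eq_integral intg[OF l(1,2) r] AE_I2)
        then show ?thesis unfolding J_def using True I0[of r y] by (simp add: ennreal_mult)
      qed
      have "(\<integral>\<^sup>+y. ennreal (exp (- s * y)) * ennreal (J y r) \<partial>lborel)
        = (\<integral>\<^sup>+y. ennreal (exp (- q * r)) * (ennreal (exp (- s * y)) * (\<integral>\<^sup>+\<omega>. ennreal (l (y - X r \<omega>)) \<partial>M)) \<partial>lborel)"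
        unfolding eq by (intro nn_integral_cong) (rule mult.left_commute)
      also have "\<dots> = ennreal (exp (- q * r)) * (\<integral>\<^sup>+y. ennreal (exp (- s * y)) * (\<integral>\<^sup>+\<omega>. ennreal (l (y - X r \<omega>)) \<partial>M) \<partial>lborel)"
        by (rule nn_integral_cmult) measurable
      also have "\<dots> = ennreal (exp (- q * r)) * ennreal (exp (r * \<psi> s) * Ll s)"
        unfolding nn_integral_laplace_shift[OF l(1) s s' r e[OF s']] \<psi>_def ..
      also have "\<dots> = ennreal (exp (- q * r) * exp (r * \<psi> s)) * ennreal (Ll s)"
        by (simp add: ennreal_mult'[symmetric] mult.assoc)
      also have "exp (- q * r) * exp (r * \<psi> s) = exp ((\<psi> s - q) * r)" unfolding mult_exp_exp by (simp add: algebra_simps)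
      finally show ?thesis using True by simp
    qed (simp add: J_def)
    have "(\<integral>\<^sup>+y. ennreal (exp (- s * y) * B y) \<partial>lborel)
      = (\<integral>\<^sup>+y. ennreal (exp (- s * y) * V y) \<partial>lborel) + (\<integral>\<^sup>+y. \<integral>\<^sup>+r. ennreal (exp (- s * y)) * ennreal (J y r) \<partial>lborel \<partial>lborel)"
      unfolding eqB by (rule nn_integral_add) measurable
    also have "(\<integral>\<^sup>+y. \<integral>\<^sup>+r. ennreal (exp (- s * y)) * ennreal (J y r) \<partial>lborel \<partial>lborel)
      = (\<integral>\<^sup>+r. \<integral>\<^sup>+y. ennreal (exp (- s * y)) * ennreal (J y r) \<partial>lborel \<partial>lborel)"
      by (rule lborel_pair.Fubini'[OF Jm'])
    also have "\<dots> = (\<integral>\<^sup>+r. ennreal (exp ((\<psi> s - q) * r)) * indicator {0..<t} r \<partial>lborel) * ennreal (Ll s)"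
      unfolding inner by (rule nn_integral_multc) measurable
    also have "\<dots> = ennreal ((exp ((\<psi> s - q) * t) - 1) / (\<psi> s - q)) * ennreal (Ll s)"
      unfolding nn_integral_exp_interval[OF d(1) t] ..
    also have "\<dots> = ennreal ((exp ((\<psi> s - q) * t) - 1) / (\<psi> s - q) * Ll s)"
      using d t Ll0[OF s] by (intro ennreal_mult[symmetric]) auto
    also have "(\<integral>\<^sup>+y. ennreal (exp (- s * y) * V y) \<partial>lborel) = ennreal (Ll s / (\<psi> s - q))" by (rule has_laplace_nn[OF V(1) s])
    also have "ennreal (Ll s / (\<psi> s - q)) + ennreal ((exp ((\<psi> s - q) * t) - 1) / (\<psi> s - q) * Ll s)
      = ennreal (Ll s / (\<psi> s - q) + (exp ((\<psi> s - q) * t) - 1) / (\<psi> s - q) * Ll s)"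
      using d t Ll0[OF s] by (intro ennreal_plus[symmetric] mult_nonneg_nonneg divide_nonneg_nonneg) auto
    also have "Ll s / (\<psi> s - q) + (exp ((\<psi> s - q) * t) - 1) / (\<psi> s - q) * Ll s = T s"
      unfolding T_def by (simp add: diff_divide_distrib left_diff_distrib)
    finally show ?thesis .
  qed
  note [measurable] = Am Bm
  have AE_eq: "AE y in lborel. A y = B y"
  proof (rule two_sided_laplace_unique[OF Am A0 Bm B0])
    fix s assume s: "s0 < s"
    show "integrable lborel (\<lambda>y. exp (- s * y) * A y)" using nnA[OF s] A0 by (intro integrableI_nonneg) auto
    show "integrable lborel (\<lambda>y. exp (- s * y) * B y)" using nnB[OF s] B0 by (intro integrableI_nonneg) auto
    have "(\<integral>y. exp (- s * y) * A y \<partial>lborel) = T s"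
      using nnA[OF s] A0 T0[OF s] by (subst integral_eq_nn_integral) auto
    moreover have "(\<integral>y. exp (- s * y) * B y \<partial>lborel) = T s"
      using nnB[OF s] B0 T0[OF s] by (subst integral_eq_nn_integral) auto
    ultimately show "(\<integral>y. exp (- s * y) * A y \<partial>lborel) = (\<integral>y. exp (- s * y) * B y \<partial>lborel)" by simp
  qed
  have "\<exists>u. y < u \<and> u < y + 1 / real (Suc n) \<and> A u = B u" for n
    by (rule AE_lborel_dense[OF AE_eq]) simp
  then obtain u where u: "\<And>n. y < u n" "\<And>n. u n < y + 1 / real (Suc n)" "\<And>n. A (u n) = B (u n)" by metis
  have u1: "u n \<le> y + 1" for n
  proof -
    have "1 / real (Suc n) \<le> 1" by simp
    then show ?thesis using u(2)[of n] by linarith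
  qed
  have u_lim: "u \<longlonglongrightarrow> y"
  proof (rule tendsto_sandwich[of "\<lambda>_. y" _ _ "\<lambda>n. y + 1 / real (Suc n)"])
    show "(\<lambda>n. y + 1 / real (Suc n)) \<longlonglongrightarrow> y" using tendsto_add[OF tendsto_const LIMSEQ_Suc[OF lim_1_over_n], of y] by simp
  qed (use u in \<open>auto intro!: always_eventually less_imp_le\<close>)
  have V_lim: "(\<lambda>n. V (u n - x)) \<longlonglongrightarrow> V (y - x)" for x
    by (rule isCont_tendsto_compose[OF _ tendsto_diff[OF u_lim tendsto_const]]) (use V(3) in \<open>simp add: continuous_on_eq_continuous_at\<close>)
  have l_lim: "(\<lambda>n. l (u n - x)) \<longlonglongrightarrow> l (y - x)" for x
  proof (rule filterlim_compose[OF l(3)])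
    show "filterlim (\<lambda>n. u n - x) (at_right (y - x)) sequentially"
      unfolding filterlim_at
    proof
      show "(\<lambda>n. u n - x) \<longlonglongrightarrow> y - x" by (rule tendsto_diff[OF u_lim tendsto_const])
      show "\<forall>\<^sub>F n in sequentially. u n - x \<in> {y - x<..} \<and> u n - x \<noteq> y - x"
        using u(1) by (intro always_eventually allI) (auto simp: less_imp_neq[symmetric])
    qed
  qed
  \<comment> \<open>All points u n are at most y + 1, so by monotonicity the values at y + 1
    dominate in each of the limits.\<close>
  have A_lim: "(\<lambda>n. A (u n)) \<longlonglongrightarrow> A y"
    unfolding A_def
  proof (intro tendsto_mult tendsto_const integral_dominated_convergence[where w = "\<lambda>\<omega>. V (y + 1 - X t \<omega>)"])
    show "integrable M (\<lambda>\<omega>. V (y + 1 - X t \<omega>))" by (rule intg[OF V(1,2) t])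
    show "AE \<omega> in M. norm (V (u n - X t \<omega>)) \<le> V (y + 1 - X t \<omega>)" for n
      using V0 u1[of n] by (intro AE_I2) (auto intro!: monoD[OF V(2)])
  qed (auto intro!: V_lim)
  have I_lim: "(\<lambda>n. I r (u n)) \<longlonglongrightarrow> I r y" if r: "0 \<le> r" for r
    unfolding I_eq[OF r]
  proof (rule integral_dominated_convergence[where w = "\<lambda>\<omega>. l (y + 1 - X r \<omega>)"])
    note [measurable] = X_measurable[OF r]
    show "integrable M (\<lambda>\<omega>. l (y + 1 - X r \<omega>))" by (rule intg[OF l(1,2) r])
    show "AE \<omega> in M. norm (l (u n - X r \<omega>)) \<le> l (y + 1 - X r \<omega>)" for n
      using l0 u1[of n] by (intro AE_I2) (auto intro!: monoD[OF l(2)])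
    show "(\<lambda>\<omega>. l (y - X r \<omega>)) \<in> borel_measurable M" by measurable
    show "(\<lambda>\<omega>. l (u n - X r \<omega>)) \<in> borel_measurable M" for n by measurable
    show "AE \<omega> in M. (\<lambda>n. l (u n - X r \<omega>)) \<longlonglongrightarrow> l (y - X r \<omega>)" using l_lim by (rule AE_I2)
  qed
  have J_le: "J (u n) r \<le> J (y + 1) r" for n r
  proof (cases "r \<in> {0..<t}")
    case True
    then have r: "0 \<le> r" by simp
    have "I r (u n) \<le> I r (y + 1)"
      unfolding I_eq[OF r] by (intro integral_mono intg[OF l(1,2) r] monoD[OF l(2)]) (use u1[of n] in simp)
    then show ?thesis unfolding J_def using True by (simp add: mult_left_mono)
  qed (simp add: J_def)
  have B_lim: "(\<lambda>n. B (u n)) \<longlonglongrightarrow> B y"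
    unfolding B_def
  proof (rule tendsto_add)
    show "(\<lambda>n. V (u n)) \<longlonglongrightarrow> V y" using V_lim[of 0] by simp
    show "(\<lambda>n. \<integral>r. J (u n) r \<partial>lborel) \<longlonglongrightarrow> (\<integral>r. J y r \<partial>lborel)"
    proof (rule integral_dominated_convergence[where w = "J (y + 1)"])
      show "integrable lborel (J (y + 1))" by (rule J_int)
      show "J y \<in> borel_measurable lborel" "J (u n) \<in> borel_measurable lborel" for n
        using J_int by (auto intro: borel_measurable_integrable)
      show "AE r in lborel. (\<lambda>n. J (u n) r) \<longlonglongrightarrow> J y r"
      proof (rule AE_I2)
        fix r show "(\<lambda>n. J (u n) r) \<longlonglongrightarrow> J y r"
        proof (cases "r \<in> {0..<t}")
          case True
          then have "0 \<le> r" by simp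
          then show ?thesis unfolding J_def by (intro tendsto_mult tendsto_const I_lim)
        qed (simp add: J_def)
      qed
      show "AE r in lborel. norm (J (u n) r) \<le> J (y + 1) r" for n
        using J0 J_le by (intro AE_I2) simp
    qed
  qed
  have "A y = B y" using LIMSEQ_unique[OF A_lim] B_lim u(3) by simp
  then show "exp (- q * t) * (\<integral>\<omega>. V (y - X t \<omega>) \<partial>M) =
    V y + (\<integral>r. indicator {0..<t} r * (exp (- q * r) * (\<integral>\<omega>. l (y - X r \<omega>) \<partial>M)) \<partial>lborel)"
    unfolding A_def B_def J_eq .
qed

end

section \<open>The value of a policy\<close>

text \<open>f need not be measurable for M, and the integral of a nonmeasurable function is a
  default value. In the completion f is measurable, since it differs from g on a null set.\<close>

lemma integral_completion_AE:
  fixes f g :: "'a \<Rightarrow> real"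
  assumes g: "g \<in> borel_measurable M" and ae: "AE x in M. f x = g x"
  shows "(\<integral>x. f x \<partial>completion M) = (\<integral>x. g x \<partial>M)"
proof -
  have ae': "AE x in completion M. f x = g x" using ae by (rule AE_completion)
  have g': "g \<in> borel_measurable (completion M)" by (rule measurable_completion[OF g])
  have f': "f \<in> borel_measurable (completion M)"
  proof (rule measurableI)
    fix S :: "real set" assume S: "S \<in> sets borel"
    have "AE x in completion M. x \<in> g -` S \<inter> space (completion M) \<longleftrightarrow> x \<in> f -` S \<inter> space (completion M)"
      using ae' by eventually_elim simp
    then show "f -` S \<inter> space (completion M) \<in> sets (completion M)"
      by (rule completion.in_sets_AE[OF _ measurable_sets[OF g' S]]) simp
  qed simp
  have "(\<integral>x. f x \<partial>completion M) = (\<integral>x. g x \<partial>completion M)"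
    by (rule integral_cong_AE[OF f' g' ae'])
  then show ?thesis using integral_completion[OF g] by simp
qed

section \<open>Integrals of the scale function as iterated primitives\<close>

lemma primitive_nonpos:
  assumes "y \<le> 0" shows "primitive V y = 0"
  unfolding primitive_def
proof (rule integral_eq_zero_AE)
  show "AE z in lborel. indicator {0..y} z * V z = 0"
    using AE_lborel_singleton[of "0::real"] by eventually_elim (use assms in \<open>auto simp: indicator_def\<close>)
qed

lemma interval_integral_from_0:
  fixes f :: "real \<Rightarrow> real" and x :: real
  shows "0 \<le> x \<Longrightarrow> (LBINT y=0..x. f y) = (\<integral>y. indicator {0..x} y * f y \<partial>lborel)"
    and "x < 0 \<Longrightarrow> (LBINT y=0..x. f y) = - (\<integral>y. indicator {x..0} y * f y \<partial>lborel)"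
proof -
  show "(LBINT y=0..x. f y) = (\<integral>y. indicator {0..x} y * f y \<partial>lborel)" if "0 \<le> x"
    using that interval_integral_Icc[of 0 x f] by (simp add: set_lebesgue_integral_def zero_ereal_def)
  show "(LBINT y=0..x. f y) = - (\<integral>y. indicator {x..0} y * f y \<partial>lborel)" if "x < 0"
  proof -
    have "(LBINT y=ereal 0..ereal x. f y) = - (LBINT y=ereal x..ereal 0. f y)"
      by (rule interval_integral_endpoints_reverse)
    then show ?thesis
      using that interval_integral_Icc[of x 0 f] by (simp add: set_lebesgue_integral_def zero_ereal_def)
  qed
qed

lemma W_bar_eq_primitive:
  fixes W :: "real \<Rightarrow> real"
  assumes W: "\<forall>y<0. W y = 0"
  shows "W_bar W x = primitive W x"
proof (cases "0 \<le> x")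
  case True
  then show ?thesis unfolding W_bar_def primitive_def by (rule interval_integral_from_0(1))
next
  case False
  have "(\<integral>y. indicator {x..0} y * W y \<partial>lborel) = 0"
  proof (rule integral_eq_zero_AE)
    show "AE z in lborel. indicator {x..0} z * W z = 0"
      using AE_lborel_singleton[of "0::real"] by eventually_elim (use W in \<open>auto simp: indicator_def\<close>)
  qed
  then show ?thesis
    unfolding W_bar_def using interval_integral_from_0(2)[of x W] False primitive_nonpos[of x W] by simp
qed

text \<open>Negative arguments matter: reversed endpoints make \<open>Z_bar q W x\<close> equal to x
  there, whereas \<open>primitive\<close> vanishes. This linear branch carries the overshoot of the
  surplus above c2.\<close>

lemma Z_bar_eq_primitive:
  fixes W :: "real \<Rightarrow> real"
  assumes W: "\<forall>y<0. W y = 0" and int: "\<And>x. integrable lborel (\<lambda>y. indicator {0..x} y * primitive W y)"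
  shows "Z_bar q W x = x + q * primitive (primitive W) x"
proof -
  have Z: "Z_fun q W z = 1 + q * primitive W z" for z
    by (simp add: Z_fun_def W_bar_eq_primitive[OF W])
  show ?thesis
  proof (cases "0 \<le> x")
    case True
    have "(LBINT z=0..x. Z_fun q W z) = (\<integral>y. indicator {0..x} y * Z_fun q W y \<partial>lborel)"
      by (rule interval_integral_from_0(1)[OF True])
    also have "\<dots> = (\<integral>y. indicator {0..x} y + q * (indicator {0..x} y * primitive W y) \<partial>lborel)"
      by (intro Bochner_Integration.integral_cong refl) (simp add: Z algebra_simps)
    also have "\<dots> = (\<integral>y. indicator {0..x} y \<partial>lborel) + q * (\<integral>y. indicator {0..x} y * primitive W y \<partial>lborel)"
      by (subst Bochner_Integration.integral_add[OF integrable_real_indicator integrable_mult_right[OF int]])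
        (auto simp: emeasure_lborel_Icc_eq)
    also have "\<dots> = x + q * primitive (primitive W) x" unfolding primitive_def[of "primitive W"] using True by simp
    finally show ?thesis unfolding Z_bar_def .
  next
    case False
    then have x: "x < 0" by simp
    have "(LBINT z=0..x. Z_fun q W z) = - (\<integral>y. indicator {x..0} y * Z_fun q W y \<partial>lborel)"
      by (rule interval_integral_from_0(2)[OF x])
    also have "(\<integral>y. indicator {x..0} y * Z_fun q W y \<partial>lborel) = (\<integral>y. indicator {x..0} y \<partial>lborel)"
      by (intro Bochner_Integration.integral_cong refl) (auto simp: Z primitive_nonpos indicator_def)
    also have "- \<dots> = x" using x by simp
    finally show ?thesis unfolding Z_bar_def using primitive_nonpos[of x "primitive W"] x by simp
  qed
qed

text \<open>The affine part of h: c + r * m is the mean at time r of an affine function of the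
  process with drift m.\<close>

lemma integral_exp_affine:
  fixes q t c m :: real
  assumes q: "0 < q" and t: "0 \<le> t"
  shows "integrable lborel (\<lambda>r. indicator {0..<t} r * (exp (- q * r) * (c + r * m)))"
    and "q * (\<integral>r. indicator {0..<t} r * (exp (- q * r) * (c + r * m)) \<partial>lborel) = (c + m / q) - exp (- q * t) * (c + t * m + m / q)"
proof -
  let ?f = "\<lambda>r. exp (- q * r) * (c + r * m)"
  let ?F = "\<lambda>r. - (exp (- q * r) * (c + r * m + m / q)) / q"
  have ae: "AE r in lborel. indicator {0..<t} r * ?f r = ?f r * indicator {0..t} r"
    using AE_lborel_singleton[of t] by eventually_elim (auto simp: indicator_def)
  have i: "integrable lborel (\<lambda>r. ?f r * indicator {0..t} r)"
    using borel_integrable_atLeastAtMost'[of 0 t ?f] by (simp add: set_integrable_def mult.commute continuous_intros)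
  show "integrable lborel (\<lambda>r. indicator {0..<t} r * ?f r)"
    by (subst integrable_cong_AE[OF _ _ ae]) (use i in auto)
  have "(\<integral>r. indicator {0..<t} r * ?f r \<partial>lborel) = (\<integral>r. ?f r * indicator {0..t} r \<partial>lborel)"
    by (rule integral_cong_AE[OF _ _ ae]) measurable
  also have "\<dots> = ?F t - ?F 0"
  proof (rule integral_FTC_Icc_real[OF t])
    fix r
    show "DERIV ?F r :> ?f r"
      using q by (auto intro!: derivative_eq_intros simp: field_simps)
    show "isCont ?f r" by (intro continuous_intros)
  qed
  finally have eq: "(\<integral>r. indicator {0..<t} r * ?f r \<partial>lborel) = ?F t - ?F 0" .
  show "q * (\<integral>r. indicator {0..<t} r * ?f r \<partial>lborel) = (c + m / q) - exp (- q * t) * (c + t * m + m / q)"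
    unfolding eq using q by (simp add: field_simps)
qed

text \<open>The transform of W is positive, as W is nonnegative and strictly increasing on the
  half-line, and it equals 1 / (\<psi> s - q); so \<psi> s > q. The case \<psi> s = q is excluded as
  well, since the quotient would be 0 by convention. The maximum with 0 in s0 makes s positive when
  transforms are divided by s.\<close>

lemma has_laplace_scale_function:
  assumes W: "is_scale_function \<psi> q W"
  defines "s0 \<equiv> max 0 (right_inverse \<psi> q)"
  shows "has_laplace W s0 (\<lambda>s. 1 / (\<psi> s - q))" and "s0 < s \<Longrightarrow> q < \<psi> s"
proof -
  have W0: "\<And>x. 0 \<le> W x" "\<And>x. x < 0 \<Longrightarrow> W x = 0" and Wc: "continuous_on {0..} W" and Ws: "strict_mono_on {0..} W"
    and Wi: "\<And>s. right_inverse \<psi> q < s \<Longrightarrow> has_bochner_integral lborel (\<lambda>x. indicator {0..} x * (exp (- s * x) * W x)) (1 / (\<psi> s - q))"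
    using W unfolding is_scale_function_def by auto
  have "(\<lambda>x. indicator {0..} x *\<^sub>R W x) \<in> borel_measurable borel"
    by (rule borel_measurable_continuous_on_indicator[OF _ Wc]) simp
  moreover have "(\<lambda>x. indicator {0..} x *\<^sub>R W x) = W"
    using W0(2) by (auto simp: fun_eq_iff indicator_def)
  ultimately have Wm: "W \<in> borel_measurable borel" by simp
  have eq: "(\<lambda>x. indicator {0..} x * (exp (- s * x) * W x)) = (\<lambda>x. exp (- s * x) * W x)" for s
    using W0(2) by (auto simp: fun_eq_iff indicator_def)
  have hb: "has_bochner_integral lborel (\<lambda>x. exp (- s * x) * W x) (1 / (\<psi> s - q))" if "s0 < s" for s
    using Wi[of s] that unfolding eq s0_def by simp
  show "has_laplace W s0 (\<lambda>s. 1 / (\<psi> s - q))"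
    unfolding has_laplace_def using Wm W0 hb
    by (auto simp: has_bochner_integral_iff)
  assume s: "s0 < s"
  have "0 < 1 / (\<psi> s - q)"
  proof (rule ccontr)
    assume n: "\<not> 0 < 1 / (\<psi> s - q)"
    have i: "integrable lborel (\<lambda>x. exp (- s * x) * W x)" and v: "(\<integral>x. exp (- s * x) * W x \<partial>lborel) = 1 / (\<psi> s - q)"
      using hb[OF s] by (auto simp: has_bochner_integral_iff)
    have nn: "AE x in lborel. 0 \<le> exp (- s * x) * W x" using W0(1) by (intro AE_I2) simp
    have "0 \<le> (\<integral>x. exp (- s * x) * W x \<partial>lborel)" by (rule integral_nonneg_AE[OF nn])
    then have "(\<integral>x. exp (- s * x) * W x \<partial>lborel) = 0" using n v by simp
    then have "AE x in lborel. exp (- s * x) * W x = 0" using integral_nonneg_eq_0_iff_AE[OF i nn] by simp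
    from AE_lborel_dense[OF this zero_less_one] obtain y where y: "0 < y" "exp (- s * y) * W y = 0" by auto
    have "W 0 < W y" using Ws y(1) by (auto simp: strict_mono_on_def)
    then show False using y(2) W0(1)[of 0] by simp
  qed
  then show "q < \<psi> s" by simp
qed

text \<open>h is an affine function plus multiples of the first and second integrals of W, with
  transforms 1 / (s (\<psi> s - q)) and 1 / (s s (\<psi> s - q)). \<open>smoothing_identity\<close>
  treats them with the Heaviside function and its primitive as l. The source terms recombine:
  (\<gamma> - y) - \<gamma> 1{y \<ge> 0} + max 0 y is \<gamma> - y for y < 0 and 0 otherwise, which
  is k.\<close>

lemma (in increment_process) harmonic_kernel_scale:
  fixes W :: "real \<Rightarrow> real" and \<gamma> q :: real
  assumes e: "\<And>s. 0 \<le> s \<Longrightarrow> integrable M (\<lambda>\<omega>. exp (- s * X 1 \<omega>))" and i: "integrable M (X 1)"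
  defines "\<psi> \<equiv> \<lambda>s. ln (\<integral>\<omega>. exp (- s * X 1 \<omega>) \<partial>M)" and "\<mu> \<equiv> \<integral>\<omega>. X 1 \<omega> \<partial>M"
  assumes q: "0 < q" and s0: "0 \<le> s0" and \<psi>q: "\<And>s. s0 < s \<Longrightarrow> q < \<psi> s"
    and W: "has_laplace W s0 (\<lambda>s. 1 / (\<psi> s - q))"
  defines "h \<equiv> \<lambda>y. \<gamma> * (1 + q * primitive W y) - (y + q * primitive (primitive W) y - \<mu> / q)"
  shows "\<exists>\<Lambda> C. harmonic_kernel K q \<Lambda> C h (\<lambda>y. if y < 0 then \<gamma> - y else 0)"
proof -
  let ?Wb = "primitive W" and ?Wbb = "primitive (primitive W)"
  let ?l1 = "indicator {0..} :: real \<Rightarrow> real" and ?l2 = "primitive (indicator {0..})"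
  let ?k = "\<lambda>y. if y < 0 then \<gamma> - y else 0"
  have e1: "integrable M (\<lambda>\<omega>. exp (- 1 * X 1 \<omega>))" by (rule e) simp
  note pW = primitive_facts[OF W s0]
  note pWb = primitive_facts[OF pW(3) s0]
  have l1: "has_laplace ?l1 s0 (\<lambda>s. 1 / s)" by (rule has_laplace_mono_abscissa[OF has_laplace_heaviside s0])
  note pl = primitive_facts[OF l1 s0]
  have mono1: "mono ?l1" by (auto intro!: monoI simp: indicator_def)
  have right1: "(?l1 \<longlongrightarrow> ?l1 y) (at_right y)" for y
  proof (rule tendsto_eventually)
    show "eventually (\<lambda>x. ?l1 x = ?l1 y) (at_right y)"
    proof (cases "0 \<le> y")
      case True
      then show ?thesis unfolding eventually_at_right_field by (intro exI[of _ "y + 1"]) (auto simp: indicator_def)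
    next
      case False
      then show ?thesis unfolding eventually_at_right_field by (intro exI[of _ 0]) (auto simp: indicator_def)
    qed
  qed
  have right2: "(?l2 \<longlongrightarrow> ?l2 y) (at_right y)" for y
  proof -
    have "isCont ?l2 y" using pl(2) by (simp add: continuous_on_eq_continuous_at)
    then show ?thesis unfolding isCont_def by (rule filterlim_mono[OF _ order_refl at_le]) simp
  qed
  have Wb_lap: "has_laplace ?Wb s0 (\<lambda>s. (1 / s) / (\<psi> s - q))"
    using pW(3) by (simp add: mult.commute)
  have Wbb_lap: "has_laplace ?Wbb s0 (\<lambda>s. (1 / s / s) / (\<psi> s - q))"
    using pWb(3) by (simp add: ac_simps)
  have e': "\<forall>s\<ge>0. integrable M (\<lambda>\<omega>. exp (- s * X 1 \<omega>))" and \<psi>q': "\<forall>s>s0. q < \<psi> s" using e \<psi>q by auto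
  note S1 = smoothing_identity[OF e' q s0 \<psi>q'[unfolded \<psi>_def] Wb_lap[unfolded \<psi>_def] pW(1,2) l1 mono1 right1]
  note S2 = smoothing_identity[OF e' q s0 \<psi>q'[unfolded \<psi>_def] Wbb_lap[unfolded \<psi>_def] pWb(1,2) pl(3) pl(1) right2]
  define \<Lambda> where "\<Lambda> = s0 + 1"
  have \<Lambda>: "s0 < \<Lambda>" "0 < \<Lambda>" "0 \<le> \<Lambda>" unfolding \<Lambda>_def using s0 by auto
  obtain a1 where a1: "\<And>y. ?Wb y \<le> a1 * exp (\<Lambda> * y)"
    using laplace_growth[OF pW(3,1) \<Lambda>(1,2)] by blast
  obtain a2 where a2: "\<And>y. ?Wbb y \<le> a2 * exp (\<Lambda> * y)"
    using laplace_growth[OF pWb(3,1) \<Lambda>(1,2)] by blast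
  note Wb0 = has_laplaceD(2)[OF Wb_lap] and Wbb0 = has_laplaceD(2)[OF Wbb_lap]
  \<comment> \<open>The summand 1 accounts for the linear term in \<bar>y\<bar>; a1 and a2 are the
    growth constants of the two integrals of W.\<close>
  define C where "C = \<bar>\<gamma>\<bar> + \<bar>\<mu> / q\<bar> + 1 + \<bar>\<gamma>\<bar> * q * \<bar>a1\<bar> + q * \<bar>a2\<bar>"
  have m: "?Wb \<in> borel_measurable borel" "?Wbb \<in> borel_measurable borel" "?l2 \<in> borel_measurable borel"
    using pW(1) pWb(1) pl(1) by (auto intro: borel_measurable_mono)
  have km: "?k \<in> borel_measurable borel" by measurable
  have fm: "integrable M (X r)" "(\<integral>\<omega>. X r \<omega> \<partial>M) = r * \<mu>" if "0 \<le> r" for r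
    unfolding \<mu>_def using first_moment[OF e1 i that] by auto
  have "harmonic_kernel K q \<Lambda> C h ?k"
  proof
    show "0 < q" "0 < \<Lambda>" by fact+
    show "0 \<le> C" unfolding C_def using q by (intro add_nonneg_nonneg mult_nonneg_nonneg) auto
    show "continuous_on UNIV h" unfolding h_def by (intro continuous_intros pW(2) pWb(2))
    show "?k \<in> borel_measurable borel" by (rule km)
    show "\<bar>h y\<bar> \<le> C * (1 + exp (\<Lambda> * y) + \<bar>y\<bar>)" for y
    proof -
      define E where "E = exp (\<Lambda> * y)"
      have E: "0 \<le> E" unfolding E_def by simp
      have b1: "\<bar>\<gamma>\<bar> * q * ?Wb y \<le> \<bar>\<gamma>\<bar> * q * \<bar>a1\<bar> * E"
      proof -
        have "a1 * E \<le> \<bar>a1\<bar> * E" using E by (intro mult_right_mono) auto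
        then have "?Wb y \<le> \<bar>a1\<bar> * E" using a1[of y] unfolding E_def by linarith
        then show ?thesis using q unfolding mult.assoc by (intro mult_left_mono) auto
      qed
      have b2: "q * ?Wbb y \<le> q * \<bar>a2\<bar> * E"
      proof -
        have "a2 * E \<le> \<bar>a2\<bar> * E" using E by (intro mult_right_mono) auto
        then have "?Wbb y \<le> \<bar>a2\<bar> * E" using a2[of y] unfolding E_def by linarith
        then show ?thesis using q unfolding mult.assoc by (intro mult_left_mono) auto
      qed
      have "\<bar>h y\<bar> \<le> \<bar>\<gamma>\<bar> + \<bar>\<gamma> * (q * ?Wb y)\<bar> + \<bar>y\<bar> + \<bar>q * ?Wbb y\<bar> + \<bar>\<mu> / q\<bar>"
        unfolding h_def distrib_left by linarith
      also have "\<bar>\<gamma> * (q * ?Wb y)\<bar> = \<bar>\<gamma>\<bar> * q * ?Wb y" using q Wb0[of y] by (simp add: abs_mult)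
      also have "\<bar>q * ?Wbb y\<bar> = q * ?Wbb y" using q Wbb0[of y] by (simp add: abs_mult)
      finally have 1: "\<bar>h y\<bar> \<le> \<bar>\<gamma>\<bar> + \<bar>\<mu> / q\<bar> + \<bar>y\<bar> + (\<bar>\<gamma>\<bar> * q * \<bar>a1\<bar> * E + q * \<bar>a2\<bar> * E)" using b1 b2 by linarith
      define c where "c = \<bar>\<gamma>\<bar> * q * \<bar>a1\<bar> + q * \<bar>a2\<bar>"
      define d where "d = \<bar>\<gamma>\<bar> + \<bar>\<mu> / q\<bar>"
      have c0: "0 \<le> c" unfolding c_def using q by (intro add_nonneg_nonneg mult_nonneg_nonneg) auto
      have d0: "0 \<le> d" unfolding d_def by simp
      have Cc: "C = d + 1 + c" unfolding C_def c_def d_def by simp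
      have 2: "\<bar>h y\<bar> \<le> d + \<bar>y\<bar> + c * E" using 1 unfolding c_def d_def by (simp add: distrib_right)
      have "0 \<le> (1 + c) * 1 + (d + 1) * E + (d + c) * \<bar>y\<bar>"
        using c0 d0 E by (intro add_nonneg_nonneg mult_nonneg_nonneg) auto
      then have "d + \<bar>y\<bar> + c * E \<le> C * (1 + E + \<bar>y\<bar>)" unfolding Cc by (simp add: algebra_simps)
      then show ?thesis using 2 unfolding E_def by linarith
    qed
    show "\<bar>?k y\<bar> \<le> C * (1 + \<bar>y\<bar>)" for y
    proof -
      have C1: "\<bar>\<gamma>\<bar> \<le> C" "1 \<le> C"
      proof -
        have "0 \<le> \<bar>\<gamma>\<bar> * q * \<bar>a1\<bar>" "0 \<le> q * \<bar>a2\<bar>" using q by auto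
        then show "\<bar>\<gamma>\<bar> \<le> C" "1 \<le> C" unfolding C_def by linarith+
      qed
      have "\<bar>?k y\<bar> \<le> \<bar>\<gamma>\<bar> + 1 * \<bar>y\<bar>" by auto
      also have "\<dots> \<le> C + C * \<bar>y\<bar>" using C1 by (intro add_mono mult_right_mono) auto
      finally show ?thesis by (simp add: distrib_left)
    qed
    show "?k y = 0" if "0 \<le> y" for y using that by simp
    show "integrable (K r) (\<lambda>z. exp (- \<Lambda> * z))" if r: "0 \<le> r" for r
    proof -
      have "(\<lambda>z. exp (- \<Lambda> * z)) \<in> borel_measurable borel" by measurable
      from integrable_K[OF r this] show ?thesis using exp_moment(1)[OF e[OF \<Lambda>(3)] \<Lambda>(3) r] by simp
    qed
    show "integrable (K r) (\<lambda>z. z)" if r: "0 \<le> r" for r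
      using integrable_K[OF r, of "\<lambda>z. z"] fm(1)[OF r] by simp
    show "\<exists>B. \<forall>r. 0 \<le> r \<and> r \<le> t \<longrightarrow> (\<integral>z. \<bar>z\<bar> \<partial>K r) \<le> B" if "0 \<le> t" for t
      by (rule abs_moment_bound[OF e1 i that])
    show "\<exists>\<delta>>0. \<forall>r. 0 \<le> r \<and> r \<le> \<delta> \<longrightarrow> measure (K r) {z. e < \<bar>z\<bar>} \<le> 1 / 8" if "0 < e" for e
      by (rule K_small_near_0[OF that])
    fix t y :: real assume t: "0 \<le> t"
    define J1 where "J1 = (\<integral>r. indicator {0..<t} r * (exp (- q * r) * (\<integral>\<omega>. ?l1 (y - X r \<omega>) \<partial>M)) \<partial>lborel)"
    define J2 where "J2 = (\<integral>r. indicator {0..<t} r * (exp (- q * r) * (\<integral>\<omega>. ?l2 (y - X r \<omega>) \<partial>M)) \<partial>lborel)"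
    have hm: "h \<in> borel_measurable borel" unfolding h_def using m by measurable
    have Kh: "(\<integral>z. h (y - z) \<partial>K t) = (\<integral>\<omega>. h (y - X t \<omega>) \<partial>M)"
      by (rule integral_K[OF t]) (use hm in measurable)
    have Eh: "(\<integral>\<omega>. h (y - X t \<omega>) \<partial>M) = (\<gamma> + \<mu> / q - y + t * \<mu>) + \<gamma> * q * (\<integral>\<omega>. ?Wb (y - X t \<omega>) \<partial>M) - q * (\<integral>\<omega>. ?Wbb (y - X t \<omega>) \<partial>M)"
    proof -
      have "(\<integral>\<omega>. h (y - X t \<omega>) \<partial>M) = (\<integral>\<omega>. (\<gamma> + \<mu> / q - y) + X t \<omega> + \<gamma> * q * ?Wb (y - X t \<omega>) - q * ?Wbb (y - X t \<omega>) \<partial>M)"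
        unfolding h_def by (intro Bochner_Integration.integral_cong refl) (simp add: algebra_simps)
      also have "\<dots> = (\<gamma> + \<mu> / q - y) + (\<integral>\<omega>. X t \<omega> \<partial>M) + \<gamma> * q * (\<integral>\<omega>. ?Wb (y - X t \<omega>) \<partial>M) - q * (\<integral>\<omega>. ?Wbb (y - X t \<omega>) \<partial>M)"
        using fm(1)[OF t] S1(3)[OF t t, of y] S2(3)[OF t t, of y] by (simp add: prob_space)
      finally show ?thesis using fm(2)[OF t] by simp
    qed
    have Ek: "(\<integral>z. ?k (y - z) \<partial>K r) = (\<gamma> - y + r * \<mu>) - \<gamma> * (\<integral>\<omega>. ?l1 (y - X r \<omega>) \<partial>M) + (\<integral>\<omega>. ?l2 (y - X r \<omega>) \<partial>M)" if r: "0 \<le> r" for r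
    proof -
      have "(\<integral>z. ?k (y - z) \<partial>K r) = (\<integral>\<omega>. ?k (y - X r \<omega>) \<partial>M)"
        by (rule integral_K[OF r]) (use km in measurable)
      also have "\<dots> = (\<integral>\<omega>. (\<gamma> - y) + X r \<omega> - \<gamma> * ?l1 (y - X r \<omega>) + ?l2 (y - X r \<omega>) \<partial>M)"
        by (intro Bochner_Integration.integral_cong refl) (auto simp: primitive_heaviside indicator_def)
      also have "\<dots> = (\<gamma> - y) + (\<integral>\<omega>. X r \<omega> \<partial>M) - \<gamma> * (\<integral>\<omega>. ?l1 (y - X r \<omega>) \<partial>M) + (\<integral>\<omega>. ?l2 (y - X r \<omega>) \<partial>M)"
        using fm(1)[OF r] S1(4)[OF r r, of y] S2(4)[OF r r, of y] by (simp add: prob_space)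
      finally show ?thesis using fm(2)[OF r] by simp
    qed
    note aff = integral_exp_affine[OF q t, of "\<gamma> - y" \<mu>]
    have "(\<integral>r. indicator {0..<t} r * (exp (- q * r) * (\<integral>z. ?k (y - z) \<partial>K r)) \<partial>lborel)
      = (\<integral>r. indicator {0..<t} r * (exp (- q * r) * ((\<gamma> - y) + r * \<mu>))
        - \<gamma> * (indicator {0..<t} r * (exp (- q * r) * (\<integral>\<omega>. ?l1 (y - X r \<omega>) \<partial>M)))
        + indicator {0..<t} r * (exp (- q * r) * (\<integral>\<omega>. ?l2 (y - X r \<omega>) \<partial>M)) \<partial>lborel)"
    proof (rule Bochner_Integration.integral_cong[OF refl])
      fix r :: real
      show "indicator {0..<t} r * (exp (- q * r) * (\<integral>z. ?k (y - z) \<partial>K r))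
        = indicator {0..<t} r * (exp (- q * r) * ((\<gamma> - y) + r * \<mu>))
        - \<gamma> * (indicator {0..<t} r * (exp (- q * r) * (\<integral>\<omega>. ?l1 (y - X r \<omega>) \<partial>M)))
        + indicator {0..<t} r * (exp (- q * r) * (\<integral>\<omega>. ?l2 (y - X r \<omega>) \<partial>M))"
      proof (cases "r \<in> {0..<t}")
        case True
        then have "0 \<le> r" by simp
        show ?thesis unfolding Ek[OF \<open>0 \<le> r\<close>] using True by (simp add: algebra_simps)
      qed simp
    qed
    also have "\<dots> = (\<integral>r. indicator {0..<t} r * (exp (- q * r) * ((\<gamma> - y) + r * \<mu>)) \<partial>lborel) - \<gamma> * J1 + J2"
      unfolding J1_def J2_def
      by (simp only: Bochner_Integration.integral_add[OF Bochner_Integration.integrable_diff[OF aff(1) integrable_mult_right[OF S1(2)[OF t]]] S2(2)[OF t]]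
        Bochner_Integration.integral_diff[OF aff(1) integrable_mult_right[OF S1(2)[OF t]]] integral_mult_right_zero)
    finally have Ik: "(\<integral>r. indicator {0..<t} r * (exp (- q * r) * (\<integral>z. ?k (y - z) \<partial>K r)) \<partial>lborel)
      = (\<integral>r. indicator {0..<t} r * (exp (- q * r) * ((\<gamma> - y) + r * \<mu>)) \<partial>lborel) - \<gamma> * J1 + J2" .
    define I0 where "I0 = (\<integral>r. indicator {0..<t} r * (exp (- q * r) * ((\<gamma> - y) + r * \<mu>)) \<partial>lborel)"
    have A0: "q * I0 = (\<gamma> - y + \<mu> / q) - exp (- q * t) * (\<gamma> - y + t * \<mu> + \<mu> / q)"
      unfolding I0_def by (rule aff(2))
    have A1: "exp (- q * t) * (\<integral>\<omega>. ?Wb (y - X t \<omega>) \<partial>M) = ?Wb y + J1" unfolding J1_def by (rule S1(1)[OF t])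
    have A2: "exp (- q * t) * (\<integral>\<omega>. ?Wbb (y - X t \<omega>) \<partial>M) = ?Wbb y + J2" unfolding J2_def by (rule S2(1)[OF t])
    have "exp (- q * t) * (\<integral>z. h (y - z) \<partial>K t) = exp (- q * t) * (\<gamma> - y + t * \<mu> + \<mu> / q)
        + \<gamma> * q * (exp (- q * t) * (\<integral>\<omega>. ?Wb (y - X t \<omega>) \<partial>M)) - q * (exp (- q * t) * (\<integral>\<omega>. ?Wbb (y - X t \<omega>) \<partial>M))"
      unfolding Kh Eh by (simp add: algebra_simps)
    also have "\<dots> = (\<gamma> - y + \<mu> / q) - q * I0 + \<gamma> * q * (?Wb y + J1) - q * (?Wbb y + J2)"
      unfolding A1 A2 A0 by simp
    also have "\<dots> = h y - q * (I0 - \<gamma> * J1 + J2)"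
      unfolding h_def by (simp add: algebra_simps)
    finally show "exp (- q * t) * (\<integral>z. h (y - z) \<partial>K t) =
      h y - q * (\<integral>r. indicator {0..<t} r * (exp (- q * r) * (\<integral>z. ?k (y - z) \<partial>K r)) \<partial>lborel)"
      unfolding Ik I0_def .
  qed
  then show ?thesis by blast
qed

theorem mainTheorem3:
  fixes M :: "'a measure" and X :: "real \<Rightarrow> 'a \<Rightarrow> real"
    and c \<sigma> :: real and \<nu> :: "real measure"
    and W :: "real \<Rightarrow> real" and q \<beta> c1 c2 x :: real
  assumes "spectrally_positive_levy M X c \<sigma> \<nu>"
    and "integrable M (X 1)"
    and "0 < q" and "0 < \<beta>"
    and "is_scale_function (laplace_exponent M X) q W"
    and "0 \<le> c1" and "c1 < c2"
    and "G_fun M X W q \<beta> c1 c2 = 0"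
    and "(0 < c1 \<and> H_fun M X W q \<beta> c1 c2 = 0) \<or> (c1 = 0 \<and> 0 \<le> H_fun M X W q \<beta> 0 c2)"
    and "0 \<le> x"
  shows "policy_value M X q \<beta> c1 c2 x =
    - R_fun (levy_mean M X) q W (c2 - x) + gamma_fun M X q \<beta> c1 c2 * Z_fun q W (c2 - x)"
proof -
  interpret spectrally_positive_levy M X c \<sigma> \<nu> by fact
  have "AE \<omega> in M. good_path (\<lambda>t. X t \<omega>)"
    using X_cadlag no_negative_jumps by eventually_elim (rule good_path_if_cadlag)
  then obtain X' where inc: "increment_process M X' (natural_filtration M X') (\<lambda>r. distr M borel (X r))"
    and ae: "AE \<omega> in M. \<forall>t. X' t \<omega> = X t \<omega>"
    by (rule good_version)
  define K where "K r = distr M borel (X r)" for r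
  interpret P: increment_process M X' "natural_filtration M X'" K
    using inc unfolding K_def .
  note [measurable] = X_measurable[OF zero_le_one] P.X_measurable[OF zero_le_one]
  have ae1: "AE \<omega> in M. X 1 \<omega> = X' 1 \<omega>" using ae by eventually_elim simp
  have e: "integrable M (\<lambda>\<omega>. exp (- s * X' 1 \<omega>))" if "0 \<le> s" for s
    using ae1 by (intro integrable_cong_AE_imp[OF laplace_integrable[OF that]]) auto
  have i: "integrable M (X' 1)"
    using ae1 by (intro integrable_cong_AE_imp[OF assms(2)]) auto
  have \<psi>: "laplace_exponent M X = (\<lambda>s. ln (\<integral>\<omega>. exp (- s * X' 1 \<omega>) \<partial>M))"
    unfolding laplace_exponent_def using ae1 by (intro ext arg_cong[where f=ln] integral_cong_AE) auto
  define \<mu> where "\<mu> = levy_mean M X"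
  have \<mu>: "\<mu> = (\<integral>\<omega>. X' 1 \<omega> \<partial>M)"
    unfolding \<mu>_def levy_mean_def using ae1 by (intro integral_cong_AE) auto
  define s0 where "s0 = max 0 (right_inverse (laplace_exponent M X) q)"
  have s0: "0 \<le> s0" unfolding s0_def by simp
  have W: "has_laplace W s0 (\<lambda>s. 1 / (laplace_exponent M X s - q))"
    unfolding s0_def by (rule has_laplace_scale_function(1)[OF assms(5)])
  have \<psi>q: "q < laplace_exponent M X s" if "s0 < s" for s
    using has_laplace_scale_function(2)[OF assms(5)] that unfolding s0_def by blast
  define \<gamma> where "\<gamma> = gamma_fun M X q \<beta> c1 c2"
  define h where "h y = \<gamma> * (1 + q * primitive W y) - (y + q * primitive (primitive W) y - \<mu> / q)" for y
  obtain \<Lambda> C where "harmonic_kernel K q \<Lambda> C h (\<lambda>y. if y < 0 then \<gamma> - y else 0)"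
    using P.harmonic_kernel_scale[OF e i assms(3) s0 \<psi>q[unfolded \<psi>] W[unfolded \<psi>], of \<gamma>]
    unfolding h_def[abs_def] \<mu> by blast
  then have hp: "harmonic_process M X' (natural_filtration M X') K q \<Lambda> C h (\<lambda>y. if y < 0 then \<gamma> - y else 0)"
    by (intro harmonic_process.intro P.increment_process_axioms)
  note pW = primitive_facts[OF W s0]
  have W_neg: "\<forall>y<0. W y = 0" using has_laplaceD(3)[OF W] by blast
  have h_eq: "h y = - R_fun \<mu> q W y + \<gamma> * Z_fun q W y" for y
    unfolding h_def R_fun_def Z_fun_def W_bar_eq_primitive[OF W_neg]
      Z_bar_eq_primitive[OF W_neg indicator_primitive_integrable[OF pW(3)]] by simp
  define v where "v = policy_value M X q \<beta> c1 c2 c1"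
  have hc: "h c2 = 0"
    using assms(8) unfolding h_eq G_fun_def \<gamma>_def[symmetric] \<mu>_def[symmetric] by simp
  \<comment> \<open>For y \<le> 0 both integrals of W vanish and h y = \<gamma> + \<mu> / q - y; the
    term \<mu> / q cancels against the one inside \<open>gamma_fun\<close>.\<close>
  have h_neg: "h y = v + c2 - c1 - \<beta> - y" if "y \<le> 0" for y
    unfolding h_def using primitive_nonpos[OF that, of W] primitive_nonpos[OF that, of "primitive W"]
    by (simp add: \<gamma>_def gamma_fun_def v_def \<mu>_def)
  have policy: "\<exists>A\<ge>0. policy_value M X q \<beta> c1 c2 y = h (c2 - y) + (h (c2 - c1) - v) * A" if y: "0 \<le> y" for y
  proof -
    obtain g A where g: "g \<in> borel_measurable M" "AE \<omega> in M. net_dividends q \<beta> c1 c2 (\<lambda>t. y + X' t \<omega>) = g \<omega>"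
      "(\<integral>\<omega>. g \<omega> \<partial>M) = h (c2 - y) + (h (c2 - c1) - v) * A" "0 \<le> A"
      by (rule expected_net_dividends[OF hp y assms(6,7) hc h_neg less_imp_le[OF assms(4)]])
    have "AE \<omega> in M. net_dividends q \<beta> c1 c2 (\<lambda>t. y + X t \<omega>) = g \<omega>"
      using g(2) ae by eventually_elim simp
    then have "policy_value M X q \<beta> c1 c2 y = (\<integral>\<omega>. g \<omega> \<partial>M)"
      unfolding policy_value_def by (rule integral_completion_AE[OF g(1)])
    then show ?thesis using g(3,4) by auto
  qed
  obtain A where A: "0 \<le> A" "v = h (c2 - c1) + (h (c2 - c1) - v) * A"
    using policy[OF assms(6)] unfolding v_def by blast
  have "(h (c2 - c1) - v) * (1 + A) = 0" using A(2) by (simp add: algebra_simps)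
  then have "h (c2 - c1) = v" using A(1) by simp
  then have "policy_value M X q \<beta> c1 c2 x = h (c2 - x)" using policy[OF assms(10)] by auto
  then show ?thesis unfolding h_eq \<gamma>_def \<mu>_def .
qed

end
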